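(* Let $(b^i:[0,T]\times\mathcal P(\mathbb T^d)\times\mathbb T^d\to\mathbb R^d)_{i\ge1}$ be a collection of uniformly bounded (i.e. $\sup_i\|b^i\|_\infty<\infty$) and measurable functions, $t_0\in[0,T)$ and $\mathfrak m$ a Borel probability measure on $T_o^\infty\times(\mathbb T^d)_o^\infty$. If $$(\Omega^{(k)},\mathcal F^{(k)},\mathbb Q^{(k)},\{\mathcal F^{(k)}_t\}_{t\in[t_0,T]},((\mathbf s^{(k)},\mathbf x^{(k)}),(X^{i,(k)})_i,(W^{i,(k)})_i)),\qquad k=1,2,$$ are two weak solutions of the system $$dX^i_t=b^i_t(\mu^\infty_t,X^i_t)\,dt+\sqrt{\tfrac{2}{s_i}}\,dW^i_t,\quad t\in[t_0,T],\qquad X^i_{t_0}=\iota(x_i),\qquad i\ge1,\qquad \mu_t^\infty=\sum_{j\ge1}s_j\delta_{X^j_t},$$ both driven by the data $(b^i)_i,t_0,\mathfrak m$, then $((\mathbf s^{(1)},\mathbf x^{(1)}),(X^{i,(1)})_i,(W^{i,(1)})_i)$ under $\mathbb Q^{(1)}$ and $((\mathbf s^{(2)},\mathbf x^{(2)}),(X^{i,(2)})_i,(W^{i,(2)})_i)$ under $\mathbb Q^{(2)}$ have the same law.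
   Context: Fix an integer $d\ge2$ and $T>0$. $\mathbb T^d=\mathbb R^d/\mathbb Z^d$; $\mathcal P(\mathbb T^d)$ is the space of Borel probability measures on $\mathbb T^d$ with the weak topology and its Borel $\sigma$-field. $T_o^\infty$ is the set of sequences $\mathbf s=(s_i)_{i\ge1}$ in $[0,1]$ that are strictly decreasing with $\sum_is_i=1$; $(\mathbb T^d)_o^\infty$ is the set of sequences $\mathbf x=(x_i)_i$ of pairwise distinct points of $\mathbb T^d$ (both with the product topology). $\iota:\mathbb T^d\to[0,1)^d\subset\mathbb R^d$ is the map sending a point to its unique representative in $[0,1)^d$, $\varpi:\mathbb R^d\to\mathbb T^d$ the canonical projection. Functions on $\mathbb T^d$ are evaluated at points $y\in\mathbb R^d$ through $\varpi(y)$, and $\delta_y$ for $y\in\mathbb R^d$ denotes $\delta_{\varpi(y)}\in\mathcal P(\mathbb T^d)$. A weak solution driven by $(b^i)_i,t_0,\mathfrak m$ is a tuple $(\Omega,\mathcal F,\mathbb Q,\{\mathcal F_t\}_{t\in[t_0,T]},((\mathbf s,\mathbf x),(X^i)_i,(W^i)_i))$ such that: (i) $(W^i)_i$ is a family of independent $d$-dimensional $\{\mathcal F_t\}_{t\in[t_0,T]}$-Brownian motions (on $[t_0,T]$, equal to $0$ at $t_0$) on the filtered probability space; (ii) $(\mathbf s,\mathbf x)$ is a $T_o^\infty\times(\mathbb T^d)_o^\infty$-valued $\mathcal F_{t_0}$-measurable random variable with law $\mathfrak m$ under $\mathbb Q$; (iii) $\mathbb Q$-a.s., for all $i\ge1$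 and $t\in[t_0,T]$, $X^i_t=\iota(x_i)+\int_{t_0}^tb^i_r(\mu^\infty_r,X^i_r)dr+\sqrt{2/s_i}\,W^i_t$, with $\mu^\infty_t=\sum_js_j\delta_{X^j_t}$. Laws are taken on the space $T^\infty_o\times(\mathbb T^d)^\infty_o\times \mathrm C([0,T];\mathbb R^d)^\infty\times \mathrm C([0,T];\mathbb R^d)^\infty$ with its Borel $\sigma$-field, paths being extended from $[t_0,T]$ to $[0,T]$ by their value at $t_0$. *)

theory Defs
  imports "HOL-Probability.Probability"
begin

section \<open>The torus\<close>

quotient_type 'n torus = "real ^ 'n::finite" / "\<lambda>x y. \<forall>k. x $ k - y $ k \<in> \<int>"
proof (rule equivpI)
  show "reflp (\<lambda>x y :: real ^ 'n. \<forall>k. x $ k - y $ k \<in> \<int>)"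
    by (simp add: reflp_def)
  show "symp (\<lambda>x y :: real ^ 'n. \<forall>k. x $ k - y $ k \<in> \<int>)"
  proof (rule sympI, rule allI)
    fix x y :: "real ^ 'n" and k
    assume "\<forall>k. x $ k - y $ k \<in> \<int>"
    then show "y $ k - x $ k \<in> \<int>"
      using Ints_minus[of "x $ k - y $ k"] by simp
  qed
  show "transp (\<lambda>x y :: real ^ 'n. \<forall>k. x $ k - y $ k \<in> \<int>)"
  proof (rule transpI, rule allI)
    fix x y z :: "real ^ 'n" and k
    assume "\<forall>k. x $ k - y $ k \<in> \<int>" "\<forall>k. y $ k - z $ k \<in> \<int>"
    then show "x $ k - z $ k \<in> \<int>"
      using Ints_add[of "x $ k - y $ k" "y $ k - z $ k"] by simp
  qed
qed

definition torus_proj :: "real ^ 'n::finite \<Rightarrow> 'n torus" where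
  "torus_proj = abs_torus"

lemma torus_proj_eq_iff: "torus_proj x = torus_proj y \<longleftrightarrow> (\<forall>k. x $ k - y $ k \<in> \<int>)"
  unfolding torus_proj_def by (rule torus.abs_eq_iff)

instantiation torus :: (finite) topological_space
begin

definition open_torus :: "'a torus set \<Rightarrow> bool" where
  "open_torus U \<longleftrightarrow> open (torus_proj -` U)"

instance
  by standard (auto simp: open_torus_def vimage_Union)

end

definition torus_rep :: "'n::finite torus \<Rightarrow> real ^ 'n" where
  "torus_rep p = (THE y. (\<forall>k. 0 \<le> y $ k \<and> y $ k < 1) \<and> torus_proj y = p)"

lemma torus_rep_ex1: "\<exists>!y. (\<forall>k. 0 \<le> y $ k \<and> y $ k < 1) \<and> torus_proj y = p"
proof -
  obtain x where x: "p = torus_proj x"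
    using Quotient_abs_rep[OF Quotient_torus, of p] by (metis torus_proj_def)
  show ?thesis
  proof (rule ex1I[of _ "\<chi> k. frac (x $ k)"])
    show "(\<forall>k. 0 \<le> (\<chi> k. frac (x $ k)) $ k \<and> (\<chi> k. frac (x $ k)) $ k < 1) \<and>
        torus_proj (\<chi> k. frac (x $ k)) = p"
      by (auto simp: x torus_proj_eq_iff frac_lt_1) (simp add: frac_def)
  next
    fix y assume y: "(\<forall>k. 0 \<le> y $ k \<and> y $ k < 1) \<and> torus_proj y = p"
    then have "x $ k - y $ k \<in> \<int>" for k
      using Ints_minus[of "y $ k - x $ k"] by (simp add: x torus_proj_eq_iff)
    then have "frac (x $ k) = y $ k" for k
      using y by (simp add: frac_unique_iff)
    then show "y = (\<chi> k. frac (x $ k))"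
      by (simp add: vec_eq_iff)
  qed
qed

section \<open>Borel probability measures with the weak topology\<close>

typedef (overloaded) 'a::topological_space borel_prob =
  "{M :: 'a measure. sets M = sets borel \<and> prob_space M}"
  by (rule exI[of _ "return borel undefined"]) (simp add: prob_space_return)

text \<open>The coarsest topology making \<open>\<mu> \<mapsto> \<integral> f d\<mu>\<close> continuous for every bounded continuous \<open>f\<close>.\<close>

instantiation borel_prob :: (topological_space) topological_space
begin

definition open_borel_prob :: "'a borel_prob set \<Rightarrow> bool" where
  "open_borel_prob = generate_topology
     {{\<mu>. (\<integral>x. f x \<partial>Rep_borel_prob \<mu>) \<in> U} | (f :: 'a \<Rightarrow> real) (U :: real set).
        continuous_on UNIV f \<and> bounded (range f) \<and> open U}"

instance
  by standard (auto simp: open_borel_prob_def intro: generate_topology.intros)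

end

definition weighted_dirac_sum ::
    "(nat \<Rightarrow> real) \<Rightarrow> (nat \<Rightarrow> 'a::topological_space) \<Rightarrow> 'a measure" where
  "weighted_dirac_sum s y = measure_of UNIV (sets borel)
     (\<lambda>A. \<Sum>j. ennreal (s j) * emeasure (return borel (y j)) A)"

text \<open>Only meaningful when the weights \<open>s\<close> are nonnegative with sum 1;
  see \<open>Rep_dirac_mixture\<close>.\<close>

definition dirac_mixture ::
    "(nat \<Rightarrow> real) \<Rightarrow> (nat \<Rightarrow> 'a::topological_space) \<Rightarrow> 'a borel_prob" where
  "dirac_mixture s y = Abs_borel_prob (weighted_dirac_sum s y)"

section \<open>Masses, initial positions and paths\<close>

text \<open>All sequences are indexed from \<open>0\<close> rather than from \<open>1\<close>.\<close>

definition mass_seqs :: "(nat \<Rightarrow> real) set" where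
  "mass_seqs = {s. (\<forall>i. s i \<in> {0..1}) \<and> (\<forall>i j. i < j \<longrightarrow> s j < s i) \<and> s sums 1}"

definition distinct_seqs :: "(nat \<Rightarrow> 'a) set" where
  "distinct_seqs = {x. inj x}"

lemma sets_weighted_dirac_sum [simp]: "sets (weighted_dirac_sum s y) = sets borel"
  unfolding weighted_dirac_sum_def
  using sets.sigma_sets_eq[of borel] by (simp add: sets_measure_of)

lemma space_weighted_dirac_sum [simp]: "space (weighted_dirac_sum s y) = UNIV"
  by (simp add: weighted_dirac_sum_def)

lemma emeasure_weighted_dirac_sum:
  assumes "A \<in> sets borel"
  shows "emeasure (weighted_dirac_sum s y) A =
    (\<Sum>j. ennreal (s j) * emeasure (return borel (y j)) A)"
proof (rule emeasure_measure_of[OF weighted_dirac_sum_def])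
  show "sets borel \<subseteq> Pow UNIV" by simp
  show "A \<in> sets (weighted_dirac_sum s y)"
    using assms by simp
  show "positive (sets (weighted_dirac_sum s y))
      (\<lambda>A. \<Sum>j. ennreal (s j) * emeasure (return borel (y j)) A)"
    by (simp add: positive_def)
  show "countably_additive (sets (weighted_dirac_sum s y))
      (\<lambda>A. \<Sum>j. ennreal (s j) * emeasure (return borel (y j)) A)"
    unfolding sets_weighted_dirac_sum
  proof (rule countably_additiveI)
    fix B :: "nat \<Rightarrow> 'a set"
    assume B: "range B \<subseteq> sets borel" "disjoint_family B"
    have "(\<Sum>i. \<Sum>j. ennreal (s j) * emeasure (return borel (y j)) (B i)) =
        (\<Sum>j. \<Sum>i. ennreal (s j) * emeasure (return borel (y j)) (B i))"
      using nn_integral_suminf[of "\<lambda>i j. ennreal (s j) * emeasure (return borel (y j)) (B i)"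
          "count_space UNIV"]
      by (simp only: nn_integral_count_space_nat measurable_count_space_eq1 UNIV_I
          simp_thms space_borel Pi_UNIV)
    also have "\<dots> = (\<Sum>j. ennreal (s j) * emeasure (return borel (y j)) (\<Union>i. B i))"
      using B by (simp add: suminf_emeasure ennreal_suminf_cmult del: emeasure_return)
    finally show "(\<Sum>i. \<Sum>j. ennreal (s j) * emeasure (return borel (y j)) (B i)) =
        (\<Sum>j. ennreal (s j) * emeasure (return borel (y j)) (\<Union>i. B i))" .
  qed
qed

lemma Rep_dirac_mixture:
  assumes "s \<in> mass_seqs"
  shows "Rep_borel_prob (dirac_mixture s y) = weighted_dirac_sum s y"
  unfolding dirac_mixture_def
proof (rule Abs_borel_prob_inverse, intro CollectI conjI prob_spaceI)
  show "sets (weighted_dirac_sum s y) = sets borel"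
    by simp
  have "emeasure (weighted_dirac_sum s y) (space (weighted_dirac_sum s y)) =
      (\<Sum>j. ennreal (s j))"
    by (simp add: emeasure_weighted_dirac_sum)
  also have "\<dots> = 1"
  proof -
    have "s sums 1" and nonneg: "\<forall>i. s i \<in> {0..1}"
      using assms unfolding mass_seqs_def by blast+
    have "0 \<le> s i" for i
      using nonneg[rule_format, of i] by simp
    from suminf_ennreal_eq[OF this \<open>s sums 1\<close>] show ?thesis
      by simp
  qed
  finally show "emeasure (weighted_dirac_sum s y) (space (weighted_dirac_sum s y)) = 1" .
qed

definition data_topology :: "((nat \<Rightarrow> real) \<times> (nat \<Rightarrow> 'n::finite torus)) topology" where
  "data_topology = prod_topology (top_of_set mass_seqs) (top_of_set distinct_seqs)"

text \<open>Elements of \<open>C([0,T]; \<real>\<^sup>d)\<close> are represented by functions that are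
  \<^term>\<open>undefined\<close> outside \<open>[0,T]\<close>; the topology is that of uniform convergence.\<close>

definition path_topology :: "real \<Rightarrow> (real \<Rightarrow> real ^ 'n::finite) topology" where
  "path_topology T = mtopology_of (cfunspace (top_of_set {0..T}) euclidean_metric)"

definition solution_topology :: "real \<Rightarrow>
    (((nat \<Rightarrow> real) \<times> (nat \<Rightarrow> 'n::finite torus)) \<times>
      (nat \<Rightarrow> real \<Rightarrow> real ^ 'n) \<times> (nat \<Rightarrow> real \<Rightarrow> real ^ 'n)) topology" where
  "solution_topology T = prod_topology data_topology
     (prod_topology (product_topology (\<lambda>_. path_topology T) UNIV)
                    (product_topology (\<lambda>_. path_topology T) UNIV))"

definition borel_of :: "'a topology \<Rightarrow> 'a measure" where
  "borel_of S = sigma (topspace S) {U. openin S U}"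

definition extend_path :: "real \<Rightarrow> real \<Rightarrow> (real \<Rightarrow> 'a) \<Rightarrow> real \<Rightarrow> 'a" where
  "extend_path t0 T f = (\<lambda>t\<in>{0..T}. f (max t0 t))"

section \<open>Weak solutions\<close>

definition filtered_prob_space ::
    "'w measure \<Rightarrow> (real \<Rightarrow> 'w measure) \<Rightarrow> real \<Rightarrow> real \<Rightarrow> bool" where
  "filtered_prob_space Q F t0 T \<longleftrightarrow> prob_space Q \<and>
     (\<forall>t\<in>{t0..T}. subalgebra Q (F t)) \<and>
     (\<forall>s\<in>{t0..T}. \<forall>t\<in>{t0..T}. s \<le> t \<longrightarrow> subalgebra (F t) (F s))"

definition continuous_adapted ::
    "'w measure \<Rightarrow> (real \<Rightarrow> 'w measure) \<Rightarrow> real \<Rightarrow> real \<Rightarrow>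
      (real \<Rightarrow> 'w \<Rightarrow> 'b::topological_space) \<Rightarrow> bool" where
  "continuous_adapted Q F t0 T Y \<longleftrightarrow>
     (\<forall>t\<in>{t0..T}. Y t \<in> borel_measurable (F t)) \<and>
     (\<forall>\<omega>\<in>space Q. continuous_on {t0..T} (\<lambda>t. Y t \<omega>))"

definition brownian_motion ::
    "'w measure \<Rightarrow> (real \<Rightarrow> 'w measure) \<Rightarrow> real \<Rightarrow> real \<Rightarrow>
      (real \<Rightarrow> 'w \<Rightarrow> real ^ 'n::finite) \<Rightarrow> bool" where
  "brownian_motion Q F t0 T B \<longleftrightarrow>
     continuous_adapted Q F t0 T B \<and>
     (AE \<omega> in Q. B t0 \<omega> = 0) \<and>
     (\<forall>s\<in>{t0..T}. \<forall>t\<in>{t0..T}. s < t \<longrightarrow>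
        prob_space.indep_set Q (sets (F s))
          {(\<lambda>\<omega>. B t \<omega> - B s \<omega>) -` A \<inter> space Q | A. A \<in> sets borel} \<and>
        distributed Q lborel (\<lambda>\<omega>. B t \<omega> - B s \<omega>)
          (\<lambda>z. ennreal (\<Prod>k\<in>UNIV. normal_density 0 (sqrt (t - s)) (z $ k))))"

text \<open>The processes \<open>X i\<close> are required to be continuous and adapted, as is part of the standard
  notion of a weak solution of a stochastic differential equation. Path continuity is required for every
  \<open>\<omega>\<close>, so that the solution is a random variable with values in the space carrying
  \<^const>\<open>solution_topology\<close>.\<close>

definition weak_solution ::
    "real \<Rightarrow> (nat \<Rightarrow> real \<Rightarrow> 'n::finite torus borel_prob \<Rightarrow> 'n torus \<Rightarrow> real ^ 'n) \<Rightarrow> real \<Rightarrow>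
      ((nat \<Rightarrow> real) \<times> (nat \<Rightarrow> 'n torus)) measure \<Rightarrow>
      'w measure \<Rightarrow> (real \<Rightarrow> 'w measure) \<Rightarrow> ('w \<Rightarrow> nat \<Rightarrow> real) \<Rightarrow> ('w \<Rightarrow> nat \<Rightarrow> 'n torus) \<Rightarrow>
      (nat \<Rightarrow> real \<Rightarrow> 'w \<Rightarrow> real ^ 'n) \<Rightarrow> (nat \<Rightarrow> real \<Rightarrow> 'w \<Rightarrow> real ^ 'n) \<Rightarrow> bool" where
  "weak_solution T b t0 m Q F s x X W \<longleftrightarrow>
     filtered_prob_space Q F t0 T \<and>
     (\<forall>i. brownian_motion Q F t0 T (W i)) \<and>
     prob_space.indep_vars Q (\<lambda>i. PiM {t0..T} (\<lambda>_. borel))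
       (\<lambda>i \<omega>. \<lambda>t\<in>{t0..T}. W i t \<omega>) UNIV \<and>
     (\<lambda>\<omega>. (s \<omega>, x \<omega>)) \<in> measurable (F t0) (borel_of data_topology) \<and>
     distr Q (borel_of data_topology) (\<lambda>\<omega>. (s \<omega>, x \<omega>)) = m \<and>
     (\<forall>i. continuous_adapted Q F t0 T (X i)) \<and>
     (AE \<omega> in Q. \<forall>i. \<forall>t\<in>{t0..T}.
        X i t \<omega> = torus_rep (x \<omega> i)
          + (LINT r:{t0..t}|lborel.
              b i r (dirac_mixture (s \<omega>) (\<lambda>j. torus_proj (X j r \<omega>))) (torus_proj (X i r \<omega>)))
          + sqrt (2 / s \<omega> i) *\<^sub>R W i t \<omega>)"

definition solution_law :: "real \<Rightarrow> real \<Rightarrow>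
      'w measure \<Rightarrow> ('w \<Rightarrow> nat \<Rightarrow> real) \<Rightarrow> ('w \<Rightarrow> nat \<Rightarrow> 'n torus) \<Rightarrow>
      (nat \<Rightarrow> real \<Rightarrow> 'w \<Rightarrow> real ^ 'n::finite) \<Rightarrow> (nat \<Rightarrow> real \<Rightarrow> 'w \<Rightarrow> real ^ 'n) \<Rightarrow>
      (((nat \<Rightarrow> real) \<times> (nat \<Rightarrow> 'n torus)) \<times>
        (nat \<Rightarrow> real \<Rightarrow> real ^ 'n) \<times> (nat \<Rightarrow> real \<Rightarrow> real ^ 'n)) measure" where
  "solution_law T t0 Q s x X W = distr Q (borel_of (solution_topology T))
     (\<lambda>\<omega>. ((s \<omega>, x \<omega>),
       (\<lambda>i. extend_path t0 T (\<lambda>t. X i t \<omega>)), (\<lambda>i. extend_path t0 T (\<lambda>t. W i t \<omega>))))"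

end

theory Submission imports Defs begin

text \<open>
  The idea is Girsanov's theorem, carried out without stochastic integrals. Rescale the \<open>i\<close>-th equation
  to \<open>V\<^sup>i = sqrt (s\<^sub>i / 2) (X\<^sup>i - \<iota>(x\<^sub>i)) = W\<^sup>i + A\<^sup>i\<close>. If the drifts are bounded by \<open>C\<close>, the path
  \<open>A\<^sup>i\<close> is Lipschitz with constant \<open>C sqrt (s\<^sub>i / 2)\<close>, and because the masses sum to \<open>1\<close> the squares of
  these constants sum to at most \<open>C\<^sup>2 / 2\<close> (times the dimension, when scalar components are counted).
  So the infinitely many drifts have a finite total energy, uniformly in \<open>\<omega>\<close>, and one change of measure
  can remove all of them. Moreover \<open>A\<close>, and with it \<open>X\<close> and \<open>W = V - A\<close>, is a measurable functional of
  \<open>Y = ((s, x), V)\<close>, the same functional for both solutions (\<open>reconstruct\<close>). Hence it suffices that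
  \<open>Y\<close> has the same law under both.

  On the dyadic grid of level \<open>n\<close>, replace the drift of finitely many components by its slope over the
  preceding grid interval. This is a piecewise constant predictable process, so its Girsanov density
  \<open>Z n\<close> is an explicit exponential of finitely many increments, and it is a function of \<open>Y\<close> that does
  not depend on the solution. Under \<open>Z n\<close> the Fourier transform of the discretised \<open>V\<close>, restricted
  to an event in the initial data, is Gaussian and depends on the law of \<open>(s, x)\<close> only (\<open>fourier_Z\<close>).
  The \<open>Z n\<close> form a Cauchy sequence in \<open>L\<^sup>1\<close> (\<open>L1_Cauchy\<close>, by a Hellinger estimate), and their limit \<open>\<Psi>\<close>,
  again a common function of \<open>Y\<close>, is positive almost everywhere, because \<open>1 / Z n\<close> has bounded mean.
  Passing to the limit, the two laws of \<open>Y\<close>, multiplied by the density \<open>\<Psi>\<close> and restricted to events in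
  the initial data, have equal Fourier transforms in every finite set of coordinates of \<open>V\<close>. The
  weighted laws are therefore equal, and dividing by \<open>\<Psi>\<close> proves that the laws
  of \<open>Y\<close> agree (\<open>girsanov_uniqueness\<close>).

  Two probabilistic facts carry the discrete computation. The exponential of a predictable combination of
  increments, with its quadratic compensator, has constant mean (\<open>exp_martingale_grid\<close>); as in Levy's
  characterisation, this rests, besides moment bounds, on the conditional means and covariances of the
  increments given the past. The covariances between different components need an argument: each \<open>W\<^sup>i\<close> is a Brownian motion
  for the common filtration and the \<open>W\<^sup>i\<close> are independent of each other, but that does not assert that
  their increments are jointly independent of the past. The vanishing of the mixed conditional covariance
  follows from the smallness of the discrete cross variation (\<open>independent_increments_orth\<close>).
\<close>

section \<open>Gaussian and exponential estimates\<close>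

lemma normal_density_exp_shift:
  assumes "\<sigma> > 0"
  shows "normal_density 0 \<sigma> x * exp (a * x) = exp (a\<^sup>2 * \<sigma>\<^sup>2 / 2) * normal_density (a * \<sigma>\<^sup>2) \<sigma> x"
proof -
  have "- (x - 0)\<^sup>2 / (2 * \<sigma>\<^sup>2) + a * x = a\<^sup>2 * \<sigma>\<^sup>2 / 2 + - (x - a * \<sigma>\<^sup>2)\<^sup>2 / (2 * \<sigma>\<^sup>2)"
    using assms by (simp add: field_simps power2_eq_square)
  then show ?thesis
    unfolding normal_density_def by (simp add: mult_exp_exp mult.left_commute)
qed

text \<open>
  The largest summand dominates the mean. This separates the variables: the exponential of a sum is
  integrable by the marginal laws of the summands alone.
\<close>

lemma exp_sum_le:
  fixes x :: "'p \<Rightarrow> real"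
  assumes "finite I" "\<And>p. p \<in> I \<Longrightarrow> 0 \<le> x p"
  shows "exp (\<Sum>p\<in>I. x p) \<le> 1 + (\<Sum>p\<in>I. exp (real (card I) * x p))"
proof (cases "I = {}")
  case False
  define M where "M = Max (x ` I)"
  have "M \<in> x ` I" unfolding M_def using False assms by (intro Max_in) auto
  then obtain q where q: "q \<in> I" "x q = M" by auto
  have "(\<Sum>p\<in>I. x p) \<le> real (card I) * M"
    using sum_bounded_above[of I x M] assms by (simp add: M_def)
  then have "exp (\<Sum>p\<in>I. x p) \<le> exp (real (card I) * x q)" using q by simp
  also have "\<dots> \<le> (\<Sum>p\<in>I. exp (real (card I) * x p))"
    using q assms by (intro member_le_sum) auto
  finally show ?thesis by simp
qed auto

section \<open>Random variables with moments of all orders\<close>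

text \<open>
  A class closed under products, sums and bounded factors, so that integrability of every product formed
  below is decided by its shape.
\<close>

definition all_moments :: "'w measure \<Rightarrow> ('w \<Rightarrow> 'b::{real_normed_field, banach, second_countable_topology}) \<Rightarrow> bool" where
  "all_moments Q f \<longleftrightarrow> f \<in> borel_measurable Q \<and> (\<forall>k. integrable Q (\<lambda>\<omega>. norm (f \<omega>) ^ k))"

lemma all_moments_measurable: "all_moments Q f \<Longrightarrow> f \<in> borel_measurable Q"
  by (simp add: all_moments_def)

lemma all_moments_integrable_power: "all_moments Q f \<Longrightarrow> integrable Q (\<lambda>\<omega>. norm (f \<omega>) ^ k)"
  by (simp add: all_moments_def)

lemma all_moments_integrable: "all_moments Q f \<Longrightarrow> integrable Q f"
  using all_moments_integrable_power[of Q f 1] integrable_norm_iff[of f Q] all_moments_measurable[of Q f] by simp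

lemma all_moments_bound:
  fixes f :: "'w \<Rightarrow> 'b::{real_normed_field, banach, second_countable_topology}"
    and g :: "'w \<Rightarrow> 'c::{real_normed_field, banach, second_countable_topology}"
  assumes "all_moments Q g" "f \<in> borel_measurable Q" "\<And>\<omega>. \<omega> \<in> space Q \<Longrightarrow> norm (f \<omega>) \<le> norm (g \<omega>)"
  shows "all_moments Q f"
  unfolding all_moments_def
proof (intro conjI allI)
  fix k
  show "integrable Q (\<lambda>\<omega>. norm (f \<omega>) ^ k)"
    using assms(2)
    by (intro Bochner_Integration.integrable_bound[OF all_moments_integrable_power[OF assms(1), of k]])
       (auto intro!: AE_I2 power_mono assms(3))
qed (use assms in auto)

lemma all_moments_mult:
  assumes "all_moments Q f" "all_moments Q g"
  shows "all_moments Q (\<lambda>\<omega>. f \<omega> * g \<omega>)"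
  unfolding all_moments_def
proof (intro conjI allI)
  have [measurable]: "f \<in> borel_measurable Q" "g \<in> borel_measurable Q"
    using assms by (auto simp: all_moments_def)
  show "(\<lambda>\<omega>. f \<omega> * g \<omega>) \<in> borel_measurable Q" by measurable
  fix k
  show "integrable Q (\<lambda>\<omega>. norm (f \<omega> * g \<omega>) ^ k)"
  proof (rule Bochner_Integration.integrable_bound)
    show "integrable Q (\<lambda>\<omega>. norm (f \<omega>) ^ (2*k) + norm (g \<omega>) ^ (2*k))"
      using assms by (auto simp: all_moments_def)
    show "AE \<omega> in Q. norm (norm (f \<omega> * g \<omega>) ^ k) \<le> norm (norm (f \<omega>) ^ (2*k) + norm (g \<omega>) ^ (2*k))"
    proof (intro AE_I2)
      fix \<omega>
      have "2 * (norm (f \<omega>) ^ k * norm (g \<omega>) ^ k) \<le> (norm (f \<omega>) ^ k)\<^sup>2 + (norm (g \<omega>) ^ k)\<^sup>2"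
        using sum_squares_bound[of "norm (f \<omega>) ^ k" "norm (g \<omega>) ^ k"] by (simp only: mult.assoc)
      moreover have "0 \<le> norm (f \<omega>) ^ k * norm (g \<omega>) ^ k" by simp
      ultimately have "norm (f \<omega>) ^ k * norm (g \<omega>) ^ k \<le> (norm (f \<omega>) ^ k)\<^sup>2 + (norm (g \<omega>) ^ k)\<^sup>2"
        by linarith
      then show "norm (norm (f \<omega> * g \<omega>) ^ k) \<le> norm (norm (f \<omega>) ^ (2*k) + norm (g \<omega>) ^ (2*k))"
        by (simp add: norm_mult power_mult_distrib norm_power power_even_eq)
    qed
  qed measurable
qed

lemma all_moments_add:
  assumes "all_moments Q f" "all_moments Q g"
  shows "all_moments Q (\<lambda>\<omega>. f \<omega> + g \<omega>)"
  unfolding all_moments_def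
proof (intro conjI allI)
  have [measurable]: "f \<in> borel_measurable Q" "g \<in> borel_measurable Q"
    using assms by (auto simp: all_moments_def)
  show "(\<lambda>\<omega>. f \<omega> + g \<omega>) \<in> borel_measurable Q" by measurable
  fix k
  show "integrable Q (\<lambda>\<omega>. norm (f \<omega> + g \<omega>) ^ k)"
  proof (rule Bochner_Integration.integrable_bound)
    show "integrable Q (\<lambda>\<omega>. 2 ^ k * (norm (f \<omega>) ^ k + norm (g \<omega>) ^ k))"
      using assms by (auto simp: all_moments_def)
    show "AE \<omega> in Q. norm (norm (f \<omega> + g \<omega>) ^ k) \<le> norm (2 ^ k * (norm (f \<omega>) ^ k + norm (g \<omega>) ^ k))"
    proof (intro AE_I2)
      fix \<omega>
      let ?m = "max (norm (f \<omega>)) (norm (g \<omega>))"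
      have "norm (f \<omega> + g \<omega>) \<le> 2 * ?m" using norm_triangle_ineq[of "f \<omega>" "g \<omega>"] by linarith
      then have "norm (f \<omega> + g \<omega>) ^ k \<le> (2 * ?m) ^ k" by (intro power_mono) auto
      also have "\<dots> \<le> 2 ^ k * (norm (f \<omega>) ^ k + norm (g \<omega>) ^ k)"
        by (auto simp: power_mult_distrib max_def)
      finally show "norm (norm (f \<omega> + g \<omega>) ^ k) \<le> norm (2 ^ k * (norm (f \<omega>) ^ k + norm (g \<omega>) ^ k))"
        by (simp add: norm_power)
    qed
  qed measurable
qed

lemma (in prob_space) all_moments_bounded:
  fixes f :: "'a \<Rightarrow> 'b::{real_normed_field, banach, second_countable_topology}"
  assumes "f \<in> borel_measurable M" "\<And>\<omega>. \<omega> \<in> space M \<Longrightarrow> norm (f \<omega>) \<le> B"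
  shows "all_moments M f"
  unfolding all_moments_def
proof (intro conjI allI)
  fix k
  show "integrable M (\<lambda>\<omega>. norm (f \<omega>) ^ k)"
    using assms by (intro integrable_const_bound[where B="B ^ k"]) (auto intro!: AE_I2 power_mono simp: norm_power)
qed fact

lemma (in prob_space) all_moments_const [simp]: "all_moments M (\<lambda>_. c)"
  by (rule all_moments_bounded[where B="norm c"]) auto

lemma all_moments_diff:
  assumes "all_moments Q f" "all_moments Q g"
  shows "all_moments Q (\<lambda>\<omega>. f \<omega> - g \<omega>)"
proof -
  have "all_moments Q (\<lambda>\<omega>. - g \<omega>)"
    using assms(2) by (auto simp: all_moments_def)
  from all_moments_add[OF assms(1) this] show ?thesis by simp
qed

lemma (in prob_space) all_moments_sum:
  assumes "\<And>p. p \<in> I \<Longrightarrow> all_moments M (f p)"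
  shows "all_moments M (\<lambda>\<omega>. \<Sum>p\<in>I. f p \<omega>)"
  using assms
proof (induction I rule: infinite_finite_induct)
  case (insert x F)
  then show ?case using all_moments_add[of M "f x" "\<lambda>\<omega>. \<Sum>p\<in>F. f p \<omega>"] by auto
qed auto

lemma all_moments_of_real:
  "all_moments Q (\<lambda>\<omega>. of_real (f \<omega>) :: 'b::{real_normed_field, banach, second_countable_topology}) \<longleftrightarrow> all_moments Q f"
  if "f \<in> borel_measurable Q"
  using that by (auto simp: all_moments_def)

lemma Int_stable_preimages: "Int_stable {f -` A \<inter> S | A. A \<in> sets N}"
proof (rule Int_stableI)
  fix a b assume "a \<in> {f -` A \<inter> S | A. A \<in> sets N}" "b \<in> {f -` A \<inter> S | A. A \<in> sets N}"
  then obtain A B where "A \<in> sets N" "B \<in> sets N" "a = f -` A \<inter> S" "b = f -` B \<inter> S" by auto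
  then have "a \<inter> b = f -` (A \<inter> B) \<inter> S" "A \<inter> B \<in> sets N" by auto
  then show "a \<inter> b \<in> {f -` A \<inter> S | A. A \<in> sets N}" by blast
qed

text \<open>
  Independence is given between a sub-sigma-algebra and the events of one variable; since the preimages
  form an intersection-stable system, it passes to the generated sigma-algebras and hence to integrals.
\<close>

lemma (in prob_space) integral_indep_factor:
  fixes Y :: "'a \<Rightarrow> complex" and D :: "'a \<Rightarrow> 'd::topological_space" and g :: "'d \<Rightarrow> real"
  assumes G: "subalgebra M G" and indep: "indep_set (sets G) {D -` A \<inter> space M | A. A \<in> sets borel}"
    and D[measurable]: "D \<in> borel_measurable M"
    and Y: "Y \<in> borel_measurable G" "integrable M Y"
    and g[measurable]: "g \<in> borel_measurable borel" and gi: "integrable M (\<lambda>\<omega>. g (D \<omega>))"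
  shows "(\<integral>\<omega>. Y \<omega> * complex_of_real (g (D \<omega>)) \<partial>M) = (\<integral>\<omega>. Y \<omega> \<partial>M) * complex_of_real (\<integral>\<omega>. g (D \<omega>) \<partial>M)"
proof -
  have sp: "space G = space M" using G by (simp add: subalgebra_def)
  have YM: "Y \<in> borel_measurable M" by (rule measurable_from_subalg[OF G Y(1)])
  have "indep_var borel Y borel (\<lambda>\<omega>. complex_of_real (g (D \<omega>)))"
    unfolding indep_var_eq
  proof (intro conjI)
    show "random_variable borel Y" by fact
    show "random_variable borel (\<lambda>\<omega>. complex_of_real (g (D \<omega>)))" by measurable
    have *: "indep_set {Y -` A \<inter> space M |A. A \<in> sets borel}
       {(\<lambda>\<omega>. complex_of_real (g (D \<omega>))) -` A \<inter> space M |A. A \<in> sets borel}"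
    proof (intro indep_setI)
      show "{Y -` A \<inter> space M |A. A \<in> sets borel} \<subseteq> events"
        using YM by (auto intro: measurable_sets)
      show "{(\<lambda>\<omega>. complex_of_real (g (D \<omega>))) -` A \<inter> space M |A. A \<in> sets borel} \<subseteq> events"
        by auto
      fix a b assume a: "a \<in> {Y -` A \<inter> space M |A. A \<in> sets borel}"
        and b: "b \<in> {(\<lambda>\<omega>. complex_of_real (g (D \<omega>))) -` A \<inter> space M |A. A \<in> sets borel}"
      have a': "a \<in> sets G" using a Y(1) sp by (auto dest: measurable_sets[of Y G borel])
      obtain A where A: "A \<in> sets borel" "b = (\<lambda>\<omega>. complex_of_real (g (D \<omega>))) -` A \<inter> space M" using b by auto
      have "(\<lambda>x. complex_of_real (g x)) -` A \<inter> space borel \<in> sets borel"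
        by (rule measurable_sets[OF _ A(1)]) measurable
      moreover have "b = D -` ((\<lambda>x. complex_of_real (g x)) -` A \<inter> space borel) \<inter> space M"
        using A by auto
      ultimately have b': "b \<in> {D -` A \<inter> space M | A. A \<in> sets borel}" by blast
      show "prob (a \<inter> b) = prob a * prob b"
        using indep_setD[OF indep a' b'] .
    qed
    show "indep_set (sigma_sets (space M) {Y -` A \<inter> space M |A. A \<in> sets borel})
     (sigma_sets (space M) {(\<lambda>\<omega>. complex_of_real (g (D \<omega>))) -` A \<inter> space M |A. A \<in> sets borel})"
      by (rule indep_set_sigma_sets[OF * Int_stable_preimages Int_stable_preimages])
  qed
  from indep_var_lebesgue_integral[OF this Y(2)] gi show ?thesis by simp
qed

section \<open>Families of Brownian motions\<close>

text \<open>
  Each \<open>w p\<close> separately has Gaussian increments that are independent of the past in a common filtration;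
  different indices are not related.
\<close>

locale brownian_marginals = prob_space Q
  for Q :: "'w measure" +
  fixes F :: "real \<Rightarrow> 'w measure" and t0 T :: real and w :: "'p \<Rightarrow> real \<Rightarrow> 'w \<Rightarrow> real"
  assumes subalg: "t \<in> {t0..T} \<Longrightarrow> subalgebra Q (F t)"
    and filt: "s \<in> {t0..T} \<Longrightarrow> t \<in> {t0..T} \<Longrightarrow> s \<le> t \<Longrightarrow> subalgebra (F t) (F s)"
    and adapted: "t \<in> {t0..T} \<Longrightarrow> w p t \<in> borel_measurable (F t)"
    and gauss: "t0 \<le> s \<Longrightarrow> s < t \<Longrightarrow> t \<le> T \<Longrightarrow>
      distributed Q lborel (\<lambda>\<omega>. w p t \<omega> - w p s \<omega>) (normal_density 0 (sqrt (t - s)))"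
    and indep: "t0 \<le> s \<Longrightarrow> s < t \<Longrightarrow> t \<le> T \<Longrightarrow>
      indep_set (sets (F s)) {(\<lambda>\<omega>. w p t \<omega> - w p s \<omega>) -` A \<inter> space Q | A. A \<in> sets borel}"
begin

lemma meas_F: "t \<in> {t0..T} \<Longrightarrow> f \<in> measurable (F t) N \<Longrightarrow> f \<in> measurable Q N"
  by (rule measurable_from_subalg[OF subalg])

lemma meas_F_mono: "s \<in> {t0..T} \<Longrightarrow> t \<in> {t0..T} \<Longrightarrow> s \<le> t \<Longrightarrow> f \<in> measurable (F s) N \<Longrightarrow> f \<in> measurable (F t) N"
  by (rule measurable_from_subalg[OF filt])

lemma w_meas[measurable]: "t \<in> {t0..T} \<Longrightarrow> w p t \<in> borel_measurable Q"
  using adapted meas_F by blast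

context
  fixes s t assumes st: "t0 \<le> s" "s < t" "t \<le> T"
begin

lemma incr_moments:
  shows incr_exp_integrable: "integrable Q (\<lambda>\<omega>. exp (a * (w p t \<omega> - w p s \<omega>)))"
    and incr_exp_integral: "(\<integral>\<omega>. exp (a * (w p t \<omega> - w p s \<omega>)) \<partial>Q) = exp (a\<^sup>2 * (t - s) / 2)"
    and incr_mean: "(\<integral>\<omega>. w p t \<omega> - w p s \<omega> \<partial>Q) = 0"
    and incr_var: "(\<integral>\<omega>. (w p t \<omega> - w p s \<omega>)\<^sup>2 \<partial>Q) = t - s"
proof -
  note D = gauss[OF st, of p]
  have \<sigma>: "sqrt (t - s) > 0" using st by simp
  note n0 = normal_density_nonneg
  have eq: "(\<lambda>x. normal_density 0 (sqrt (t - s)) x * exp (a * x)) =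
      (\<lambda>x. exp (a\<^sup>2 * (t - s) / 2) * normal_density (a * (t - s)) (sqrt (t - s)) x)"
    using normal_density_exp_shift[OF \<sigma>, of _ a] st by simp
  have "integrable lborel (\<lambda>x. normal_density 0 (sqrt (t - s)) x * exp (a * x))"
    unfolding eq using \<sigma> by simp
  then show "integrable Q (\<lambda>\<omega>. exp (a * (w p t \<omega> - w p s \<omega>)))"
    using distributed_integrable[OF D, of "\<lambda>x. exp (a * x)"] by simp
  have "(\<integral>x. normal_density 0 (sqrt (t - s)) x * exp (a * x) \<partial>lborel) = exp (a\<^sup>2 * (t - s) / 2)"
    unfolding eq using \<sigma> by simp
  then show "(\<integral>\<omega>. exp (a * (w p t \<omega> - w p s \<omega>)) \<partial>Q) = exp (a\<^sup>2 * (t - s) / 2)"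
    using distributed_integral[OF D, of "\<lambda>x. exp (a * x)"] by simp
  show "(\<integral>\<omega>. w p t \<omega> - w p s \<omega> \<partial>Q) = 0"
    using normal_distributed_expectation[OF \<sigma> D] by simp
  show "(\<integral>\<omega>. (w p t \<omega> - w p s \<omega>)\<^sup>2 \<partial>Q) = t - s"
    using normal_distributed_variance[OF \<sigma> D] normal_distributed_expectation[OF \<sigma> D] st by simp
qed

lemma incr_abs_exp:
  assumes "a \<ge> 0"
  shows incr_abs_exp_integrable: "integrable Q (\<lambda>\<omega>. exp (a * \<bar>w p t \<omega> - w p s \<omega>\<bar>))"
    and incr_abs_exp_integral: "(\<integral>\<omega>. exp (a * \<bar>w p t \<omega> - w p s \<omega>\<bar>) \<partial>Q) \<le> 2 * exp (a\<^sup>2 * (t - s) / 2)"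
proof -
  have [measurable]: "w p t \<in> borel_measurable Q" "w p s \<in> borel_measurable Q"
    using st by auto
  have le: "exp (a * \<bar>x\<bar>) \<le> exp (a * x) + exp ((-a) * x)" for x :: real
    by (cases "x \<ge> 0") auto
  have i: "integrable Q (\<lambda>\<omega>. exp (a * (w p t \<omega> - w p s \<omega>)) + exp ((-a) * (w p t \<omega> - w p s \<omega>)))"
    by (intro Bochner_Integration.integrable_add incr_exp_integrable)
  show *: "integrable Q (\<lambda>\<omega>. exp (a * \<bar>w p t \<omega> - w p s \<omega>\<bar>))"
    by (rule Bochner_Integration.integrable_bound[OF i]) (use le in \<open>auto intro!: AE_I2 simp del: mult_minus_left\<close>)
  have "(\<integral>\<omega>. exp (a * \<bar>w p t \<omega> - w p s \<omega>\<bar>) \<partial>Q) \<le>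
      (\<integral>\<omega>. exp (a * (w p t \<omega> - w p s \<omega>)) + exp ((-a) * (w p t \<omega> - w p s \<omega>)) \<partial>Q)"
    by (intro integral_mono * i le)
  also have "\<dots> = 2 * exp (a\<^sup>2 * (t - s) / 2)"
    unfolding Bochner_Integration.integral_add[OF incr_exp_integrable incr_exp_integrable]
      incr_exp_integral by simp
  finally show "(\<integral>\<omega>. exp (a * \<bar>w p t \<omega> - w p s \<omega>\<bar>) \<partial>Q) \<le> 2 * exp (a\<^sup>2 * (t - s) / 2)" .
qed

lemma exp_incr_all_moments:
  assumes "a \<ge> 0"
  shows "all_moments Q (\<lambda>\<omega>. exp (a * \<bar>w p t \<omega> - w p s \<omega>\<bar>))"
  unfolding all_moments_def
proof (intro conjI allI)
  show "(\<lambda>\<omega>. exp (a * \<bar>w p t \<omega> - w p s \<omega>\<bar>)) \<in> borel_measurable Q"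
    using st by simp
  fix k
  show "integrable Q (\<lambda>\<omega>. norm (exp (a * \<bar>w p t \<omega> - w p s \<omega>\<bar>)) ^ k)"
    using incr_abs_exp_integrable[of "of_nat k * a" p] assms
    by (simp add: exp_of_nat_mult[symmetric] mult.assoc)
qed

lemma incr_all_moments: "all_moments Q (\<lambda>\<omega>. w p t \<omega> - w p s \<omega>)"
proof (rule all_moments_bound[OF exp_incr_all_moments[of 1 p]])
  fix \<omega>
  have "\<bar>w p t \<omega> - w p s \<omega>\<bar> \<le> exp \<bar>w p t \<omega> - w p s \<omega>\<bar>"
    using exp_ge_add_one_self[of "\<bar>w p t \<omega> - w p s \<omega>\<bar>"] by linarith
  then show "norm (w p t \<omega> - w p s \<omega>) \<le> norm (exp (1 * \<bar>w p t \<omega> - w p s \<omega>\<bar>))" by simp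
qed (use st in auto)

lemma incr_c_all_moments: "all_moments Q (\<lambda>\<omega>. complex_of_real (w p t \<omega> - w p s \<omega>))"
  using incr_all_moments[of p] st by (subst all_moments_of_real) auto

lemma incr_indep:
  fixes Y :: "'w \<Rightarrow> complex"
  assumes Y: "Y \<in> borel_measurable (F s)" "integrable Q Y"
    and g: "g \<in> borel_measurable borel" "integrable Q (\<lambda>\<omega>. g (w p t \<omega> - w p s \<omega>))"
  shows "(\<integral>\<omega>. Y \<omega> * complex_of_real (g (w p t \<omega> - w p s \<omega>)) \<partial>Q) =
      (\<integral>\<omega>. Y \<omega> \<partial>Q) * complex_of_real (\<integral>\<omega>. g (w p t \<omega> - w p s \<omega>) \<partial>Q)"
proof (rule integral_indep_factor[OF _ indep[OF st] _ Y g])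
  show "subalgebra Q (F s)" using st by (intro subalg) auto
qed (use st in auto)

lemma incr_mean_zero:
  fixes Y :: "'w \<Rightarrow> complex"
  assumes "Y \<in> borel_measurable (F s)" "integrable Q Y"
  shows "(\<integral>\<omega>. Y \<omega> * complex_of_real (w p t \<omega> - w p s \<omega>) \<partial>Q) = 0"
  using incr_indep[OF assms, of "\<lambda>x. x" p] incr_mean[of p] all_moments_integrable[OF incr_all_moments[of p]] by simp

end

end

text \<open>
  The only link between different components that the exponential martingale needs: their increments
  are uncorrelated given the past. This is weaker than joint independence of the increments from the past.
\<close>

locale brownian_family = brownian_marginals Q F t0 T w
  for Q :: "'w measure" and F :: "real \<Rightarrow> 'w measure" and t0 T :: real and w :: "'p \<Rightarrow> real \<Rightarrow> 'w \<Rightarrow> real" +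
  assumes orth: "p \<noteq> q \<Longrightarrow> t0 \<le> s \<Longrightarrow> s < t \<Longrightarrow> t \<le> T \<Longrightarrow> Y \<in> borel_measurable (F s) \<Longrightarrow> all_moments Q Y \<Longrightarrow>
      (\<integral>\<omega>. Y \<omega> * complex_of_real ((w p t \<omega> - w p s \<omega>) * (w q t \<omega> - w q s \<omega>)) \<partial>Q) = 0"
begin

lemma incr_second_moment:
  fixes Y :: "'w \<Rightarrow> complex"
  assumes st: "t0 \<le> s" "s < t" "t \<le> T" and Y: "Y \<in> borel_measurable (F s)" "all_moments Q Y"
  shows "(\<integral>\<omega>. Y \<omega> * complex_of_real ((w p t \<omega> - w p s \<omega>) * (w q t \<omega> - w q s \<omega>)) \<partial>Q) =
    (if p = q then complex_of_real (t - s) * (\<integral>\<omega>. Y \<omega> \<partial>Q) else 0)"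
proof (cases "p = q")
  case True
  have "integrable Q (\<lambda>\<omega>. (w p t \<omega> - w p s \<omega>)\<^sup>2)"
    using all_moments_integrable[OF all_moments_mult[OF incr_all_moments[OF st, of p] incr_all_moments[OF st, of p]]]
    by (simp add: power2_eq_square)
  then show ?thesis
    using incr_indep[OF st Y(1) all_moments_integrable[OF Y(2)], of "\<lambda>x. x\<^sup>2" p] incr_var[OF st, of p] True
    by (simp add: power2_eq_square mult.commute)
next
  case False
  then show ?thesis using orth[OF False st Y] by simp
qed

end

section \<open>Exponential martingales\<close>

lemma pow6_le_exp:
  fixes g :: real assumes "g \<ge> 0" shows "g ^ 6 \<le> 46656 * exp g"
proof -
  have "g / 6 \<le> exp (g / 6)" using exp_ge_add_one_self[of "g/6"] by linarith
  then have "(g / 6) ^ 6 \<le> exp (g / 6) ^ 6" using assms by (intro power_mono) auto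
  also have "\<dots> = exp g" by (simp add: exp_of_nat_mult[symmetric])
  finally show ?thesis by (simp add: power_divide)
qed

lemma le_square_add_1: "(x::real) \<le> x\<^sup>2 + 1"
proof -
  have "2 * x * 1 \<le> x\<^sup>2 + 1\<^sup>2" by (rule sum_squares_bound)
  moreover have "0 \<le> x\<^sup>2" by simp
  ultimately show ?thesis unfolding one_power2 by linarith
qed

lemma norm_exp_le_exp_norm: "norm (exp z) \<le> exp (norm (z::complex))"
  using complex_Re_le_cmod[of z] by (simp add: norm_exp_eq_Re)

text \<open>Half-integer powers of the step size are written with \<^const>\<open>sqrt\<close>.\<close>

lemma exp_taylor2_square_bound:
  fixes z :: complex and g h :: real
  assumes h: "0 < h" "h \<le> 1" and g: "g \<ge> 0" and z: "norm z \<le> sqrt h * g"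
  shows "(norm (exp z - 1 - z - z\<^sup>2 / 2))\<^sup>2 \<le> h ^ 3 * (46656 * exp (3 * g))"
proof -
  have s: "sqrt h \<le> 1" "sqrt h > 0" using h by auto
  have zg: "norm z \<le> g" using z s g mult_right_mono[of "sqrt h" 1 g] by simp
  have e: "exp z - 1 - z - z\<^sup>2 / 2 = exp z - (\<Sum>k\<le>2. z ^ k / fact k)"
    by (simp add: numeral_2_eq_2)
  have "norm (exp z - 1 - z - z\<^sup>2 / 2) \<le> exp \<bar>Re z\<bar> * norm z ^ Suc 2 / fact 2"
    unfolding e by (rule Taylor_exp)
  also have "\<dots> \<le> exp g * (sqrt h * g) ^ 3"
  proof -
    have "exp \<bar>Re z\<bar> \<le> exp g" using abs_Re_le_cmod[of z] zg by simp
    moreover have "norm z ^ 3 \<le> (sqrt h * g) ^ 3" using z by (intro power_mono) auto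
    ultimately have "exp \<bar>Re z\<bar> * norm z ^ 3 \<le> exp g * (sqrt h * g) ^ 3"
      by (intro mult_mono) auto
    moreover have "0 \<le> exp g * (sqrt h * g) ^ 3" using h g by simp
    ultimately have "exp \<bar>Re z\<bar> * norm z ^ 3 / 2 \<le> exp g * (sqrt h * g) ^ 3" by linarith
    then show ?thesis by (simp add: numeral_3_eq_3 numeral_2_eq_2)
  qed
  finally have "(norm (exp z - 1 - z - z\<^sup>2 / 2))\<^sup>2 \<le> (exp g * (sqrt h * g) ^ 3)\<^sup>2"
    by (intro power_mono) auto
  also have "\<dots> = (exp g)\<^sup>2 * ((sqrt h)\<^sup>2) ^ 3 * g ^ 6"
    by (simp only: power_mult_distrib power_mult[symmetric]) simp
  also have "\<dots> \<le> (exp g)\<^sup>2 * h ^ 3 * (46656 * exp g)"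
    using h pow6_le_exp[OF g] by (intro mult_mono) auto
  also have "\<dots> = h ^ 3 * (46656 * exp (3 * g))"
    by (simp add: exp_of_nat_mult[of 3 g, simplified] power2_eq_square power3_eq_cube)
  finally show ?thesis .
qed

text \<open>
  The exponent of an exponential martingale over a step of length \<open>h\<close>, with complex coefficients
  \<open>c\<close> and quadratic compensator. No absolute values are taken in \<open>(c p)\<^sup>2\<close>, so imaginary coefficients give
  Fourier transforms.
\<close>

definition exp_increment :: "'p set \<Rightarrow> ('p \<Rightarrow> complex) \<Rightarrow> ('p \<Rightarrow> real) \<Rightarrow> real \<Rightarrow> complex" where
  "exp_increment I c D h = (\<Sum>p\<in>I. c p * of_real (D p)) - (\<Sum>p\<in>I. (c p)\<^sup>2) * of_real (h / 2)"

lemma norm_exp_increment_le: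
  assumes I: "finite I" and c: "\<And>p. p \<in> I \<Longrightarrow> norm (c p) \<le> B" and h: "h \<ge> 0" and B: "B \<ge> 0"
  shows "norm (exp_increment I c D h) \<le> B * (\<Sum>p\<in>I. \<bar>D p\<bar>) + real (card I) * B\<^sup>2 * h / 2"
proof -
  have "norm (\<Sum>p\<in>I. c p * of_real (D p)) \<le> (\<Sum>p\<in>I. B * \<bar>D p\<bar>)"
    by (rule sum_norm_le) (auto simp: norm_mult intro!: mult_right_mono c)
  moreover have "norm (\<Sum>p\<in>I. (c p)\<^sup>2) \<le> (\<Sum>p\<in>I. B\<^sup>2)"
    by (rule sum_norm_le) (auto simp: norm_power intro!: power_mono c)
  then have "norm ((\<Sum>p\<in>I. (c p)\<^sup>2) * of_real (h / 2)) \<le> real (card I) * B\<^sup>2 * (h / 2)"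
    using h unfolding norm_mult by (intro mult_mono) auto
  ultimately show ?thesis
    unfolding exp_increment_def
    using norm_triangle_ineq4[of "\<Sum>p\<in>I. c p * of_real (D p)" "(\<Sum>p\<in>I. (c p)\<^sup>2) * of_real (h / 2)"]
    by (simp add: sum_distrib_left)
qed

context brownian_family
begin

lemma exp_abs_sum_integral:
  assumes I: "finite I" and a: "a \<ge> 0" and st: "t0 \<le> s" "s < t" "t \<le> T"
  shows "integrable Q (\<lambda>\<omega>. exp (a * (\<Sum>p\<in>I. \<bar>w p t \<omega> - w p s \<omega>\<bar>)))"
    and "(\<integral>\<omega>. exp (a * (\<Sum>p\<in>I. \<bar>w p t \<omega> - w p s \<omega>\<bar>)) \<partial>Q) \<le>
      1 + real (card I) * (2 * exp ((real (card I) * a)\<^sup>2 * (t - s) / 2))"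
proof -
  let ?N = "real (card I)"
  let ?G = "\<lambda>\<omega>. 1 + (\<Sum>p\<in>I. exp (?N * a * \<bar>w p t \<omega> - w p s \<omega>\<bar>))"
  have [measurable]: "\<And>p. w p t \<in> borel_measurable Q" "\<And>p. w p s \<in> borel_measurable Q" using st by auto
  have le: "exp (a * (\<Sum>p\<in>I. \<bar>w p t \<omega> - w p s \<omega>\<bar>)) \<le> ?G \<omega>" for \<omega>
    using exp_sum_le[OF I, of "\<lambda>p. a * \<bar>w p t \<omega> - w p s \<omega>\<bar>"] a by (simp add: sum_distrib_left mult.assoc)
  have G: "integrable Q ?G"
    using a by (intro Bochner_Integration.integrable_add Bochner_Integration.integrable_sum incr_abs_exp_integrable[OF st]) auto
  show i: "integrable Q (\<lambda>\<omega>. exp (a * (\<Sum>p\<in>I. \<bar>w p t \<omega> - w p s \<omega>\<bar>)))"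
  proof (rule Bochner_Integration.integrable_bound[OF G])
    show "AE \<omega> in Q. norm (exp (a * (\<Sum>p\<in>I. \<bar>w p t \<omega> - w p s \<omega>\<bar>))) \<le> norm (?G \<omega>)"
      using le by (intro AE_I2) (simp add: abs_of_nonneg sum_nonneg)
  qed measurable
  have "(\<integral>\<omega>. exp (a * (\<Sum>p\<in>I. \<bar>w p t \<omega> - w p s \<omega>\<bar>)) \<partial>Q) \<le> (\<integral>\<omega>. ?G \<omega> \<partial>Q)"
    by (intro integral_mono i G le)
  also have "\<dots> = 1 + (\<Sum>p\<in>I. \<integral>\<omega>. exp (?N * a * \<bar>w p t \<omega> - w p s \<omega>\<bar>) \<partial>Q)"
    using a by (subst Bochner_Integration.integral_add)
      (auto simp: Bochner_Integration.integral_sum incr_abs_exp_integrable[OF st] prob_space)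
  also have "\<dots> \<le> 1 + (\<Sum>p\<in>I. 2 * exp ((?N * a)\<^sup>2 * (t - s) / 2))"
    using a by (intro add_left_mono sum_mono incr_abs_exp_integral[OF st]) auto
  finally show "(\<integral>\<omega>. exp (a * (\<Sum>p\<in>I. \<bar>w p t \<omega> - w p s \<omega>\<bar>)) \<partial>Q) \<le>
      1 + ?N * (2 * exp ((?N * a)\<^sup>2 * (t - s) / 2))" by simp
qed

lemma exp_abs_sum_all_moments:
  assumes I: "finite I" and a: "a \<ge> 0" and st: "t0 \<le> s" "s < t" "t \<le> T"
  shows "all_moments Q (\<lambda>\<omega>. exp (a * (\<Sum>p\<in>I. \<bar>w p t \<omega> - w p s \<omega>\<bar>)))"
  unfolding all_moments_def
proof (intro conjI allI)
  have [measurable]: "\<And>p. w p t \<in> borel_measurable Q" "\<And>p. w p s \<in> borel_measurable Q" using st by auto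
  show "(\<lambda>\<omega>. exp (a * (\<Sum>p\<in>I. \<bar>w p t \<omega> - w p s \<omega>\<bar>))) \<in> borel_measurable Q" by measurable
  fix k
  show "integrable Q (\<lambda>\<omega>. norm (exp (a * (\<Sum>p\<in>I. \<bar>w p t \<omega> - w p s \<omega>\<bar>))) ^ k)"
    using exp_abs_sum_integral(1)[OF I _ st, of "of_nat k * a"] a
    by (simp add: exp_of_nat_mult[symmetric] mult.assoc)
qed

lemma exp_increment_measurable:
  assumes "s \<in> {t0..T}" "t \<in> {t0..T}" "s \<le> t" and c: "\<And>p. p \<in> I \<Longrightarrow> c p \<in> borel_measurable (F s)"
  shows "(\<lambda>\<omega>. exp_increment I (\<lambda>p. c p \<omega>) (\<lambda>p. w p t \<omega> - w p s \<omega>) h) \<in> borel_measurable (F t)"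
proof -
  have [measurable]: "\<And>p. w p t \<in> borel_measurable (F t)" "\<And>p. w p s \<in> borel_measurable (F t)"
    using assms(2) adapted meas_F_mono[OF assms(1-3) adapted[OF assms(1)]] by auto
  have [measurable]: "p \<in> I \<Longrightarrow> c p \<in> borel_measurable (F t)" for p
    using meas_F_mono[OF assms(1-3) c] by auto
  show ?thesis unfolding exp_increment_def by measurable
qed

lemma exp_increment_all_moments:
  assumes I: "finite I" and st: "t0 \<le> s" "s < t" "t \<le> T" and c: "\<And>p. p \<in> I \<Longrightarrow> c p \<in> borel_measurable (F s)"
    and B: "B \<ge> 0" "\<And>p \<omega>. p \<in> I \<Longrightarrow> \<omega> \<in> space Q \<Longrightarrow> norm (c p \<omega>) \<le> B" and h: "h \<ge> 0"
  shows "all_moments Q (\<lambda>\<omega>. exp (exp_increment I (\<lambda>p. c p \<omega>) (\<lambda>p. w p t \<omega> - w p s \<omega>) h))" (is "all_moments Q ?e")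
proof (rule all_moments_bound)
  show "all_moments Q (\<lambda>\<omega>. exp (real (card I) * B\<^sup>2 * h / 2) * exp (B * (\<Sum>p\<in>I. \<bar>w p t \<omega> - w p s \<omega>\<bar>)))"
    by (intro all_moments_mult all_moments_const exp_abs_sum_all_moments I B st)
  have "?e \<in> borel_measurable (F t)"
    using exp_increment_measurable[of s t I c h] st c by auto
  then show "?e \<in> borel_measurable Q" using meas_F[of t] st by auto
  fix \<omega> assume \<omega>: "\<omega> \<in> space Q"
  have "norm (?e \<omega>) \<le> exp (norm (exp_increment I (\<lambda>p. c p \<omega>) (\<lambda>p. w p t \<omega> - w p s \<omega>) h))"
    by (rule norm_exp_le_exp_norm)
  also have "\<dots> \<le> exp (B * (\<Sum>p\<in>I. \<bar>w p t \<omega> - w p s \<omega>\<bar>) + real (card I) * B\<^sup>2 * h / 2)"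
    using norm_exp_increment_le[OF I, of "\<lambda>p. c p \<omega>" B h] B \<omega> h by simp
  finally show "norm (?e \<omega>) \<le> norm (exp (real (card I) * B\<^sup>2 * h / 2) * exp (B * (\<Sum>p\<in>I. \<bar>w p t \<omega> - w p s \<omega>\<bar>)))"
    by (simp add: mult_exp_exp add.commute)
qed

text \<open>
  The compensator is chosen so that the contribution of \<open>z\<close> cancels the conditional mean of \<open>z\<^sup>2 / 2\<close> to
  first order in the step. What is left is half the square of the compensator, of second order.
\<close>

lemma one_step_second_order:
  assumes I: "finite I" and st: "t0 \<le> s" "s < t" "t \<le> T"
    and c: "\<And>p. p \<in> I \<Longrightarrow> c p \<in> borel_measurable (F s)"
    and B: "B \<ge> 0" "\<And>p \<omega>. p \<in> I \<Longrightarrow> \<omega> \<in> space Q \<Longrightarrow> norm (c p \<omega>) \<le> B"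
    and Y: "Y \<in> borel_measurable (F s)" "all_moments Q Y"
  defines "z \<equiv> \<lambda>\<omega>. exp_increment I (\<lambda>p. c p \<omega>) (\<lambda>p. w p t \<omega> - w p s \<omega>) (t - s)"
  shows "all_moments Q z"
    and "(\<integral>\<omega>. Y \<omega> * (z \<omega> + (z \<omega>)\<^sup>2 / 2) \<partial>Q) = (\<integral>\<omega>. Y \<omega> * (\<Sum>p\<in>I. (c p \<omega>)\<^sup>2)\<^sup>2 \<partial>Q) * of_real ((t - s)\<^sup>2 / 8)"
proof -
  let ?h = "t - s"
  let ?D = "\<lambda>p \<omega>. complex_of_real (w p t \<omega> - w p s \<omega>)"
  define q where "q = (\<lambda>\<omega>. \<Sum>p\<in>I. (c p \<omega>)\<^sup>2)"
  define S where "S = (\<lambda>\<omega>. \<Sum>p\<in>I. c p \<omega> * ?D p \<omega>)"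
  have sT: "s \<in> {t0..T}" using st by auto
  have cQ: "p \<in> I \<Longrightarrow> c p \<in> borel_measurable Q" for p using c meas_F[OF sT] by auto
  have cm: "p \<in> I \<Longrightarrow> all_moments Q (c p)" for p
    by (rule all_moments_bounded[where B=B]) (use cQ B in auto)
  have cF[measurable]: "p \<in> I \<Longrightarrow> c p \<in> borel_measurable (F s)" for p by (rule c)
  have YF[measurable]: "Y \<in> borel_measurable (F s)" by (rule Y)
  have qF[measurable]: "q \<in> borel_measurable (F s)" unfolding q_def by measurable
  note mom = all_moments_mult all_moments_sum all_moments_add all_moments_diff all_moments_const
    incr_c_all_moments[OF st] Y(2) cm
  have qm: "all_moments Q q" unfolding q_def power2_eq_square by (intro mom)
  have Sm: "all_moments Q S" unfolding S_def by (intro mom)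
  note mom = mom qm Sm
  have zS: "z = (\<lambda>\<omega>. S \<omega> - q \<omega> * of_real (?h / 2))"
    by (simp add: z_def exp_increment_def S_def q_def)
  show "all_moments Q z" unfolding zS by (intro mom)
  have YS: "(\<integral>\<omega>. Y' \<omega> * S \<omega> \<partial>Q) = 0" if "Y' \<in> borel_measurable (F s)" "all_moments Q Y'" for Y'
  proof -
    note [measurable] = that(1)
    have "(\<integral>\<omega>. Y' \<omega> * S \<omega> \<partial>Q) = (\<integral>\<omega>. (\<Sum>p\<in>I. (Y' \<omega> * c p \<omega>) * ?D p \<omega>) \<partial>Q)"
      by (simp add: S_def sum_distrib_left mult.assoc)
    also have "\<dots> = (\<Sum>p\<in>I. \<integral>\<omega>. (Y' \<omega> * c p \<omega>) * ?D p \<omega> \<partial>Q)"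
      by (intro Bochner_Integration.integral_sum all_moments_integrable mom that)
    also have "\<dots> = 0"
      using that by (intro sum.neutral ballI incr_mean_zero[OF st] all_moments_integrable mom) measurable
    finally show ?thesis .
  qed
  have YSS: "(\<integral>\<omega>. Y \<omega> * (S \<omega> * S \<omega>) \<partial>Q) = of_real ?h * (\<integral>\<omega>. Y \<omega> * q \<omega> \<partial>Q)"
  proof -
    have "(\<integral>\<omega>. Y \<omega> * (S \<omega> * S \<omega>) \<partial>Q) =
        (\<integral>\<omega>. (\<Sum>p\<in>I. \<Sum>q\<in>I. (Y \<omega> * c p \<omega> * c q \<omega>) * complex_of_real ((w p t \<omega> - w p s \<omega>) * (w q t \<omega> - w q s \<omega>))) \<partial>Q)"
      by (simp add: S_def sum_product sum_distrib_left mult_ac)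
    also have "\<dots> = (\<Sum>p\<in>I. \<Sum>q\<in>I. \<integral>\<omega>. (Y \<omega> * c p \<omega> * c q \<omega>) * complex_of_real ((w p t \<omega> - w p s \<omega>) * (w q t \<omega> - w q s \<omega>)) \<partial>Q)"
      unfolding of_real_mult
      by (subst Bochner_Integration.integral_sum, (intro all_moments_integrable mom; assumption))
         (intro sum.cong refl Bochner_Integration.integral_sum all_moments_integrable mom; assumption)
    also have "\<dots> = (\<Sum>p\<in>I. \<Sum>q\<in>I. if p = q then ?h * (\<integral>\<omega>. Y \<omega> * c p \<omega> * c q \<omega> \<partial>Q) else 0)"
    proof (intro sum.cong refl)
      fix p q assume pq: "p \<in> I" "q \<in> I"
      have "(\<lambda>\<omega>. Y \<omega> * c p \<omega> * c q \<omega>) \<in> borel_measurable (F s)" using pq by measurable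
      moreover have "all_moments Q (\<lambda>\<omega>. Y \<omega> * c p \<omega> * c q \<omega>)" using pq by (intro mom)
      ultimately show "(\<integral>\<omega>. (Y \<omega> * c p \<omega> * c q \<omega>) * complex_of_real ((w p t \<omega> - w p s \<omega>) * (w q t \<omega> - w q s \<omega>)) \<partial>Q)
          = (if p = q then ?h * (\<integral>\<omega>. Y \<omega> * c p \<omega> * c q \<omega> \<partial>Q) else 0)"
        by (rule incr_second_moment[OF st])
    qed
    also have "\<dots> = of_real ?h * (\<Sum>p\<in>I. \<integral>\<omega>. Y \<omega> * c p \<omega> * c p \<omega> \<partial>Q)"
      using I by (simp add: sum_distrib_left)
    also have "(\<Sum>p\<in>I. \<integral>\<omega>. Y \<omega> * c p \<omega> * c p \<omega> \<partial>Q) = (\<integral>\<omega>. Y \<omega> * q \<omega> \<partial>Q)"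
      unfolding q_def sum_distrib_left power2_eq_square mult.assoc[symmetric]
      by (rule Bochner_Integration.integral_sum[symmetric]) (intro all_moments_integrable mom; assumption)
    finally show ?thesis .
  qed
  have "(\<integral>\<omega>. Y \<omega> * (z \<omega> + (z \<omega>)\<^sup>2 / 2) \<partial>Q) =
      (\<integral>\<omega>. Y \<omega> * S \<omega> + Y \<omega> * (S \<omega> * S \<omega>) * (1/2) - Y \<omega> * q \<omega> * S \<omega> * of_real (?h/2) - Y \<omega> * q \<omega> * of_real (?h/2)
        + Y \<omega> * (q \<omega> * q \<omega>) * of_real (?h\<^sup>2/8) \<partial>Q)"
    unfolding zS by (intro Bochner_Integration.integral_cong refl) (simp add: field_simps power2_eq_square)
  also have "\<dots> = (\<integral>\<omega>. Y \<omega> * S \<omega> \<partial>Q) + (\<integral>\<omega>. Y \<omega> * (S \<omega> * S \<omega>) \<partial>Q) * (1/2) - (\<integral>\<omega>. Y \<omega> * q \<omega> * S \<omega> \<partial>Q) * of_real (?h/2)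
      - (\<integral>\<omega>. Y \<omega> * q \<omega> \<partial>Q) * of_real (?h/2) + (\<integral>\<omega>. Y \<omega> * (q \<omega> * q \<omega>) \<partial>Q) * of_real (?h\<^sup>2/8)"
    by (subst Bochner_Integration.integral_add Bochner_Integration.integral_diff, (intro all_moments_integrable mom; assumption),
        (intro all_moments_integrable mom; assumption))+ (simp only: integral_mult_left_zero)
  also have "\<dots> = (\<integral>\<omega>. Y \<omega> * (q \<omega> * q \<omega>) \<partial>Q) * of_real (?h\<^sup>2/8)"
    using YS[of Y] YS[of "\<lambda>\<omega>. Y \<omega> * q \<omega>"] YSS by (simp add: mom)
  finally show "(\<integral>\<omega>. Y \<omega> * (z \<omega> + (z \<omega>)\<^sup>2 / 2) \<partial>Q) = (\<integral>\<omega>. Y \<omega> * (\<Sum>p\<in>I. (c p \<omega>)\<^sup>2)\<^sup>2 \<partial>Q) * of_real (?h\<^sup>2 / 8)"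
    by (simp add: q_def power2_eq_square)
qed

text \<open>
  The defect of the martingale property over one step is of order \<open>h powr (3/2)\<close>, hence summable to a
  vanishing total over a fine partition. The constant depends on the number and size of the coefficients
  only, so it is the same for all steps.
\<close>

lemma one_step_bound:
  assumes I: "finite I" and B: "B \<ge> 0"
  obtains C where "C \<ge> 0" "\<And>s t c Y. t0 \<le> s \<Longrightarrow> s < t \<Longrightarrow> t \<le> T \<Longrightarrow> t - s \<le> 1 \<Longrightarrow>
      (\<And>p. p \<in> I \<Longrightarrow> c p \<in> borel_measurable (F s)) \<Longrightarrow>
      (\<And>p \<omega>. p \<in> I \<Longrightarrow> \<omega> \<in> space Q \<Longrightarrow> norm (c p \<omega>) \<le> B) \<Longrightarrow>
      Y \<in> borel_measurable (F s) \<Longrightarrow> all_moments Q Y \<Longrightarrow>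
      norm (\<integral>\<omega>. Y \<omega> * (exp (exp_increment I (\<lambda>p. c p \<omega>) (\<lambda>p. w p t \<omega> - w p s \<omega>) (t - s)) - 1) \<partial>Q)
      \<le> C * ((t - s) * sqrt (t - s)) * (1 + (\<integral>\<omega>. (norm (Y \<omega>))\<^sup>2 \<partial>Q))"
proof -
  define N where "N = real (card I)"
  define b where "b = N * B\<^sup>2 / 2"
  \<comment> \<open>\<open>C1\<close> bounds the mean of \<open>46656 * exp (3 * g)\<close> for the \<open>g\<close> below; \<open>46656 = 6 ^ 6\<close> comes from \<open>pow6_le_exp\<close>.\<close>
  define C1 where "C1 = 46656 * (exp (3 * b) * (1 + N * (2 * exp ((N * (3 * B))\<^sup>2 / 2))))"
  define C where "C = N\<^sup>2 * B ^ 4 + C1 + 1"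
  have N0: "N \<ge> 0" and b0: "b \<ge> 0" by (auto simp: N_def b_def)
  have C1: "C1 \<ge> 0" unfolding C1_def using N0 by simp
  show thesis
  proof (rule that)
    show "C \<ge> 0" using C1 N0 by (simp add: C_def)
    fix s t :: real and c :: "'p \<Rightarrow> 'w \<Rightarrow> complex" and Y :: "'w \<Rightarrow> complex"
    assume st: "t0 \<le> s" "s < t" "t \<le> T" and h1: "t - s \<le> 1"
      and c: "\<And>p. p \<in> I \<Longrightarrow> c p \<in> borel_measurable (F s)"
      and cB: "\<And>p \<omega>. p \<in> I \<Longrightarrow> \<omega> \<in> space Q \<Longrightarrow> norm (c p \<omega>) \<le> B"
      and Y: "Y \<in> borel_measurable (F s)" "all_moments Q Y"
    let ?h = "t - s"
    have h: "?h > 0" using st by simp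
    define z where "z = (\<lambda>\<omega>. exp_increment I (\<lambda>p. c p \<omega>) (\<lambda>p. w p t \<omega> - w p s \<omega>) ?h)"
    define q where "q = (\<lambda>\<omega>. \<Sum>p\<in>I. (c p \<omega>)\<^sup>2)"
    define R where "R = (\<lambda>\<omega>. exp (z \<omega>) - 1 - z \<omega> - (z \<omega>)\<^sup>2 / 2)"
    \<comment> \<open>The increments have size \<open>sqrt h\<close>, so \<open>g\<close> has exponential moments bounded uniformly in \<open>h\<close>.\<close>
    define g where "g = (\<lambda>\<omega>. B / sqrt ?h * (\<Sum>p\<in>I. \<bar>w p t \<omega> - w p s \<omega>\<bar>) + b)"
    have sT: "s \<in> {t0..T}" using st by auto
    have [measurable]: "\<And>p. w p t \<in> borel_measurable Q" "\<And>p. w p s \<in> borel_measurable Q" using st by auto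
    have g0: "g \<omega> \<ge> 0" for \<omega> unfolding g_def using B b0 h by (simp add: sum_nonneg)
    have zm: "all_moments Q z" unfolding z_def
      by (rule one_step_second_order(1)[OF I st, where B=B and Y=Y]) (use c B cB Y in auto)
    have z2: "(\<integral>\<omega>. Y \<omega> * (z \<omega> + (z \<omega>)\<^sup>2 / 2) \<partial>Q) = (\<integral>\<omega>. Y \<omega> * (q \<omega>)\<^sup>2 \<partial>Q) * of_real (?h\<^sup>2 / 8)"
      unfolding z_def q_def by (rule one_step_second_order(2)[OF I st, where B=B]) (use c B cB Y in auto)
    have em: "all_moments Q (\<lambda>\<omega>. exp (z \<omega>))"
      unfolding z_def using h by (intro exp_increment_all_moments[OF I st c B cB]) auto
    note mom = all_moments_mult all_moments_sum all_moments_add all_moments_diff all_moments_const zm em Y(2)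
    have z2m: "all_moments Q (\<lambda>\<omega>. (z \<omega>)\<^sup>2 / 2)"
      using all_moments_mult[OF all_moments_mult[OF zm zm] all_moments_const[of "1/2"]] by (simp add: power2_eq_square)
    have Rm: "all_moments Q R" unfolding R_def by (intro mom z2m)
    have zb: "norm (z \<omega>) \<le> sqrt ?h * g \<omega>" if "\<omega> \<in> space Q" for \<omega>
    proof -
      have "norm (z \<omega>) \<le> B * (\<Sum>p\<in>I. \<bar>w p t \<omega> - w p s \<omega>\<bar>) + N * B\<^sup>2 * ?h / 2"
        unfolding z_def N_def using norm_exp_increment_le[OF I, of "\<lambda>p. c p \<omega>" B ?h "\<lambda>p. w p t \<omega> - w p s \<omega>"] cB that h B by auto
      also have "N * B\<^sup>2 * ?h / 2 = b * (sqrt ?h * sqrt ?h)" using h by (simp add: b_def)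
      also have "b * (sqrt ?h * sqrt ?h) \<le> b * (sqrt ?h * 1)"
        using h h1 b0 by (intro mult_left_mono) auto
      finally show ?thesis using h by (simp add: g_def distrib_left mult.commute)
    qed
    have R2: "(norm (R \<omega>))\<^sup>2 \<le> ?h ^ 3 * (46656 * exp (3 * g \<omega>))" if "\<omega> \<in> space Q" for \<omega>
      unfolding R_def by (rule exp_taylor2_square_bound[OF h h1 g0 zb[OF that]])
    have a: "3 * B / sqrt ?h \<ge> 0" using B h by simp
    have eg: "exp (3 * g \<omega>) = exp (3 * b) * exp (3 * B / sqrt ?h * (\<Sum>p\<in>I. \<bar>w p t \<omega> - w p s \<omega>\<bar>))" for \<omega>
      by (simp add: g_def mult_exp_exp algebra_simps)
    have gi: "integrable Q (\<lambda>\<omega>. exp (3 * g \<omega>))"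
      unfolding eg by (intro integrable_mult_right exp_abs_sum_integral(1)[OF I a st])
    have gI: "46656 * (\<integral>\<omega>. exp (3 * g \<omega>) \<partial>Q) \<le> C1"
    proof -
      have "(real (card I) * (3 * B / sqrt ?h))\<^sup>2 * ?h / 2 = (N * (3 * B))\<^sup>2 / 2"
        using h by (simp add: N_def power_mult_distrib power_divide)
      with exp_abs_sum_integral(2)[OF I a st]
      show ?thesis unfolding eg C1_def by (simp add: N_def)
    qed
    have R2i: "integrable Q (\<lambda>\<omega>. (norm (R \<omega>))\<^sup>2)" and Y2i: "integrable Q (\<lambda>\<omega>. (norm (Y \<omega>))\<^sup>2)"
      using all_moments_integrable_power[OF Rm] all_moments_integrable_power[OF Y(2)] by auto
    have R2I: "(\<integral>\<omega>. (norm (R \<omega>))\<^sup>2 \<partial>Q) \<le> ?h ^ 3 * C1"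
    proof -
      have "(\<integral>\<omega>. (norm (R \<omega>))\<^sup>2 \<partial>Q) \<le> (\<integral>\<omega>. ?h ^ 3 * (46656 * exp (3 * g \<omega>)) \<partial>Q)"
        using gi R2 by (intro integral_mono R2i) auto
      also have "\<dots> = ?h ^ 3 * (46656 * (\<integral>\<omega>. exp (3 * g \<omega>) \<partial>Q))" by simp
      also have "\<dots> \<le> ?h ^ 3 * C1" using gI h by (intro mult_left_mono) auto
      finally show ?thesis .
    qed
    let ?r = "?h * sqrt ?h"
    have r0: "?r > 0" using h by simp
    have r2: "?r * ?r = ?h ^ 3" using h by (simp add: power3_eq_cube algebra_simps)
    let ?E = "\<integral>\<omega>. (norm (Y \<omega>))\<^sup>2 \<partial>Q"
    have E0: "?E \<ge> 0" by simp
    have YR: "norm (\<integral>\<omega>. Y \<omega> * R \<omega> \<partial>Q) \<le> ?r * (?E + C1)"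
    proof -
      have "norm (\<integral>\<omega>. Y \<omega> * R \<omega> \<partial>Q) \<le> (\<integral>\<omega>. norm (Y \<omega> * R \<omega>) \<partial>Q)" by simp
      also have "\<dots> \<le> (\<integral>\<omega>. ?r * (norm (Y \<omega>))\<^sup>2 + (norm (R \<omega>))\<^sup>2 / ?r \<partial>Q)"
      proof (rule integral_mono)
        show "integrable Q (\<lambda>\<omega>. norm (Y \<omega> * R \<omega>))"
          by (intro integrable_norm all_moments_integrable mom Rm)
        show "integrable Q (\<lambda>\<omega>. ?r * (norm (Y \<omega>))\<^sup>2 + (norm (R \<omega>))\<^sup>2 / ?r)" using R2i Y2i by simp
        fix \<omega>
        have "2 * (?r * norm (Y \<omega>)) * norm (R \<omega>) \<le> (?r * norm (Y \<omega>))\<^sup>2 + (norm (R \<omega>))\<^sup>2"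
          by (rule sum_squares_bound)
        moreover have "0 \<le> ?r * norm (Y \<omega>) * norm (R \<omega>)" using r0 by simp
        ultimately have "?r * (norm (Y \<omega>) * norm (R \<omega>)) \<le> (?r * norm (Y \<omega>))\<^sup>2 + (norm (R \<omega>))\<^sup>2"
          by (simp only: mult.assoc)
        also have "\<dots> = ?r * (?r * (norm (Y \<omega>))\<^sup>2 + (norm (R \<omega>))\<^sup>2 / ?r)"
          using h r0 by (simp add: distrib_left power_mult_distrib power2_eq_square)
        finally show "norm (Y \<omega> * R \<omega>) \<le> ?r * (norm (Y \<omega>))\<^sup>2 + (norm (R \<omega>))\<^sup>2 / ?r"
          using r0 by (simp only: mult_le_cancel_left_pos norm_mult)
      qed
      also have "\<dots> = ?r * ?E + (\<integral>\<omega>. (norm (R \<omega>))\<^sup>2 \<partial>Q) / ?r"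
        using R2i Y2i by (subst Bochner_Integration.integral_add) auto
      also have "(\<integral>\<omega>. (norm (R \<omega>))\<^sup>2 \<partial>Q) / ?r \<le> ?h ^ 3 * C1 / ?r"
        using R2I r0 by (intro divide_right_mono) auto
      also have "?h ^ 3 * C1 / ?r = ?r * C1" unfolding r2[symmetric] using r0 by simp
      finally show ?thesis by (simp add: distrib_left)
    qed
    have qb: "norm ((q \<omega>)\<^sup>2) \<le> N\<^sup>2 * B ^ 4" if "\<omega> \<in> space Q" for \<omega>
    proof -
      have "norm (q \<omega>) \<le> (\<Sum>p\<in>I. B\<^sup>2)" unfolding q_def
        by (rule sum_norm_le) (auto simp: norm_power intro!: power_mono cB that)
      then have "norm (q \<omega>) \<le> N * B\<^sup>2" by (simp add: N_def)
      then have "(norm (q \<omega>))\<^sup>2 \<le> (N * B\<^sup>2)\<^sup>2" by (intro power_mono) auto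
      then show ?thesis by (simp add: norm_power power_mult_distrib)
    qed
    have qQ: "q \<in> borel_measurable Q" unfolding q_def
      using c meas_F[OF sT] by (intro borel_measurable_sum borel_measurable_power) auto
    have q2m: "all_moments Q (\<lambda>\<omega>. (q \<omega>)\<^sup>2)"
      using qQ qb by (intro all_moments_bounded[where B="N\<^sup>2 * B ^ 4"]) auto
    have hh: "?h\<^sup>2 / 8 \<le> ?r"
    proof -
      have "?h * sqrt ?h \<le> 1 * sqrt ?h" using h h1 by (intro mult_right_mono) auto
      have "sqrt ?h * sqrt ?h \<le> 1 * sqrt ?h" using h h1 by (intro mult_right_mono) auto
      then have "?h \<le> sqrt ?h" using h by simp
      then have "?h * ?h \<le> ?r" using h by (intro mult_left_mono) auto
      moreover have "?h * ?h / 8 \<le> ?h * ?h" using h by simp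
      ultimately show ?thesis unfolding power2_eq_square by (rule order_trans[rotated])
    qed
    have Yq: "norm (\<integral>\<omega>. Y \<omega> * (q \<omega>)\<^sup>2 \<partial>Q) \<le> N\<^sup>2 * B ^ 4 * (1 + ?E)"
    proof -
      have "norm (\<integral>\<omega>. Y \<omega> * (q \<omega>)\<^sup>2 \<partial>Q) \<le> (\<integral>\<omega>. norm (Y \<omega> * (q \<omega>)\<^sup>2) \<partial>Q)" by simp
      also have "\<dots> \<le> (\<integral>\<omega>. N\<^sup>2 * B ^ 4 * (1 + (norm (Y \<omega>))\<^sup>2) \<partial>Q)"
      proof (rule integral_mono)
        show "integrable Q (\<lambda>\<omega>. norm (Y \<omega> * (q \<omega>)\<^sup>2))"
          by (intro integrable_norm all_moments_integrable mom q2m)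
        show "integrable Q (\<lambda>\<omega>. N\<^sup>2 * B ^ 4 * (1 + (norm (Y \<omega>))\<^sup>2))" using Y2i by simp
        fix \<omega> assume \<omega>: "\<omega> \<in> space Q"
        have "norm (Y \<omega>) \<le> 1 + (norm (Y \<omega>))\<^sup>2"
          using le_square_add_1[of "norm (Y \<omega>)"] by simp
        then have "norm (Y \<omega>) * norm ((q \<omega>)\<^sup>2) \<le> (1 + (norm (Y \<omega>))\<^sup>2) * (N\<^sup>2 * B ^ 4)"
          using qb[OF \<omega>] by (intro mult_mono) auto
        then show "norm (Y \<omega> * (q \<omega>)\<^sup>2) \<le> N\<^sup>2 * B ^ 4 * (1 + (norm (Y \<omega>))\<^sup>2)"
          by (simp add: norm_mult mult.commute)
      qed
      also have "\<dots> = N\<^sup>2 * B ^ 4 * (1 + ?E)" using Y2i by (simp add: prob_space)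
      finally show ?thesis .
    qed
    have "(\<integral>\<omega>. Y \<omega> * (exp (z \<omega>) - 1) \<partial>Q) = (\<integral>\<omega>. Y \<omega> * (z \<omega> + (z \<omega>)\<^sup>2 / 2) + Y \<omega> * R \<omega> \<partial>Q)"
      by (simp add: R_def algebra_simps)
    also have "\<dots> = (\<integral>\<omega>. Y \<omega> * (z \<omega> + (z \<omega>)\<^sup>2 / 2) \<partial>Q) + (\<integral>\<omega>. Y \<omega> * R \<omega> \<partial>Q)"
      by (intro Bochner_Integration.integral_add all_moments_integrable mom z2m Rm)
    finally have "norm (\<integral>\<omega>. Y \<omega> * (exp (z \<omega>) - 1) \<partial>Q) \<le>
        norm (\<integral>\<omega>. Y \<omega> * (q \<omega>)\<^sup>2 \<partial>Q) * (?h\<^sup>2 / 8) + norm (\<integral>\<omega>. Y \<omega> * R \<omega> \<partial>Q)"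
      unfolding z2 using norm_triangle_ineq[of "(\<integral>\<omega>. Y \<omega> * (q \<omega>)\<^sup>2 \<partial>Q) * of_real (?h\<^sup>2 / 8)" "\<integral>\<omega>. Y \<omega> * R \<omega> \<partial>Q"]
      by (simp only: norm_mult norm_of_real abs_of_nonneg zero_le_power2 zero_le_divide_iff zero_le_numeral simp_thms)
    also have "\<dots> \<le> N\<^sup>2 * B ^ 4 * (1 + ?E) * ?r + ?r * (?E + C1)"
      using Yq hh YR N0 E0 by (intro add_mono mult_mono) auto
    also have "\<dots> = ?r * (N\<^sup>2 * B ^ 4 * (1 + ?E) + (?E + C1))" by (simp add: algebra_simps)
    also have "\<dots> \<le> ?r * (C * (1 + ?E))"
      using r0 E0 C1 by (intro mult_left_mono) (simp_all add: C_def algebra_simps)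
    finally show "norm (\<integral>\<omega>. Y \<omega> * (exp (exp_increment I (\<lambda>p. c p \<omega>) (\<lambda>p. w p t \<omega> - w p s \<omega>) ?h) - 1) \<partial>Q)
      \<le> C * ?r * (1 + ?E)" by (simp add: z_def mult_ac)
  qed
qed

lemma exp_increment_0: "exp_increment I c (\<lambda>p. 0) 0 = 0"
  by (simp add: exp_increment_def)

lemma exp_increment_add:
  "exp_increment I c D h + exp_increment I c D' h' = exp_increment I c (\<lambda>p. D p + D' p) (h + h')"
  by (simp add: exp_increment_def sum.distrib algebra_simps add_divide_distrib)

text \<open>
  Cut the interval into \<open>m\<close> equal steps while keeping \<open>c\<close> fixed. The defects of \<open>one_step_bound\<close>
  add up to a multiple of \<open>sqrt (1 / m)\<close>, and \<open>m\<close> is arbitrary.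
\<close>

lemma exp_martingale_step:
  assumes I: "finite I" and st: "t0 \<le> s" "s < t" "t \<le> T" and c: "\<And>p. p \<in> I \<Longrightarrow> c p \<in> borel_measurable (F s)"
    and B: "B \<ge> 0" "\<And>p \<omega>. p \<in> I \<Longrightarrow> \<omega> \<in> space Q \<Longrightarrow> norm (c p \<omega>) \<le> B"
    and H: "H \<in> borel_measurable (F s)" "all_moments Q H"
  shows "(\<integral>\<omega>. H \<omega> * exp (exp_increment I (\<lambda>p. c p \<omega>) (\<lambda>p. w p t \<omega> - w p s \<omega>) (t - s)) \<partial>Q) = (\<integral>\<omega>. H \<omega> \<partial>Q)"
proof -
  obtain C where C: "C \<ge> 0" "\<And>s t c Y. t0 \<le> s \<Longrightarrow> s < t \<Longrightarrow> t \<le> T \<Longrightarrow> t - s \<le> 1 \<Longrightarrow>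
      (\<And>p. p \<in> I \<Longrightarrow> c p \<in> borel_measurable (F s)) \<Longrightarrow>
      (\<And>p \<omega>. p \<in> I \<Longrightarrow> \<omega> \<in> space Q \<Longrightarrow> norm (c p \<omega>) \<le> B) \<Longrightarrow>
      Y \<in> borel_measurable (F s) \<Longrightarrow> all_moments Q Y \<Longrightarrow>
      norm (\<integral>\<omega>. Y \<omega> * (exp (exp_increment I (\<lambda>p. c p \<omega>) (\<lambda>p. w p t \<omega> - w p s \<omega>) (t - s)) - 1) \<partial>Q)
      \<le> C * ((t - s) * sqrt (t - s)) * (1 + (\<integral>\<omega>. (norm (Y \<omega>))\<^sup>2 \<partial>Q))"
    using one_step_bound[OF I B(1)] by blast
  define N where "N = real (card I)"
  have N0: "N \<ge> 0" by (simp add: N_def)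
  let ?\<tau> = "t - s"
  have \<tau>: "?\<tau> > 0" using st by simp
  have sT: "s \<in> {t0..T}" using st by auto
  define Y where "Y = (\<lambda>u \<omega>. H \<omega> * exp (exp_increment I (\<lambda>p. c p \<omega>) (\<lambda>p. w p u \<omega> - w p s \<omega>) (u - s)))"
  \<comment> \<open>\<open>K\<close> bounds the second moment of the process at all intermediate times.\<close>
  define K where "K = (\<integral>\<omega>. norm (H \<omega>) ^ 4 \<partial>Q) + exp (2 * N * B\<^sup>2 * ?\<tau>) * (1 + N * (2 * exp ((N * (4 * B))\<^sup>2 * ?\<tau> / 2)))"
  have K1: "K \<ge> (\<integral>\<omega>. norm (H \<omega>) ^ 4 \<partial>Q) + 1"
  proof -
    have "1 * 1 \<le> exp (2 * N * B\<^sup>2 * ?\<tau>) * (1 + N * (2 * exp ((N * (4 * B))\<^sup>2 * ?\<tau> / 2)))"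
      using N0 \<tau> by (intro mult_mono) auto
    then show ?thesis by (simp add: K_def)
  qed
  have Ys: "Y s = H" by (simp add: Y_def exp_increment_0)
  have YF: "Y u \<in> borel_measurable (F u)" if "s \<le> u" "u \<le> t" for u
  proof -
    have u: "u \<in> {t0..T}" using that st by auto
    have [measurable]: "H \<in> borel_measurable (F u)" by (rule meas_F_mono[OF sT u that(1) H(1)])
    have [measurable]: "(\<lambda>\<omega>. exp_increment I (\<lambda>p. c p \<omega>) (\<lambda>p. w p u \<omega> - w p s \<omega>) (u - s)) \<in> borel_measurable (F u)"
      by (rule exp_increment_measurable[OF sT u that(1) c])
    show ?thesis unfolding Y_def by measurable
  qed
  have Ym: "all_moments Q (Y u)" if "s \<le> u" "u \<le> t" for u
  proof (cases "u = s")
    case False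
    then show ?thesis unfolding Y_def using that st
      by (intro all_moments_mult H exp_increment_all_moments[OF I _ _ _ c B]) auto
  qed (use Ys H in auto)
  have YK: "(\<integral>\<omega>. (norm (Y u \<omega>))\<^sup>2 \<partial>Q) \<le> K" if u: "s \<le> u" "u \<le> t" for u
  proof (cases "u = s")
    case True
    have "(\<integral>\<omega>. (norm (H \<omega>))\<^sup>2 \<partial>Q) \<le> (\<integral>\<omega>. norm (H \<omega>) ^ 4 + 1 \<partial>Q)"
    proof (rule integral_mono)
      fix \<omega>
      have "(norm (H \<omega>))\<^sup>2 \<le> ((norm (H \<omega>))\<^sup>2)\<^sup>2 + 1" by (rule le_square_add_1)
      then show "(norm (H \<omega>))\<^sup>2 \<le> norm (H \<omega>) ^ 4 + 1" by simp
    qed (use all_moments_integrable_power[OF H(2)] in auto)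
    also have "\<dots> = (\<integral>\<omega>. norm (H \<omega>) ^ 4 \<partial>Q) + 1"
      using all_moments_integrable_power[OF H(2), of 4] by (simp add: prob_space)
    finally show ?thesis using K1 True Ys by simp
  next
    case False
    with u st have su: "t0 \<le> s" "s < u" "u \<le> T" by auto
    let ?G = "\<lambda>\<omega>. \<Sum>p\<in>I. \<bar>w p u \<omega> - w p s \<omega>\<bar>"
    have B4: "4 * B \<ge> 0" using B by simp
    have "(\<integral>\<omega>. (norm (Y u \<omega>))\<^sup>2 \<partial>Q) \<le> (\<integral>\<omega>. norm (H \<omega>) ^ 4 + exp (2 * N * B\<^sup>2 * ?\<tau>) * exp (4 * B * ?G \<omega>) \<partial>Q)"
    proof (rule integral_mono)
      show "integrable Q (\<lambda>\<omega>. (norm (Y u \<omega>))\<^sup>2)" by (rule all_moments_integrable_power[OF Ym[OF u]])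
      show "integrable Q (\<lambda>\<omega>. norm (H \<omega>) ^ 4 + exp (2 * N * B\<^sup>2 * ?\<tau>) * exp (4 * B * ?G \<omega>))"
        by (intro Bochner_Integration.integrable_add all_moments_integrable_power[OF H(2)] integrable_mult_right
            exp_abs_sum_integral(1)[OF I B4 su])
      fix \<omega> assume \<omega>: "\<omega> \<in> space Q"
      let ?e = "exp_increment I (\<lambda>p. c p \<omega>) (\<lambda>p. w p u \<omega> - w p s \<omega>) (u - s)"
      have "norm ?e \<le> B * ?G \<omega> + N * B\<^sup>2 * (u - s) / 2"
        unfolding N_def using su B \<omega> by (intro norm_exp_increment_le[OF I]) auto
      also have "N * B\<^sup>2 * (u - s) / 2 \<le> N * B\<^sup>2 * ?\<tau> / 2"
        using N0 u by (intro divide_right_mono mult_left_mono) auto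
      finally have e: "norm ?e \<le> B * ?G \<omega> + N * B\<^sup>2 * ?\<tau> / 2" by simp
      have "norm (exp ?e) ^ 4 \<le> exp (norm ?e) ^ 4" by (intro power_mono norm_exp_le_exp_norm) auto
      also have "\<dots> = exp (4 * norm ?e)" by (simp add: exp_of_nat_mult[symmetric])
      also have "\<dots> \<le> exp (4 * (B * ?G \<omega> + N * B\<^sup>2 * ?\<tau> / 2))" unfolding exp_le_cancel_iff using e by (intro mult_left_mono) auto
      also have "\<dots> = exp (2 * N * B\<^sup>2 * ?\<tau>) * exp (4 * B * ?G \<omega>)" by (simp add: mult_exp_exp field_simps)
      finally have e4: "norm (exp ?e) ^ 4 \<le> exp (2 * N * B\<^sup>2 * ?\<tau>) * exp (4 * B * ?G \<omega>)" .
      have "2 * (norm (H \<omega>))\<^sup>2 * (norm (exp ?e))\<^sup>2 \<le> ((norm (H \<omega>))\<^sup>2)\<^sup>2 + ((norm (exp ?e))\<^sup>2)\<^sup>2"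
        by (rule sum_squares_bound)
      moreover have "(norm (H \<omega>))\<^sup>2 * (norm (exp ?e))\<^sup>2 \<ge> 0" by simp
      ultimately have "(norm (H \<omega>))\<^sup>2 * (norm (exp ?e))\<^sup>2 \<le> ((norm (H \<omega>))\<^sup>2)\<^sup>2 + ((norm (exp ?e))\<^sup>2)\<^sup>2"
        by (simp only: mult.assoc)
      also have "\<dots> = norm (H \<omega>) ^ 4 + norm (exp ?e) ^ 4" by (simp del: norm_exp_eq_Re)
      finally show "(norm (Y u \<omega>))\<^sup>2 \<le> norm (H \<omega>) ^ 4 + exp (2 * N * B\<^sup>2 * ?\<tau>) * exp (4 * B * ?G \<omega>)"
        using e4 unfolding Y_def norm_mult power_mult_distrib by linarith
    qed
    also have "\<dots> = (\<integral>\<omega>. norm (H \<omega>) ^ 4 \<partial>Q) + exp (2 * N * B\<^sup>2 * ?\<tau>) * (\<integral>\<omega>. exp (4 * B * ?G \<omega>) \<partial>Q)"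
      using all_moments_integrable_power[OF H(2), of 4] exp_abs_sum_integral(1)[OF I B4 su] by simp
    also have "(\<integral>\<omega>. exp (4 * B * ?G \<omega>) \<partial>Q) \<le> 1 + N * (2 * exp ((N * (4 * B))\<^sup>2 * (u - s) / 2))"
      unfolding N_def by (rule exp_abs_sum_integral(2)[OF I B4 su])
    also have "\<dots> \<le> 1 + N * (2 * exp ((N * (4 * B))\<^sup>2 * ?\<tau> / 2))"
      using N0 u by (intro add_left_mono mult_left_mono) (auto intro!: mult_left_mono)
    finally show ?thesis by (simp add: K_def)
  qed
  have bound: "norm ((\<integral>\<omega>. Y t \<omega> \<partial>Q) - (\<integral>\<omega>. H \<omega> \<partial>Q)) \<le> C * (1 + K) * ?\<tau> * sqrt (?\<tau> / real m)"
    if m: "m > 0" "?\<tau> / real m \<le> 1" for m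
  proof -
    let ?h = "?\<tau> / real m"
    define u where "u = (\<lambda>l. s + real l * ?h)"
    have h: "?h > 0" using \<tau> m by simp
    have du: "u (Suc l) - u l = ?h" for l unfolding u_def of_nat_Suc distrib_right by simp
    have u0: "u 0 = s" by (simp add: u_def)
    have um: "u m = t" using m by (simp add: u_def)
    have us: "s \<le> u l" for l using \<tau> by (simp add: u_def)
    have ut: "u l \<le> t" if "l \<le> m" for l
    proof -
      have "real l * ?h \<le> real m * ?h" using that h by (intro mult_right_mono) auto
      then show ?thesis using um by (simp add: u_def)
    qed
    have step: "norm ((\<integral>\<omega>. Y (u (Suc l)) \<omega> \<partial>Q) - (\<integral>\<omega>. Y (u l) \<omega> \<partial>Q)) \<le> C * (?h * sqrt ?h) * (1 + K)" if l: "l < m" for l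
    proof -
      let ?e = "\<lambda>\<omega>. exp_increment I (\<lambda>p. c p \<omega>) (\<lambda>p. w p (u (Suc l)) \<omega> - w p (u l) \<omega>) (u (Suc l) - u l)"
      have l': "l \<le> m" "Suc l \<le> m" using l by auto
      have lt: "u l < u (Suc l)" using du[of l] h by linarith
      have ulT: "u l \<in> {t0..T}" using us[of l] ut[OF l'(1)] st by auto
      have tT: "u (Suc l) \<le> T" "t0 \<le> u l" using us[of l] ut[OF l'(2)] st by auto
      have cl: "p \<in> I \<Longrightarrow> c p \<in> borel_measurable (F (u l))" for p
        by (rule meas_F_mono[OF sT ulT us c])
      have "Y (u (Suc l)) \<omega> = Y (u l) \<omega> * exp (?e \<omega>)" for \<omega>
        unfolding Y_def mult.assoc mult_exp_exp exp_increment_add by simp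
      then have eq: "Y (u (Suc l)) \<omega> - Y (u l) \<omega> = Y (u l) \<omega> * (exp (?e \<omega>) - 1)" for \<omega>
        by (simp add: right_diff_distrib)
      have "(\<integral>\<omega>. Y (u (Suc l)) \<omega> \<partial>Q) - (\<integral>\<omega>. Y (u l) \<omega> \<partial>Q) = (\<integral>\<omega>. Y (u (Suc l)) \<omega> - Y (u l) \<omega> \<partial>Q)"
        by (intro Bochner_Integration.integral_diff[symmetric] all_moments_integrable Ym us ut l')
      also have "\<dots> = (\<integral>\<omega>. Y (u l) \<omega> * (exp (?e \<omega>) - 1) \<partial>Q)" unfolding eq ..
      also have "norm \<dots> \<le> C * ((u (Suc l) - u l) * sqrt (u (Suc l) - u l)) * (1 + (\<integral>\<omega>. (norm (Y (u l) \<omega>))\<^sup>2 \<partial>Q))"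
        using m lt tT du by (intro C(2) cl B YF Ym us ut l') auto
      also have "\<dots> \<le> C * (?h * sqrt ?h) * (1 + K)"
        unfolding du using YK[OF us ut[OF l'(1)]] C(1) less_imp_le[OF h]
        by (intro mult_left_mono add_left_mono mult_nonneg_nonneg real_sqrt_ge_zero)
      finally show ?thesis .
    qed
    have "(\<integral>\<omega>. Y t \<omega> \<partial>Q) - (\<integral>\<omega>. H \<omega> \<partial>Q) = (\<Sum>l<m. (\<integral>\<omega>. Y (u (Suc l)) \<omega> \<partial>Q) - (\<integral>\<omega>. Y (u l) \<omega> \<partial>Q))"
      by (subst sum_lessThan_telescope) (simp add: um u0 Ys)
    also have "norm \<dots> \<le> (\<Sum>l<m. C * (?h * sqrt ?h) * (1 + K))"
      by (rule sum_norm_le) (use step in auto)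
    also have "\<dots> = C * (1 + K) * ?\<tau> * sqrt ?h" using m by simp
    finally show ?thesis .
  qed
  have "(\<lambda>m. C * (1 + K) * ?\<tau> * sqrt (?\<tau> / real m)) \<longlonglongrightarrow> C * (1 + K) * ?\<tau> * sqrt 0"
    by (intro tendsto_intros lim_const_over_n)
  moreover have "eventually (\<lambda>m. norm ((\<integral>\<omega>. Y t \<omega> \<partial>Q) - (\<integral>\<omega>. H \<omega> \<partial>Q)) \<le> C * (1 + K) * ?\<tau> * sqrt (?\<tau> / real m)) sequentially"
  proof -
    obtain m0 :: nat where m0: "?\<tau> \<le> real m0" using real_arch_simple by blast
    show ?thesis
      using eventually_ge_at_top[of "max 1 m0"]
    proof (rule eventually_mono)
      fix m assume "max 1 m0 \<le> m"
      then have "m > 0" "?\<tau> \<le> real m" using m0 by auto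
      then show "norm ((\<integral>\<omega>. Y t \<omega> \<partial>Q) - (\<integral>\<omega>. H \<omega> \<partial>Q)) \<le> C * (1 + K) * ?\<tau> * sqrt (?\<tau> / real m)"
        by (intro bound) (simp_all add: divide_le_eq)
    qed
  qed
  ultimately have "norm ((\<integral>\<omega>. Y t \<omega> \<partial>Q) - (\<integral>\<omega>. H \<omega> \<partial>Q)) \<le> C * (1 + K) * ?\<tau> * sqrt 0"
    by (intro tendsto_lowerbound) auto
  then show ?thesis by (simp add: Y_def)
qed

text \<open>A process \<open>c\<close> frozen at the left end points of a partition \<open>u\<close>.\<close>

lemma exp_martingale_grid:
  fixes u :: "nat \<Rightarrow> real"
  assumes I: "finite I" and u: "u 0 = t0" "\<And>k. k < n \<Longrightarrow> u k < u (Suc k)" "u n \<le> T"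
    and c: "\<And>k p. k < n \<Longrightarrow> p \<in> I \<Longrightarrow> c k p \<in> borel_measurable (F (u k))"
    and B: "B \<ge> 0" "\<And>k p \<omega>. k < n \<Longrightarrow> p \<in> I \<Longrightarrow> \<omega> \<in> space Q \<Longrightarrow> norm (c k p \<omega>) \<le> B"
    and H: "H \<in> borel_measurable (F t0)" "all_moments Q H"
  defines "M \<equiv> \<lambda>\<omega>. H \<omega> * exp (\<Sum>k<n. exp_increment I (\<lambda>p. c k p \<omega>) (\<lambda>p. w p (u (Suc k)) \<omega> - w p (u k) \<omega>) (u (Suc k) - u k))"
  shows "all_moments Q M \<and> (\<integral>\<omega>. M \<omega> \<partial>Q) = (\<integral>\<omega>. H \<omega> \<partial>Q)"
proof -
  have mono: "u i \<le> u j" if "i \<le> j" "j \<le> n" for i j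
    using that
  proof (induction j)
    case (Suc j)
    then show ?case using u(2)[of j] by (cases "i = Suc j") auto
  qed simp
  define M' where "M' = (\<lambda>m \<omega>. H \<omega> * exp (\<Sum>k<m. exp_increment I (\<lambda>p. c k p \<omega>) (\<lambda>p. w p (u (Suc k)) \<omega> - w p (u k) \<omega>) (u (Suc k) - u k)))"
  have "M' m \<in> borel_measurable (F (u m)) \<and> all_moments Q (M' m) \<and> (\<integral>\<omega>. M' m \<omega> \<partial>Q) = (\<integral>\<omega>. H \<omega> \<partial>Q)" if "m \<le> n" for m
    using that
  proof (induction m)
    case 0
    then show ?case using H u(1) by (simp add: M'_def)
  next
    case (Suc m)
    then have m: "m < n" and IH: "M' m \<in> borel_measurable (F (u m))" "all_moments Q (M' m)" "(\<integral>\<omega>. M' m \<omega> \<partial>Q) = (\<integral>\<omega>. H \<omega> \<partial>Q)" by auto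
    have st: "t0 \<le> u m" "u m < u (Suc m)" "u (Suc m) \<le> T"
      using mono[of 0 m] mono[of "Suc m" n] u m by auto
    let ?e = "\<lambda>\<omega>. exp_increment I (\<lambda>p. c m p \<omega>) (\<lambda>p. w p (u (Suc m)) \<omega> - w p (u m) \<omega>) (u (Suc m) - u m)"
    have eq: "M' (Suc m) = (\<lambda>\<omega>. M' m \<omega> * exp (?e \<omega>))"
      by (simp add: M'_def exp_add mult.assoc)
    have T: "u m \<in> {t0..T}" "u (Suc m) \<in> {t0..T}" "u m \<le> u (Suc m)" using st by auto
    have [measurable]: "M' m \<in> borel_measurable (F (u (Suc m)))" by (rule meas_F_mono[OF T IH(1)])
    have [measurable]: "?e \<in> borel_measurable (F (u (Suc m)))"
      by (rule exp_increment_measurable[OF T c[OF m]])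
    have "M' (Suc m) \<in> borel_measurable (F (u (Suc m)))" unfolding eq by measurable
    moreover have "all_moments Q (M' (Suc m))" unfolding eq
      using st by (intro all_moments_mult IH exp_increment_all_moments[OF I st c[OF m] B(1) B(2)[OF m]]) auto
    moreover have "(\<integral>\<omega>. M' (Suc m) \<omega> \<partial>Q) = (\<integral>\<omega>. H \<omega> \<partial>Q)" unfolding eq
      using exp_martingale_step[OF I st c[OF m] B(1) B(2)[OF m] IH(1,2)] IH(3) by simp
    ultimately show ?case by simp
  qed
  from this[of n] show ?thesis by (simp add: M_def M'_def)
qed

end

section \<open>Dyadic slopes of Lipschitz paths\<close>

definition mesh :: "real \<Rightarrow> real \<Rightarrow> nat \<Rightarrow> real" where
  "mesh t0 T n = (T - t0) / 2 ^ n"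

definition grid :: "real \<Rightarrow> real \<Rightarrow> nat \<Rightarrow> nat \<Rightarrow> real" where
  "grid t0 T n k = t0 + real k * mesh t0 T n"

definition slope :: "real \<Rightarrow> real \<Rightarrow> nat \<Rightarrow> (real \<Rightarrow> real) \<Rightarrow> nat \<Rightarrow> real" where
  "slope t0 T n f k = (f (grid t0 T n (Suc k)) - f (grid t0 T n k)) / mesh t0 T n"

text \<open>
  The slope over the preceding grid interval, so that for an adapted path the value on an interval is known
  at its left end point. The first interval has no predecessor. Slopes larger than \<open>B\<close> are discarded; on
  Lipschitz paths this never happens, but it makes the coefficients bounded for every \<open>\<omega>\<close>, also on the
  null set where the path is not Lipschitz.
\<close>

definition lagged_slope :: "real \<Rightarrow> real \<Rightarrow> real \<Rightarrow> nat \<Rightarrow> (real \<Rightarrow> real) \<Rightarrow> nat \<Rightarrow> real" where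
  "lagged_slope t0 T B n f k =
     (if k = 0 \<or> B < \<bar>slope t0 T n f (k - 1)\<bar> then 0 else slope t0 T n f (k - 1))"

text \<open>
  The energy of the piecewise linear interpolation of \<open>f\<close> on level \<open>n\<close>.
\<close>

definition slope_energy :: "real \<Rightarrow> real \<Rightarrow> (real \<Rightarrow> real) \<Rightarrow> nat \<Rightarrow> real" where
  "slope_energy t0 T f n = (\<Sum>k<2 ^ n. mesh t0 T n * (slope t0 T n f k)\<^sup>2)"

text \<open>
  The squared \<open>L\<^sup>2\<close> distance of two lagged slopes as step functions; a cell of level \<open>n'\<close> with number
  \<open>k\<close> lies in the cell of level \<open>n\<close> with number \<open>k div 2 ^ (n' - n)\<close>.
\<close>

definition lagged_dist :: "real \<Rightarrow> real \<Rightarrow> real \<Rightarrow> (real \<Rightarrow> real) \<Rightarrow> nat \<Rightarrow> nat \<Rightarrow> real" where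
  "lagged_dist t0 T B f n n' = (\<Sum>k<2 ^ n'. mesh t0 T n' * (lagged_slope t0 T B n' f k - lagged_slope t0 T B n f (k div 2 ^ (n' - n)))\<^sup>2)"

lemma abs_lagged_slope_le: "B \<ge> 0 \<Longrightarrow> \<bar>lagged_slope t0 T B n f k\<bar> \<le> B"
  by (simp add: lagged_slope_def)

lemma grid_0 [simp]: "grid t0 T n 0 = t0"
  by (simp add: grid_def)

lemma grid_end [simp]: "grid t0 T n (2 ^ n) = T"
  by (simp add: grid_def mesh_def)

lemma grid_Suc: "grid t0 T n (Suc k) = grid t0 T n k + mesh t0 T n"
  by (simp add: grid_def algebra_simps)

lemma mesh_pos: "t0 < T \<Longrightarrow> mesh t0 T n > 0"
  by (simp add: mesh_def)

lemma grid_refine: "N \<le> n \<Longrightarrow> grid t0 T n (k * 2 ^ (n - N)) = grid t0 T N k"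
proof -
  assume "N \<le> n"
  then have "(2::real) ^ n = 2 ^ N * 2 ^ (n - N)" by (simp add: power_add[symmetric])
  then show ?thesis by (simp add: grid_def mesh_def)
qed

lemma mesh_refine: "N \<le> n \<Longrightarrow> mesh t0 T N = 2 ^ (n - N) * mesh t0 T n"
proof -
  assume "N \<le> n"
  then have "(2::real) ^ n = 2 ^ N * 2 ^ (n - N)" by (simp add: power_add[symmetric])
  then show ?thesis by (simp add: mesh_def)
qed

lemma grid_mono: "t0 \<le> T \<Longrightarrow> i \<le> j \<Longrightarrow> grid t0 T n i \<le> grid t0 T n j"
  by (auto simp: grid_def mesh_def intro!: mult_right_mono divide_right_mono)

lemma grid_in: "t0 \<le> T \<Longrightarrow> k \<le> 2 ^ n \<Longrightarrow> grid t0 T n k \<in> {t0..T}"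
  using grid_mono[of t0 T 0 k n] grid_mono[of t0 T k "2 ^ n" n] by simp

lemma sum_blocks:
  fixes g :: "nat \<Rightarrow> real"
  assumes "N \<le> n"
  shows "(\<Sum>k<2 ^ n. g k) = (\<Sum>j<2 ^ N. \<Sum>r<2 ^ (n - N). g (j * 2 ^ (n - N) + r))"
proof -
  let ?m = "2 ^ (n - N) :: nat"
  have "(2::nat) ^ n = 2 ^ N * ?m" using assms by (simp add: power_add[symmetric])
  then have "(\<Sum>k<2 ^ n. g k) = (\<Sum>j<2 ^ N. sum g {j * ?m..<j * ?m + ?m})"
    by (simp add: sum.nat_group)
  also have "\<dots> = (\<Sum>j<2 ^ N. \<Sum>r<?m. g (j * ?m + r))"
  proof (rule sum.cong[OF refl])
    fix j
    show "sum g {j * ?m..<j * ?m + ?m} = (\<Sum>r<?m. g (j * ?m + r))"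
      using sum.shift_bounds_nat_ivl[of g 0 "j * ?m" ?m] by (simp add: add.commute lessThan_atLeast0)
  qed
  finally show ?thesis .
qed

lemma sum_mesh_refine:
  fixes g :: "nat \<Rightarrow> real"
  assumes "N \<le> n"
  shows "(\<Sum>k<2 ^ n. mesh t0 T n * g (k div 2 ^ (n - N))) = (\<Sum>j<2 ^ N. mesh t0 T N * g j)"
  by (simp add: sum_blocks[OF assms] mesh_refine[OF assms] mult.assoc)

lemma sum_shift_le:
  fixes G :: "nat \<Rightarrow> real"
  assumes "\<And>k. G k \<ge> 0"
  shows "(\<Sum>k<m. if k = 0 then 0 else G (k - 1)) \<le> (\<Sum>k<m. G k)"
proof (cases m)
  case (Suc m')
  have "(\<Sum>k<Suc m'. if k = 0 then 0 else G (k - 1)) = (\<Sum>k<m'. G k)"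
    by (subst sum.lessThan_Suc_shift) simp
  then show ?thesis using assms Suc by simp
qed simp

context
  fixes t0 T :: real and f :: "real \<Rightarrow> real" and l B :: real
  assumes t0T: "t0 < T"
    and lip: "\<And>t u. t \<in> {t0..T} \<Longrightarrow> u \<in> {t0..T} \<Longrightarrow> \<bar>f t - f u\<bar> \<le> l * \<bar>t - u\<bar>"
    and l: "0 \<le> l" "l \<le> B"
begin

lemma abs_slope_le: "k < 2 ^ n \<Longrightarrow> \<bar>slope t0 T n f k\<bar> \<le> l"
proof -
  assume k: "k < 2 ^ n"
  have "\<bar>f (grid t0 T n (Suc k)) - f (grid t0 T n k)\<bar> \<le> l * mesh t0 T n"
    using lip[OF grid_in grid_in, of "Suc k" n k n] k t0T mesh_pos[OF t0T, of n] by (simp add: grid_Suc)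
  then show ?thesis using mesh_pos[OF t0T, of n] by (simp add: slope_def abs_divide divide_le_eq)
qed

lemma lagged_slope_eq:
  assumes "k \<le> 2 ^ n"
  shows "lagged_slope t0 T B n f k = (if k = 0 then 0 else slope t0 T n f (k - 1))"
proof (cases "k = 0")
  case False
  then have "k - 1 < 2 ^ n" using assms by linarith
  from abs_slope_le[OF this] show ?thesis using l by (auto simp: lagged_slope_def)
qed (simp add: lagged_slope_def)

lemma abs_lagged_slope_le_lip:
  assumes "k \<le> 2 ^ n"
  shows "\<bar>lagged_slope t0 T B n f k\<bar> \<le> l"
proof (cases "k = 0")
  case False
  then have "k - 1 < 2 ^ n" using assms by linarith
  from abs_slope_le[OF this] show ?thesis using l by (auto simp: lagged_slope_def)
qed (use l in \<open>simp add: lagged_slope_def\<close>)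

lemma slope_average:
  assumes "N \<le> n"
  shows "(\<Sum>r<2 ^ (n - N). slope t0 T n f (j * 2 ^ (n - N) + r)) = 2 ^ (n - N) * slope t0 T N f j"
proof -
  let ?m = "2 ^ (n - N) :: nat"
  have "(\<Sum>r<?m. slope t0 T n f (j * ?m + r)) =
      (\<Sum>r<?m. f (grid t0 T n (j * ?m + Suc r)) - f (grid t0 T n (j * ?m + r))) / mesh t0 T n"
    by (simp add: slope_def sum_divide_distrib)
  also have "\<dots> = (f (grid t0 T n (Suc j * ?m)) - f (grid t0 T n (j * ?m))) / mesh t0 T n"
    by (subst sum_lessThan_telescope) (simp add: add.commute)
  also have "\<dots> = 2 ^ (n - N) * slope t0 T N f j"
    unfolding grid_refine[OF assms] slope_def using mesh_refine[OF assms, of t0 T] mesh_pos[OF t0T, of n] by simp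
  finally show ?thesis .
qed

text \<open>
  The slopes of level \<open>N\<close> are the averages of those of level \<open>n\<close> (\<open>slope_average\<close>), that is, their
  orthogonal projection on coarser step functions; this is Pythagoras' theorem.
\<close>

lemma slope_energy_diff:
  assumes "N \<le> n"
  shows "(\<Sum>k<2 ^ n. mesh t0 T n * (slope t0 T n f k - slope t0 T N f (k div 2 ^ (n - N)))\<^sup>2) =
      slope_energy t0 T f n - slope_energy t0 T f N"
proof -
  let ?m = "2 ^ (n - N) :: nat"
  have blk: "(\<Sum>r<?m. (slope t0 T n f (j * ?m + r) - slope t0 T N f j)\<^sup>2) =
      (\<Sum>r<?m. (slope t0 T n f (j * ?m + r))\<^sup>2) - real ?m * (slope t0 T N f j)\<^sup>2" for j
  proof -
    have "(\<Sum>r<?m. (slope t0 T n f (j * ?m + r) - slope t0 T N f j)\<^sup>2) =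
        (\<Sum>r<?m. (slope t0 T n f (j * ?m + r))\<^sup>2) + real ?m * (slope t0 T N f j)\<^sup>2
        - 2 * slope t0 T N f j * (\<Sum>r<?m. slope t0 T n f (j * ?m + r))"
      by (simp add: power2_diff sum.distrib sum_subtractf sum_distrib_left mult_ac)
    then show ?thesis unfolding slope_average[OF assms] by (simp add: power2_eq_square)
  qed
  have "(\<Sum>k<2 ^ n. mesh t0 T n * (slope t0 T n f k - slope t0 T N f (k div ?m))\<^sup>2) =
      (\<Sum>j<2 ^ N. mesh t0 T n * (\<Sum>r<?m. (slope t0 T n f (j * ?m + r) - slope t0 T N f j)\<^sup>2))"
    by (simp add: sum_blocks[OF assms] sum_distrib_left)
  also have "\<dots> = (\<Sum>j<2 ^ N. mesh t0 T n * (\<Sum>r<?m. (slope t0 T n f (j * ?m + r))\<^sup>2))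
      - (\<Sum>j<2 ^ N. mesh t0 T N * (slope t0 T N f j)\<^sup>2)"
    unfolding blk mesh_refine[OF assms, of t0 T] by (simp add: sum_subtractf right_diff_distrib mult_ac)
  also have "\<dots> = slope_energy t0 T f n - slope_energy t0 T f N"
    by (simp add: slope_energy_def sum_blocks[OF assms] sum_distrib_left)
  finally show ?thesis .
qed

lemma slope_energy_mono: "N \<le> n \<Longrightarrow> slope_energy t0 T f N \<le> slope_energy t0 T f n"
proof -
  assume "N \<le> n"
  then have "0 \<le> slope_energy t0 T f n - slope_energy t0 T f N"
    unfolding slope_energy_diff[OF \<open>N \<le> n\<close>, symmetric]
    using less_imp_le[OF mesh_pos[OF t0T, of n]] by (intro sum_nonneg mult_nonneg_nonneg) auto
  then show ?thesis by simp
qed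

lemma slope_energy_bound: "slope_energy t0 T f n \<le> l\<^sup>2 * (T - t0)"
proof -
  have "slope_energy t0 T f n \<le> (\<Sum>k<(2::nat) ^ n. mesh t0 T n * l\<^sup>2)"
    unfolding slope_energy_def using mesh_pos[OF t0T, of n] abs_slope_le l
    by (intro sum_mono mult_left_mono) (auto simp: abs_le_square_iff[symmetric])
  also have "\<dots> = l\<^sup>2 * (T - t0)" by (simp add: mesh_def)
  finally show ?thesis .
qed

text \<open>
  Shifting by one fine cell stays inside the same coarse cell except at its left edge. These
  \<open>2 ^ N\<close> exceptional cells cause the last summand, which vanishes as the fine mesh does.
\<close>

lemma lagged_slope_dist:
  assumes "N \<le> n"
  shows "(\<Sum>k<2 ^ n. mesh t0 T n * (lagged_slope t0 T B n f k - slope t0 T N f (k div 2 ^ (n - N)))\<^sup>2)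
      \<le> slope_energy t0 T f n - slope_energy t0 T f N + 4 * l\<^sup>2 * 2 ^ N * mesh t0 T n"
proof -
  let ?m = "2 ^ (n - N) :: nat"
  define G where "G = (\<lambda>k. mesh t0 T n * (slope t0 T n f k - slope t0 T N f (k div ?m))\<^sup>2)"
  have d: "mesh t0 T n > 0" by (rule mesh_pos[OF t0T])
  have G0: "G k \<ge> 0" for k using d by (simp add: G_def)
  have eq2: "(2::nat) ^ n = 2 ^ N * ?m" using assms by (simp add: power_add[symmetric])
  have "(\<Sum>k<2 ^ n. mesh t0 T n * (lagged_slope t0 T B n f k - slope t0 T N f (k div ?m))\<^sup>2)
      \<le> (\<Sum>k<2 ^ n. (if k = 0 then 0 else G (k - 1)) + (if ?m dvd k then mesh t0 T n * (2 * l)\<^sup>2 else 0))"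
  proof (rule sum_mono)
    fix k :: nat assume k: "k \<in> {..<2 ^ n}"
    let ?t = "mesh t0 T n * (lagged_slope t0 T B n f k - slope t0 T N f (k div ?m))\<^sup>2"
    show "?t \<le> (if k = 0 then 0 else G (k - 1)) + (if ?m dvd k then mesh t0 T n * (2 * l)\<^sup>2 else 0)"
    proof (cases "?m dvd k")
      case True
      have "k div ?m < 2 ^ N" using k eq2 by (simp add: less_mult_imp_div_less)
      then have "\<bar>lagged_slope t0 T B n f k - slope t0 T N f (k div ?m)\<bar> \<le> 2 * l"
        using abs_slope_le[of "k div ?m" N] abs_lagged_slope_le_lip[of k n] k by auto
      then have "(lagged_slope t0 T B n f k - slope t0 T N f (k div ?m))\<^sup>2 \<le> (2 * l)\<^sup>2"
        using l by (intro abs_le_square_iff[THEN iffD1]) auto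
      then have "?t \<le> mesh t0 T n * (2 * l)\<^sup>2" using d by (intro mult_left_mono) auto
      then show ?thesis using True G0[of "k - 1"] by auto
    next
      case False
      then have k0: "k \<noteq> 0" by (metis dvd_0_right)
      then obtain k' where k': "k = Suc k'" using not0_implies_Suc by blast
      have "k div ?m = k' div ?m" using False unfolding k' by (simp add: div_Suc dvd_eq_mod_eq_0)
      then show ?thesis using False k k0 lagged_slope_eq[of k n] by (simp add: G_def k')
    qed
  qed
  also have "\<dots> = (\<Sum>k<2 ^ n. (if k = 0 then 0 else G (k - 1))) + (\<Sum>k<2 ^ n. if ?m dvd k then mesh t0 T n * (2 * l)\<^sup>2 else 0)"
    by (rule sum.distrib)
  also have "(\<Sum>k<2 ^ n. (if k = 0 then 0 else G (k - 1))) \<le> (\<Sum>k<2 ^ n. G k)"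
    by (rule sum_shift_le[OF G0])
  also have "(\<Sum>k<2 ^ n. G k) = slope_energy t0 T f n - slope_energy t0 T f N"
    unfolding G_def by (rule slope_energy_diff[OF assms])
  also have "(\<Sum>k<2 ^ n. if ?m dvd k then mesh t0 T n * (2 * l)\<^sup>2 else 0) = 4 * l\<^sup>2 * 2 ^ N * mesh t0 T n"
  proof -
    have "(\<Sum>r<?m. if ?m dvd (j * ?m + r) then mesh t0 T n * (2 * l)\<^sup>2 else 0) = mesh t0 T n * (2 * l)\<^sup>2" for j
    proof -
      have "(\<Sum>r<?m. if ?m dvd (j * ?m + r) then mesh t0 T n * (2 * l)\<^sup>2 else 0) = (\<Sum>r<?m. if r = 0 then mesh t0 T n * (2 * l)\<^sup>2 else 0)"
        by (intro sum.cong refl) (auto simp: dvd_add_right_iff dest: dvd_imp_le)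
      also have "\<dots> = mesh t0 T n * (2 * l)\<^sup>2" by (subst sum.delta) auto
      finally show ?thesis .
    qed
    then show ?thesis unfolding sum_blocks[OF assms] by (simp add: power2_eq_square)
  qed
  finally show ?thesis by simp
qed

lemma lagged_dist_bound: "n \<le> n' \<Longrightarrow> lagged_dist t0 T B f n n' \<le> 4 * l\<^sup>2 * (T - t0)"
proof -
  assume n: "n \<le> n'"
  have "lagged_dist t0 T B f n n' \<le> (\<Sum>k<(2::nat) ^ n'. mesh t0 T n' * (2 * l)\<^sup>2)"
    unfolding lagged_dist_def
  proof (rule sum_mono)
    fix k :: nat assume k: "k \<in> {..<2 ^ n'}"
    have "(2::nat) ^ n' = 2 ^ n * 2 ^ (n' - n)" using n by (simp add: power_add[symmetric])
    then have "k div 2 ^ (n' - n) < 2 ^ n" using k by (simp add: less_mult_imp_div_less)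
    then have "\<bar>lagged_slope t0 T B n' f k - lagged_slope t0 T B n f (k div 2 ^ (n' - n))\<bar> \<le> 2 * l"
      using abs_lagged_slope_le_lip[of k n'] abs_lagged_slope_le_lip[of "k div 2 ^ (n' - n)" n] k by auto
    then have "(lagged_slope t0 T B n' f k - lagged_slope t0 T B n f (k div 2 ^ (n' - n)))\<^sup>2 \<le> (2 * l)\<^sup>2"
      using l by (intro abs_le_square_iff[THEN iffD1]) auto
    then show "mesh t0 T n' * (lagged_slope t0 T B n' f k - lagged_slope t0 T B n f (k div 2 ^ (n' - n)))\<^sup>2 \<le> mesh t0 T n' * (2 * l)\<^sup>2"
      using mesh_pos[OF t0T, of n'] by (intro mult_left_mono) auto
  qed
  also have "\<dots> = 4 * l\<^sup>2 * (T - t0)" by (simp add: mesh_def power2_eq_square)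
  finally show ?thesis .
qed

lemma lagged_dist_le:
  assumes "N \<le> n" "n \<le> n'"
  shows "lagged_dist t0 T B f n n' \<le> 2 * (slope_energy t0 T f n' - slope_energy t0 T f N + 4 * l\<^sup>2 * 2 ^ N * mesh t0 T n')
     + 2 * (slope_energy t0 T f n - slope_energy t0 T f N + 4 * l\<^sup>2 * 2 ^ N * mesh t0 T n)"
proof -
  let ?s = "\<lambda>k. slope t0 T N f (k div 2 ^ (n' - N))"
  have kd: "k div 2 ^ (n' - N) = (k div 2 ^ (n' - n)) div 2 ^ (n - N)" for k :: nat
    using assms by (simp add: div_mult2_eq[symmetric] power_add[symmetric])
  have sq: "(x - y)\<^sup>2 \<le> 2 * (x - s)\<^sup>2 + 2 * (y - s)\<^sup>2" for x y s :: real
  proof -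
    have "0 \<le> (x + y - 2 * s)\<^sup>2" by simp
    then show ?thesis by (simp add: power2_eq_square algebra_simps)
  qed
  have "lagged_dist t0 T B f n n' \<le> (\<Sum>k<2 ^ n'. 2 * (mesh t0 T n' * (lagged_slope t0 T B n' f k - ?s k)\<^sup>2)
      + 2 * (mesh t0 T n' * (lagged_slope t0 T B n f (k div 2 ^ (n' - n)) - ?s k)\<^sup>2))"
    unfolding lagged_dist_def
  proof (rule sum_mono)
    fix k
    show "mesh t0 T n' * (lagged_slope t0 T B n' f k - lagged_slope t0 T B n f (k div 2 ^ (n' - n)))\<^sup>2
        \<le> 2 * (mesh t0 T n' * (lagged_slope t0 T B n' f k - ?s k)\<^sup>2)
      + 2 * (mesh t0 T n' * (lagged_slope t0 T B n f (k div 2 ^ (n' - n)) - ?s k)\<^sup>2)"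
      using mult_left_mono[OF sq[of "lagged_slope t0 T B n' f k" "lagged_slope t0 T B n f (k div 2 ^ (n' - n))" "?s k"], of "mesh t0 T n'"]
        mesh_pos[OF t0T, of n'] by (simp add: distrib_left mult.left_commute)
  qed
  also have "\<dots> = 2 * (\<Sum>k<2 ^ n'. mesh t0 T n' * (lagged_slope t0 T B n' f k - ?s k)\<^sup>2)
      + 2 * (\<Sum>k<2 ^ n'. mesh t0 T n' * (lagged_slope t0 T B n f (k div 2 ^ (n' - n)) - slope t0 T N f (k div 2 ^ (n' - n) div 2 ^ (n - N)))\<^sup>2)"
    unfolding kd sum.distrib by (simp add: sum_distrib_left)
  also have "\<dots> = 2 * (\<Sum>k<2 ^ n'. mesh t0 T n' * (lagged_slope t0 T B n' f k - ?s k)\<^sup>2)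
      + 2 * (\<Sum>j<2 ^ n. mesh t0 T n * (lagged_slope t0 T B n f j - slope t0 T N f (j div 2 ^ (n - N)))\<^sup>2)"
    using sum_mesh_refine[OF assms(2), of t0 T "\<lambda>j. (lagged_slope t0 T B n f j - slope t0 T N f (j div 2 ^ (n - N)))\<^sup>2"] by simp
  also have "\<dots> \<le> 2 * (slope_energy t0 T f n' - slope_energy t0 T f N + 4 * l\<^sup>2 * 2 ^ N * mesh t0 T n')
     + 2 * (slope_energy t0 T f n - slope_energy t0 T f N + 4 * l\<^sup>2 * 2 ^ N * mesh t0 T n)"
    using assms by (intro add_mono mult_left_mono lagged_slope_dist) auto
  finally show ?thesis .
qed

text \<open>
  Slope energies increase with the level and are bounded, so they converge. Comparing both lagged slopes
  with the unlagged slope of a fixed level \<open>N\<close> bounds their distance by differences of energies.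
\<close>

lemma lagged_dist_Cauchy:
  assumes "\<epsilon> > 0"
  shows "\<exists>M. \<forall>n\<ge>M. \<forall>n'\<ge>n. lagged_dist t0 T B f n n' < \<epsilon>"
proof -
  have "convergent (slope_energy t0 T f)"
  proof (rule Bseq_mono_convergent)
    show "Bseq (slope_energy t0 T f)"
    proof (rule BseqI')
      fix n
      have "0 \<le> slope_energy t0 T f n" unfolding slope_energy_def
        using less_imp_le[OF mesh_pos[OF t0T, of n]] by (intro sum_nonneg mult_nonneg_nonneg) auto
      then show "norm (slope_energy t0 T f n) \<le> l\<^sup>2 * (T - t0)" using slope_energy_bound[of n] by simp
    qed
  qed (use slope_energy_mono in auto)
  then have "Cauchy (slope_energy t0 T f)" by (simp add: Cauchy_convergent_iff)
  then obtain N where N: "\<And>m n. m \<ge> N \<Longrightarrow> n \<ge> N \<Longrightarrow> dist (slope_energy t0 T f m) (slope_energy t0 T f n) < \<epsilon> / 8"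
    using assms by (meson metric_CauchyD divide_pos_pos zero_less_numeral)
  let ?c = "4 * l\<^sup>2 * 2 ^ N"
  have "(\<lambda>n. ?c * mesh t0 T n) \<longlonglongrightarrow> 0"
    unfolding mesh_def using tendsto_mult_right_zero[OF LIMSEQ_divide_realpow_zero[of 2 "T - t0"], of ?c] by simp
  then have "eventually (\<lambda>n. ?c * mesh t0 T n < \<epsilon> / 8) sequentially"
    using assms by (auto dest: order_tendstoD(2)[where a="\<epsilon> / 8"])
  then obtain M0 where M0: "\<And>n. n \<ge> M0 \<Longrightarrow> ?c * mesh t0 T n < \<epsilon> / 8" by (auto simp: eventually_sequentially)
  show ?thesis
  proof (intro exI[of _ "max N M0"] allI impI)
    fix n n' assume n: "max N M0 \<le> n" "n \<le> n'"
    have "lagged_dist t0 T B f n n' \<le> 2 * (slope_energy t0 T f n' - slope_energy t0 T f N + ?c * mesh t0 T n')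
     + 2 * (slope_energy t0 T f n - slope_energy t0 T f N + ?c * mesh t0 T n)"
      using n by (intro lagged_dist_le) auto
    moreover have d: "\<bar>slope_energy t0 T f n' - slope_energy t0 T f N\<bar> < \<epsilon> / 8" "\<bar>slope_energy t0 T f n - slope_energy t0 T f N\<bar> < \<epsilon> / 8"
      using N[of n' N] N[of n N] n by (auto simp: dist_real_def)
    have "slope_energy t0 T f n' - slope_energy t0 T f N < \<epsilon> / 8" "slope_energy t0 T f n - slope_energy t0 T f N < \<epsilon> / 8"
      using d by linarith+
    moreover have "?c * mesh t0 T n' < \<epsilon> / 8" "?c * mesh t0 T n < \<epsilon> / 8" using M0 n by auto
    ultimately show "lagged_dist t0 T B f n n' < \<epsilon>" by argo
  qed
qed

end

section \<open>Drifts of bounded energy\<close>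

text \<open>
  A family of Lipschitz paths whose Lipschitz constants have squared \<open>\<ell>\<^sup>2\<close> norm at most \<open>K\<close>. The index
  type is arbitrary, which is why the sum is bounded over finite sets.
\<close>

definition energy_bounded :: "real \<Rightarrow> real \<Rightarrow> real \<Rightarrow> ('p \<Rightarrow> real \<Rightarrow> real) \<Rightarrow> bool" where
  "energy_bounded t0 T K a \<longleftrightarrow> (\<exists>l. (\<forall>p. 0 \<le> l p) \<and> (\<forall>S. finite S \<longrightarrow> (\<Sum>p\<in>S. (l p)\<^sup>2) \<le> K) \<and>
     (\<forall>p. \<forall>t\<in>{t0..T}. \<forall>u\<in>{t0..T}. \<bar>a p t - a p u\<bar> \<le> l p * \<bar>t - u\<bar>))"

text \<open>
  As \<open>lagged_dist\<close>, summed over the components. Level \<open>n\<close> takes only the components in \<open>J n\<close> into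
  account, the others having slope \<open>0\<close> there.
\<close>

definition drift_dist :: "real \<Rightarrow> real \<Rightarrow> real \<Rightarrow> (nat \<Rightarrow> 'p set) \<Rightarrow> ('p \<Rightarrow> real \<Rightarrow> real) \<Rightarrow> nat \<Rightarrow> nat \<Rightarrow> real" where
  "drift_dist t0 T B J a n n' = (\<Sum>k<2 ^ n'. \<Sum>p\<in>J n'. mesh t0 T n' * (lagged_slope t0 T B n' (a p) k
      - (if p \<in> J n then lagged_slope t0 T B n (a p) (k div 2 ^ (n' - n)) else 0))\<^sup>2)"

lemma finite_sums_small_tail:
  fixes x :: "'p \<Rightarrow> real"
  assumes x: "\<And>p. 0 \<le> x p" and K: "\<And>S. finite S \<Longrightarrow> sum x S \<le> K" and e: "\<epsilon> > 0"
  obtains S0 where "finite S0" "\<And>S. finite S \<Longrightarrow> S \<inter> S0 = {} \<Longrightarrow> sum x S < \<epsilon>"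
proof -
  let ?A = "sum x ` {S. finite S}"
  have bdd: "bdd_above ?A" using K by (auto intro!: bdd_aboveI2)
  have ne: "?A \<noteq> {}" by auto
  have "Sup ?A - \<epsilon> < Sup ?A" using e by simp
  then obtain y where "y \<in> ?A" "Sup ?A - \<epsilon> < y" using less_cSup_iff[OF ne bdd] by blast
  then obtain S0 where S0: "finite S0" "Sup ?A - \<epsilon> < sum x S0" by auto
  show thesis
  proof (rule that[OF S0(1)])
    fix S assume S: "finite S" "S \<inter> S0 = {}"
    have "sum x S + sum x S0 = sum x (S \<union> S0)" using S S0 by (intro sum.union_disjoint[symmetric]) auto
    also have "\<dots> \<le> Sup ?A" using S S0 bdd by (intro cSup_upper) auto
    finally show "sum x S < \<epsilon>" using S0(2) by linarith
  qed
qed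

context
  fixes t0 T K B :: real and J :: "nat \<Rightarrow> 'p set" and a :: "'p \<Rightarrow> real \<Rightarrow> real"
  assumes t0T: "t0 < T" and B: "B = sqrt K"
    and J: "\<And>n. finite (J n)" "mono J" "(\<Union>n. J n) = UNIV"
    and a: "energy_bounded t0 T K a"
begin

lemma energy_boundedE:
  obtains l where "\<And>p. 0 \<le> l p" "\<And>p. l p \<le> B" "\<And>S. finite S \<Longrightarrow> (\<Sum>p\<in>S. (l p)\<^sup>2) \<le> K"
    "\<And>p t u. t \<in> {t0..T} \<Longrightarrow> u \<in> {t0..T} \<Longrightarrow> \<bar>a p t - a p u\<bar> \<le> l p * \<bar>t - u\<bar>"
proof -
  obtain l where l: "\<forall>p. 0 \<le> l p" "\<forall>S. finite S \<longrightarrow> (\<Sum>p\<in>S. (l p)\<^sup>2) \<le> K"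
    "\<forall>p. \<forall>t\<in>{t0..T}. \<forall>u\<in>{t0..T}. \<bar>a p t - a p u\<bar> \<le> l p * \<bar>t - u\<bar>"
    using a unfolding energy_bounded_def by blast
  have "l p \<le> B" for p
    unfolding B by (rule real_le_rsqrt) (use l(2)[rule_format, of "{p}"] in simp)
  with l show thesis by (intro that[of l]) auto
qed

lemma lagged_energy_le: "(\<Sum>k<2 ^ n. \<Sum>p\<in>J n. mesh t0 T n * (lagged_slope t0 T B n (a p) k)\<^sup>2) \<le> K * (T - t0)"
proof -
  obtain l where l: "\<And>p. 0 \<le> l p" "\<And>p. l p \<le> B" "\<And>S. finite S \<Longrightarrow> (\<Sum>p\<in>S. (l p)\<^sup>2) \<le> K"
    "\<And>p t u. t \<in> {t0..T} \<Longrightarrow> u \<in> {t0..T} \<Longrightarrow> \<bar>a p t - a p u\<bar> \<le> l p * \<bar>t - u\<bar>"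
    using energy_boundedE by blast
  have "(\<Sum>k<2 ^ n. \<Sum>p\<in>J n. mesh t0 T n * (lagged_slope t0 T B n (a p) k)\<^sup>2) \<le> (\<Sum>k<(2::nat) ^ n. \<Sum>p\<in>J n. mesh t0 T n * (l p)\<^sup>2)"
  proof (intro sum_mono mult_left_mono)
    fix k :: nat and p assume "k \<in> {..<2 ^ n}"
    then have "\<bar>lagged_slope t0 T B n (a p) k\<bar> \<le> l p"
      using abs_lagged_slope_le_lip[OF t0T l(4) l(1,2), of k n p] by simp
    then show "(lagged_slope t0 T B n (a p) k)\<^sup>2 \<le> (l p)\<^sup>2"
      using l(1)[of p] by (intro abs_le_square_iff[THEN iffD1]) auto
  qed (use mesh_pos[OF t0T, of n] in auto)
  also have "\<dots> = (T - t0) * (\<Sum>p\<in>J n. (l p)\<^sup>2)"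
    by (simp add: sum_distrib_left mesh_def)
  also have "\<dots> \<le> (T - t0) * K" using l(3)[OF J(1)] t0T by (intro mult_left_mono) auto
  finally show ?thesis by (simp add: mult.commute)
qed

lemma drift_dist_le_sum:
  assumes l: "\<And>p. 0 \<le> l p" "\<And>p. l p \<le> B"
    "\<And>p t u. t \<in> {t0..T} \<Longrightarrow> u \<in> {t0..T} \<Longrightarrow> \<bar>a p t - a p u\<bar> \<le> l p * \<bar>t - u\<bar>"
    and S: "finite S" "S \<subseteq> J n" and n: "n \<le> n'"
  shows "drift_dist t0 T B J a n n' \<le> (\<Sum>p\<in>S. lagged_dist t0 T B (a p) n n') + 4 * (T - t0) * (\<Sum>p\<in>J n' - S. (l p)\<^sup>2)"
proof -
  let ?g = "\<lambda>p. \<Sum>k<2 ^ n'. mesh t0 T n' * (lagged_slope t0 T B n' (a p) k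
      - (if p \<in> J n then lagged_slope t0 T B n (a p) (k div 2 ^ (n' - n)) else 0))\<^sup>2"
  have sub: "S \<subseteq> J n'" using S monoD[OF J(2) n] by auto
  have g: "?g p = lagged_dist t0 T B (a p) n n'" if "p \<in> J n" for p
    using that by (simp add: lagged_dist_def)
  have g4: "?g p \<le> 4 * (T - t0) * (l p)\<^sup>2" for p
  proof (cases "p \<in> J n")
    case True
    show ?thesis unfolding g[OF True] using lagged_dist_bound[OF t0T l(3) l(1,2) n, of p] by (simp only: mult_ac)
  next
    case False
    have "?g p \<le> (\<Sum>k<(2::nat) ^ n'. mesh t0 T n' * (l p)\<^sup>2)"
    proof (intro sum_mono mult_left_mono)
      fix k :: nat assume "k \<in> {..<2 ^ n'}"
      then have "\<bar>lagged_slope t0 T B n' (a p) k\<bar> \<le> l p"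
        using abs_lagged_slope_le_lip[OF t0T l(3) l(1,2), of k n' p] by simp
      then have "(lagged_slope t0 T B n' (a p) k)\<^sup>2 \<le> (l p)\<^sup>2"
        using l(1)[of p] by (intro abs_le_square_iff[THEN iffD1]) auto
      then show "(lagged_slope t0 T B n' (a p) k - (if p \<in> J n then lagged_slope t0 T B n (a p) (k div 2 ^ (n' - n)) else 0))\<^sup>2 \<le> (l p)\<^sup>2"
        using False by simp
    qed (use mesh_pos[OF t0T, of n'] in auto)
    also have "\<dots> = (T - t0) * (l p)\<^sup>2" by (simp add: mesh_def)
    also have "\<dots> \<le> 4 * (T - t0) * (l p)\<^sup>2" using t0T by (intro mult_right_mono) auto
    finally show ?thesis .
  qed
  have "drift_dist t0 T B J a n n' = (\<Sum>p\<in>J n'. ?g p)"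
    unfolding drift_dist_def by (rule sum.swap)
  also have "\<dots> = (\<Sum>p\<in>S. ?g p) + (\<Sum>p\<in>J n' - S. ?g p)"
    using sum.subset_diff[OF sub J(1)] by (simp add: add.commute)
  also have "(\<Sum>p\<in>S. ?g p) = (\<Sum>p\<in>S. lagged_dist t0 T B (a p) n n')"
    using S by (intro sum.cong refl g) auto
  also have "(\<Sum>p\<in>J n' - S. ?g p) \<le> (\<Sum>p\<in>J n' - S. 4 * (T - t0) * (l p)\<^sup>2)"
    by (intro sum_mono g4)
  finally show ?thesis by (simp add: sum_distrib_left)
qed

lemma drift_dist_nonneg: "drift_dist t0 T B J a n n' \<ge> 0"
  unfolding drift_dist_def using mesh_pos[OF t0T, of n'] by (intro sum_nonneg mult_nonneg_nonneg) auto

lemma drift_dist_bound: "n \<le> n' \<Longrightarrow> drift_dist t0 T B J a n n' \<le> 4 * (T - t0) * K"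
proof -
  assume n: "n \<le> n'"
  obtain l where l: "\<And>p. 0 \<le> l p" "\<And>p. l p \<le> B" "\<And>S. finite S \<Longrightarrow> (\<Sum>p\<in>S. (l p)\<^sup>2) \<le> K"
    "\<And>p t u. t \<in> {t0..T} \<Longrightarrow> u \<in> {t0..T} \<Longrightarrow> \<bar>a p t - a p u\<bar> \<le> l p * \<bar>t - u\<bar>"
    using energy_boundedE by blast
  have "drift_dist t0 T B J a n n' \<le> 4 * (T - t0) * (\<Sum>p\<in>J n'. (l p)\<^sup>2)"
    using drift_dist_le_sum[OF l(1,2,4), of "{}" n n'] n by simp
  also have "\<dots> \<le> 4 * (T - t0) * K" using l(3)[OF J(1)] t0T by (intro mult_left_mono) auto
  finally show ?thesis .
qed

text \<open>
  Up to a small tail of the energy only finitely many components matter, and each of them is handled by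
  \<open>lagged_dist_Cauchy\<close>.
\<close>

lemma drift_dist_Cauchy:
  assumes e: "\<epsilon> > 0"
  shows "\<exists>M. \<forall>n\<ge>M. \<forall>n'\<ge>n. drift_dist t0 T B J a n n' < \<epsilon>"
proof -
  obtain l where l: "\<And>p. 0 \<le> l p" "\<And>p. l p \<le> B" "\<And>S. finite S \<Longrightarrow> (\<Sum>p\<in>S. (l p)\<^sup>2) \<le> K"
    "\<And>p t u. t \<in> {t0..T} \<Longrightarrow> u \<in> {t0..T} \<Longrightarrow> \<bar>a p t - a p u\<bar> \<le> l p * \<bar>t - u\<bar>"
    using energy_boundedE by blast
  have e1: "\<epsilon> / 2 / (4 * (T - t0)) > 0" using e t0T by simp
  obtain S where S: "finite S" "\<And>S'. finite S' \<Longrightarrow> S' \<inter> S = {} \<Longrightarrow> (\<Sum>p\<in>S'. (l p)\<^sup>2) < \<epsilon> / 2 / (4 * (T - t0))"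
    using finite_sums_small_tail[of "\<lambda>p. (l p)\<^sup>2" K, OF _ l(3) e1] by auto
  have "\<exists>n. S \<subseteq> J n"
  proof -
    have "\<exists>n. p \<in> J n" for p using J(3) by auto
    then obtain \<nu> where \<nu>: "\<And>p. p \<in> J (\<nu> p)" by metis
    have "S \<subseteq> J (Max (insert 0 (\<nu> ` S)))"
    proof
      fix p assume "p \<in> S"
      then have "\<nu> p \<le> Max (insert 0 (\<nu> ` S))" using S by (intro Max_ge) auto
      then show "p \<in> J (Max (insert 0 (\<nu> ` S)))" using \<nu>[of p] monoD[OF J(2)] by blast
    qed
    then show ?thesis by blast
  qed
  then obtain n0 where n0: "S \<subseteq> J n0" by blast
  have e2: "\<epsilon> / 2 / (real (card S) + 1) > 0" using e by simp
  have "\<forall>p. \<exists>M. \<forall>n\<ge>M. \<forall>n'\<ge>n. lagged_dist t0 T B (a p) n n' < \<epsilon> / 2 / (real (card S) + 1)"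
    using lagged_dist_Cauchy[OF t0T l(4) l(1,2) e2] by blast
  then obtain M where M: "\<And>p n n'. n \<ge> M p \<Longrightarrow> n' \<ge> n \<Longrightarrow> lagged_dist t0 T B (a p) n n' < \<epsilon> / 2 / (real (card S) + 1)"
    by metis
  show ?thesis
  proof (intro exI allI impI)
    fix n n' assume n: "Max (insert n0 (M ` S)) \<le> n" "n \<le> n'"
    have n0n: "n0 \<le> n" using n S(1) by simp
    have Mn: "M p \<le> n" if "p \<in> S" for p using n S(1) that by simp
    have SJ: "S \<subseteq> J n" using n0 monoD[OF J(2) n0n] by blast
    have "drift_dist t0 T B J a n n' \<le> (\<Sum>p\<in>S. lagged_dist t0 T B (a p) n n') + 4 * (T - t0) * (\<Sum>p\<in>J n' - S. (l p)\<^sup>2)"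
      by (rule drift_dist_le_sum[OF l(1,2,4) S(1) SJ n(2)])
    also have "(\<Sum>p\<in>S. lagged_dist t0 T B (a p) n n') \<le> real (card S) * (\<epsilon> / 2 / (real (card S) + 1))"
      by (rule sum_bounded_above) (use M Mn n in \<open>auto intro!: less_imp_le\<close>)
    also have "real (card S) * (\<epsilon> / 2 / (real (card S) + 1)) \<le> \<epsilon> / 2"
      using e by (simp add: field_simps)
    also have "4 * (T - t0) * (\<Sum>p\<in>J n' - S. (l p)\<^sup>2) < 4 * (T - t0) * (\<epsilon> / 2 / (4 * (T - t0)))"
      using S(2)[of "J n' - S"] J(1) t0T by (intro mult_strict_left_mono) auto
    also have "4 * (T - t0) * (\<epsilon> / 2 / (4 * (T - t0))) = \<epsilon> / 2"
    proof -
      have "4 * (T - t0) \<noteq> 0" using t0T by simp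
      then show ?thesis by (metis nonzero_mult_div_cancel_left times_divide_eq_right)
    qed
    finally show "drift_dist t0 T B J a n n' < \<epsilon>" by simp
  qed
qed

end

section \<open>Discrete Girsanov densities\<close>

text \<open>
  The logarithm of the Girsanov density that removes from \<open>w + a\<close> the drift \<open>a\<close>, with the derivative of
  \<open>a\<close> replaced by its lagged slope.
\<close>

definition log_density :: "real \<Rightarrow> real \<Rightarrow> real \<Rightarrow> (nat \<Rightarrow> 'p set) \<Rightarrow> nat \<Rightarrow> ('p \<Rightarrow> real \<Rightarrow> real) \<Rightarrow> ('p \<Rightarrow> real \<Rightarrow> real) \<Rightarrow> real" where
  "log_density t0 T B J n w a = - (\<Sum>k<2 ^ n. \<Sum>p\<in>J n.
      lagged_slope t0 T B n (a p) k * (w p (grid t0 T n (Suc k)) - w p (grid t0 T n k))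
      + (lagged_slope t0 T B n (a p) k)\<^sup>2 / 2 * mesh t0 T n)"

lemma sum_increments_refine:
  fixes f :: "real \<Rightarrow> real" and g :: "nat \<Rightarrow> real"
  assumes "N \<le> n"
  shows "(\<Sum>k<2 ^ n. g (k div 2 ^ (n - N)) * (f (grid t0 T n (Suc k)) - f (grid t0 T n k))) =
    (\<Sum>j<2 ^ N. g j * (f (grid t0 T N (Suc j)) - f (grid t0 T N j)))"
proof -
  let ?m = "2 ^ (n - N) :: nat"
  have "(\<Sum>r<?m. f (grid t0 T n (Suc (j * ?m + r))) - f (grid t0 T n (j * ?m + r))) =
      f (grid t0 T N (Suc j)) - f (grid t0 T N j)" for j
  proof -
    have "(\<Sum>r<?m. f (grid t0 T n (j * ?m + Suc r)) - f (grid t0 T n (j * ?m + r))) =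
        f (grid t0 T n (Suc j * ?m)) - f (grid t0 T n (j * ?m))"
      by (subst sum_lessThan_telescope) (simp add: add.commute)
    then show ?thesis unfolding grid_refine[OF assms] by simp
  qed
  then show ?thesis by (simp add: sum_blocks[OF assms] sum_distrib_left[symmetric])
qed

text \<open>
  Coefficients that are constant on the coarse cells give the same sums on the fine grid, so densities of
  different levels can be compared on one grid.
\<close>

lemma log_density_refine:
  assumes n: "n \<le> n'" and J: "\<And>n. finite (J n)" "mono J"
  shows "log_density t0 T B J n w a = - (\<Sum>k<2 ^ n'. \<Sum>p\<in>J n'.
      (if p \<in> J n then lagged_slope t0 T B n (a p) (k div 2 ^ (n' - n)) else 0) * (w p (grid t0 T n' (Suc k)) - w p (grid t0 T n' k))
      + (if p \<in> J n then lagged_slope t0 T B n (a p) (k div 2 ^ (n' - n)) else 0)\<^sup>2 / 2 * mesh t0 T n')"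
proof -
  let ?\<theta> = "\<lambda>p. lagged_slope t0 T B n (a p)"
  have sub: "J n \<subseteq> J n'" using monoD[OF J(2) n] .
  have "(\<Sum>k<2 ^ n'. \<Sum>p\<in>J n'.
      (if p \<in> J n then ?\<theta> p (k div 2 ^ (n' - n)) else 0) * (w p (grid t0 T n' (Suc k)) - w p (grid t0 T n' k))
      + (if p \<in> J n then ?\<theta> p (k div 2 ^ (n' - n)) else 0)\<^sup>2 / 2 * mesh t0 T n') =
    (\<Sum>k<2 ^ n'. \<Sum>p\<in>J n. ?\<theta> p (k div 2 ^ (n' - n)) * (w p (grid t0 T n' (Suc k)) - w p (grid t0 T n' k))
      + (?\<theta> p (k div 2 ^ (n' - n)))\<^sup>2 / 2 * mesh t0 T n')"
    by (intro sum.cong refl sum.mono_neutral_cong_right J(1) sub) auto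
  also have "\<dots> = (\<Sum>p\<in>J n. (\<Sum>k<2 ^ n'. ?\<theta> p (k div 2 ^ (n' - n)) * (w p (grid t0 T n' (Suc k)) - w p (grid t0 T n' k)))
      + (\<Sum>k<2 ^ n'. mesh t0 T n' * ((?\<theta> p (k div 2 ^ (n' - n)))\<^sup>2 / 2)))"
    by (subst sum.swap) (simp add: sum.distrib mult.commute)
  also have "\<dots> = (\<Sum>p\<in>J n. (\<Sum>k<2 ^ n. ?\<theta> p k * (w p (grid t0 T n (Suc k)) - w p (grid t0 T n k)))
      + (\<Sum>k<2 ^ n. mesh t0 T n * ((?\<theta> p k)\<^sup>2 / 2)))"
    using sum_increments_refine[OF n, of "?\<theta> p" "w p" t0 T for p]
      sum_mesh_refine[OF n, of t0 T "\<lambda>k. (?\<theta> p k)\<^sup>2 / 2" for p] by simp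
  also have "\<dots> = (\<Sum>k<2 ^ n. \<Sum>p\<in>J n. ?\<theta> p k * (w p (grid t0 T n (Suc k)) - w p (grid t0 T n k))
      + (?\<theta> p k)\<^sup>2 / 2 * mesh t0 T n)"
    unfolding sum.distrib[symmetric] by (subst sum.swap) (simp add: mult.commute)
  finally show ?thesis unfolding log_density_def by simp
qed

lemma mult_le_weighted_squares:
  fixes u s \<eta> :: real
  assumes "\<eta> > 0"
  shows "u * s \<le> u\<^sup>2 / \<eta> + \<eta> * s\<^sup>2"
proof -
  have "0 \<le> (u - \<eta> * s / 2)\<^sup>2 + 3 / 4 * (\<eta> * s)\<^sup>2" by simp
  then have "\<eta> * (u * s) \<le> u\<^sup>2 + \<eta>\<^sup>2 * s\<^sup>2" by (simp add: power2_eq_square field_simps)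
  then show ?thesis using assms by (simp add: field_simps power2_eq_square)
qed

text \<open>
  Factor \<open>x - y\<close> into the difference and the sum of the square roots. The first term is the integrand
  of the Hellinger distance; \<open>\<eta>\<close> is left free to balance both terms.
\<close>

lemma abs_diff_le_hellinger:
  fixes x y \<eta> :: real
  assumes "x \<ge> 0" "y \<ge> 0" "\<eta> > 0"
  shows "\<bar>x - y\<bar> \<le> (x + y - 2 * sqrt (x * y)) / \<eta> + \<eta> * (2 * x + 2 * y)"
proof -
  define a b where "a = sqrt x" and "b = sqrt y"
  have xy: "x = a * a" "y = b * b" "sqrt (x * y) = a * b" "a \<ge> 0" "b \<ge> 0"
    using assms by (auto simp: a_def b_def real_sqrt_mult)
  have "\<bar>a - b\<bar> * (a + b) \<le> (a - b)\<^sup>2 / \<eta> + \<eta> * (a + b)\<^sup>2"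
    using mult_le_weighted_squares[OF assms(3), of "\<bar>a - b\<bar>" "a + b"] by simp
  moreover have f2: "\<bar>x - y\<bar> = \<bar>a - b\<bar> * (a + b)"
  proof -
    have "x - y = (a - b) * (a + b)" by (simp add: xy algebra_simps)
    then show ?thesis using xy by (simp add: abs_mult)
  qed
  moreover have f3: "x + y - 2 * sqrt (x * y) = (a - b)\<^sup>2" unfolding xy(3) unfolding xy(1,2) by (simp add: power2_eq_square algebra_simps)
  moreover have "\<eta> * (a + b)\<^sup>2 \<le> \<eta> * (2 * x + 2 * y)"
  proof -
    have "0 \<le> (a - b)\<^sup>2" by simp
    then have "(a + b)\<^sup>2 \<le> 2 * x + 2 * y" by (simp add: xy power2_eq_square algebra_simps)
    then show ?thesis using assms by (intro mult_left_mono) auto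
  qed
  ultimately show ?thesis unfolding f2 f3 by linarith
qed

text \<open>
  The finite sets \<open>J n\<close> exhaust the components; level \<open>n\<close> of the discretisation uses \<open>J n\<close> and the dyadic
  grid with \<open>2 ^ n\<close> cells. The energy bound \<open>K\<close> is deterministic.
\<close>

locale drifted_brownian = brownian_family Q F t0 T w
  for Q :: "'w measure" and F :: "real \<Rightarrow> 'w measure" and t0 T :: real and w :: "'p \<Rightarrow> real \<Rightarrow> 'w \<Rightarrow> real" +
  fixes A :: "'p \<Rightarrow> real \<Rightarrow> 'w \<Rightarrow> real" and K :: real and J :: "nat \<Rightarrow> 'p set"
  assumes t0T: "t0 < T"
    and J: "\<And>n. finite (J n)" "mono J" "(\<Union>n. J n) = UNIV"
    and K0: "K \<ge> 0"
    and A_adapted: "t \<in> {t0..T} \<Longrightarrow> A p t \<in> borel_measurable (F t)"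
    and A_energy: "AE \<omega> in Q. energy_bounded t0 T K (\<lambda>p t. A p t \<omega>)"
    and w_cont: "AE \<omega> in Q. \<forall>p. continuous_on {t0..T} (\<lambda>t. w p t \<omega>)"
    and start_0: "AE \<omega> in Q. \<forall>p. w p t0 \<omega> = 0 \<and> A p t0 \<omega> = 0"
begin

abbreviation "B \<equiv> sqrt K"
abbreviation "g \<equiv> grid t0 T"
abbreviation "\<delta> \<equiv> mesh t0 T"

definition \<theta> :: "nat \<Rightarrow> nat \<Rightarrow> 'p \<Rightarrow> 'w \<Rightarrow> real" where
  "\<theta> n k p \<omega> = lagged_slope t0 T B n (\<lambda>t. A p t \<omega>) k"

definition Z :: "nat \<Rightarrow> 'w \<Rightarrow> real" where
  "Z n \<omega> = exp (log_density t0 T B J n (\<lambda>p t. w p t \<omega>) (\<lambda>p t. A p t \<omega>))"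

lemma g_in: "k \<le> 2 ^ n \<Longrightarrow> g n k \<in> {t0..T}"
  using grid_in[of t0 T k n] t0T by simp

lemma g_less: "g n k < g n (Suc k)"
  using mesh_pos[OF t0T] by (simp add: grid_Suc)

lemma \<theta>_bound: "\<bar>\<theta> n k p \<omega>\<bar> \<le> B"
  unfolding \<theta>_def using K0 by (intro abs_lagged_slope_le) simp

lemma \<theta>_adapted: "k < 2 ^ n \<Longrightarrow> \<theta> n k p \<in> borel_measurable (F (g n k))"
proof (cases k)
  case 0
  then have "\<theta> n k p = (\<lambda>_. 0)" by (auto simp: \<theta>_def lagged_slope_def)
  then show ?thesis by simp
next
  case (Suc j)
  assume k: "k < 2 ^ n"
  have T: "g n j \<in> {t0..T}" "g n k \<in> {t0..T}" "g n j \<le> g n k"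
    using g_in[of j n] g_in[of k n] g_less[of n j] k Suc by auto
  have [measurable]: "A p (g n k) \<in> borel_measurable (F (g n k))" "A p (g n j) \<in> borel_measurable (F (g n k))"
    using A_adapted[OF T(2)] meas_F_mono[OF T A_adapted[OF T(1)]] by auto
  have "\<theta> n k p = (\<lambda>\<omega>. if B < \<bar>(A p (g n k) \<omega> - A p (g n j) \<omega>) / \<delta> n\<bar> then 0 else (A p (g n k) \<omega> - A p (g n j) \<omega>) / \<delta> n)"
    by (auto simp: \<theta>_def lagged_slope_def slope_def Suc)
  then show ?thesis by simp
qed

lemma \<theta>_meas: "k < 2 ^ n \<Longrightarrow> \<theta> n k p \<in> borel_measurable Q"
  using \<theta>_adapted meas_F g_in[of k n] by (metis less_imp_le)

lemma real_exp_martingale: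
  assumes S: "finite S" and c: "\<And>k p. k < 2 ^ n \<Longrightarrow> p \<in> S \<Longrightarrow> c k p \<in> borel_measurable (F (g n k))"
    and C: "C \<ge> 0" "\<And>k p \<omega>. k < 2 ^ n \<Longrightarrow> p \<in> S \<Longrightarrow> \<bar>c k p \<omega>\<bar> \<le> C"
  defines "M \<equiv> \<lambda>\<omega>. exp (\<Sum>k<2 ^ n. \<Sum>p\<in>S. c k p \<omega> * (w p (g n (Suc k)) \<omega> - w p (g n k) \<omega>) - (c k p \<omega>)\<^sup>2 / 2 * \<delta> n)"
  shows "all_moments Q M" "(\<integral>\<omega>. M \<omega> \<partial>Q) = 1"
proof -
  have eq: "1 * exp (\<Sum>k<2 ^ n. exp_increment S (\<lambda>p. complex_of_real (c k p \<omega>)) (\<lambda>p. w p (g n (Suc k)) \<omega> - w p (g n k) \<omega>) (g n (Suc k) - g n k))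
      = complex_of_real (M \<omega>)" for \<omega>
    unfolding M_def exp_of_real[symmetric]
    by (simp add: exp_increment_def grid_Suc sum_subtractf sum_distrib_right sum_divide_distrib)
  have 1: "all_moments Q (\<lambda>\<omega>. complex_of_real (M \<omega>)) \<and> (\<integral>\<omega>. complex_of_real (M \<omega>) \<partial>Q) = (\<integral>\<omega>. (1::complex) \<partial>Q)"
    unfolding eq[symmetric]
    by (rule exp_martingale_grid[where B=C, OF S]) (use c C g_less in auto)
  then have "(\<lambda>\<omega>. complex_of_real (M \<omega>)) \<in> borel_measurable Q" using all_moments_measurable by blast
  then have M: "M \<in> borel_measurable Q" by (simp add: borel_measurable_complex_iff)
  show "all_moments Q M" using 1 all_moments_of_real[OF M, where ?'b=complex] by blast
  show "(\<integral>\<omega>. M \<omega> \<partial>Q) = 1" using 1 by (simp add: prob_space flip: of_real_eq_iff)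
qed

lemma energy_sum_bound: "AE \<omega> in Q. (\<Sum>k<2 ^ n. \<Sum>p\<in>J n. (\<theta> n k p \<omega>)\<^sup>2 * \<delta> n) \<le> K * (T - t0)"
  using A_energy
proof eventually_elim
  case (elim \<omega>)
  from lagged_energy_le[OF t0T refl J elim, of n] show ?case by (simp add: \<theta>_def mult.commute)
qed

lemma Z_eq: "Z n \<omega> = exp (\<Sum>k<2 ^ n. \<Sum>p\<in>J n. (- \<theta> n k p \<omega>) * (w p (g n (Suc k)) \<omega> - w p (g n k) \<omega>) - (- \<theta> n k p \<omega>)\<^sup>2 / 2 * \<delta> n)"
  unfolding Z_def log_density_def \<theta>_def sum_negf[symmetric] by (simp add: algebra_simps)

lemma Z_pos: "Z n \<omega> > 0"
  by (simp add: Z_def)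

lemma Z_moments: "all_moments Q (Z n)" and Z_mean: "(\<integral>\<omega>. Z n \<omega> \<partial>Q) = 1"
  unfolding Z_eq using \<theta>_bound K0
  by (intro real_exp_martingale[where C=B] J; auto intro: \<theta>_adapted)+

text \<open>
  \<open>1 / Z n\<close> is the exponential martingale with the opposite coefficients times the exponential of the
  energy, which is bounded.
\<close>

lemma Z_inverse: "integrable Q (\<lambda>\<omega>. 1 / Z n \<omega>)" "(\<integral>\<omega>. 1 / Z n \<omega> \<partial>Q) \<le> exp (K * (T - t0))"
proof -
  define M where "M = (\<lambda>\<omega>. exp (\<Sum>k<2 ^ n. \<Sum>p\<in>J n. \<theta> n k p \<omega> * (w p (g n (Suc k)) \<omega> - w p (g n k) \<omega>) - (\<theta> n k p \<omega>)\<^sup>2 / 2 * \<delta> n))"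
  have M: "all_moments Q M" "(\<integral>\<omega>. M \<omega> \<partial>Q) = 1"
    unfolding M_def using \<theta>_bound K0 by (intro real_exp_martingale[where C=B] J; auto intro: \<theta>_adapted)+
  have eq: "1 / Z n \<omega> = M \<omega> * exp (\<Sum>k<2 ^ n. \<Sum>p\<in>J n. (\<theta> n k p \<omega>)\<^sup>2 * \<delta> n)" for \<omega>
    unfolding Z_eq M_def mult_exp_exp sum.distrib[symmetric] exp_minus'[symmetric] sum_negf[symmetric]
    by (intro arg_cong[where f=exp] sum.cong refl) (simp add: algebra_simps)
  have le: "AE \<omega> in Q. 1 / Z n \<omega> \<le> M \<omega> * exp (K * (T - t0))"
    using energy_sum_bound[of n]
  proof eventually_elim
    case (elim \<omega>)
    then show ?case unfolding eq by (intro mult_left_mono) (auto simp: M_def)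
  qed
  have [measurable]: "Z n \<in> borel_measurable Q" using Z_moments all_moments_measurable by blast
  have i: "integrable Q (\<lambda>\<omega>. M \<omega> * exp (K * (T - t0)))" using all_moments_integrable[OF M(1)] by simp
  show 1: "integrable Q (\<lambda>\<omega>. 1 / Z n \<omega>)"
    by (rule Bochner_Integration.integrable_bound[OF i]) (use le Z_pos in \<open>auto simp: M_def less_imp_le\<close>)
  have "(\<integral>\<omega>. 1 / Z n \<omega> \<partial>Q) \<le> (\<integral>\<omega>. M \<omega> * exp (K * (T - t0)) \<partial>Q)"
    by (rule integral_mono_AE[OF 1 i le])
  then show "(\<integral>\<omega>. 1 / Z n \<omega> \<partial>Q) \<le> exp (K * (T - t0))" using M by simp
qed

text \<open>
  The distance of the drift coefficients of levels \<open>n\<close> and \<open>n'\<close> along a path.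
\<close>

definition drift_gap :: "nat \<Rightarrow> nat \<Rightarrow> 'w \<Rightarrow> real" where
  "drift_gap n n' \<omega> = drift_dist t0 T B J (\<lambda>p t. A p t \<omega>) n n'"

text \<open>
  The coefficients of level \<open>n\<close>, read on the finer grid of level \<open>n'\<close>.
\<close>

definition \<theta>c :: "nat \<Rightarrow> nat \<Rightarrow> nat \<Rightarrow> 'p \<Rightarrow> 'w \<Rightarrow> real" where
  "\<theta>c n n' k p \<omega> = (if p \<in> J n then \<theta> n (k div 2 ^ (n' - n)) p \<omega> else 0)"

lemma div_level_less: "n \<le> n' \<Longrightarrow> k < 2 ^ n' \<Longrightarrow> k div 2 ^ (n' - n) < (2::nat) ^ n"
proof -
  assume "n \<le> n'" "k < 2 ^ n'"
  moreover from this have "(2::nat) ^ n' = 2 ^ n * 2 ^ (n' - n)" by (simp add: power_add[symmetric])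
  ultimately show ?thesis by (simp add: less_mult_imp_div_less)
qed

lemma \<theta>c_adapted:
  assumes n: "n \<le> n'" and k: "k < 2 ^ n'"
  shows "\<theta>c n n' k p \<in> borel_measurable (F (g n' k))"
proof (cases "p \<in> J n")
  case True
  let ?j = "k div 2 ^ (n' - n)"
  have j: "?j < 2 ^ n" by (rule div_level_less[OF n k])
  have "g n ?j = g n' (?j * 2 ^ (n' - n))" using grid_refine[OF n] by simp
  also have "\<dots> \<le> g n' k" using t0T by (intro grid_mono) auto
  finally have le: "g n ?j \<le> g n' k" .
  have "\<theta> n ?j p \<in> borel_measurable (F (g n' k))"
    using j k by (intro meas_F_mono[OF g_in g_in le \<theta>_adapted]) auto
  then show ?thesis using True by (simp add: \<theta>c_def[abs_def])
qed (simp add: \<theta>c_def[abs_def])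

lemma \<theta>c_bound: "\<bar>\<theta>c n n' k p \<omega>\<bar> \<le> B"
  using \<theta>_bound K0 by (simp add: \<theta>c_def)

lemma drift_gap_eq: "drift_gap n n' \<omega> = (\<Sum>k<2 ^ n'. \<Sum>p\<in>J n'. (\<theta> n' k p \<omega> - \<theta>c n n' k p \<omega>)\<^sup>2 * \<delta> n')"
  unfolding drift_gap_def drift_dist_def \<theta>_def \<theta>c_def by (simp add: mult.commute)

lemma drift_gap_meas: "n \<le> n' \<Longrightarrow> drift_gap n n' \<in> borel_measurable Q"
proof -
  assume n: "n \<le> n'"
  have [measurable]: "\<theta> n' k p \<in> borel_measurable Q" "\<theta>c n n' k p \<in> borel_measurable Q" if "k < 2 ^ n'" for k p
    using meas_F[OF g_in \<theta>_adapted] meas_F[OF g_in \<theta>c_adapted[OF n]] that by auto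
  show ?thesis unfolding drift_gap_eq by (intro borel_measurable_sum) (auto intro!: borel_measurable_times borel_measurable_power borel_measurable_diff)
qed

lemma drift_gap_bound: "n \<le> n' \<Longrightarrow> AE \<omega> in Q. 0 \<le> drift_gap n n' \<omega> \<and> drift_gap n n' \<omega> \<le> 4 * (T - t0) * K"
  using A_energy
proof eventually_elim
  case (elim \<omega>)
  then show ?case unfolding drift_gap_def
    using drift_dist_bound[OF t0T refl J elim(2)] drift_dist_nonneg[OF t0T refl J elim(2)] by auto
qed

lemma drift_gap_integrable: "n \<le> n' \<Longrightarrow> integrable Q (drift_gap n n')"
  using drift_gap_bound[of n n'] drift_gap_meas[of n n'] by (intro integrable_const_bound[where B="4 * (T - t0) * K"]) auto

text \<open>
  Almost surely the gaps vanish as both levels grow, and they are uniformly bounded, so dominated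
  convergence applies along any sequence of levels that would violate the claim.
\<close>

lemma drift_gap_Cauchy:
  assumes e: "\<epsilon> > 0"
  shows "\<exists>M. \<forall>n\<ge>M. \<forall>n'\<ge>n. (\<integral>\<omega>. drift_gap n n' \<omega> \<partial>Q) < \<epsilon>"
proof (rule ccontr)
  assume "\<not> ?thesis"
  then have "\<forall>M. \<exists>n n'. M \<le> n \<and> n \<le> n' \<and> \<epsilon> \<le> (\<integral>\<omega>. drift_gap n n' \<omega> \<partial>Q)" by (meson not_le)
  then obtain \<nu> \<nu>' where \<nu>: "\<And>M. M \<le> \<nu> M" "\<And>M. \<nu> M \<le> \<nu>' M" "\<And>M. \<epsilon> \<le> (\<integral>\<omega>. drift_gap (\<nu> M) (\<nu>' M) \<omega> \<partial>Q)"
    by metis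
  have "(\<lambda>M. \<integral>\<omega>. drift_gap (\<nu> M) (\<nu>' M) \<omega> \<partial>Q) \<longlonglongrightarrow> (\<integral>\<omega>. 0 \<partial>Q)"
  proof (rule integral_dominated_convergence[where w="\<lambda>_. 4 * (T - t0) * K"])
    show "AE \<omega> in Q. (\<lambda>M. drift_gap (\<nu> M) (\<nu>' M) \<omega>) \<longlonglongrightarrow> 0"
      using A_energy
    proof eventually_elim
      case (elim \<omega>)
      show ?case
      proof (rule LIMSEQ_I)
        fix r :: real assume "0 < r"
        from drift_dist_Cauchy[OF t0T refl J elim this] obtain M
          where M: "\<And>n n'. n \<ge> M \<Longrightarrow> n' \<ge> n \<Longrightarrow> drift_gap n n' \<omega> < r" unfolding drift_gap_def by blast
        show "\<exists>no. \<forall>m\<ge>no. norm (drift_gap (\<nu> m) (\<nu>' m) \<omega> - 0) < r"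
        proof (intro exI allI impI)
          fix m assume "M \<le> m"
          then have "drift_gap (\<nu> m) (\<nu>' m) \<omega> < r" using \<nu>(1)[of m] \<nu>(2)[of m] by (intro M) auto
          then show "norm (drift_gap (\<nu> m) (\<nu>' m) \<omega> - 0) < r"
            using drift_dist_nonneg[OF t0T refl J elim, of "\<nu> m" "\<nu>' m"] by (simp add: drift_gap_def)
        qed
      qed
    qed
    show "AE \<omega> in Q. norm (drift_gap (\<nu> M) (\<nu>' M) \<omega>) \<le> 4 * (T - t0) * K" for M
      using drift_gap_bound[OF \<nu>(2)[of M]] by auto
  qed (use drift_gap_meas \<nu> in auto)
  then have "\<epsilon> \<le> 0" by (intro LIMSEQ_le_const[of _ 0]) (use \<nu>(3) in auto)
  with e show False by simp
qed

text \<open>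
  The geometric mean of two densities equals \<open>M * exp (- drift_gap / 8)\<close>, where \<open>M\<close> is the exponential
  martingale with the averaged coefficients. Since \<open>M\<close> has mean \<open>1\<close>, like both densities, the Hellinger
  distance is controlled by the mean of the gap.
\<close>

lemma L1_bound:
  assumes n: "n \<le> n'" and \<eta>: "\<eta> > 0"
  shows "(\<integral>\<omega>. \<bar>Z n \<omega> - Z n' \<omega>\<bar> \<partial>Q) \<le>
     (4 + exp (K * (T - t0)) / 4) * \<eta> + (T - t0) * K * (\<integral>\<omega>. drift_gap n n' \<omega> \<partial>Q) / \<eta> ^ 3"
proof -
  define c where "c = (\<lambda>k p \<omega>. - (\<theta> n' k p \<omega> + \<theta>c n n' k p \<omega>) / 2)"
  define X where "X = (\<lambda>a \<omega>. exp (\<Sum>k<2 ^ n'. \<Sum>p\<in>J n'. a * c k p \<omega> * (w p (g n' (Suc k)) \<omega> - w p (g n' k) \<omega>) - (a * c k p \<omega>)\<^sup>2 / 2 * \<delta> n'))"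
  define M where "M = X 1"
  have cb: "\<bar>c k p \<omega>\<bar> \<le> B" for k p \<omega>
    using \<theta>_bound[of n' k p \<omega>] \<theta>c_bound[of n n' k p \<omega>] by (simp add: c_def abs_le_iff)
  have cF: "c k p \<in> borel_measurable (F (g n' k))" if "k < 2 ^ n'" for k p
    unfolding c_def using \<theta>_adapted[OF that] \<theta>c_adapted[OF n that] by measurable
  have X: "all_moments Q (X a)" "(\<integral>\<omega>. X a \<omega> \<partial>Q) = 1" for a
  proof -
    have b: "\<bar>a * c k p \<omega>\<bar> \<le> \<bar>a\<bar> * B" for k p \<omega> unfolding abs_mult using cb by (intro mult_left_mono) auto
    show "all_moments Q (X a)" "(\<integral>\<omega>. X a \<omega> \<partial>Q) = 1" unfolding X_def
      using cF b K0 by (intro real_exp_martingale[where C="\<bar>a\<bar> * B"] J; auto)+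
  qed
  have M0: "M \<omega> > 0" for \<omega> by (simp add: M_def X_def)
  have MM: "AE \<omega> in Q. (M \<omega>)\<^sup>2 \<le> X 2 \<omega> * exp (K * (T - t0))"
    using energy_sum_bound[of n] energy_sum_bound[of n']
  proof eventually_elim
    case (elim \<omega>)
    have r: "(\<Sum>k<2 ^ n'. \<Sum>p\<in>J n'. (\<theta>c n n' k p \<omega>)\<^sup>2 * \<delta> n') = (\<Sum>k<2 ^ n. \<Sum>p\<in>J n. (\<theta> n k p \<omega>)\<^sup>2 * \<delta> n)"
    proof -
      have "(\<Sum>k<2 ^ n'. \<Sum>p\<in>J n'. (\<theta>c n n' k p \<omega>)\<^sup>2 * \<delta> n') =
          (\<Sum>k<2 ^ n'. \<delta> n' * (\<Sum>p\<in>J n. (\<theta> n (k div 2 ^ (n' - n)) p \<omega>)\<^sup>2))"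
        unfolding sum_distrib_left
        by (intro sum.cong refl sum.mono_neutral_cong_right J(1) monoD[OF J(2) n]) (auto simp: \<theta>c_def mult.commute)
      also have "\<dots> = (\<Sum>k<2 ^ n. \<delta> n * (\<Sum>p\<in>J n. (\<theta> n k p \<omega>)\<^sup>2))" by (rule sum_mesh_refine[OF n])
      finally show ?thesis by (simp add: sum_distrib_left mult.commute)
    qed
    have "(\<Sum>k<2 ^ n'. \<Sum>p\<in>J n'. (c k p \<omega>)\<^sup>2 * \<delta> n') \<le> (\<Sum>k<2 ^ n'. \<Sum>p\<in>J n'. ((\<theta> n' k p \<omega>)\<^sup>2 * \<delta> n' + (\<theta>c n n' k p \<omega>)\<^sup>2 * \<delta> n') / 2)"
    proof (intro sum_mono)
      fix k p
      have "0 \<le> (\<theta> n' k p \<omega> - \<theta>c n n' k p \<omega>)\<^sup>2" by simp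
      then have "(c k p \<omega>)\<^sup>2 \<le> ((\<theta> n' k p \<omega>)\<^sup>2 + (\<theta>c n n' k p \<omega>)\<^sup>2) / 2"
        by (simp add: c_def power2_eq_square field_simps)
      then have "(c k p \<omega>)\<^sup>2 * \<delta> n' \<le> ((\<theta> n' k p \<omega>)\<^sup>2 + (\<theta>c n n' k p \<omega>)\<^sup>2) / 2 * \<delta> n'"
        using mesh_pos[OF t0T, of n'] by (intro mult_right_mono) auto
      then show "(c k p \<omega>)\<^sup>2 * \<delta> n' \<le> ((\<theta> n' k p \<omega>)\<^sup>2 * \<delta> n' + (\<theta>c n n' k p \<omega>)\<^sup>2 * \<delta> n') / 2"
        by (simp add: distrib_right)
    qed
    also have "\<dots> = ((\<Sum>k<2 ^ n'. \<Sum>p\<in>J n'. (\<theta> n' k p \<omega>)\<^sup>2 * \<delta> n') + (\<Sum>k<2 ^ n'. \<Sum>p\<in>J n'. (\<theta>c n n' k p \<omega>)\<^sup>2 * \<delta> n')) / 2"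
      by (simp add: sum.distrib sum_divide_distrib[symmetric])
    also have "\<dots> \<le> K * (T - t0)" using elim r by simp
    finally have s: "(\<Sum>k<2 ^ n'. \<Sum>p\<in>J n'. (c k p \<omega>)\<^sup>2 * \<delta> n') \<le> K * (T - t0)" .
    have "(M \<omega>)\<^sup>2 = X 2 \<omega> * exp (\<Sum>k<2 ^ n'. \<Sum>p\<in>J n'. (c k p \<omega>)\<^sup>2 * \<delta> n')"
      unfolding power2_eq_square[of "M \<omega>"] unfolding M_def X_def mult_exp_exp sum.distrib[symmetric]
      by (intro arg_cong[where f=exp] sum.cong refl) (simp add: power2_eq_square field_simps)
    also have "\<dots> \<le> X 2 \<omega> * exp (K * (T - t0))" using s by (intro mult_left_mono) (auto simp: X_def)
    finally show ?case .
  qed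
  have M2: "(\<integral>\<omega>. (M \<omega>)\<^sup>2 \<partial>Q) \<le> exp (K * (T - t0))" and M2i: "integrable Q (\<lambda>\<omega>. (M \<omega>)\<^sup>2)"
  proof -
    show i: "integrable Q (\<lambda>\<omega>. (M \<omega>)\<^sup>2)"
      using all_moments_integrable_power[OF X(1)[of 1], of 2] by (simp add: M_def)
    have "(\<integral>\<omega>. (M \<omega>)\<^sup>2 \<partial>Q) \<le> (\<integral>\<omega>. X 2 \<omega> * exp (K * (T - t0)) \<partial>Q)"
      using all_moments_integrable[OF X(1)[of 2]] by (intro integral_mono_AE[OF i _ MM]) simp
    then show "(\<integral>\<omega>. (M \<omega>)\<^sup>2 \<partial>Q) \<le> exp (K * (T - t0))" using X(2)[of 2] by simp
  qed
  have geo: "sqrt (Z n \<omega> * Z n' \<omega>) = M \<omega> * exp (- drift_gap n n' \<omega> / 8)" for \<omega>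
  proof -
    have Zn: "Z n \<omega> = exp (\<Sum>k<2 ^ n'. \<Sum>p\<in>J n'. - (\<theta>c n n' k p \<omega> * (w p (g n' (Suc k)) \<omega> - w p (g n' k) \<omega>)
        + (\<theta>c n n' k p \<omega>)\<^sup>2 / 2 * \<delta> n'))"
      unfolding Z_def log_density_refine[OF n J(1,2)] \<theta>c_def \<theta>_def sum_negf by simp
    have Zn': "Z n' \<omega> = exp (\<Sum>k<2 ^ n'. \<Sum>p\<in>J n'. - (\<theta> n' k p \<omega> * (w p (g n' (Suc k)) \<omega> - w p (g n' k) \<omega>)
        + (\<theta> n' k p \<omega>)\<^sup>2 / 2 * \<delta> n'))"
      unfolding Z_def log_density_def \<theta>_def sum_negf by simp
    have "Z n \<omega> * Z n' \<omega> = (M \<omega> * exp (- drift_gap n n' \<omega> / 8))\<^sup>2"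
      unfolding Zn Zn' power2_eq_square M_def X_def drift_gap_eq mult_exp_exp sum.distrib[symmetric] sum_negf[symmetric] sum_divide_distrib
      by (intro arg_cong[where f=exp] sum.cong refl) (simp add: c_def power2_eq_square field_simps)
    then show ?thesis using M0[of \<omega>] by simp
  qed
  define E where "E = (\<integral>\<omega>. drift_gap n n' \<omega> \<partial>Q)"
  let ?C = "4 * (T - t0) * K"
  note Zi = all_moments_integrable[OF Z_moments]
  have "AE \<omega> in Q. \<bar>Z n \<omega> - Z n' \<omega>\<bar> \<le> (Z n \<omega> + Z n' \<omega> - 2 * M \<omega>) / \<eta> + (\<eta>\<^sup>2 * (M \<omega>)\<^sup>2 + ?C * drift_gap n n' \<omega> / \<eta>\<^sup>2) / (4 * \<eta>) + \<eta> * (2 * Z n \<omega> + 2 * Z n' \<omega>)"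
    using drift_gap_bound[OF n]
  proof eventually_elim
    case (elim \<omega>)
    let ?D = "drift_gap n n' \<omega>"
    have "1 - ?D / 8 \<le> exp (- ?D / 8)" using exp_ge_add_one_self[of "- ?D / 8"] by simp
    then have "M \<omega> * (1 - ?D / 8) \<le> M \<omega> * exp (- ?D / 8)" using M0[of \<omega>] by (intro mult_left_mono) auto
    then have s: "M \<omega> - M \<omega> * ?D / 8 \<le> sqrt (Z n \<omega> * Z n' \<omega>)" by (simp add: geo right_diff_distrib)
    have "2 * (\<eta> * M \<omega>) * (?D / \<eta>) \<le> (\<eta> * M \<omega>)\<^sup>2 + (?D / \<eta>)\<^sup>2" by (rule sum_squares_bound)
    then have "2 * (M \<omega> * ?D) \<le> \<eta>\<^sup>2 * (M \<omega>)\<^sup>2 + ?D\<^sup>2 / \<eta>\<^sup>2" using \<eta> by (simp add: power_mult_distrib power_divide)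
    moreover have "0 \<le> M \<omega> * ?D" using M0[of \<omega>] elim by simp
    moreover have "?D\<^sup>2 / \<eta>\<^sup>2 \<le> ?C * ?D / \<eta>\<^sup>2" unfolding power2_eq_square[of ?D] using elim
      by (intro divide_right_mono mult_right_mono) auto
    ultimately have MD: "M \<omega> * ?D \<le> \<eta>\<^sup>2 * (M \<omega>)\<^sup>2 + ?C * ?D / \<eta>\<^sup>2" by linarith
    have "\<bar>Z n \<omega> - Z n' \<omega>\<bar> \<le> (Z n \<omega> + Z n' \<omega> - 2 * sqrt (Z n \<omega> * Z n' \<omega>)) / \<eta> + \<eta> * (2 * Z n \<omega> + 2 * Z n' \<omega>)"
      using Z_pos[of n \<omega>] Z_pos[of n' \<omega>] \<eta> by (intro abs_diff_le_hellinger) auto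
    also have "(Z n \<omega> + Z n' \<omega> - 2 * sqrt (Z n \<omega> * Z n' \<omega>)) / \<eta> \<le> (Z n \<omega> + Z n' \<omega> - 2 * M \<omega> + (\<eta>\<^sup>2 * (M \<omega>)\<^sup>2 + ?C * ?D / \<eta>\<^sup>2) / 4) / \<eta>"
    proof (rule divide_right_mono)
      have aux: "m - d / 8 \<le> r \<Longrightarrow> d \<le> c \<Longrightarrow> z + z' - 2 * r \<le> z + z' - 2 * m + c / 4" for m d r c z z' :: real
        by linarith
      show "Z n \<omega> + Z n' \<omega> - 2 * sqrt (Z n \<omega> * Z n' \<omega>) \<le> Z n \<omega> + Z n' \<omega> - 2 * M \<omega> + (\<eta>\<^sup>2 * (M \<omega>)\<^sup>2 + ?C * ?D / \<eta>\<^sup>2) / 4"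
        by (rule aux[OF s MD])
    qed (use \<eta> in simp)
    finally show ?case using \<eta> by (simp add: add_divide_distrib)
  qed
  then have "(\<integral>\<omega>. \<bar>Z n \<omega> - Z n' \<omega>\<bar> \<partial>Q) \<le> (\<integral>\<omega>. (Z n \<omega> + Z n' \<omega> - 2 * M \<omega>) / \<eta> + (\<eta>\<^sup>2 * (M \<omega>)\<^sup>2 + ?C * drift_gap n n' \<omega> / \<eta>\<^sup>2) / (4 * \<eta>) + \<eta> * (2 * Z n \<omega> + 2 * Z n' \<omega>) \<partial>Q)"
    using Zi all_moments_integrable[OF X(1)[of 1], folded M_def] M2i drift_gap_integrable[OF n]
    by (intro integral_mono_AE) auto
  also have "\<dots> = (\<eta>\<^sup>2 * (\<integral>\<omega>. (M \<omega>)\<^sup>2 \<partial>Q) + ?C * E / \<eta>\<^sup>2) / (4 * \<eta>) + \<eta> * 4"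
    using Zi all_moments_integrable[OF X(1)[of 1], folded M_def] M2i drift_gap_integrable[OF n] X(2)[of 1, folded M_def] Z_mean[of n] Z_mean[of n']
    by (simp add: E_def)
  also have "\<dots> \<le> (\<eta>\<^sup>2 * exp (K * (T - t0)) + ?C * E / \<eta>\<^sup>2) / (4 * \<eta>) + \<eta> * 4"
    using M2 \<eta> by (intro add_right_mono divide_right_mono mult_left_mono) auto
  also have "\<dots> = (4 + exp (K * (T - t0)) / 4) * \<eta> + (T - t0) * K * E / \<eta> ^ 3"
    using \<eta> by (simp add: field_simps power2_eq_square power3_eq_cube)
  finally show ?thesis by (simp add: E_def)
qed

lemma L1_Cauchy:
  assumes e: "\<epsilon> > 0"
  shows "\<exists>M. \<forall>n\<ge>M. \<forall>n'\<ge>n. (\<integral>\<omega>. \<bar>Z n \<omega> - Z n' \<omega>\<bar> \<partial>Q) < \<epsilon>"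
proof -
  define c where "c = 4 + exp (K * (T - t0)) / 4"
  have c: "c > 0" unfolding c_def by (simp add: add_pos_pos)
  define \<eta> where "\<eta> = \<epsilon> / (2 * c)"
  have \<eta>: "\<eta> > 0" using c e by (simp add: \<eta>_def)
  define b where "b = (T - t0) * K / \<eta> ^ 3"
  have b: "b \<ge> 0" using \<eta> t0T K0 by (simp add: b_def)
  have "\<epsilon> / (2 * (b + 1)) > 0" using b e by simp
  from drift_gap_Cauchy[OF this] obtain M where M: "\<And>n n'. M \<le> n \<Longrightarrow> n \<le> n' \<Longrightarrow> (\<integral>\<omega>. drift_gap n n' \<omega> \<partial>Q) < \<epsilon> / (2 * (b + 1))"
    by blast
  show ?thesis
  proof (intro exI allI impI)
    fix n n' assume n: "M \<le> n" "n \<le> n'"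
    have "(\<integral>\<omega>. \<bar>Z n \<omega> - Z n' \<omega>\<bar> \<partial>Q) \<le> c * \<eta> + b * (\<integral>\<omega>. drift_gap n n' \<omega> \<partial>Q)"
      using L1_bound[OF n(2) \<eta>] by (simp add: c_def b_def)
    also have "c * \<eta> = \<epsilon> / 2" using c by (simp add: \<eta>_def)
    also have "b * (\<integral>\<omega>. drift_gap n n' \<omega> \<partial>Q) \<le> b * (\<epsilon> / (2 * (b + 1)))"
      using M[OF n] b by (intro mult_left_mono) auto
    also have "b * (\<epsilon> / (2 * (b + 1))) < \<epsilon> / 2" using b e by (simp add: field_simps)
    finally show "(\<integral>\<omega>. \<bar>Z n \<omega> - Z n' \<omega>\<bar> \<partial>Q) < \<epsilon>" by simp
  qed
qed

text \<open>
  Apply the exponential martingale with the coefficients \<open>- \<theta> + \<i> ll\<close>. The cross term in their squares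
  is exactly the shift by the discretised drift, so it leaves a deterministic Gaussian factor.
\<close>

lemma fourier_discrete:
  fixes ll :: "nat \<Rightarrow> 'p \<Rightarrow> real" and H :: "'w \<Rightarrow> real"
  assumes H: "H \<in> borel_measurable (F t0)" "all_moments Q H"
  shows "(\<integral>\<omega>. of_real (H \<omega> * Z n \<omega>) *
      iexp (\<Sum>k<2 ^ n. \<Sum>p\<in>J n. ll k p * (w p (g n (Suc k)) \<omega> - w p (g n k) \<omega> + \<theta> n k p \<omega> * \<delta> n)) \<partial>Q) =
    of_real ((\<integral>\<omega>. H \<omega> \<partial>Q) * exp (- (\<Sum>k<2 ^ n. \<Sum>p\<in>J n. (ll k p)\<^sup>2 / 2 * \<delta> n)))"
proof -
  define c where "c = (\<lambda>k p \<omega>. complex_of_real (- \<theta> n k p \<omega>) + \<i> * complex_of_real (ll k p))"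
  define C where "C = B + (\<Sum>k<2 ^ n. \<Sum>p\<in>J n. \<bar>ll k p\<bar>)"
  define \<Lambda> where "\<Lambda> = (\<Sum>k<2 ^ n. \<Sum>p\<in>J n. (ll k p)\<^sup>2 / 2 * \<delta> n)"
  have C0: "C \<ge> 0" unfolding C_def using K0 by (intro add_nonneg_nonneg sum_nonneg) auto
  have cC: "norm (c k p \<omega>) \<le> C" if "k < 2 ^ n" "p \<in> J n" for k p \<omega>
  proof -
    have "\<bar>ll k p\<bar> \<le> (\<Sum>p\<in>J n. \<bar>ll k p\<bar>)" using that J(1) by (intro member_le_sum) auto
    also have "\<dots> \<le> (\<Sum>k<2 ^ n. \<Sum>p\<in>J n. \<bar>ll k p\<bar>)"
      using that by (intro member_le_sum[where f="\<lambda>k. \<Sum>p\<in>J n. \<bar>ll k p\<bar>"]) (auto intro!: sum_nonneg)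
    finally have "\<bar>\<theta> n k p \<omega>\<bar> + \<bar>ll k p\<bar> \<le> C" using \<theta>_bound[of n k p \<omega>] by (simp add: C_def)
    moreover have "norm (c k p \<omega>) \<le> \<bar>\<theta> n k p \<omega>\<bar> + \<bar>ll k p\<bar>"
      unfolding c_def by (rule order_trans[OF norm_triangle_ineq]) (simp add: norm_mult)
    ultimately show ?thesis by linarith
  qed
  have cF: "c k p \<in> borel_measurable (F (g n k))" if "k < 2 ^ n" for k p
    unfolding c_def using \<theta>_adapted[OF that] by measurable
  have HF: "(\<lambda>\<omega>. complex_of_real (H \<omega>)) \<in> borel_measurable (F t0)" using H by simp
  have HQ: "H \<in> borel_measurable Q" using H all_moments_measurable by blast
  have Hm: "all_moments Q (\<lambda>\<omega>. complex_of_real (H \<omega>))" using H HQ by (simp add: all_moments_of_real)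
  define Xp where "Xp = (\<lambda>\<omega>. iexp (\<Sum>k<2 ^ n. \<Sum>p\<in>J n. ll k p * (w p (g n (Suc k)) \<omega> - w p (g n k) \<omega> + \<theta> n k p \<omega> * \<delta> n)))"
  have eq: "complex_of_real (H \<omega>) * exp (\<Sum>k<2 ^ n. exp_increment (J n) (\<lambda>p. c k p \<omega>) (\<lambda>p. w p (g n (Suc k)) \<omega> - w p (g n k) \<omega>) (g n (Suc k) - g n k))
      = of_real (H \<omega> * Z n \<omega>) * Xp \<omega> * of_real (exp \<Lambda>)" for \<omega>
  proof -
    have "(\<Sum>k<2 ^ n. exp_increment (J n) (\<lambda>p. c k p \<omega>) (\<lambda>p. w p (g n (Suc k)) \<omega> - w p (g n k) \<omega>) (g n (Suc k) - g n k)) =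
      of_real (\<Sum>k<2 ^ n. \<Sum>p\<in>J n. (- \<theta> n k p \<omega>) * (w p (g n (Suc k)) \<omega> - w p (g n k) \<omega>) - (- \<theta> n k p \<omega>)\<^sup>2 / 2 * \<delta> n)
      + \<i> * of_real (\<Sum>k<2 ^ n. \<Sum>p\<in>J n. ll k p * (w p (g n (Suc k)) \<omega> - w p (g n k) \<omega> + \<theta> n k p \<omega> * \<delta> n)) + of_real \<Lambda>"
      unfolding \<Lambda>_def exp_increment_def sum_distrib_right sum_subtractf[symmetric] of_real_sum sum_distrib_left sum.distrib[symmetric]
      by (intro sum.cong refl) (simp add: c_def grid_Suc power2_eq_square field_simps)
    then show ?thesis unfolding Z_eq Xp_def by (simp only: exp_add exp_of_real of_real_mult mult_ac)
  qed
  have "(\<integral>\<omega>. of_real (H \<omega> * Z n \<omega>) * Xp \<omega> * of_real (exp \<Lambda>) \<partial>Q) = (\<integral>\<omega>. complex_of_real (H \<omega>) \<partial>Q)"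
    unfolding eq[symmetric]
    by (rule exp_martingale_grid[where B=C, THEN conjunct2, OF J(1)]) (use cF C0 cC g_less HF Hm in auto)
  also have "(\<integral>\<omega>. of_real (H \<omega> * Z n \<omega>) * Xp \<omega> * of_real (exp \<Lambda>) \<partial>Q) = (\<integral>\<omega>. of_real (H \<omega> * Z n \<omega>) * Xp \<omega> \<partial>Q) * of_real (exp \<Lambda>)"
    by (rule integral_mult_left_zero)
  finally have "(\<integral>\<omega>. of_real (H \<omega> * Z n \<omega>) * Xp \<omega> \<partial>Q) * of_real (exp \<Lambda>) * of_real (exp (- \<Lambda>)) = of_real (\<integral>\<omega>. H \<omega> \<partial>Q) * of_real (exp (- \<Lambda>))"
    by simp
  then have "(\<integral>\<omega>. of_real (H \<omega> * Z n \<omega>) * Xp \<omega> \<partial>Q) = of_real ((\<integral>\<omega>. H \<omega> \<partial>Q) * exp (- \<Lambda>))"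
    by (simp add: mult.assoc mult_exp_exp flip: of_real_mult)
  then show ?thesis by (simp only: Xp_def \<Lambda>_def)
qed

end

section \<open>Discretised observations and their Fourier transforms\<close>

definition round_index :: "real \<Rightarrow> real \<Rightarrow> nat \<Rightarrow> real \<Rightarrow> nat" where
  "round_index t0 T n t = nat \<lfloor>(t - t0) / mesh t0 T n\<rfloor>"

lemma round_index:
  assumes "t0 < T" "t \<in> {t0..T}"
  shows "round_index t0 T n t \<le> 2 ^ n"
    and "\<bar>grid t0 T n (round_index t0 T n t) - t\<bar> \<le> mesh t0 T n"
    and "\<bar>grid t0 T n (round_index t0 T n t - 1) - t\<bar> \<le> 2 * mesh t0 T n"
proof -
  let ?\<delta> = "mesh t0 T n" and ?k = "round_index t0 T n t"
  have d: "?\<delta> > 0" using mesh_pos assms by blast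
  have q0: "(t - t0) / ?\<delta> \<ge> 0" using assms d by auto
  have k: "real ?k = of_int \<lfloor>(t - t0) / ?\<delta>\<rfloor>" using q0 by (simp add: round_index_def)
  have k1: "real ?k \<le> (t - t0) / ?\<delta>" unfolding k by simp
  have k2: "(t - t0) / ?\<delta> < real ?k + 1" unfolding k by linarith
  have "(t - t0) / ?\<delta> \<le> (T - t0) / ?\<delta>" using assms d by (intro divide_right_mono) auto
  also have "\<dots> = 2 ^ n" using assms by (simp add: mesh_def)
  finally have "real ?k \<le> real ((2::nat) ^ n)" using k1 unfolding of_nat_power of_nat_numeral by linarith
  then show "?k \<le> 2 ^ n" by (simp only: of_nat_le_iff)
  have a: "real ?k * ?\<delta> \<le> t - t0" "t - t0 < (real ?k + 1) * ?\<delta>"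
    using k1 k2 d by (simp_all add: pos_le_divide_eq pos_divide_less_eq)
  then show b: "\<bar>grid t0 T n ?k - t\<bar> \<le> ?\<delta>" by (simp add: grid_def abs_le_iff algebra_simps)
  have "\<bar>grid t0 T n (?k - 1) - grid t0 T n ?k\<bar> \<le> ?\<delta>"
    using d by (cases ?k) (auto simp: grid_def algebra_simps)
  then show "\<bar>grid t0 T n (?k - 1) - t\<bar> \<le> 2 * ?\<delta>" using b by linarith
qed

lemma mesh_LIMSEQ: "(\<lambda>n. mesh t0 T n) \<longlonglongrightarrow> 0"
  unfolding mesh_def using LIMSEQ_divide_realpow_zero[of 2 "T - t0"] by simp

lemma round_index_LIMSEQ:
  assumes "t0 < T" "t \<in> {t0..T}"
  shows "(\<lambda>n. grid t0 T n (round_index t0 T n t)) \<longlonglongrightarrow> t"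
    and "(\<lambda>n. grid t0 T n (round_index t0 T n t - 1)) \<longlonglongrightarrow> t"
proof -
  have "(\<lambda>n. grid t0 T n (round_index t0 T n t) - t) \<longlonglongrightarrow> 0"
    by (rule Lim_null_comparison[OF _ mesh_LIMSEQ[of t0 T]]) (use round_index(2)[OF assms] in auto)
  then show "(\<lambda>n. grid t0 T n (round_index t0 T n t)) \<longlonglongrightarrow> t" by (simp only: LIM_zero_iff)
  have "(\<lambda>n. 2 * mesh t0 T n) \<longlonglongrightarrow> 0" using tendsto_mult_right_zero[OF mesh_LIMSEQ[of t0 T], of 2] by simp
  then have "(\<lambda>n. grid t0 T n (round_index t0 T n t - 1) - t) \<longlonglongrightarrow> 0"
    by (rule Lim_null_comparison[rotated]) (use round_index(3)[OF assms] in auto)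
  then show "(\<lambda>n. grid t0 T n (round_index t0 T n t - 1)) \<longlonglongrightarrow> t" by (simp only: LIM_zero_iff)
qed

text \<open>
  Rewrites a linear combination of values at times \<open>snd x\<close> as one of increments: the increment over cell
  \<open>k\<close> of component \<open>p\<close> is counted for every \<open>x\<close> with that component and a later rounded time.
\<close>

definition rounded_coeff :: "real \<Rightarrow> real \<Rightarrow> ('p \<times> real) set \<Rightarrow> ('p \<times> real \<Rightarrow> real) \<Rightarrow> nat \<Rightarrow> nat \<Rightarrow> 'p \<Rightarrow> real" where
  "rounded_coeff t0 T L \<mu> n k p = (\<Sum>x\<in>L. if fst x = p \<and> k < round_index t0 T n (snd x) then \<mu> x else 0)"

lemma sum_rounded_coeff:
  fixes X :: "nat \<Rightarrow> 'p \<Rightarrow> real"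
  assumes t0T: "t0 < T" and L: "finite L" "snd ` L \<subseteq> {t0..T}" and J: "finite (J n)"
  shows "(\<Sum>k<2 ^ n. \<Sum>p\<in>J n. rounded_coeff t0 T L \<mu> n k p * X k p) =
    (\<Sum>x\<in>L. if fst x \<in> J n then \<mu> x * (\<Sum>k<round_index t0 T n (snd x). X k (fst x)) else 0)"
proof -
  have "(\<Sum>k<2 ^ n. \<Sum>p\<in>J n. rounded_coeff t0 T L \<mu> n k p * X k p) =
      (\<Sum>x\<in>L. \<Sum>k<2 ^ n. \<Sum>p\<in>J n. (if fst x = p \<and> k < round_index t0 T n (snd x) then \<mu> x * X k p else 0))"
    unfolding rounded_coeff_def sum_distrib_right
    by (subst sum.swap[of _ "L"], subst sum.swap[of _ "L"]) (auto intro!: sum.cong)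
  also have "\<dots> = (\<Sum>x\<in>L. if fst x \<in> J n then \<mu> x * (\<Sum>k<round_index t0 T n (snd x). X k (fst x)) else 0)"
  proof (rule sum.cong[OF refl])
    fix x assume x: "x \<in> L"
    let ?\<kappa> = "round_index t0 T n (snd x)"
    have \<kappa>: "?\<kappa> \<le> 2 ^ n" using round_index(1)[OF t0T, of "snd x" n] L x by auto
    have "(\<Sum>k<2 ^ n. \<Sum>p\<in>J n. (if fst x = p \<and> k < ?\<kappa> then \<mu> x * X k p else 0)) =
        (\<Sum>k<2 ^ n. if k < ?\<kappa> then (\<Sum>p\<in>J n. if fst x = p then \<mu> x * X k p else 0) else 0)"
      by (intro sum.cong refl) auto
    also have "\<dots> = (\<Sum>k<?\<kappa>. \<Sum>p\<in>J n. if fst x = p then \<mu> x * X k p else 0)"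
      using \<kappa> by (intro sum.mono_neutral_cong_right) auto
    also have "\<dots> = (if fst x \<in> J n then \<mu> x * (\<Sum>k<?\<kappa>. X k (fst x)) else 0)"
      using J by (simp add: sum_distrib_left)
    finally show "(\<Sum>k<2 ^ n. \<Sum>p\<in>J n. (if fst x = p \<and> k < ?\<kappa> then \<mu> x * X k p else 0)) =
      (if fst x \<in> J n then \<mu> x * (\<Sum>k<?\<kappa>. X k (fst x)) else 0)" .
  qed
  finally show ?thesis .
qed

context drifted_brownian
begin

text \<open>
  The discrete counterpart of \<open>w p t + A p t\<close> for \<open>x = (p, t)\<close>: the drift is integrated through its lagged
  slopes and the time is rounded down to the grid.
\<close>

definition S :: "nat \<Rightarrow> 'p \<times> real \<Rightarrow> 'w \<Rightarrow> real" where
  "S n x \<omega> = (\<Sum>k<round_index t0 T n (snd x). w (fst x) (g n (Suc k)) \<omega> - w (fst x) (g n k) \<omega> + \<theta> n k (fst x) \<omega> * \<delta> n)"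

text \<open>
  Both sums telescope: the drift part yields \<open>A\<close> at the grid point one cell before the rounded time, so
  continuity gives the limit.
\<close>

lemma S_LIMSEQ:
  "AE \<omega> in Q. \<forall>p. \<forall>t\<in>{t0..T}. (\<lambda>n. S n (p, t) \<omega>) \<longlonglongrightarrow> w p t \<omega> + A p t \<omega>"
  using A_energy w_cont start_0
proof eventually_elim
  case (elim \<omega>)
  obtain l where l: "\<And>p. 0 \<le> l p" "\<And>p. l p \<le> B"
    "\<And>p t u. t \<in> {t0..T} \<Longrightarrow> u \<in> {t0..T} \<Longrightarrow> \<bar>A p t \<omega> - A p u \<omega>\<bar> \<le> l p * \<bar>t - u\<bar>"
    using energy_boundedE[OF t0T refl J elim(1)] by metis
  show ?case
  proof (intro allI ballI)
    fix p t assume t: "t \<in> {t0..T}"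
    let ?\<kappa> = "\<lambda>n. round_index t0 T n t"
    have \<kappa>: "?\<kappa> n \<le> 2 ^ n" for n by (rule round_index(1)[OF t0T t])
    have Acont: "continuous_on {t0..T} (\<lambda>t. A p t \<omega>)"
    proof (rule continuous_onI)
      fix x e :: real assume x: "x \<in> {t0..T}" and e: "e > 0"
      have l1: "l p + 1 > 0" using l(1)[of p] by simp
      show "\<exists>d>0. \<forall>x'\<in>{t0..T}. dist x' x < d \<longrightarrow> dist (A p x' \<omega>) (A p x \<omega>) \<le> e"
      proof (intro exI[of _ "e / (l p + 1)"] conjI ballI impI)
        show "0 < e / (l p + 1)" using e l1 by simp
        fix x' assume x': "x' \<in> {t0..T}" "dist x' x < e / (l p + 1)"
        have "dist (A p x' \<omega>) (A p x \<omega>) \<le> l p * \<bar>x' - x\<bar>" using l(3)[OF x'(1) x] by (simp add: dist_real_def)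
        also have "\<dots> \<le> (l p + 1) * \<bar>x' - x\<bar>" by (intro mult_right_mono) auto
        also have "\<dots> \<le> (l p + 1) * (e / (l p + 1))"
          using x'(2) l1 by (intro mult_left_mono) (auto simp: dist_real_def)
        finally show "dist (A p x' \<omega>) (A p x \<omega>) \<le> e" using l1 by simp
      qed
    qed
    have S1: "S n (p, t) \<omega> = w p (g n (?\<kappa> n)) \<omega> + A p (g n (?\<kappa> n - 1)) \<omega>" for n
    proof -
      have "S n (p, t) \<omega> = (\<Sum>k<?\<kappa> n. w p (g n (Suc k)) \<omega> - w p (g n k) \<omega>) + (\<Sum>k<?\<kappa> n. \<theta> n k p \<omega> * \<delta> n)"
        by (simp add: S_def sum.distrib)
      also have "(\<Sum>k<?\<kappa> n. w p (g n (Suc k)) \<omega> - w p (g n k) \<omega>) = w p (g n (?\<kappa> n)) \<omega>"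
        using elim(3) sum_lessThan_telescope[of "\<lambda>k. w p (g n k) \<omega>" "?\<kappa> n"] by simp
      also have "(\<Sum>k<?\<kappa> n. \<theta> n k p \<omega> * \<delta> n) = (\<Sum>k<?\<kappa> n. A p (g n k) \<omega> - A p (g n (k - 1)) \<omega>)"
      proof (rule sum.cong[OF refl])
        fix k assume "k \<in> {..<?\<kappa> n}"
        then have "k \<le> 2 ^ n" using \<kappa>[of n] by auto
        from lagged_slope_eq[OF t0T l(3) l(1,2) this, of p]
        show "\<theta> n k p \<omega> * \<delta> n = A p (g n k) \<omega> - A p (g n (k - 1)) \<omega>"
          using mesh_pos[OF t0T, of n] by (cases k) (auto simp: \<theta>_def slope_def)
      qed
      also have "\<dots> = A p (g n (?\<kappa> n - 1)) \<omega>"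
      proof (cases "?\<kappa> n")
        case (Suc m)
        have "(\<Sum>k<Suc m. A p (g n k) \<omega> - A p (g n (k - 1)) \<omega>) = (\<Sum>k<m. A p (g n (Suc k)) \<omega> - A p (g n k) \<omega>)"
          by (subst sum.lessThan_Suc_shift) simp
        also have "\<dots> = A p (g n m) \<omega>"
          using elim(3) sum_lessThan_telescope[of "\<lambda>k. A p (g n k) \<omega>" m] by simp
        finally show ?thesis using Suc by simp
      qed (use elim(3) in simp)
      finally show ?thesis .
    qed
    have gk: "g n (?\<kappa> n) \<in> {t0..T}" "g n (?\<kappa> n - 1) \<in> {t0..T}" for n
      using g_in \<kappa>[of n] by (auto intro!: g_in order_trans[OF diff_le_self])
    show "(\<lambda>n. S n (p, t) \<omega>) \<longlonglongrightarrow> w p t \<omega> + A p t \<omega>"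
      unfolding S1
    proof (intro tendsto_add)
      show "(\<lambda>n. w p (g n (?\<kappa> n)) \<omega>) \<longlonglongrightarrow> w p t \<omega>"
        using gk by (intro continuous_on_tendsto_compose[OF elim(2)[rule_format] round_index_LIMSEQ(1)[OF t0T t] t]) auto
      show "(\<lambda>n. A p (g n (?\<kappa> n - 1)) \<omega>) \<longlonglongrightarrow> A p t \<omega>"
        using gk by (intro continuous_on_tendsto_compose[OF Acont round_index_LIMSEQ(2)[OF t0T t] t]) auto
    qed
  qed
qed

text \<open>
  Terms whose component is not yet in \<open>J n\<close> are dropped; for fixed \<open>L\<close> this stops happening for large
  \<open>n\<close>.
\<close>

definition G :: "('p \<times> real) set \<Rightarrow> ('p \<times> real \<Rightarrow> real) \<Rightarrow> nat \<Rightarrow> 'w \<Rightarrow> complex" where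
  "G L \<mu> n \<omega> = iexp (\<Sum>x\<in>L. if fst x \<in> J n then \<mu> x * S n x \<omega> else 0)"

lemma G_norm: "norm (G L \<mu> n \<omega>) = 1"
  by (simp add: G_def)

lemma G_measurable:
  assumes L: "snd ` L \<subseteq> {t0..T}"
  shows "G L \<mu> n \<in> borel_measurable Q"
proof -
  have "S n x \<in> borel_measurable Q" if "x \<in> L" for x
  proof -
    have \<kappa>: "round_index t0 T n (snd x) \<le> 2 ^ n" using L that by (intro round_index(1)[OF t0T]) auto
    have "w (fst x) (g n (Suc k)) \<in> borel_measurable Q" "w (fst x) (g n k) \<in> borel_measurable Q" "\<theta> n k (fst x) \<in> borel_measurable Q"
      if "k < round_index t0 T n (snd x)" for k
      using \<kappa> that by (auto intro!: w_meas g_in \<theta>_meas)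
    then show ?thesis unfolding S_def[abs_def] by (intro borel_measurable_sum) auto
  qed
  then have "(\<lambda>\<omega>. \<Sum>x\<in>L. if fst x \<in> J n then \<mu> x * S n x \<omega> else 0) \<in> borel_measurable Q"
    by (intro borel_measurable_sum) auto
  then show ?thesis unfolding G_def[abs_def] by measurable
qed

lemma G_LIMSEQ:
  assumes L: "finite L" "snd ` L \<subseteq> {t0..T}"
  shows "AE \<omega> in Q. (\<lambda>n. G L \<mu> n \<omega>) \<longlonglongrightarrow> iexp (\<Sum>x\<in>L. \<mu> x * (w (fst x) (snd x) \<omega> + A (fst x) (snd x) \<omega>))"
  using S_LIMSEQ
proof eventually_elim
  case (elim \<omega>)
  have "(\<lambda>n. if fst x \<in> J n then \<mu> x * S n x \<omega> else 0) \<longlonglongrightarrow> \<mu> x * (w (fst x) (snd x) \<omega> + A (fst x) (snd x) \<omega>)" if x: "x \<in> L" for x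
  proof -
    obtain n0 where n0: "fst x \<in> J n0" using J(3) by auto
    have "eventually (\<lambda>n. \<mu> x * S n x \<omega> = (if fst x \<in> J n then \<mu> x * S n x \<omega> else 0)) sequentially"
      using eventually_ge_at_top[of n0] by eventually_elim (use n0 monoD[OF J(2)] in auto)
    moreover have "(\<lambda>n. \<mu> x * S n x \<omega>) \<longlonglongrightarrow> \<mu> x * (w (fst x) (snd x) \<omega> + A (fst x) (snd x) \<omega>)"
      using elim[rule_format, of "snd x" "fst x"] L x by (intro tendsto_mult tendsto_const) auto
    ultimately show ?thesis by (rule Lim_transform_eventually[rotated])
  qed
  then show ?case unfolding G_def by (intro tendsto_intros) auto
qed

text \<open>
  The right-hand side contains the process only through the mean of \<open>H\<close>. This is what makes the two
  solutions comparable.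
\<close>

lemma fourier_Z:
  fixes H :: "'w \<Rightarrow> real"
  assumes H: "H \<in> borel_measurable (F t0)" "all_moments Q H" and L: "finite L" "snd ` L \<subseteq> {t0..T}"
  shows "(\<integral>\<omega>. of_real (H \<omega> * Z n \<omega>) * G L \<mu> n \<omega> \<partial>Q) =
    of_real ((\<integral>\<omega>. H \<omega> \<partial>Q) * exp (- (\<Sum>k<2 ^ n. \<Sum>p\<in>J n. (rounded_coeff t0 T L \<mu> n k p)\<^sup>2 / 2 * \<delta> n)))"
  unfolding G_def S_def
  using fourier_discrete[OF H, of n "rounded_coeff t0 T L \<mu> n"]
  unfolding sum_rounded_coeff[where J=J, OF t0T L J(1)] .

end

section \<open>Fourier transforms determine finite measures\<close>

text \<open>
  Normalising a bounded non-negative weight produces a probability distribution on the line, which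
  makes Levy's uniqueness theorem applicable to weighted measures.
\<close>

lemma weighted_distribution:
  fixes h f :: "'e \<Rightarrow> real"
  assumes N: "finite_measure N" and [measurable]: "h \<in> borel_measurable N" "f \<in> borel_measurable N"
    and h: "\<And>y. 0 \<le> h y" "\<And>y. h y \<le> C" and m: "m = (\<integral>y. h y \<partial>N)" "m > 0"
  defines "R \<equiv> distr (density N (\<lambda>y. ennreal (h y / m))) borel f"
  shows "real_distribution R"
    and "char R t = (\<integral>y. of_real (h y) * iexp (t * f y) \<partial>N) / of_real m"
    and "b \<in> sets borel \<Longrightarrow> measure R b = (\<integral>y. h y * indicator b (f y) \<partial>N) / m"
proof -
  interpret finite_measure N by fact
  let ?P = "density N (\<lambda>y. ennreal (h y / m))"
  have hi: "integrable N h" by (rule integrable_const_bound[where B=C]) (use h in auto)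
  have "emeasure ?P (space ?P) = (\<integral>\<^sup>+y. ennreal (h y / m) \<partial>N)"
    by (simp add: emeasure_density cong: nn_integral_cong)
  also have "\<dots> = ennreal (\<integral>y. h y / m \<partial>N)"
    using h m hi by (intro nn_integral_eq_integral) auto
  also have "\<dots> = 1" using m by simp
  finally interpret P: prob_space ?P by (rule prob_spaceI)
  have [measurable]: "f \<in> borel_measurable ?P" by simp
  show "real_distribution R" unfolding R_def by (rule P.real_distribution_distr) simp
  have "char R t = (\<integral>y. iexp (t * f y) \<partial>?P)"
    unfolding R_def char_def by (subst integral_distr) auto
  also have "\<dots> = (\<integral>y. (h y / m) *\<^sub>R iexp (t * f y) \<partial>N)"
    using h m by (subst integral_density) auto
  also have "\<dots> = (\<integral>y. (of_real (h y) * iexp (t * f y)) / of_real m \<partial>N)"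
    by (simp add: scaleR_conv_of_real)
  also have "\<dots> = (\<integral>y. of_real (h y) * iexp (t * f y) \<partial>N) / of_real m" by (rule integral_divide_zero)
  finally show "char R t = (\<integral>y. of_real (h y) * iexp (t * f y) \<partial>N) / of_real m" .
  assume [measurable]: "b \<in> sets borel"
  have "measure R b = measure ?P (f -` b \<inter> space N)"
    unfolding R_def by (subst measure_distr) auto
  also have "\<dots> = (\<integral>y. indicator (f -` b \<inter> space N) y \<partial>?P)" by simp
  also have "\<dots> = (\<integral>y. (h y / m) *\<^sub>R indicator (f -` b \<inter> space N) y \<partial>N)"
    using h m by (subst integral_density) auto
  also have "\<dots> = (\<integral>y. (h y * indicator b (f y)) / m \<partial>N)"
    by (intro Bochner_Integration.integral_cong refl) (auto simp: indicator_def)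
  finally show "measure R b = (\<integral>y. h y * indicator b (f y) \<partial>N) / m" by simp
qed

lemma weighted_fourier_unique:
  fixes h f :: "'e \<Rightarrow> real"
  assumes N: "finite_measure N1" "finite_measure N2"
    and meas: "h \<in> borel_measurable N1" "f \<in> borel_measurable N1" "h \<in> borel_measurable N2" "f \<in> borel_measurable N2"
    and h: "\<And>y. 0 \<le> h y" "\<And>y. h y \<le> C"
    and eq: "\<And>t. (\<integral>y. of_real (h y) * iexp (t * f y) \<partial>N1) = (\<integral>y. of_real (h y) * iexp (t * f y) \<partial>N2)"
    and b: "b \<in> sets borel"
  shows "(\<integral>y. h y * indicator b (f y) \<partial>N1) = (\<integral>y. h y * indicator b (f y) \<partial>N2)"
proof -
  have i: "integrable N1 h" "integrable N2 h"
    by (rule finite_measure.integrable_const_bound[OF N(1), where B=C], use h meas in auto)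
       (rule finite_measure.integrable_const_bound[OF N(2), where B=C], use h meas in auto)
  have "complex_of_real (\<integral>y. h y \<partial>N1) = of_real (\<integral>y. h y \<partial>N2)" using eq[of 0] by simp
  then have m: "(\<integral>y. h y \<partial>N1) = (\<integral>y. h y \<partial>N2)" by (simp only: of_real_eq_iff)
  have m0: "(\<integral>y. h y \<partial>N1) \<ge> 0" using h by (simp add: integral_nonneg_AE)
  show ?thesis
  proof (cases "(\<integral>y. h y \<partial>N1) = 0")
    case True
    have "AE y in N1. h y = 0" "AE y in N2. h y = 0"
      using integral_nonneg_eq_0_iff_AE[OF i(1)] integral_nonneg_eq_0_iff_AE[OF i(2)] h True m by auto
    then have "AE y in N1. h y * indicator b (f y) = 0" "AE y in N2. h y * indicator b (f y) = 0" by auto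
    then have "(\<integral>y. h y * indicator b (f y) \<partial>N1) = 0" "(\<integral>y. h y * indicator b (f y) \<partial>N2) = 0"
      by (auto intro: integral_eq_zero_AE)
    then show ?thesis by simp
  next
    case False
    let ?m = "\<integral>y. h y \<partial>N1"
    let ?R = "\<lambda>N. distr (density N (\<lambda>y. ennreal (h y / ?m))) borel f"
    have mp: "?m > 0" using False m0 by simp
    note d1 = weighted_distribution[OF N(1) meas(1,2) h refl mp]
    note d2 = weighted_distribution[OF N(2) meas(3,4) h m mp]
    have "char (?R N1) = char (?R N2)" by (rule ext) (simp only: d1(2) d2(2) eq)
    then have "?R N1 = ?R N2" by (intro Levy_uniqueness d1(1) d2(1))
    then have "measure (?R N1) b = measure (?R N2) b" by simp
    then show ?thesis using d1(3)[OF b] d2(3)[OF b] mp by simp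
  qed
qed

lemma integral_combination3:
  fixes u v z :: "'e \<Rightarrow> complex"
  assumes "integrable N u" "integrable N v" "integrable N z"
  shows "(\<integral>y. u y + v y * a + z y * b \<partial>N) = (\<integral>y. u y \<partial>N) + (\<integral>y. v y \<partial>N) * a + (\<integral>y. z y \<partial>N) * b"
  using assms by simp

text \<open>
  The functions \<open>f x\<close> are the coordinates in which Fourier transforms are taken, and \<open>\<D>\<close> is a system of
  events to which the measures are restricted before that.
\<close>

locale fourier_pair =
  fixes N1 N2 :: "'e measure" and X :: "'x set" and f :: "'x \<Rightarrow> 'e \<Rightarrow> real" and \<D> :: "'e set set"
  assumes N: "finite_measure N1" "finite_measure N2" and sets_eq: "sets N1 = sets N2"
    and f: "\<And>x. x \<in> X \<Longrightarrow> f x \<in> borel_measurable N1"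
    and \<D>: "\<D> \<subseteq> sets N1" "Int_stable \<D>" "space N1 \<in> \<D>"
    and fourier: "\<And>A L \<mu>. A \<in> \<D> \<Longrightarrow> finite L \<Longrightarrow> L \<subseteq> X \<Longrightarrow>
      (\<integral>y. of_real (indicator A y) * iexp (\<Sum>x\<in>L. \<mu> x * f x y) \<partial>N1) =
      (\<integral>y. of_real (indicator A y) * iexp (\<Sum>x\<in>L. \<mu> x * f x y) \<partial>N2)"
begin

definition cyl :: "'e set \<Rightarrow> 'x set \<Rightarrow> ('x \<Rightarrow> real set) \<Rightarrow> 'e \<Rightarrow> real" where
  "cyl A M b y = indicator A y * (\<Prod>x\<in>M. indicator (b x) (f x y))"

lemma cyl_bounds: "0 \<le> cyl A M b y" "cyl A M b y \<le> 1"
proof -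
  have "(\<Prod>x\<in>M. indicator (b x) (f x y)) \<in> {0..(1::real)}"
    using prod_nonneg[of M "\<lambda>x. indicator (b x) (f x y) :: real"] prod_le_1[of M "\<lambda>x. indicator (b x) (f x y) :: real"] by simp
  then show "0 \<le> cyl A M b y" "cyl A M b y \<le> 1" by (auto simp: cyl_def indicator_def)
qed

lemma meas_eq: "measurable N1 L = measurable N2 L"
  by (rule measurable_cong_sets[OF sets_eq refl])

lemma cyl_measurable:
  assumes "A \<in> \<D>" "M \<subseteq> X" "\<And>x. b x \<in> sets borel"
  shows "cyl A M b \<in> borel_measurable N1"
proof -
  have [measurable]: "A \<in> sets N1" using assms \<D> by auto
  have "(\<lambda>y. indicator (b x) (f x y) :: real) \<in> borel_measurable N1" if "x \<in> M" for x
    using f[of x] that assms by (intro measurable_compose[OF f borel_measurable_indicator]) auto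
  then have [measurable]: "(\<lambda>y. \<Prod>x\<in>M. indicator (b x) (f x y) :: real) \<in> borel_measurable N1"
    by (intro borel_measurable_prod) auto
  show ?thesis unfolding cyl_def[abs_def] by measurable
qed

lemma cos_shift_exp: "complex_of_real (cos (s - \<phi>)) = (iexp s * iexp (- \<phi>) + iexp (- s) * iexp \<phi>) / 2"
proof -
  have "complex_of_real (cos (s - \<phi>)) = cos (complex_of_real (s - \<phi>))" by (rule cos_of_real[symmetric])
  also have "\<dots> = (iexp (s - \<phi>) + exp (- (\<i> * complex_of_real (s - \<phi>)))) / 2" by (rule cos_exp_eq)
  also have "iexp (s - \<phi>) = iexp s * iexp (- \<phi>)" by (simp add: mult_exp_exp right_diff_distrib)
  also have "exp (- (\<i> * complex_of_real (s - \<phi>))) = iexp (- s) * iexp \<phi>" by (simp add: mult_exp_exp right_diff_distrib)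
  finally show ?thesis .
qed

text \<open>
  Induction on the number of coordinates that are restricted to Borel sets: one exponential factor at a
  time is traded for an indicator by one-dimensional uniqueness. The remaining exponential is a complex
  weight, so it is decomposed into the non-negative weights \<open>1 + cos (s - \<phi>)\<close>; the choices \<open>\<phi> = 0\<close> and
  \<open>\<phi> = pi / 2\<close> recover its real and imaginary parts.
\<close>

lemma cyl_fourier:
  assumes "finite M" "A \<in> \<D>" "M \<subseteq> X" "\<And>x. b x \<in> sets borel" "finite L" "L \<subseteq> X"
  shows "(\<integral>y. of_real (cyl A M b y) * iexp (\<Sum>x\<in>L. \<mu> x * f x y) \<partial>N1) =
      (\<integral>y. of_real (cyl A M b y) * iexp (\<Sum>x\<in>L. \<mu> x * f x y) \<partial>N2)"
  using assms(1,3,5,6)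
proof (induction M arbitrary: L \<mu> rule: finite_induct)
  case empty
  then show ?case using fourier[OF assms(2)] by (simp add: cyl_def)
next
  case (insert q M)
  have q: "q \<in> X" and M: "M \<subseteq> X" using insert by auto
  define k where "k = cyl A M b"
  define s where "s = (\<lambda>y. \<Sum>x\<in>L. \<mu> x * f x y)"
  have k[measurable]: "k \<in> borel_measurable N1" unfolding k_def by (rule cyl_measurable[OF assms(2) M assms(4)])
  have s[measurable]: "s \<in> borel_measurable N1" unfolding s_def using f insert.prems
    by (intro borel_measurable_sum borel_measurable_times) auto
  have fq[measurable]: "f q \<in> borel_measurable N1" by (rule f[OF q])
  note m2 = k[unfolded meas_eq] s[unfolded meas_eq] fq[unfolded meas_eq]
  have kb: "0 \<le> k y" "k y \<le> 1" for y unfolding k_def by (rule cyl_bounds)+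
  have L': "finite (insert q L)" "insert q L \<subseteq> X" using insert.prems q by auto
  have lin: "(\<integral>y. of_real (k y) * iexp (t * f q y + a * s y) \<partial>N1) = (\<integral>y. of_real (k y) * iexp (t * f q y + a * s y) \<partial>N2)" for t a
  proof -
    define \<nu> where "\<nu> = (\<lambda>x. (if x = q then t else 0) + (if x \<in> L then a * \<mu> x else 0))"
    have "(\<Sum>x\<in>insert q L. \<nu> x * f x y) = t * f q y + a * s y" for y
    proof -
      have "(\<Sum>x\<in>insert q L. \<nu> x * f x y) = (\<Sum>x\<in>insert q L. if x = q then t * f x y else 0) + (\<Sum>x\<in>insert q L. if x \<in> L then a * \<mu> x * f x y else 0)"
        unfolding sum.distrib[symmetric] by (intro sum.cong refl) (auto simp: \<nu>_def algebra_simps)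
      also have "(\<Sum>x\<in>insert q L. if x = q then t * f x y else 0) = t * f q y" using insert.prems by simp
      also have "(\<Sum>x\<in>insert q L. if x \<in> L then a * \<mu> x * f x y else 0) = (\<Sum>x\<in>L. a * \<mu> x * f x y)"
        using insert.prems by (intro sum.mono_neutral_cong_right) auto
      finally show ?thesis by (simp add: s_def sum_distrib_left mult.assoc)
    qed
    with insert.IH[OF M L', of \<nu>] show ?thesis by (simp add: k_def)
  qed
  have int: "integrable N1 (\<lambda>y. of_real (k y) * iexp (t * f q y + a * s y))" "integrable N2 (\<lambda>y. of_real (k y) * iexp (t * f q y + a * s y))" for t a
    by (rule finite_measure.integrable_const_bound[OF N(1), where B=1], use kb in \<open>auto simp: norm_mult\<close>)
       (rule finite_measure.integrable_const_bound[OF N(2), where B=1], use kb m2 in \<open>auto simp: norm_mult\<close>)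
  have shifted: "(\<integral>y. k y * (1 + cos (s y - \<phi>)) * indicator (b q) (f q y) \<partial>N1) = (\<integral>y. k y * (1 + cos (s y - \<phi>)) * indicator (b q) (f q y) \<partial>N2)" for \<phi>
  proof (rule weighted_fourier_unique[OF N, where C=2])
    have c: "0 \<le> 1 + cos x" "1 + cos x \<le> 2" for x :: real
      using cos_ge_minus_one[of x] cos_le_one[of x] by linarith+
    show "0 \<le> k y * (1 + cos (s y - \<phi>))" for y
      by (intro mult_nonneg_nonneg kb c)
    show "k y * (1 + cos (s y - \<phi>)) \<le> 2" for y
      using mult_mono[OF kb(2)[of y] c(2)[of "s y - \<phi>"]] c(1) by simp
    fix t
    have e: "of_real (k y * (1 + cos (s y - \<phi>))) * iexp (t * f q y) = of_real (k y) * iexp (t * f q y + 0 * s y)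
        + (of_real (k y) * iexp (t * f q y + 1 * s y)) * (iexp (- \<phi>) / 2) + (of_real (k y) * iexp (t * f q y + (-1) * s y)) * (iexp \<phi> / 2)" for y
    proof -
      have ring: "u * (1 + (p * v + z * a) / 2) * e = u * e + (u * (e * p)) * (v / 2) + (u * (e * z)) * (a / 2)"
        for u p v z a e :: complex by (simp add: field_simps)
      have x: "iexp (t * f q y + a * s y) = iexp (t * f q y) * iexp (a * s y)" for a
        by (simp add: distrib_left exp_add)
      show ?thesis unfolding x unfolding of_real_mult of_real_add of_real_1 cos_shift_exp ring by simp
    qed
    show "(\<integral>y. of_real (k y * (1 + cos (s y - \<phi>))) * iexp (t * f q y) \<partial>N1) = (\<integral>y. of_real (k y * (1 + cos (s y - \<phi>))) * iexp (t * f q y) \<partial>N2)"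
      unfolding e
      unfolding integral_combination3[OF int(1) int(1) int(1)] integral_combination3[OF int(2) int(2) int(2)] lin ..
    show "(\<lambda>y. k y * (1 + cos (s y - \<phi>))) \<in> borel_measurable N1" by measurable
    show "(\<lambda>y. k y * (1 + cos (s y - \<phi>))) \<in> borel_measurable N2"
      using m2(1,2) by (intro borel_measurable_times borel_measurable_add borel_measurable_const borel_measurable_diff
          measurable_compose[OF _ borel_measurable_continuous_onI[OF continuous_on_cos[OF continuous_on_id]]])
  qed (rule fq m2 assms(4))+
  have plain: "(\<integral>y. k y * indicator (b q) (f q y) \<partial>N1) = (\<integral>y. k y * indicator (b q) (f q y) \<partial>N2)"
  proof (rule weighted_fourier_unique[OF N, where C=1])
    show "(\<integral>y. of_real (k y) * iexp (t * f q y) \<partial>N1) = (\<integral>y. of_real (k y) * iexp (t * f q y) \<partial>N2)" for t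
      using lin[of t 0] by simp
  qed (rule k fq m2 assms(4) kb)+
  have bq[measurable]: "b q \<in> sets borel" by (rule assms(4))
  have int1: "integrable N1 (\<lambda>y. k y * indicator (b q) (f q y))" "integrable N2 (\<lambda>y. k y * indicator (b q) (f q y))"
  proof -
    have le: "\<bar>k y * indicator (b q) (f q y)\<bar> \<le> 1" for y using kb[of y] by (simp add: indicator_def)
    show "integrable N1 (\<lambda>y. k y * indicator (b q) (f q y))"
      by (rule finite_measure.integrable_const_bound[OF N(1), where B=1]) (rule AE_I2, unfold real_norm_def, rule le, measurable)
    note [measurable] = m2
    show "integrable N2 (\<lambda>y. k y * indicator (b q) (f q y))"
      by (rule finite_measure.integrable_const_bound[OF N(2), where B=1]) (rule AE_I2, unfold real_norm_def, rule le, measurable)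
  qed
  have cosb: "\<bar>k y * cos (s y - \<phi>) * indicator (b q) (f q y)\<bar> \<le> 1" for y \<phi>
  proof -
    have "\<bar>k y\<bar> * \<bar>cos (s y - \<phi>)\<bar> \<le> 1 * 1" using kb[of y] by (intro mult_mono) auto
    then show ?thesis by (simp add: abs_mult indicator_def)
  qed
  have int2: "integrable N1 (\<lambda>y. k y * cos (s y - \<phi>) * indicator (b q) (f q y))" "integrable N2 (\<lambda>y. k y * cos (s y - \<phi>) * indicator (b q) (f q y))" for \<phi>
  proof -
    show "integrable N1 (\<lambda>y. k y * cos (s y - \<phi>) * indicator (b q) (f q y))"
      by (rule finite_measure.integrable_const_bound[OF N(1), where B=1]) (rule AE_I2, unfold real_norm_def, rule cosb, measurable)
    show "integrable N2 (\<lambda>y. k y * cos (s y - \<phi>) * indicator (b q) (f q y))"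
    proof -
      note [measurable] = m2
      show ?thesis by (rule finite_measure.integrable_const_bound[OF N(2), where B=1]) (rule AE_I2, unfold real_norm_def, rule cosb, measurable)
    qed
  qed
  have cs: "(\<integral>y. k y * cos (s y - \<phi>) * indicator (b q) (f q y) \<partial>N1) = (\<integral>y. k y * cos (s y - \<phi>) * indicator (b q) (f q y) \<partial>N2)" for \<phi>
  proof -
    have e2: "k y * (1 + cos (s y - \<phi>)) * indicator (b q) (f q y) =
        k y * indicator (b q) (f q y) + k y * cos (s y - \<phi>) * indicator (b q) (f q y)" for y
      by (simp only: distrib_left distrib_right mult_1_right)
    show ?thesis
      using shifted[of \<phi>] plain
      unfolding e2 Bochner_Integration.integral_add[OF int1(1) int2(1)] Bochner_Integration.integral_add[OF int1(2) int2(2)]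
      by simp
  qed
  have e: "of_real (cyl A (insert q M) b y) * iexp (s y) = of_real (k y * cos (s y - 0) * indicator (b q) (f q y))
      + \<i> * of_real (k y * cos (s y - pi / 2) * indicator (b q) (f q y))" for y
  proof -
    have 1: "iexp (s y) = of_real (cos (s y)) + \<i> * of_real (sin (s y))"
      unfolding cis_conv_exp[symmetric] by (simp add: complex_eq_iff)
    have 2: "cos (s y - pi / 2) = sin (s y)" by (simp add: cos_diff)
    have 3: "cyl A (insert q M) b y = k y * indicator (b q) (f q y)"
      using insert.hyps(1,2) by (simp add: cyl_def k_def mult_ac)
    show ?thesis unfolding 1 2 3 diff_zero of_real_mult by (simp only: distrib_left mult_ac)
  qed
  have "(\<integral>y. of_real (cyl A (insert q M) b y) * iexp (s y) \<partial>N1) = (\<integral>y. of_real (cyl A (insert q M) b y) * iexp (s y) \<partial>N2)"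
    unfolding e
    by (subst (1 2) Bochner_Integration.integral_add, (intro integrable_mult_right integrable_of_real int2)+)
       (simp only: integral_mult_right_zero integral_complex_of_real cs)
  then show ?case by (simp only: s_def)
qed

definition cylset :: "'e set \<Rightarrow> 'x set \<Rightarrow> ('x \<Rightarrow> real set) \<Rightarrow> 'e set" where
  "cylset A M b = A \<inter> {y\<in>space N1. \<forall>x\<in>M. f x y \<in> b x}"

definition cylinders :: "'e set set" where
  "cylinders = {cylset A M b | A M b. A \<in> \<D> \<and> finite M \<and> M \<subseteq> X \<and> (\<forall>x. b x \<in> sets borel)}"

lemma cylindersE:
  assumes "C \<in> cylinders"
  obtains A M b where "C = cylset A M b" "A \<in> \<D>" "finite M" "M \<subseteq> X" "\<forall>x. b x \<in> sets borel"
proof -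
  from assms have "\<exists>A M b. C = cylset A M b \<and> A \<in> \<D> \<and> finite M \<and> M \<subseteq> X \<and> (\<forall>x. b x \<in> sets borel)"
    unfolding cylinders_def mem_Collect_eq .
  then show thesis by (elim exE conjE) (rule that)
qed

lemma measures_eq:
  assumes gen: "sets N1 = sigma_sets (space N1) cylinders"
  shows "N1 = N2"
proof -
  have sp: "space N1 = space N2" by (rule sets_eq_imp_space_eq[OF sets_eq])
  have cyl_meas: "measure N1 C = measure N2 C \<and> C \<in> sets N1" if CC: "C \<in> cylinders" for C
  proof -
    obtain A M b where C': "C = cylset A M b"
      and A: "A \<in> \<D>" and M: "finite M" "M \<subseteq> X" and b': "\<forall>x. b x \<in> sets borel"
      by (rule cylindersE[OF CC])
    note C = C'[unfolded cylset_def]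
    have b: "b x \<in> sets borel" for x using b' by blast
    have AS: "A \<subseteq> space N1" using A \<D>(1) sets.sets_into_space by blast
    have ind: "cyl A M b y = indicator C y" for y
    proof -
      have p: "(\<Prod>x\<in>M. indicator (b x) (f x y)) = (if \<forall>x\<in>M. f x y \<in> b x then 1 else 0 :: real)"
      proof (cases "\<forall>x\<in>M. f x y \<in> b x")
        case False
        then obtain x where x: "x \<in> M" "f x y \<notin> b x" by blast
        then have "(\<Prod>x\<in>M. indicator (b x) (f x y)) = (0 :: real)" using M(1) by (subst prod_zero_iff) (auto intro!: bexI[of _ x])
        then show ?thesis unfolding if_not_P[OF False] .
      qed simp
      have yS: "y \<in> A \<Longrightarrow> y \<in> space N1" using AS by blast
      show ?thesis unfolding cyl_def p C by (auto simp: indicator_def dest: yS)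
    qed
    have ind_fun: "cyl A M b = indicator C" by (rule ext) (rule ind)
    have "(indicator C :: 'e \<Rightarrow> real) \<in> borel_measurable N1" 
      using cyl_measurable[where b=b, OF A M(2) b] unfolding ind_fun .
    moreover have CS: "C \<subseteq> space N1" using AS unfolding C by blast
    ultimately have Cs: "C \<in> sets N1" unfolding borel_measurable_indicator_iff Int_absorb2[OF CS] by blast
    have "(\<integral>y. complex_of_real (cyl A M b y) \<partial>N1) = (\<integral>y. complex_of_real (cyl A M b y) \<partial>N2)"
      using cyl_fourier[where b=b and L="{}", OF M(1) A M(2) b] by simp
    then have "complex_of_real (\<integral>y. indicator C y \<partial>N1) = complex_of_real (\<integral>y. indicator C y \<partial>N2)"
      unfolding ind integral_complex_of_real .
    then have "(\<integral>y. indicator C y \<partial>N1) = (\<integral>y. indicator C y \<partial>N2 :: real)" by (simp only: of_real_eq_iff)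
    then have "measure N1 C = measure N2 C"
      unfolding Bochner_Integration.integral_indicator sp[symmetric] Int_absorb2[OF CS] .
    with Cs show ?thesis by simp
  qed
  show ?thesis
  proof (rule measure_eqI_generator_eq[where E=cylinders and \<Omega>="space N1" and A="\<lambda>_. space N1"])
    show "Int_stable cylinders"
    proof (rule Int_stableI)
      fix C C' assume C0: "C \<in> cylinders" and C0': "C' \<in> cylinders"
      obtain A M b where C: "C = cylset A M b" "A \<in> \<D>" "finite M" "M \<subseteq> X" "\<forall>x. b x \<in> sets borel"
        by (rule cylindersE[OF C0])
      obtain A' M' b' where C': "C' = cylset A' M' b'" "A' \<in> \<D>" "finite M'" "M' \<subseteq> X" "\<forall>x. b' x \<in> sets borel"
        by (rule cylindersE[OF C0'])
      let ?b = "\<lambda>x. (if x \<in> M then b x else UNIV) \<inter> (if x \<in> M' then b' x else UNIV)"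
      have "C \<inter> C' = cylset (A \<inter> A') (M \<union> M') ?b" unfolding C(1) C'(1) cylset_def by auto
      moreover have "A \<inter> A' \<in> \<D>" using C(2) C'(2) \<D>(2) unfolding Int_stable_def by blast
      moreover have "\<forall>x. ?b x \<in> sets borel" using C(5) C'(5) by simp
      moreover have "finite (M \<union> M')" "M \<union> M' \<subseteq> X" using C(3,4) C'(3,4) by simp_all
      ultimately show "C \<inter> C' \<in> cylinders" unfolding cylinders_def
        by (intro CollectI exI[of _ "A \<inter> A'"] exI[of _ "M \<union> M'"] exI[of _ ?b] conjI)
    qed
    show "cylinders \<subseteq> Pow (space N1)" using cyl_meas sets.sets_into_space by blast
    show "emeasure N1 C = emeasure N2 C" if "C \<in> cylinders" for C
      using cyl_meas[OF that] finite_measure.emeasure_eq_measure[OF N(1)] finite_measure.emeasure_eq_measure[OF N(2)] by simp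
    show "sets N2 = sigma_sets (space N1) cylinders" using gen sets_eq by simp
    have "space N1 \<in> cylinders" unfolding cylinders_def
      by (rule CollectI, rule exI[of _ "space N1"], rule exI[of _ "{}"], rule exI[of _ "\<lambda>_. UNIV"]) (use \<D>(3) in \<open>simp add: cylset_def\<close>)
    then show "range (\<lambda>_. space N1) \<subseteq> cylinders" by auto
    show "emeasure N1 (space N1) \<noteq> \<infinity>" using finite_measure.emeasure_finite[OF N(1)] by simp
  qed (use gen in auto)
qed

end

section \<open>Limits in mean along a common subsequence\<close>

text \<open>
  The limit has to be one function that serves all the measures. A fast subsequence is chosen for all of
  them at once, and the limit is defined pointwise as the sum of the differences, which converges almost
  everywhere for each measure.
\<close>

lemma common_L1_limit:
  fixes \<Phi> :: "nat \<Rightarrow> 'e \<Rightarrow> real"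
  assumes sets: "\<And>j. sets (N j) = sets E" and j: "finite I"
    and \<Phi>: "\<And>n. \<Phi> n \<in> borel_measurable E" "\<And>j n. j \<in> I \<Longrightarrow> integrable (N j) (\<Phi> n)"
    and cauchy: "\<And>j \<epsilon>. j \<in> I \<Longrightarrow> \<epsilon> > 0 \<Longrightarrow> \<exists>M. \<forall>n\<ge>M. \<forall>n'\<ge>n. (\<integral>y. \<bar>\<Phi> n y - \<Phi> n' y\<bar> \<partial>N j) < \<epsilon>"
  obtains r :: "nat \<Rightarrow> nat" and \<Psi> where "strict_mono r" "\<Psi> \<in> borel_measurable E"
    "\<And>j. j \<in> I \<Longrightarrow> integrable (N j) \<Psi>"
    "\<And>j. j \<in> I \<Longrightarrow> AE y in N j. (\<lambda>k. \<Phi> (r k) y) \<longlonglongrightarrow> \<Psi> y"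
    "\<And>j. j \<in> I \<Longrightarrow> (\<lambda>k. \<integral>y. \<bar>\<Phi> (r k) y - \<Psi> y\<bar> \<partial>N j) \<longlonglongrightarrow> 0"
proof -
  have "\<exists>M. \<forall>j\<in>I. \<forall>n\<ge>M. \<forall>n'\<ge>n. (\<integral>y. \<bar>\<Phi> n y - \<Phi> n' y\<bar> \<partial>N j) < (1/2) ^ k" for k :: nat
  proof -
    have "\<forall>j\<in>I. \<exists>M. \<forall>n\<ge>M. \<forall>n'\<ge>n. (\<integral>y. \<bar>\<Phi> n y - \<Phi> n' y\<bar> \<partial>N j) < (1/2) ^ k"
      by (intro ballI cauchy) auto
    from bchoice[OF this] obtain M
      where M: "\<forall>j\<in>I. \<forall>n\<ge>M j. \<forall>n'\<ge>n. (\<integral>y. \<bar>\<Phi> n y - \<Phi> n' y\<bar> \<partial>N j) < (1/2) ^ k" by blast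
    have le: "M j \<le> Max (insert 0 (M ` I))" if "j \<in> I" for j using j that by (auto intro!: Max_ge)
    show ?thesis
    proof (intro exI[of _ "Max (insert 0 (M ` I))"] ballI allI impI)
      fix j n n' assume jn: "j \<in> I" "Max (insert 0 (M ` I)) \<le> n" "n \<le> n'"
      from le[OF jn(1)] jn(2) have "M j \<le> n" by (rule order_trans)
      with M jn show "(\<integral>y. \<bar>\<Phi> n y - \<Phi> n' y\<bar> \<partial>N j) < (1/2) ^ k" by blast
    qed
  qed
  then have "\<forall>k. \<exists>M. \<forall>j\<in>I. \<forall>n\<ge>M. \<forall>n'\<ge>n. (\<integral>y. \<bar>\<Phi> n y - \<Phi> n' y\<bar> \<partial>N j) < (1/2) ^ k" by (rule allI)
  from choice[OF this] obtain M
    where "\<forall>k. \<forall>j\<in>I. \<forall>n\<ge>M k. \<forall>n'\<ge>n. (\<integral>y. \<bar>\<Phi> n y - \<Phi> n' y\<bar> \<partial>N j) < (1/2) ^ k" by blast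
  then have M: "(\<integral>y. \<bar>\<Phi> n y - \<Phi> n' y\<bar> \<partial>N j) < (1/2) ^ k" if "j \<in> I" "n \<ge> M k" "n' \<ge> n" for k j n n'
    using that by blast
  define r where "r = rec_nat (M 0) (\<lambda>k m. max (Suc m) (M (Suc k)))"
  have r0: "r 0 = M 0" and rS: "r (Suc k) = max (Suc (r k)) (M (Suc k))" for k by (simp_all add: r_def)
  have sm: "strict_mono r" by (rule strict_monoI_Suc) (simp add: rS less_max_iff_disj)
  have rM: "M k \<le> r k" for k by (cases k) (simp_all add: r0 rS)
  define d where "d = (\<lambda>k y. \<Phi> (r (Suc k)) y - \<Phi> (r k) y)"
  define \<Psi> where "\<Psi> = (\<lambda>y. \<Phi> (r 0) y + (\<Sum>k. d k y))"
  have dm[measurable]: "d k \<in> borel_measurable E" for k unfolding d_def using \<Phi>(1) by measurable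
  have \<Psi>m: "\<Psi> \<in> borel_measurable E" unfolding \<Psi>_def using \<Phi>(1) by measurable
  have tele: "(\<Sum>k<n. d k y) = \<Phi> (r n) y - \<Phi> (r 0) y" for n y
    unfolding d_def by (rule sum_lessThan_telescope)
  have *: "integrable (N j) \<Psi> \<and> (AE y in N j. (\<lambda>k. \<Phi> (r k) y) \<longlonglongrightarrow> \<Psi> y) \<and>
    (\<lambda>k. \<integral>y. \<bar>\<Phi> (r k) y - \<Psi> y\<bar> \<partial>N j) \<longlonglongrightarrow> 0" if jI: "j \<in> I" for j
  proof -
    have dmj[measurable]: "d k \<in> borel_measurable (N j)" for k
      unfolding measurable_cong_sets[OF sets[of j] refl, of borel] by (rule dm)
    have \<Psi>mj[measurable]: "\<Psi> \<in> borel_measurable (N j)" unfolding measurable_cong_sets[OF sets[of j] refl, of borel] by (rule \<Psi>m)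
    have \<Phi>mj[measurable]: "\<Phi> k \<in> borel_measurable (N j)" for k
      unfolding measurable_cong_sets[OF sets[of j] refl, of borel] by (rule \<Phi>(1))
    have di: "integrable (N j) (d k)" for k unfolding d_def using \<Phi>(2)[OF jI] by simp
    have dI: "(\<integral>y. \<bar>d k y\<bar> \<partial>N j) \<le> (1/2) ^ k" for k
    proof -
      have "(\<integral>y. \<bar>\<Phi> (r k) y - \<Phi> (r (Suc k)) y\<bar> \<partial>N j) < (1/2) ^ k"
        using strict_monoD[OF sm, of k "Suc k"] by (intro M[OF jI rM]) auto
      then show ?thesis by (simp add: d_def abs_minus_commute)
    qed
    have sd: "summable (\<lambda>k. \<integral>y. \<bar>d k y\<bar> \<partial>N j)"
      by (rule summable_comparison_test'[OF summable_geometric[of "1/2 :: real"], of 0])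
         (use dI in \<open>auto simp: abs_of_nonneg\<close>)
    have nn: "(\<integral>\<^sup>+y. ennreal \<bar>d k y\<bar> \<partial>N j) = ennreal (\<integral>y. \<bar>d k y\<bar> \<partial>N j)" for k
      by (rule nn_integral_eq_integral) (use di in auto)
    have "(\<integral>\<^sup>+y. (\<Sum>k. ennreal \<bar>d k y\<bar>) \<partial>N j) = (\<Sum>k. ennreal (\<integral>y. \<bar>d k y\<bar> \<partial>N j))"
      by (subst nn_integral_suminf) (auto simp: nn)
    also have "\<dots> = ennreal (\<Sum>k. \<integral>y. \<bar>d k y\<bar> \<partial>N j)"
      by (rule suminf_ennreal2[OF _ sd]) simp
    finally have fin: "(\<integral>\<^sup>+y. (\<Sum>k. ennreal \<bar>d k y\<bar>) \<partial>N j) \<noteq> \<infinity>" by simp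
    have AEs: "AE y in N j. summable (\<lambda>k. \<bar>d k y\<bar>)"
    proof -
      have "AE y in N j. (\<Sum>k. ennreal \<bar>d k y\<bar>) \<noteq> \<infinity>" by (rule nn_integral_PInf_AE[OF _ fin]) measurable
      then show ?thesis
      proof eventually_elim
        case (elim y)
        then show ?case by (intro summable_suminf_not_top) (auto simp: infinity_ennreal_def)
      qed
    qed
    have wi: "integrable (N j) (\<lambda>y. \<Sum>k. \<bar>d k y\<bar>)"
      by (rule integrable_suminf) (use di AEs sd in auto)
    have lim: "AE y in N j. (\<lambda>k. \<Phi> (r k) y) \<longlonglongrightarrow> \<Psi> y" using AEs
    proof eventually_elim
      case (elim y)
      have "(\<lambda>k. d k y) sums (\<Sum>k. d k y)" by (rule summable_sums[OF summable_rabs_cancel[OF elim]])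
      then have "(\<lambda>n. \<Phi> (r 0) y + (\<Sum>k<n. d k y)) \<longlonglongrightarrow> \<Psi> y" unfolding sums_def \<Psi>_def by (intro tendsto_intros)
      then show ?case by (simp add: tele)
    qed
    have \<Psi>i: "integrable (N j) \<Psi>" unfolding \<Psi>_def
      using \<Phi>(2)[OF jI] by (intro Bochner_Integration.integrable_add integrable_suminf) (use di AEs sd in auto)
    have "(\<lambda>k. \<integral>y. \<bar>\<Phi> (r k) y - \<Psi> y\<bar> \<partial>N j) \<longlonglongrightarrow> (\<integral>y. 0 \<partial>N j)"
    proof (rule integral_dominated_convergence[OF _ _ Bochner_Integration.integrable_add[OF wi wi]])
      show "AE y in N j. (\<lambda>k. \<bar>\<Phi> (r k) y - \<Psi> y\<bar>) \<longlonglongrightarrow> 0" using lim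
      proof eventually_elim
        case (elim y)
        then show ?case by (simp add: LIM_zero tendsto_rabs_zero)
      qed
      show "AE y in N j. norm \<bar>\<Phi> (r k) y - \<Psi> y\<bar> \<le> (\<Sum>k. \<bar>d k y\<bar>) + (\<Sum>k. \<bar>d k y\<bar>)" for k using AEs
      proof eventually_elim
        case (elim y)
        have "\<Phi> (r k) y - \<Psi> y = (\<Sum>i<k. d i y) - (\<Sum>i. d i y)" by (simp add: tele \<Psi>_def)
        moreover have "\<bar>\<Sum>i<k. d i y\<bar> \<le> (\<Sum>i<k. \<bar>d i y\<bar>)" by (rule sum_abs)
        moreover have "(\<Sum>i<k. \<bar>d i y\<bar>) \<le> (\<Sum>i. \<bar>d i y\<bar>)" by (rule sum_le_suminf[OF elim]) auto
        moreover have "\<bar>\<Sum>i. d i y\<bar> \<le> (\<Sum>i. \<bar>d i y\<bar>)" by (rule summable_rabs[OF elim])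
        ultimately show ?case unfolding real_norm_def abs_idempotent by linarith
      qed
    qed measurable
    then show ?thesis using \<Psi>i lim by simp
  qed
  show thesis by (rule that[OF sm \<Psi>m]) (use * in auto)
qed

text \<open>
  By Fatou's lemma \<open>1 / \<Phi> k\<close> cannot tend to infinity on a set of positive measure.
\<close>

lemma positive_limit:
  fixes \<Phi> :: "nat \<Rightarrow> 'e \<Rightarrow> real"
  assumes pos: "\<And>k y. \<Phi> k y > 0" and m[measurable]: "\<And>k. \<Phi> k \<in> borel_measurable N"
    and i: "\<And>k. integrable N (\<lambda>y. 1 / \<Phi> k y)" "\<And>k. (\<integral>y. 1 / \<Phi> k y \<partial>N) \<le> C"
    and lim: "AE y in N. (\<lambda>k. \<Phi> k y) \<longlonglongrightarrow> \<Psi> y"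
  shows "AE y in N. \<Psi> y > 0"
proof -
  have "(\<integral>\<^sup>+y. ennreal (1 / \<Phi> k y) \<partial>N) \<le> ennreal C" for k
    using nn_integral_eq_integral[OF i(1)[of k]] i(2)[of k] pos[of k] by (auto simp: less_imp_le intro!: ennreal_leI)
  then have "liminf (\<lambda>k. \<integral>\<^sup>+y. ennreal (1 / \<Phi> k y) \<partial>N) \<le> ennreal C"
    by (intro Liminf_le) (auto simp: eventually_sequentially)
  with nn_integral_liminf[of "\<lambda>k y. ennreal (1 / \<Phi> k y)" N]
  have "(\<integral>\<^sup>+y. liminf (\<lambda>k. ennreal (1 / \<Phi> k y)) \<partial>N) \<le> ennreal C" by (auto intro: order_trans)
  then have "(\<integral>\<^sup>+y. liminf (\<lambda>k. ennreal (1 / \<Phi> k y)) \<partial>N) \<noteq> \<infinity>" by (auto simp: top_unique)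
  then have "AE y in N. liminf (\<lambda>k. ennreal (1 / \<Phi> k y)) \<noteq> \<infinity>"
    by (intro nn_integral_PInf_AE) measurable
  with lim show ?thesis
  proof eventually_elim
    case (elim y)
    have "\<Psi> y \<ge> 0" by (rule LIMSEQ_le_const[OF elim(1)]) (use pos in \<open>auto simp: less_imp_le\<close>)
    moreover have "\<Psi> y \<noteq> 0"
    proof
      assume "\<Psi> y = 0"
      then have "filterlim (\<lambda>k. \<Phi> k y) (at_right 0) sequentially"
        using elim(1) pos[of _ y] less_imp_neq[OF pos[of _ y], symmetric] by (auto simp: filterlim_at)
      then have "filterlim (\<lambda>k. inverse (\<Phi> k y)) at_top sequentially"
        by (rule filterlim_compose[OF filterlim_inverse_at_top_right])
      then have "(\<lambda>k. ennreal (1 / \<Phi> k y)) \<longlonglongrightarrow> top"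
        by (simp add: ennreal_tendsto_top_eq_at_top inverse_eq_divide)
      then have "liminf (\<lambda>k. ennreal (1 / \<Phi> k y)) = top" by (rule lim_imp_Liminf[OF sequentially_bot])
      with elim(2) show False by simp
    qed
    ultimately show ?case by simp
  qed
qed

section \<open>Uniqueness in law\<close>

lemma telescoped_product: "(h * z) * u - p * (h * q) = h * ((z - p) * u + p * (u - q))"
  for h z u p q :: complex
proof -
  have "h * ((z - p) * u + p * (u - q)) = h * (z * u - p * u + (p * u - p * q))"
    by (simp only: left_diff_distrib right_diff_distrib)
  also have "\<dots> = h * (z * u) - h * (p * q)" by (simp add: right_diff_distrib)
  finally show ?thesis by (simp only: mult_ac)
qed

text \<open>
  The state \<open>Y\<close> takes values in a space \<open>E\<close> on which the sum \<open>v\<close> of the Brownian motion and its drift, and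
  the drift \<open>\<alpha>\<close> itself, are given functionals. The functionals do not mention the probability space, so
  two solutions share them.
\<close>

locale observed_drift = drifted_brownian Q F t0 T w A K J
  for Q :: "'w measure" and F :: "real \<Rightarrow> 'w measure" and t0 T :: real and w :: "'p \<Rightarrow> real \<Rightarrow> 'w \<Rightarrow> real"
    and A :: "'p \<Rightarrow> real \<Rightarrow> 'w \<Rightarrow> real" and K :: real and J :: "nat \<Rightarrow> 'p set" +
  fixes E :: "'e measure" and Y :: "'w \<Rightarrow> 'e" and v \<alpha> :: "'p \<Rightarrow> real \<Rightarrow> 'e \<Rightarrow> real" and \<D> :: "'e set set"
  assumes Y[measurable]: "Y \<in> measurable Q E"
    and v_meas: "t \<in> {t0..T} \<Longrightarrow> v p t \<in> borel_measurable E"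
    and \<alpha>_meas: "t \<in> {t0..T} \<Longrightarrow> \<alpha> p t \<in> borel_measurable E"
    and observed: "AE \<omega> in Q. \<forall>p. \<forall>t\<in>{t0..T}. v p t (Y \<omega>) = w p t \<omega> + A p t \<omega> \<and> \<alpha> p t (Y \<omega>) = A p t \<omega>"
    and \<D>: "\<D> \<subseteq> sets E"
    and initial: "D \<in> \<D> \<Longrightarrow> Y -` D \<inter> space Q \<in> sets (F t0)"
begin

text \<open>
  The density \<open>Z n\<close> as a function on the state space.
\<close>

definition \<Phi> :: "nat \<Rightarrow> 'e \<Rightarrow> real" where
  "\<Phi> n y = exp (log_density t0 T B J n (\<lambda>p t. v p t y - \<alpha> p t y) (\<lambda>p t. \<alpha> p t y))"

lemma \<Phi>_pos: "\<Phi> n y > 0"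
  by (simp add: \<Phi>_def)

lemma \<Phi>_meas[measurable]: "\<Phi> n \<in> borel_measurable E"
proof -
  have vm: "v p (g n k) \<in> borel_measurable E" "\<alpha> p (g n k) \<in> borel_measurable E" if "k \<le> 2 ^ n" for p k
    using g_in[OF that] v_meas \<alpha>_meas by auto
  have l: "(\<lambda>y. lagged_slope t0 T B n (\<lambda>t. \<alpha> p t y) k) \<in> borel_measurable E" if k: "k \<le> 2 ^ n" for p k
  proof (cases k)
    case 0
    then show ?thesis by (simp add: lagged_slope_def)
  next
    case (Suc j)
    have [measurable]: "\<alpha> p (g n k) \<in> borel_measurable E" "\<alpha> p (g n j) \<in> borel_measurable E" using vm k Suc by auto
    have "(\<lambda>y. lagged_slope t0 T B n (\<lambda>t. \<alpha> p t y) k) =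
        (\<lambda>y. if B < \<bar>(\<alpha> p (g n k) y - \<alpha> p (g n j) y) / \<delta> n\<bar> then 0 else (\<alpha> p (g n k) y - \<alpha> p (g n j) y) / \<delta> n)"
      by (auto simp: lagged_slope_def slope_def Suc)
    then show ?thesis by simp
  qed
  show ?thesis unfolding \<Phi>_def log_density_def
    using l vm
    by (intro borel_measurable_exp[THEN measurable_compose[rotated]] borel_measurable_uminus borel_measurable_sum borel_measurable_add borel_measurable_times
        borel_measurable_diff borel_measurable_divide borel_measurable_power borel_measurable_const) auto
qed

lemma Z_eq_\<Phi>: "AE \<omega> in Q. \<forall>n. Z n \<omega> = \<Phi> n (Y \<omega>)"
  using observed
proof eventually_elim
  case (elim \<omega>)
  show ?case
  proof
    fix n
    have e: "v p (g n k) (Y \<omega>) = w p (g n k) \<omega> + A p (g n k) \<omega>" "\<alpha> p (g n k) (Y \<omega>) = A p (g n k) \<omega>" if "k \<le> 2 ^ n" for p k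
      using elim g_in[OF that] by auto
    have l: "lagged_slope t0 T B n (\<lambda>t. \<alpha> p t (Y \<omega>)) k = lagged_slope t0 T B n (\<lambda>t. A p t \<omega>) k" if k: "k \<le> 2 ^ n" for p k
    proof (cases k)
      case (Suc j)
      then show ?thesis using e(2)[of k p] e(2)[of j p] k by (simp add: lagged_slope_def slope_def)
    qed (simp add: lagged_slope_def)
    show "Z n \<omega> = \<Phi> n (Y \<omega>)" unfolding Z_def \<Phi>_def log_density_def
      by (intro arg_cong[where f=exp] arg_cong[where f=uminus] sum.cong refl) (simp add: e l)
  qed
qed

abbreviation "N \<equiv> distr Q E Y"

lemma N_integral:
  fixes h :: "'e \<Rightarrow> real"
  assumes [measurable]: "h \<in> borel_measurable E" and H: "AE \<omega> in Q. h (Y \<omega>) = H \<omega>" "H \<in> borel_measurable Q"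
  shows "(\<integral>y. h y \<partial>N) = (\<integral>\<omega>. H \<omega> \<partial>Q)" "integrable N h \<longleftrightarrow> integrable Q H"
proof -
  have "(\<integral>y. h y \<partial>N) = (\<integral>\<omega>. h (Y \<omega>) \<partial>Q)" by (rule integral_distr) measurable
  also have "\<dots> = (\<integral>\<omega>. H \<omega> \<partial>Q)" by (rule integral_cong_AE) (use H in auto)
  finally show "(\<integral>y. h y \<partial>N) = (\<integral>\<omega>. H \<omega> \<partial>Q)" .
  have "integrable N h \<longleftrightarrow> integrable Q (\<lambda>\<omega>. h (Y \<omega>))" by (rule integrable_distr_eq) measurable
  also have "\<dots> \<longleftrightarrow> integrable Q H" by (rule integrable_cong_AE) (use H in auto)
  finally show "integrable N h \<longleftrightarrow> integrable Q H" .
qed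

lemma Z_meas[measurable]: "Z n \<in> borel_measurable Q"
  using Z_moments all_moments_measurable by blast

lemma \<Phi>_integrable: "integrable N (\<Phi> n)"
proof -
  have "AE \<omega> in Q. \<Phi> n (Y \<omega>) = Z n \<omega>" using Z_eq_\<Phi> by eventually_elim simp
  from N_integral(2)[OF \<Phi>_meas this Z_meas] show ?thesis using all_moments_integrable[OF Z_moments] by simp
qed

lemma \<Phi>_Cauchy: "\<epsilon> > 0 \<Longrightarrow> \<exists>M. \<forall>n\<ge>M. \<forall>n'\<ge>n. (\<integral>y. \<bar>\<Phi> n y - \<Phi> n' y\<bar> \<partial>N) < \<epsilon>"
proof -
  have "(\<integral>y. \<bar>\<Phi> n y - \<Phi> n' y\<bar> \<partial>N) = (\<integral>\<omega>. \<bar>Z n \<omega> - Z n' \<omega>\<bar> \<partial>Q)" for n n'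
  proof (rule N_integral(1))
    show "AE \<omega> in Q. \<bar>\<Phi> n (Y \<omega>) - \<Phi> n' (Y \<omega>)\<bar> = \<bar>Z n \<omega> - Z n' \<omega>\<bar>" using Z_eq_\<Phi> by eventually_elim simp
  qed measurable
  then show "\<epsilon> > 0 \<Longrightarrow> ?thesis" using L1_Cauchy by simp
qed

lemma \<Phi>_inverse: "integrable N (\<lambda>y. 1 / \<Phi> n y)" "(\<integral>y. 1 / \<Phi> n y \<partial>N) \<le> exp (K * (T - t0))"
proof -
  have 1: "AE \<omega> in Q. 1 / \<Phi> n (Y \<omega>) = 1 / Z n \<omega>" using Z_eq_\<Phi> by eventually_elim simp
  have m: "(\<lambda>y. 1 / \<Phi> n y) \<in> borel_measurable E" "(\<lambda>\<omega>. 1 / Z n \<omega>) \<in> borel_measurable Q" by measurable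
  show "integrable N (\<lambda>y. 1 / \<Phi> n y)" using N_integral(2)[OF m(1) 1 m(2)] Z_inverse by simp
  show "(\<integral>y. 1 / \<Phi> n y \<partial>N) \<le> exp (K * (T - t0))" using N_integral(1)[OF m(1) 1 m(2)] Z_inverse by simp
qed

text \<open>
  Passage to the limit in \<open>fourier_Z\<close>: the densities converge in mean, and the exponentials converge
  almost surely and have modulus \<open>1\<close>.
\<close>

lemma fourier_limit:
  assumes \<Psi>[measurable]: "\<Psi> \<in> borel_measurable E" "integrable N \<Psi>" and r: "strict_mono r"
    and lim: "(\<lambda>k. \<integral>y. \<bar>\<Phi> (r k) y - \<Psi> y\<bar> \<partial>N) \<longlonglongrightarrow> 0"
    and D: "D \<in> \<D>" and L: "finite L" "snd ` L \<subseteq> {t0..T}"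
  shows "(\<lambda>k. complex_of_real (prob (Y -` D \<inter> space Q) *
      exp (- (\<Sum>i<2 ^ r k. \<Sum>p\<in>J (r k). (rounded_coeff t0 T L \<mu> (r k) i p)\<^sup>2 / 2 * \<delta> (r k))))) \<longlonglongrightarrow>
    (\<integral>y. of_real (\<Psi> y) * (of_real (indicator D y) * iexp (\<Sum>x\<in>L. \<mu> x * v (fst x) (snd x) y)) \<partial>N)"
proof -
  have Ds[measurable]: "D \<in> sets E" using D \<D> by auto
  let ?D = "Y -` D \<inter> space Q"
  have D0: "?D \<in> sets (F t0)" by (rule initial[OF D])
  have t0: "t0 \<in> {t0..T}" using t0T by simp
  have D0Q[measurable]: "?D \<in> sets Q" by measurable
  let ?H = "indicator ?D :: 'w \<Rightarrow> real"
  have H: "?H \<in> borel_measurable (F t0)" using D0 by measurable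
  have Hm: "all_moments Q ?H" by (rule all_moments_bounded[where B=1]) (auto simp: indicator_def)
  define g' where "g' = (\<lambda>y. iexp (\<Sum>x\<in>L. \<mu> x * v (fst x) (snd x) y))"
  have vL: "v (fst x) (snd x) \<in> borel_measurable E" if "x \<in> L" for x using L that by (intro v_meas) auto
  have sm: "(\<lambda>y. \<Sum>x\<in>L. \<mu> x * v (fst x) (snd x) y) \<in> borel_measurable E"
    using vL by (intro borel_measurable_sum borel_measurable_times borel_measurable_const) auto
  have g'[measurable]: "g' \<in> borel_measurable E" unfolding g'_def using sm by measurable
  have g'1: "norm (g' y) = 1" for y by (simp add: g'_def)
  define C where "C = (\<integral>\<omega>. of_real (\<Psi> (Y \<omega>)) * (of_real (?H \<omega>) * g' (Y \<omega>)) \<partial>Q)"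
  have C: "(\<integral>y. of_real (\<Psi> y) * (of_real (indicator D y) * g' y) \<partial>N) = C"
  proof -
    have "(\<integral>y. of_real (\<Psi> y) * (of_real (indicator D y) * g' y) \<partial>N) = (\<integral>\<omega>. of_real (\<Psi> (Y \<omega>)) * (of_real (indicator D (Y \<omega>)) * g' (Y \<omega>)) \<partial>Q)"
      by (rule integral_distr) measurable
    also have "\<dots> = C" unfolding C_def
      by (intro Bochner_Integration.integral_cong refl) (simp add: indicator_def)
    finally show ?thesis .
  qed
  have Glim: "AE \<omega> in Q. (\<lambda>n. G L \<mu> n \<omega>) \<longlonglongrightarrow> g' (Y \<omega>)"
    using G_LIMSEQ[OF L, of \<mu>] observed
  proof eventually_elim
    case (elim \<omega>)
    have "(\<Sum>x\<in>L. \<mu> x * v (fst x) (snd x) (Y \<omega>)) = (\<Sum>x\<in>L. \<mu> x * (w (fst x) (snd x) \<omega> + A (fst x) (snd x) \<omega>))"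
      using elim(2) L by (intro sum.cong refl) auto
    then show ?case using elim(1) by (simp only: g'_def)
  qed
  have \<Psi>i: "integrable Q (\<lambda>\<omega>. \<Psi> (Y \<omega>))" using \<Psi>(2) integrable_distr_eq[OF Y \<Psi>(1)] by blast
  have Zlim: "(\<lambda>k. \<integral>\<omega>. \<bar>Z (r k) \<omega> - \<Psi> (Y \<omega>)\<bar> \<partial>Q) \<longlonglongrightarrow> 0"
  proof -
    have "(\<integral>y. \<bar>\<Phi> (r k) y - \<Psi> y\<bar> \<partial>N) = (\<integral>\<omega>. \<bar>Z (r k) \<omega> - \<Psi> (Y \<omega>)\<bar> \<partial>Q)" for k
    proof (rule N_integral(1))
      show "AE \<omega> in Q. \<bar>\<Phi> (r k) (Y \<omega>) - \<Psi> (Y \<omega>)\<bar> = \<bar>Z (r k) \<omega> - \<Psi> (Y \<omega>)\<bar>" using Z_eq_\<Phi> by eventually_elim simp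
    qed measurable
    then show ?thesis using lim by simp
  qed
  have Gm[measurable]: "G L \<mu> n \<in> borel_measurable Q" for n by (rule G_measurable[OF L(2)])
  have Rm: "(\<lambda>\<omega>. \<bar>\<Psi> (Y \<omega>)\<bar> * norm (G L \<mu> (r k) \<omega> - g' (Y \<omega>))) \<in> borel_measurable Q" for k
    by measurable
  define R where "R = (\<lambda>k. \<integral>\<omega>. \<bar>\<Psi> (Y \<omega>)\<bar> * norm (G L \<mu> (r k) \<omega> - g' (Y \<omega>)) \<partial>Q)"
  have Rlim: "R \<longlonglongrightarrow> 0"
  proof -
    have "R \<longlonglongrightarrow> (\<integral>\<omega>. 0 \<partial>Q)" unfolding R_def
    proof (rule integral_dominated_convergence[where w="\<lambda>\<omega>. 2 * \<bar>\<Psi> (Y \<omega>)\<bar>"])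
      show "AE \<omega> in Q. (\<lambda>k. \<bar>\<Psi> (Y \<omega>)\<bar> * norm (G L \<mu> (r k) \<omega> - g' (Y \<omega>))) \<longlonglongrightarrow> 0"
        using Glim
      proof eventually_elim
        case (elim \<omega>)
        have "(\<lambda>k. G L \<mu> (r k) \<omega>) \<longlonglongrightarrow> g' (Y \<omega>)" using LIMSEQ_subseq_LIMSEQ[OF elim r] by (simp add: o_def)
        then have "(\<lambda>k. norm (G L \<mu> (r k) \<omega> - g' (Y \<omega>))) \<longlonglongrightarrow> 0" by (simp add: LIM_zero tendsto_norm_zero)
        then show ?case by (rule tendsto_mult_right_zero)
      qed
      show "AE \<omega> in Q. norm (\<bar>\<Psi> (Y \<omega>)\<bar> * norm (G L \<mu> (r k) \<omega> - g' (Y \<omega>))) \<le> 2 * \<bar>\<Psi> (Y \<omega>)\<bar>" for k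
      proof (rule AE_I2)
        fix \<omega>
        have "norm (G L \<mu> (r k) \<omega> - g' (Y \<omega>)) \<le> 2"
          using norm_triangle_ineq4[of "G L \<mu> (r k) \<omega>" "g' (Y \<omega>)"] by (simp add: G_norm g'1)
        then have "\<bar>\<Psi> (Y \<omega>)\<bar> * norm (G L \<mu> (r k) \<omega> - g' (Y \<omega>)) \<le> \<bar>\<Psi> (Y \<omega>)\<bar> * 2" by (intro mult_left_mono) auto
        then show "norm (\<bar>\<Psi> (Y \<omega>)\<bar> * norm (G L \<mu> (r k) \<omega> - g' (Y \<omega>))) \<le> 2 * \<bar>\<Psi> (Y \<omega>)\<bar>" by (simp add: abs_mult)
      qed
    qed (use \<Psi>i Rm in simp_all)
    then show ?thesis by simp
  qed
  define x where "x = (\<lambda>k. \<integral>\<omega>. of_real (?H \<omega> * Z (r k) \<omega>) * G L \<mu> (r k) \<omega> \<partial>Q)"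
  have le: "norm (x k - C) \<le> (\<integral>\<omega>. \<bar>Z (r k) \<omega> - \<Psi> (Y \<omega>)\<bar> \<partial>Q) + R k" for k
  proof -
    note Zi = all_moments_integrable[OF Z_moments, of "r k"]
    have i1: "integrable Q (\<lambda>\<omega>. of_real (?H \<omega> * Z (r k) \<omega>) * G L \<mu> (r k) \<omega>)"
      by (rule Bochner_Integration.integrable_bound[OF Zi]) (auto simp: norm_mult G_norm indicator_def)
    have i2: "integrable Q (\<lambda>\<omega>. of_real (\<Psi> (Y \<omega>)) * (of_real (?H \<omega>) * g' (Y \<omega>)))"
      by (rule Bochner_Integration.integrable_bound[OF \<Psi>i]) (auto simp: norm_mult g'1 indicator_def)
    have i3: "integrable Q (\<lambda>\<omega>. \<bar>Z (r k) \<omega> - \<Psi> (Y \<omega>)\<bar>)" using Zi \<Psi>i by simp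
    have i4: "integrable Q (\<lambda>\<omega>. \<bar>\<Psi> (Y \<omega>)\<bar> * norm (G L \<mu> (r k) \<omega> - g' (Y \<omega>)))"
    proof (rule Bochner_Integration.integrable_bound[OF integrable_mult_right[OF \<Psi>i, of 2]])
      show "AE \<omega> in Q. norm (\<bar>\<Psi> (Y \<omega>)\<bar> * norm (G L \<mu> (r k) \<omega> - g' (Y \<omega>))) \<le> norm (2 * \<Psi> (Y \<omega>))"
      proof (rule AE_I2)
        fix \<omega>
        have "norm (G L \<mu> (r k) \<omega> - g' (Y \<omega>)) \<le> 2"
          using norm_triangle_ineq4[of "G L \<mu> (r k) \<omega>" "g' (Y \<omega>)"] by (simp add: G_norm g'1)
        then have "\<bar>\<Psi> (Y \<omega>)\<bar> * norm (G L \<mu> (r k) \<omega> - g' (Y \<omega>)) \<le> \<bar>\<Psi> (Y \<omega>)\<bar> * 2" by (intro mult_left_mono) auto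
        then show "norm (\<bar>\<Psi> (Y \<omega>)\<bar> * norm (G L \<mu> (r k) \<omega> - g' (Y \<omega>))) \<le> norm (2 * \<Psi> (Y \<omega>))" by (simp add: abs_mult)
      qed
    qed (rule Rm)
    define z1 z2 where "z1 = (\<lambda>\<omega>. of_real (?H \<omega> * Z (r k) \<omega>) * G L \<mu> (r k) \<omega>)"
      and "z2 = (\<lambda>\<omega>. of_real (\<Psi> (Y \<omega>)) * (of_real (?H \<omega>) * g' (Y \<omega>)))"
    note i12 = i1[folded z1_def] i2[folded z2_def]
    have "x k - C = (\<integral>\<omega>. z1 \<omega> - z2 \<omega> \<partial>Q)"
      unfolding x_def C_def z1_def[symmetric] z2_def[symmetric]
      by (rule Bochner_Integration.integral_diff[OF i12, symmetric])
    then have "norm (x k - C) \<le> (\<integral>\<omega>. norm (z1 \<omega> - z2 \<omega>) \<partial>Q)"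
      by (simp only: integral_norm_bound)
    also have "\<dots> \<le> (\<integral>\<omega>. \<bar>Z (r k) \<omega> - \<Psi> (Y \<omega>)\<bar> + \<bar>\<Psi> (Y \<omega>)\<bar> * norm (G L \<mu> (r k) \<omega> - g' (Y \<omega>)) \<partial>Q)"
    proof (rule integral_mono)
      show "integrable Q (\<lambda>\<omega>. norm (z1 \<omega> - z2 \<omega>))"
        by (rule integrable_norm[OF Bochner_Integration.integrable_diff[OF i12]])
      show "integrable Q (\<lambda>\<omega>. \<bar>Z (r k) \<omega> - \<Psi> (Y \<omega>)\<bar> + \<bar>\<Psi> (Y \<omega>)\<bar> * norm (G L \<mu> (r k) \<omega> - g' (Y \<omega>)))"
        by (rule Bochner_Integration.integrable_add[OF i3 i4])
      fix \<omega>
      let ?z = "of_real (Z (r k) \<omega> - \<Psi> (Y \<omega>)) * G L \<mu> (r k) \<omega> + of_real (\<Psi> (Y \<omega>)) * (G L \<mu> (r k) \<omega> - g' (Y \<omega>))"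
      have 1: "z1 \<omega> - z2 \<omega> = of_real (?H \<omega>) * ?z"
        unfolding z1_def z2_def of_real_mult of_real_diff by (rule telescoped_product)
      have 2: "norm (of_real (?H \<omega>) * ?z) \<le> norm ?z"
        unfolding norm_mult by (rule mult_left_le_one_le) (simp_all add: indicator_def)
      have 3: "norm ?z \<le> \<bar>Z (r k) \<omega> - \<Psi> (Y \<omega>)\<bar> + \<bar>\<Psi> (Y \<omega>)\<bar> * norm (G L \<mu> (r k) \<omega> - g' (Y \<omega>))"
        by (rule order_trans[OF norm_triangle_ineq]) (simp only: norm_mult norm_of_real G_norm mult_1_right order_refl)
      show "norm (z1 \<omega> - z2 \<omega>) \<le> \<bar>Z (r k) \<omega> - \<Psi> (Y \<omega>)\<bar> + \<bar>\<Psi> (Y \<omega>)\<bar> * norm (G L \<mu> (r k) \<omega> - g' (Y \<omega>))"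
        unfolding 1 using 2 3 by (rule order_trans)
    qed
    also have "\<dots> = (\<integral>\<omega>. \<bar>Z (r k) \<omega> - \<Psi> (Y \<omega>)\<bar> \<partial>Q) + R k"
      unfolding R_def by (rule Bochner_Integration.integral_add[OF i3 i4])
    finally show ?thesis .
  qed
  have "(\<lambda>k. x k - C) \<longlonglongrightarrow> 0"
  proof (rule Lim_null_comparison)
    show "(\<lambda>k. (\<integral>\<omega>. \<bar>Z (r k) \<omega> - \<Psi> (Y \<omega>)\<bar> \<partial>Q) + R k) \<longlonglongrightarrow> 0" using tendsto_add[OF Zlim Rlim] by simp
  qed (use le in auto)
  then have xC: "x \<longlonglongrightarrow> C" by (simp only: LIM_zero_iff)
  have xk: "x = (\<lambda>k. complex_of_real (prob ?D * exp (- (\<Sum>i<2 ^ r k. \<Sum>p\<in>J (r k). (rounded_coeff t0 T L \<mu> (r k) i p)\<^sup>2 / 2 * \<delta> (r k)))))"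
    unfolding x_def fourier_Z[OF H Hm L] by simp
  show ?thesis using xC unfolding C[symmetric] xk g'_def .
qed

end

text \<open>
  The limit density \<open>\<Psi>\<close> turns the two laws into measures with the same Fourier transforms, because both
  transforms are limits of one deterministic sequence. Since \<open>\<Psi>\<close> is positive almost everywhere under
  both laws, it can be divided out.
\<close>

theorem girsanov_uniqueness:
  fixes v :: "'p \<Rightarrow> real \<Rightarrow> 'e \<Rightarrow> real"
  assumes 1: "observed_drift Q1 F1 t0 T w1 A1 K J E Y1 v \<alpha> \<D>"
    and 2: "observed_drift Q2 F2 t0 T w2 A2 K J E Y2 v \<alpha> \<D>"
    and \<D>: "Int_stable \<D>" "space E \<in> \<D>"
    and law: "\<And>D. D \<in> \<D> \<Longrightarrow> measure Q1 (Y1 -` D \<inter> space Q1) = measure Q2 (Y2 -` D \<inter> space Q2)"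
    and gen: "sets E = sigma_sets (space E) {D \<inter> {y\<in>space E. \<forall>x\<in>M. v (fst x) (snd x) y \<in> b x} | D M b.
       D \<in> \<D> \<and> finite M \<and> M \<subseteq> UNIV \<times> {t0..T} \<and> (\<forall>x. b x \<in> sets (borel :: real measure))}"
  shows "distr Q1 E Y1 = distr Q2 E Y2"
proof -
  interpret o1: observed_drift Q1 F1 t0 T w1 A1 K J E Y1 v \<alpha> \<D> by (rule 1)
  interpret o2: observed_drift Q2 F2 t0 T w2 A2 K J E Y2 v \<alpha> \<D> by (rule 2)
  define N where "N = (\<lambda>j::bool. if j then distr Q1 E Y1 else distr Q2 E Y2)"
  have sN: "sets (N j) = sets E" for j by (simp add: N_def)
  have spN: "space (N j) = space E" for j by (simp add: N_def)
  obtain r :: "nat \<Rightarrow> nat" and \<Psi> where r: "strict_mono r" and \<Psi>: "\<Psi> \<in> borel_measurable E"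
    "\<And>j. integrable (N j) \<Psi>" "\<And>j. AE y in N j. (\<lambda>k. o1.\<Phi> (r k) y) \<longlonglongrightarrow> \<Psi> y"
    "\<And>j. (\<lambda>k. \<integral>y. \<bar>o1.\<Phi> (r k) y - \<Psi> y\<bar> \<partial>N j) \<longlonglongrightarrow> 0"
  proof (rule common_L1_limit[of N E "UNIV :: bool set" o1.\<Phi>])
    show "integrable (N j) (o1.\<Phi> n)" for j n using o1.\<Phi>_integrable o2.\<Phi>_integrable by (simp add: N_def)
    show "\<exists>M. \<forall>n\<ge>M. \<forall>n'\<ge>n. (\<integral>y. \<bar>o1.\<Phi> n y - o1.\<Phi> n' y\<bar> \<partial>N j) < \<epsilon>" if "\<epsilon> > 0" for j \<epsilon>
      using o1.\<Phi>_Cauchy[OF that] o2.\<Phi>_Cauchy[OF that] by (simp add: N_def)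
  qed (use sN in auto)
  have pos: "AE y in N j. \<Psi> y > 0" for j
  proof (rule positive_limit[where \<Phi>="\<lambda>k. o1.\<Phi> (r k)" and C="exp (K * (T - t0))"])
    show "integrable (N j) (\<lambda>y. 1 / o1.\<Phi> (r k) y)" for k using o1.\<Phi>_inverse(1) o2.\<Phi>_inverse(1) by (simp add: N_def)
    show "(\<integral>y. 1 / o1.\<Phi> (r k) y \<partial>N j) \<le> exp (K * (T - t0))" for k using o1.\<Phi>_inverse(2) o2.\<Phi>_inverse(2) by (simp add: N_def)
    show "o1.\<Phi> (r k) \<in> borel_measurable (N j)" for k by (simp add: N_def)
  qed (use \<Psi> o1.\<Phi>_pos in auto)
  have \<Psi>N[measurable]: "\<Psi> \<in> borel_measurable (N j)" for j using \<Psi>(1) by (simp add: N_def)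
  define N' where "N' = (\<lambda>j. density (N j) (\<lambda>y. ennreal (\<Psi> y)))"
  have sN': "sets (N' j) = sets E" "space (N' j) = space E" for j by (simp_all add: N'_def sN spN)
  have fin: "finite_measure (N' j)" for j
  proof (rule finite_measureI)
    have "emeasure (N' j) (space (N' j)) = (\<integral>\<^sup>+y. ennreal (\<Psi> y) \<partial>N j)"
      unfolding N'_def by (simp add: emeasure_density cong: nn_integral_cong)
    also have "\<dots> = ennreal (\<integral>y. \<Psi> y \<partial>N j)"
      using pos[of j] by (intro nn_integral_eq_integral \<Psi>) auto
    finally show "emeasure (N' j) (space (N' j)) \<noteq> \<infinity>" by simp
  qed
  interpret fp: fourier_pair "N' True" "N' False" "UNIV \<times> {t0..T}" "\<lambda>x. v (fst x) (snd x)" \<D>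
  proof (rule fourier_pair.intro)
    show "sets (N' True) = sets (N' False)" by (simp add: sN')
    show "v (fst x) (snd x) \<in> borel_measurable (N' True)" if "x \<in> UNIV \<times> {t0..T}" for x
    proof -
      have "v (fst x) (snd x) \<in> borel_measurable E" using that by (intro o1.v_meas) auto
      then show ?thesis by (simp add: N'_def N_def)
    qed
    show "\<D> \<subseteq> sets (N' True)" "Int_stable \<D>" "space (N' True) \<in> \<D>" using o1.\<D> \<D> by (auto simp: sN')
    fix D :: "'e set" and L :: "('p \<times> real) set" and \<mu> :: "'p \<times> real \<Rightarrow> real"
    assume D: "D \<in> \<D>" and L: "finite L" "L \<subseteq> UNIV \<times> {t0..T}"
    have L': "snd ` L \<subseteq> {t0..T}" using L by auto
    have Ds[measurable]: "D \<in> sets E" using D o1.\<D> by auto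
    have sm: "(\<lambda>y. \<Sum>x\<in>L. \<mu> x * v (fst x) (snd x) y) \<in> borel_measurable E"
      using L by (intro borel_measurable_sum borel_measurable_times borel_measurable_const o1.v_meas) auto
    define h where "h = (\<lambda>y. complex_of_real (indicator D y) * iexp (\<Sum>x\<in>L. \<mu> x * v (fst x) (snd x) y))"
    have h: "h \<in> borel_measurable E" unfolding h_def using sm by measurable
    have hN: "h \<in> borel_measurable (N j)" for j using h by (simp add: N_def)
    have I: "(\<integral>y. h y \<partial>N' j) = (\<integral>y. of_real (\<Psi> y) * h y \<partial>N j)" for j
    proof -
      have "(\<integral>y. h y \<partial>N' j) = (\<integral>y. \<Psi> y *\<^sub>R h y \<partial>N j)" unfolding N'_def
        using pos[of j] by (intro integral_density hN \<Psi>N) auto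
      then show ?thesis by (simp add: scaleR_conv_of_real)
    qed
    have "(\<integral>y. of_real (\<Psi> y) * h y \<partial>N True) = (\<integral>y. of_real (\<Psi> y) * h y \<partial>N False)"
    proof (rule LIMSEQ_unique)
      show "(\<lambda>k. complex_of_real (measure Q1 (Y1 -` D \<inter> space Q1) *
        exp (- (\<Sum>i<2 ^ r k. \<Sum>p\<in>J (r k). (rounded_coeff t0 T L \<mu> (r k) i p)\<^sup>2 / 2 * mesh t0 T (r k))))) \<longlonglongrightarrow>
        (\<integral>y. of_real (\<Psi> y) * h y \<partial>N True)"
        using o1.fourier_limit[OF \<Psi>(1) _ r _ D L(1) L', of \<mu>] \<Psi>(2)[of True] \<Psi>(4)[of True]
        by (simp add: N_def h_def)
      show "(\<lambda>k. complex_of_real (measure Q1 (Y1 -` D \<inter> space Q1) *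
        exp (- (\<Sum>i<2 ^ r k. \<Sum>p\<in>J (r k). (rounded_coeff t0 T L \<mu> (r k) i p)\<^sup>2 / 2 * mesh t0 T (r k))))) \<longlonglongrightarrow>
        (\<integral>y. of_real (\<Psi> y) * h y \<partial>N False)"
        using o2.fourier_limit[OF \<Psi>(1) _ r _ D L(1) L', of \<mu>] \<Psi>(2)[of False] \<Psi>(4)[of False] law[OF D]
        by (simp add: N_def h_def)
    qed
    then have "(\<integral>y. h y \<partial>N' True) = (\<integral>y. h y \<partial>N' False)" by (simp only: I)
    then show "(\<integral>y. of_real (indicator D y) * iexp (\<Sum>x\<in>L. \<mu> x * v (fst x) (snd x) y) \<partial>N' True) =
        (\<integral>y. of_real (indicator D y) * iexp (\<Sum>x\<in>L. \<mu> x * v (fst x) (snd x) y) \<partial>N' False)"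
      by (simp only: h_def)
  qed (rule fin fin[of False])+
  have "N' True = N' False"
    by (rule fp.measures_eq) (simp add: sN' gen fp.cylinders_def fp.cylset_def)
  moreover have "N j = density (N' j) (\<lambda>y. ennreal (1 / \<Psi> y))" for j
  proof -
    have "density (N' j) (\<lambda>y. ennreal (1 / \<Psi> y)) = density (N j) (\<lambda>y. ennreal (\<Psi> y) * ennreal (1 / \<Psi> y))"
      unfolding N'_def by (rule density_density_eq) measurable
    also have "\<dots> = density (N j) (\<lambda>_. 1)"
    proof (rule density_cong)
      show "AE y in N j. ennreal (\<Psi> y) * ennreal (1 / \<Psi> y) = 1" using pos[of j]
      proof eventually_elim
        case (elim y)
        have "ennreal (\<Psi> y) * ennreal (1 / \<Psi> y) = ennreal (\<Psi> y * (1 / \<Psi> y))" using elim by (intro ennreal_mult[symmetric]) auto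
        then show ?case using elim by simp
      qed
    qed measurable
    finally show ?thesis by (simp add: density_1)
  qed
  ultimately have "N True = N False" by metis
  then show ?thesis by (simp add: N_def)
qed

section \<open>Borel sigma-algebras of second countable spaces\<close>

lemma space_borel_of [simp]: "space (borel_of S) = topspace S"
  unfolding borel_of_def by (rule space_measure_of_conv)

lemma sets_borel_of: "sets (borel_of S) = sigma_sets (topspace S) {U. openin S U}"
  unfolding borel_of_def by (rule sets_measure_of) (auto dest: openin_subset)

lemma openin_sets_borel_of: "openin S U \<Longrightarrow> U \<in> sets (borel_of S)"
  unfolding sets_borel_of by (rule sigma_sets.Basic) simp

lemma borel_of_euclidean: "sets (borel_of euclidean) = sets borel"
  by (simp add: sets_borel_of borel_def)

lemma measurable_borel_ofI:
  assumes "\<And>\<omega>. \<omega> \<in> space M \<Longrightarrow> f \<omega> \<in> topspace S" "\<And>U. openin S U \<Longrightarrow> f -` U \<inter> space M \<in> sets M"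
  shows "f \<in> measurable M (borel_of S)"
  unfolding borel_of_def using assms by (intro measurable_measure_of) (auto dest: openin_subset)

lemma measurable_borel_of_continuous:
  assumes "continuous_map S S' f"
  shows "f \<in> measurable (borel_of S) (borel_of S')"
proof (rule measurable_borel_ofI)
  show "\<omega> \<in> space (borel_of S) \<Longrightarrow> f \<omega> \<in> topspace S'" for \<omega>
    using assms by (simp add: continuous_map_def Pi_iff)
  fix U assume "openin S' U"
  then have "openin S {x \<in> topspace S. f x \<in> U}" using assms by (rule openin_continuous_map_preimage[rotated])
  moreover have "f -` U \<inter> space (borel_of S) = {x \<in> topspace S. f x \<in> U}" by auto
  ultimately show "f -` U \<inter> space (borel_of S) \<in> sets (borel_of S)" using openin_sets_borel_of by metis
qed

lemma measurable_borel_continuous: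
  assumes "continuous_map S euclidean f"
  shows "f \<in> borel_measurable (borel_of S)"
  using measurable_borel_of_continuous[OF assms] measurable_cong_sets[OF refl borel_of_euclidean] by blast

lemma second_countableE:
  assumes "second_countable S"
  obtains \<B> where "countable \<B>" "\<forall>V\<in>\<B>. openin S V" "\<forall>U x. openin S U \<and> x \<in> U \<longrightarrow> (\<exists>V\<in>\<B>. x \<in> V \<and> V \<subseteq> U)"
  using assms unfolding second_countable_def by (elim exE conjE) (rule that)

lemma second_countableI:
  assumes "countable \<B>" "\<And>V. V \<in> \<B> \<Longrightarrow> openin S V" "\<And>U x. openin S U \<Longrightarrow> x \<in> U \<Longrightarrow> \<exists>V\<in>\<B>. x \<in> V \<and> V \<subseteq> U"
  shows "second_countable S"
  unfolding second_countable_def by (intro exI[of _ \<B>] conjI ballI allI impI) (use assms in simp_all)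

lemma measurable_borel_of_basis:
  assumes \<B>: "countable \<B>" "\<And>U x. openin S U \<Longrightarrow> x \<in> U \<Longrightarrow> \<exists>V\<in>\<B>. x \<in> V \<and> V \<subseteq> U"
    and f: "\<And>\<omega>. \<omega> \<in> space M \<Longrightarrow> f \<omega> \<in> topspace S" "\<And>V. V \<in> \<B> \<Longrightarrow> f -` V \<inter> space M \<in> sets M"
  shows "f \<in> measurable M (borel_of S)"
proof (rule measurable_borel_ofI[OF f(1)])
  fix U assume "openin S U"
  then have "U = \<Union>{V\<in>\<B>. V \<subseteq> U}" using \<B>(2) by blast
  then have "f -` U \<inter> space M = (\<Union>V\<in>{V\<in>\<B>. V \<subseteq> U}. f -` V \<inter> space M)" by blast
  also have "\<dots> \<in> sets M" using \<B>(1) f(2) by (intro sets.countable_UN') auto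
  finally show "f -` U \<inter> space M \<in> sets M" .
qed

lemma prod_topology_basis:
  assumes "countable \<B>" "\<And>V. V \<in> \<B> \<Longrightarrow> openin X V" "\<And>U x. openin X U \<Longrightarrow> x \<in> U \<Longrightarrow> \<exists>V\<in>\<B>. x \<in> V \<and> V \<subseteq> U"
    and "countable \<C>" "\<And>V. V \<in> \<C> \<Longrightarrow> openin Y V" "\<And>U x. openin Y U \<Longrightarrow> x \<in> U \<Longrightarrow> \<exists>V\<in>\<C>. x \<in> V \<and> V \<subseteq> U"
  defines "\<E> \<equiv> (\<lambda>(V, W). V \<times> W) ` (\<B> \<times> \<C>)"
  shows "countable \<E>" "\<And>V. V \<in> \<E> \<Longrightarrow> openin (prod_topology X Y) V"
    "\<And>U z. openin (prod_topology X Y) U \<Longrightarrow> z \<in> U \<Longrightarrow> \<exists>V\<in>\<E>. z \<in> V \<and> V \<subseteq> U"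
proof -
  show "countable \<E>" unfolding \<E>_def using assms by (intro countable_image countable_SIGMA) auto
  show "openin (prod_topology X Y) V" if "V \<in> \<E>" for V
    using that assms by (auto simp: \<E>_def openin_prod_Times_iff)
  fix U z assume U: "openin (prod_topology X Y) U" "z \<in> U"
  obtain x y where z: "z = (x, y)" by force
  have "\<exists>V W. openin X V \<and> openin Y W \<and> x \<in> V \<and> y \<in> W \<and> V \<times> W \<subseteq> U"
    using iffD1[OF openin_prod_topology_alt U(1), THEN spec, THEN spec, of x y] U(2) z by blast
  then obtain V W where VW: "openin X V" "openin Y W" "x \<in> V" "y \<in> W" "V \<times> W \<subseteq> U" by blast
  obtain V' where V': "V' \<in> \<B>" "x \<in> V'" "V' \<subseteq> V" using assms(3)[OF VW(1,3)] by blast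
  obtain W' where W': "W' \<in> \<C>" "y \<in> W'" "W' \<subseteq> W" using assms(6)[OF VW(2,4)] by blast
  have "V' \<times> W' \<in> \<E>" unfolding \<E>_def using V' W' by auto
  moreover have "z \<in> V' \<times> W'" using V' W' z by simp
  moreover have "V' \<times> W' \<subseteq> U" using Sigma_mono[OF V'(3) W'(3)] VW(5) by (rule order_trans)
  ultimately show "\<exists>V\<in>\<E>. z \<in> V \<and> V \<subseteq> U" by (intro bexI[of _ "V' \<times> W'"] conjI)
qed

lemma second_countable_prod_topology:
  assumes "second_countable X" "second_countable Y"
  shows "second_countable (prod_topology X Y)"
proof -
  obtain \<B> where B0: "countable \<B>" "\<forall>V\<in>\<B>. openin X V" "\<forall>U x. openin X U \<and> x \<in> U \<longrightarrow> (\<exists>V\<in>\<B>. x \<in> V \<and> V \<subseteq> U)"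
    by (rule second_countableE[OF assms(1)])
  note B = B0(1) B0(2)[rule_format] B0(3)[rule_format, OF conjI]
  obtain \<C> where C0: "countable \<C>" "\<forall>V\<in>\<C>. openin Y V" "\<forall>U x. openin Y U \<and> x \<in> U \<longrightarrow> (\<exists>V\<in>\<C>. x \<in> V \<and> V \<subseteq> U)"
    by (rule second_countableE[OF assms(2)])
  note C = C0(1) C0(2)[rule_format] C0(3)[rule_format, OF conjI]
  show ?thesis by (rule second_countableI[OF prod_topology_basis[OF B C]])
qed

lemma measurable_borel_of_prod:
  assumes "second_countable X" "second_countable Y"
    and f: "f \<in> measurable M (borel_of X)" and g: "g \<in> measurable M (borel_of Y)"
  shows "(\<lambda>\<omega>. (f \<omega>, g \<omega>)) \<in> measurable M (borel_of (prod_topology X Y))"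
proof -
  obtain \<B> where B0: "countable \<B>" "\<forall>V\<in>\<B>. openin X V" "\<forall>U x. openin X U \<and> x \<in> U \<longrightarrow> (\<exists>V\<in>\<B>. x \<in> V \<and> V \<subseteq> U)"
    by (rule second_countableE[OF assms(1)])
  note B = B0(1) B0(2)[rule_format] B0(3)[rule_format, OF conjI]
  obtain \<C> where C0: "countable \<C>" "\<forall>V\<in>\<C>. openin Y V" "\<forall>U x. openin Y U \<and> x \<in> U \<longrightarrow> (\<exists>V\<in>\<C>. x \<in> V \<and> V \<subseteq> U)"
    by (rule second_countableE[OF assms(2)])
  note C = C0(1) C0(2)[rule_format] C0(3)[rule_format, OF conjI]
  show ?thesis
  proof (rule measurable_borel_of_basis[OF prod_topology_basis(1,3)[OF B C]])
    show "(f \<omega>, g \<omega>) \<in> topspace (prod_topology X Y)" if "\<omega> \<in> space M" for \<omega>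
      using measurable_space[OF f that] measurable_space[OF g that] by simp
    fix V assume "V \<in> (\<lambda>(V, W). V \<times> W) ` (\<B> \<times> \<C>)"
    then obtain V1 V2 where V: "V = V1 \<times> V2" "V1 \<in> \<B>" "V2 \<in> \<C>" by auto
    have "(\<lambda>\<omega>. (f \<omega>, g \<omega>)) -` V \<inter> space M = (f -` V1 \<inter> space M) \<inter> (g -` V2 \<inter> space M)" using V by auto
    also have "\<dots> \<in> sets M" using V B C
      by (intro sets.Int measurable_sets[OF f] measurable_sets[OF g] openin_sets_borel_of) auto
    finally show "(\<lambda>\<omega>. (f \<omega>, g \<omega>)) -` V \<inter> space M \<in> sets M" .
  qed
qed

text \<open>
  Finite lists of pairs \<open>(i, V)\<close> describe the basic open sets of the product; there are only countably
  many when \<open>V\<close> ranges over a countable basis.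
\<close>

lemma product_topology_basis:
  fixes X :: "'a topology"
  assumes "countable \<B>" "\<And>V. V \<in> \<B> \<Longrightarrow> openin X V" "\<And>U x. openin X U \<Longrightarrow> x \<in> U \<Longrightarrow> \<exists>V\<in>\<B>. x \<in> V \<and> V \<subseteq> U"
  defines "\<E> \<equiv> (\<lambda>l::(nat \<times> 'a set) list. {x. (\<forall>i. x i \<in> topspace X) \<and> (\<forall>(i, V)\<in>set l. x i \<in> V)}) ` lists (UNIV \<times> \<B>)"
  shows "countable \<E>" "\<And>V. V \<in> \<E> \<Longrightarrow> openin (product_topology (\<lambda>_. X) UNIV) V"
    "\<And>U z. openin (product_topology (\<lambda>_. X) UNIV) U \<Longrightarrow> z \<in> U \<Longrightarrow> \<exists>V\<in>\<E>. z \<in> V \<and> V \<subseteq> U"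
proof -
  show "countable \<E>" unfolding \<E>_def using assms by (intro countable_image countable_lists countable_SIGMA) auto
  show "openin (product_topology (\<lambda>_. X) UNIV) V" if V: "V \<in> \<E>" for V
  proof -
    from V obtain l where l: "l \<in> lists (UNIV \<times> \<B>)" "V = {x. (\<forall>i. x i \<in> topspace X) \<and> (\<forall>(i, V)\<in>set l. x i \<in> V)}"
      unfolding \<E>_def by auto
    let ?P = "product_topology (\<lambda>_::nat. X) UNIV"
    have top: "topspace ?P = {x. \<forall>i. x i \<in> topspace X}" by (auto simp: PiE_def)
    have "V = topspace ?P \<inter> \<Inter>((\<lambda>(i, V). {x\<in>topspace ?P. x i \<in> V}) ` set l)"
      unfolding l(2) top by auto
    also have "openin ?P \<dots>"
    proof (cases "l = []")
      case False
      have "openin ?P {x\<in>topspace ?P. x i \<in> V}" if "(i, V) \<in> set l" for i V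
        using l(1) that assms(2)
        by (intro openin_continuous_map_preimage[OF continuous_map_product_projection]) auto
      then show ?thesis using False by (intro openin_Int openin_topspace openin_Inter) auto
    next
      case True
      then show ?thesis using openin_topspace[of ?P] by simp
    qed
    finally show ?thesis .
  qed
  fix U and z :: "nat \<Rightarrow> 'a" assume U: "openin (product_topology (\<lambda>_. X) UNIV) U" "z \<in> U"
  from product_topology_open_contains_basis[OF this] obtain V where
    V0: "z \<in> (\<Pi>\<^sub>E i\<in>UNIV. V i) \<and> (\<forall>i. openin X (V i)) \<and> finite {i. V i \<noteq> topspace X} \<and> (\<Pi>\<^sub>E i\<in>UNIV. V i) \<subseteq> U"
    by (rule exE)
  then have V: "z \<in> (\<Pi>\<^sub>E i\<in>UNIV. V i)" "openin X (V i)" "finite {i. V i \<noteq> topspace X}" "(\<Pi>\<^sub>E i\<in>UNIV. V i) \<subseteq> U" for i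
    by simp_all
  have zV: "z i \<in> V i" for i using V(1) by auto
  have "\<exists>W\<in>\<B>. z i \<in> W \<and> W \<subseteq> V i" for i using assms(3)[OF V(2) zV] .
  then obtain W where W: "\<And>i. W i \<in> \<B>" "\<And>i. z i \<in> W i" "\<And>i. W i \<subseteq> V i" by metis
  obtain js where js: "set js = {i. V i \<noteq> topspace X}" using finite_list[OF V(3)] by blast
  let ?l = "map (\<lambda>i. (i, W i)) js"
  let ?E = "{x. (\<forall>i. x i \<in> topspace X) \<and> (\<forall>(i, V)\<in>set ?l. x i \<in> V)}"
  have "?E \<in> \<E>" unfolding \<E>_def using W by (intro imageI) auto
  moreover have "z \<in> ?E"
  proof -
    have "z i \<in> topspace X" for i by (rule subsetD[OF openin_subset[OF V(2)] zV])
    then show ?thesis using W(2) by auto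
  qed
  moreover have "?E \<subseteq> U"
  proof
    fix x assume x: "x \<in> ?E"
    have "x i \<in> V i" for i
    proof (cases "V i = topspace X")
      case False
      then have "i \<in> set js" using js by simp
      then have "(i, W i) \<in> set ?l" by simp
      moreover have "\<forall>(i, V)\<in>set ?l. x i \<in> V" using x unfolding mem_Collect_eq by (rule conjunct2)
      ultimately have "x i \<in> W i" by fast
      then show ?thesis by (rule subsetD[OF W(3)])
    qed (use x in auto)
    then have "x \<in> (\<Pi>\<^sub>E i\<in>UNIV. V i)" by (intro PiE_I) simp_all
    then show "x \<in> U" by (rule subsetD[OF V(4)])
  qed
  ultimately show "\<exists>V\<in>\<E>. z \<in> V \<and> V \<subseteq> U" by (intro bexI[of _ ?E] conjI)
qed

lemma second_countable_product_topology:
  assumes "second_countable X"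
  shows "second_countable (product_topology (\<lambda>_::nat. X) UNIV)"
proof -
  obtain \<B> where B0: "countable \<B>" "\<forall>V\<in>\<B>. openin X V" "\<forall>U x. openin X U \<and> x \<in> U \<longrightarrow> (\<exists>V\<in>\<B>. x \<in> V \<and> V \<subseteq> U)"
    by (rule second_countableE[OF assms(1)])
  note B = B0(1) B0(2)[rule_format] B0(3)[rule_format, OF conjI]
  show ?thesis by (rule second_countableI[OF product_topology_basis[OF B]])
qed

text \<open>
  For second countable factors the Borel sigma-algebra of a countable product is the product
  sigma-algebra.
\<close>

lemma measurable_borel_of_product:
  fixes X :: "'a topology" and M :: "'w measure"
  assumes "second_countable X" and f: "\<And>i::nat. f i \<in> measurable M (borel_of X)"
  shows "(\<lambda>\<omega> i. f i \<omega>) \<in> measurable M (borel_of (product_topology (\<lambda>_. X) UNIV))"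
proof -
  obtain \<B> where B0: "countable \<B>" "\<forall>V\<in>\<B>. openin X V" "\<forall>U x. openin X U \<and> x \<in> U \<longrightarrow> (\<exists>V\<in>\<B>. x \<in> V \<and> V \<subseteq> U)"
    by (rule second_countableE[OF assms(1)])
  note B = B0(1) B0(2)[rule_format] B0(3)[rule_format, OF conjI]
  have fs: "f i \<omega> \<in> topspace X" if "\<omega> \<in> space M" for i \<omega> using measurable_space[OF f that] by simp
  show ?thesis
  proof (rule measurable_borel_of_basis[OF product_topology_basis(1,3)[OF B]])
    show "(\<lambda>i. f i \<omega>) \<in> topspace (product_topology (\<lambda>_. X) UNIV)" if "\<omega> \<in> space M" for \<omega>
      using fs[OF that] by auto
    fix V assume "V \<in> (\<lambda>l::(nat \<times> 'a set) list. {x. (\<forall>i. x i \<in> topspace X) \<and> (\<forall>(i, V)\<in>set l. x i \<in> V)}) ` lists (UNIV \<times> \<B>)"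
    then obtain l where l: "l \<in> lists (UNIV \<times> \<B>)" "V = {x. (\<forall>i. x i \<in> topspace X) \<and> (\<forall>(i, V)\<in>set l. x i \<in> V)}" by auto
    have "(\<lambda>\<omega> i. f i \<omega>) -` V \<inter> space M = {\<omega>\<in>space M. \<forall>z\<in>set l. f (fst z) \<omega> \<in> snd z}"
      unfolding l(2) using fs by (auto simp: case_prod_beta)
    also have "\<dots> \<in> sets M"
    proof (rule sets.sets_Collect_finite_All)
      fix z assume z: "z \<in> set l"
      have "f (fst z) -` snd z \<inter> space M \<in> sets M"
        using l(1) z B(2) by (intro measurable_sets[OF f] openin_sets_borel_of) auto
      moreover have "f (fst z) -` snd z \<inter> space M = {\<omega>\<in>space M. f (fst z) \<omega> \<in> snd z}" by auto
      ultimately show "{\<omega>\<in>space M. f (fst z) \<omega> \<in> snd z} \<in> sets M" by simp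
    qed simp
    finally show "(\<lambda>\<omega> i. f i \<omega>) -` V \<inter> space M \<in> sets M" .
  qed
qed

section \<open>The path space\<close>

lemma topspace_path_topology: "topspace (path_topology T) = {f. f \<in> extensional {0..T} \<and> continuous_on {0..T} f}"
proof -
  have "compactin (top_of_set {0..T}) (topspace (top_of_set {0..T}))"
    by (simp add: compactin_subtopology)
  then have "mspace (cfunspace (top_of_set {0..T}) euclidean_metric) = {f. f \<in> extensional {0..T} \<and> continuous_on {0..T} f}"
    by (subst compactin_mspace_cfunspace) auto
  then show ?thesis by (simp add: path_topology_def)
qed

lemma path_metric_le:
  assumes "T > 0" "f \<in> topspace (path_topology T)" "h \<in> topspace (path_topology T)"
  shows "mdist (cfunspace (top_of_set {0..T}) euclidean_metric) f h \<le> a \<longleftrightarrow> (\<forall>t\<in>{0..T}. dist (f t) (h t) \<le> a)"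
proof -
  have "{0..T} \<noteq> {}" using assms by simp
  then show ?thesis using assms(2,3) cfunspace_mdist_le[of f "top_of_set {0..T}" euclidean_metric h a]
    unfolding path_topology_def topspace_mtopology_of by simp
qed

lemma path_open_ball:
  assumes U: "openin (path_topology T) U" and f: "f \<in> U"
  obtains r where "r > 0" "\<forall>h\<in>topspace (path_topology T). mdist (cfunspace (top_of_set {0..T}) euclidean_metric) f h < r \<longrightarrow> h \<in> U"
proof -
  let ?m = "cfunspace (top_of_set {0..T}) euclidean_metric :: (real \<Rightarrow> real ^ 'a) metric"
  interpret Metric_space "mspace ?m" "mdist ?m" by (rule Metric_space_mspace_mdist)
  have "openin mtopology U" using U by (simp add: path_topology_def mtopology_of_def)
  then obtain r where r: "r > 0" "mball f r \<subseteq> U" "U \<subseteq> mspace ?m" using f unfolding openin_mtopology by blast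
  show thesis
  proof (rule that[OF r(1)])
    have "h \<in> mball f r" if "h \<in> topspace (path_topology T)" "mdist ?m f h < r" for h
      using f r that by (auto simp: in_mball path_topology_def simp del: mspace_cfunspace)
    then show "\<forall>h\<in>topspace (path_topology T). mdist ?m f h < r \<longrightarrow> h \<in> U" using r by blast
  qed
qed

lemma path_ball_open:
  assumes "c \<in> topspace (path_topology T)"
  shows "openin (path_topology T) {h\<in>topspace (path_topology T). mdist (cfunspace (top_of_set {0..T}) euclidean_metric) c h < r}"
proof -
  let ?m = "cfunspace (top_of_set {0..T}) euclidean_metric :: (real \<Rightarrow> real ^ 'a) metric"
  interpret Metric_space "mspace ?m" "mdist ?m" by (rule Metric_space_mspace_mdist)
  have "mball c r = {h\<in>topspace (path_topology T). mdist ?m c h < r}"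
    using assms by (auto simp: in_mball path_topology_def simp del: mspace_cfunspace)
  then show ?thesis using openin_mball[of c r] by (simp add: path_topology_def mtopology_of_def)
qed

text \<open>
  A path is coded by a number \<open>n\<close> of time steps, taken from its modulus of continuity, and by its values
  at these times rounded to multiples of \<open>\<eta>\<close>. There are countably many codes and two paths with the same
  code are \<open>\<epsilon>\<close>-close, so one path per code suffices.
\<close>

lemma path_separable:
  assumes T: "T > 0" and e: "\<epsilon> > 0"
  shows "\<exists>C. countable C \<and> C \<subseteq> topspace (path_topology T) \<and>
    (\<forall>f\<in>topspace (path_topology T :: (real \<Rightarrow> real ^ 'n::finite) topology). \<exists>c\<in>C. \<forall>t\<in>{0..T}. dist (c t) (f t) \<le> \<epsilon>)"
proof -
  let ?X = "topspace (path_topology T) :: (real \<Rightarrow> real ^ 'n) set"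
  define \<eta> where "\<eta> = \<epsilon> / (3 * real CARD('n))"
  have \<eta>: "\<eta> > 0" using e by (simp add: \<eta>_def)
  have "\<exists>n::nat. n > 0 \<and> (\<forall>t\<in>{0..T}. \<forall>u\<in>{0..T}. \<bar>t - u\<bar> \<le> T / real n \<longrightarrow> dist (f t) (f u) \<le> \<epsilon> / 3)" if f: "f \<in> ?X" for f
  proof -
    have "uniformly_continuous_on {0..T} f"
      using f by (intro compact_uniformly_continuous) (auto simp: topspace_path_topology)
    then obtain d where d: "d > 0" "\<And>t u. t \<in> {0..T} \<Longrightarrow> u \<in> {0..T} \<Longrightarrow> dist u t < d \<Longrightarrow> dist (f u) (f t) < \<epsilon> / 3"
      using e unfolding uniformly_continuous_on_def by (metis zero_less_divide_iff zero_less_numeral)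
    obtain n :: nat where n: "T / d < real n" using reals_Archimedean2 by blast
    have n0: "n > 0" using n T d by (metis gr0I divide_pos_pos less_asym of_nat_0)
    have "T / real n < d" using n n0 d by (simp add: divide_less_eq mult.commute)
    then show ?thesis using d(2) n0 by (intro exI[of _ n]) (force simp: dist_real_def intro: less_imp_le)
  qed
  then obtain n where n: "\<And>f. f \<in> ?X \<Longrightarrow> n f > (0::nat)"
    "\<And>f t u. f \<in> ?X \<Longrightarrow> t \<in> {0..T} \<Longrightarrow> u \<in> {0..T} \<Longrightarrow> \<bar>t - u\<bar> \<le> T / real (n f) \<Longrightarrow> dist (f t) (f u) \<le> \<epsilon> / 3"
    by metis
  define code :: "(real \<Rightarrow> real ^ 'n) \<Rightarrow> nat \<times> ('n \<Rightarrow> int) list" where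
    "code = (\<lambda>f. (n f, map (\<lambda>k i. \<lfloor>f (real k * T / real (n f)) $ i / \<eta>\<rfloor>) [0..<Suc (n f)]))"
  have close: "dist (f t) (h t) \<le> \<epsilon>" if f: "f \<in> ?X" and h: "h \<in> ?X" and eq: "code f = code h" and t: "t \<in> {0..T}" for f h t
  proof -
    let ?n = "n f"
    have nn: "n h = ?n" using eq by (simp add: code_def)
    have n0: "real ?n > 0" using n(1)[OF f] by simp
    define k where "k = nat \<lfloor>t * real ?n / T\<rfloor>"
    have q0: "t * real ?n / T \<ge> 0" using t T by simp
    have kr: "real k = of_int \<lfloor>t * real ?n / T\<rfloor>" using q0 by (simp add: k_def)
    have k1: "real k \<le> t * real ?n / T" "t * real ?n / T < real k + 1" unfolding kr by linarith+
    have "t * real ?n / T \<le> real ?n" using t T n0 by (simp add: divide_le_eq mult.commute)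
    then have kn: "k \<le> ?n" using k1 by linarith
    let ?u = "real k * T / real ?n"
    have u: "?u \<in> {0..T}" using T n0 kn by (auto simp: divide_le_eq mult.commute)
    have "real k * T \<le> t * real ?n" "t * real ?n < (real k + 1) * T"
      using k1 T by (simp_all add: pos_le_divide_eq pos_divide_less_eq)
    then have "?u \<le> t" "t \<le> ?u + T / real ?n" using n0 by (simp_all add: field_simps)
    then have tu: "\<bar>t - ?u\<bar> \<le> T / real ?n" by linarith
    have "map (\<lambda>k i. \<lfloor>f (real k * T / real ?n) $ i / \<eta>\<rfloor>) [0..<Suc ?n] = map (\<lambda>k i. \<lfloor>h (real k * T / real ?n) $ i / \<eta>\<rfloor>) [0..<Suc ?n]"
      using eq nn by (simp only: code_def prod.inject)
    then have "map (\<lambda>k i. \<lfloor>f (real k * T / real ?n) $ i / \<eta>\<rfloor>) [0..<Suc ?n] ! k = map (\<lambda>k i. \<lfloor>h (real k * T / real ?n) $ i / \<eta>\<rfloor>) [0..<Suc ?n] ! k"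
      by (rule arg_cong[where f="\<lambda>l. l ! k"])
    then have fl: "(\<lambda>i. \<lfloor>f ?u $ i / \<eta>\<rfloor>) = (\<lambda>i. \<lfloor>h ?u $ i / \<eta>\<rfloor>)" using kn by (simp del: upt_Suc)
    have comp: "\<bar>f ?u $ i - h ?u $ i\<bar> \<le> \<eta>" for i
    proof -
      have "\<lfloor>f ?u $ i / \<eta>\<rfloor> = \<lfloor>h ?u $ i / \<eta>\<rfloor>" using fun_cong[OF fl] .
      then have "\<bar>f ?u $ i / \<eta> - h ?u $ i / \<eta>\<bar> \<le> 1" by linarith
      then have "\<bar>(f ?u $ i - h ?u $ i) / \<eta>\<bar> \<le> 1" by (simp add: diff_divide_distrib)
      then show ?thesis using \<eta> by (simp add: abs_divide divide_le_eq)
    qed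
    have "dist (f ?u) (h ?u) \<le> (\<Sum>i\<in>UNIV. \<bar>(f ?u - h ?u) $ i\<bar>)" unfolding dist_norm by (rule norm_le_l1_cart)
    also have "\<dots> \<le> (\<Sum>i\<in>(UNIV :: 'n set). \<eta>)" using comp by (intro sum_mono) simp
    also have "\<dots> = \<epsilon> / 3" by (simp add: \<eta>_def)
    finally have a: "dist (f ?u) (h ?u) \<le> \<epsilon> / 3" .
    have "dist (f t) (f ?u) \<le> \<epsilon> / 3" "dist (h t) (h ?u) \<le> \<epsilon> / 3"
      using n(2)[OF f t u tu] n(2)[OF h t u] tu nn by auto
    with a show ?thesis using dist_triangle[of "f t" "h t" "f ?u"] dist_triangle[of "f ?u" "h t" "h ?u"]
      by (simp add: dist_commute)
  qed
  define rep where "rep = inv_into ?X code"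
  show ?thesis
  proof (intro exI[of _ "rep ` (code ` ?X)"] conjI ballI)
    show "countable (rep ` (code ` ?X))" by (rule countable_image[OF countableI_type])
    show "rep ` (code ` ?X) \<subseteq> ?X" by (auto simp: rep_def inv_into_into)
    fix f assume f: "f \<in> ?X"
    have r: "rep (code f) \<in> ?X" "code (rep (code f)) = code f"
      using f by (auto simp: rep_def inv_into_into f_inv_into_f)
    show "\<exists>c\<in>rep ` (code ` ?X). \<forall>t\<in>{0..T}. dist (c t) (f t) \<le> \<epsilon>"
      using close[OF r(1) f r(2)] f by blast
  qed
qed

lemma path_basis:
  assumes T: "T > 0"
  obtains C where "countable C" "C \<subseteq> topspace (path_topology T :: (real \<Rightarrow> real ^ 'n::finite) topology)"
    "\<forall>U f. openin (path_topology T) U \<and> f \<in> U \<longrightarrow> (\<exists>c\<in>C. \<exists>k::nat.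
       f \<in> {h\<in>topspace (path_topology T). mdist (cfunspace (top_of_set {0..T}) euclidean_metric) c h < 1 / real (Suc k)} \<and>
       {h\<in>topspace (path_topology T). mdist (cfunspace (top_of_set {0..T}) euclidean_metric) c h < 1 / real (Suc k)} \<subseteq> U)"
proof -
  let ?m = "cfunspace (top_of_set {0..T}) euclidean_metric :: (real \<Rightarrow> real ^ 'n) metric"
  let ?X = "topspace (path_topology T) :: (real \<Rightarrow> real ^ 'n) set"
  interpret Metric_space "mspace ?m" "mdist ?m" by (rule Metric_space_mspace_mdist)
  have X: "?X = mspace ?m" by (simp add: path_topology_def)
  have "\<forall>k::nat. \<exists>C. countable C \<and> C \<subseteq> ?X \<and> (\<forall>f\<in>?X. \<exists>c\<in>C. \<forall>t\<in>{0..T}. dist (c t) (f t) \<le> 1 / (2 * real (Suc k)))"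
    by (intro allI path_separable[OF T]) simp
  then obtain C where C: "\<And>k. countable (C k)" "\<And>k. C k \<subseteq> ?X"
    "\<And>k f. f \<in> ?X \<Longrightarrow> \<exists>c\<in>C k. \<forall>t\<in>{0..T}. dist (c t) (f t) \<le> 1 / (2 * real (Suc k))" by metis
  show thesis
  proof (rule that[of "\<Union>k. C k"], goal_cases)
    case 3
    show ?case
    proof (intro allI impI)
    fix U and f :: "real \<Rightarrow> real ^ 'n" assume "openin (path_topology T) U \<and> f \<in> U"
    then have U: "openin (path_topology T) U" "f \<in> U" by auto
    obtain r where r0: "r > 0" "\<forall>h\<in>?X. mdist ?m f h < r \<longrightarrow> h \<in> U" by (rule path_open_ball[OF U])
    note r = r0(1) r0(2)[rule_format]
    have fX: "f \<in> ?X" using U openin_subset by blast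
    obtain k where k: "2 / real (Suc k) < r"
    proof -
      obtain k where "2 / r < real (Suc k)" using reals_Archimedean2 by (metis less_Suc_eq less_trans of_nat_less_iff)
      then have "2 / real (Suc k) < r" using r(1) by (simp add: divide_less_eq mult.commute)
      then show thesis by (rule that)
    qed
    obtain c where c: "c \<in> C k" "\<forall>t\<in>{0..T}. dist (c t) (f t) \<le> 1 / (2 * real (Suc k))" using C(3)[OF fX] by blast
    have cX: "c \<in> ?X" using C(2) c by blast
    have d1: "mdist ?m c f \<le> 1 / (2 * real (Suc k))" using c path_metric_le[OF T cX fX] by simp
    have d2: "1 / (2 * real (Suc k)) < 1 / real (Suc k)" by (simp add: frac_less2)
    have "mdist ?m c f < 1 / real (Suc k)" using d1 d2 by linarith
    moreover have "h \<in> U" if h: "h \<in> ?X" "mdist ?m c h < 1 / real (Suc k)" for h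
    proof (rule r(2)[OF h(1)])
      have "mdist ?m f h \<le> mdist ?m f c + mdist ?m c h" using fX cX h X by (intro triangle) auto
      also have "mdist ?m f c = mdist ?m c f" by (rule commute)
      finally show "mdist ?m f h < r" using d1 d2 h k by linarith
    qed
    ultimately show "\<exists>c\<in>\<Union>k. C k. \<exists>k::nat. f \<in> {h\<in>?X. mdist ?m c h < 1 / real (Suc k)} \<and> {h\<in>?X. mdist ?m c h < 1 / real (Suc k)} \<subseteq> U"
      using c fX by blast
    qed
  qed (use C in blast)+
qed

lemma second_countable_path_topology:
  assumes "T > 0"
  shows "second_countable (path_topology T :: (real \<Rightarrow> real ^ 'n::finite) topology)"
proof -
  let ?m = "cfunspace (top_of_set {0..T}) euclidean_metric :: (real \<Rightarrow> real ^ 'n) metric"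
  obtain C where C0: "countable C" "C \<subseteq> topspace (path_topology T :: (real \<Rightarrow> real ^ 'n) topology)"
    "\<forall>U f. openin (path_topology T) U \<and> f \<in> U \<longrightarrow> (\<exists>c\<in>C. \<exists>k::nat. f \<in> {h\<in>topspace (path_topology T). mdist ?m c h < 1 / real (Suc k)} \<and>
       {h\<in>topspace (path_topology T). mdist ?m c h < 1 / real (Suc k)} \<subseteq> U)"
    by (rule path_basis[OF assms])
  note C = C0(1,2) C0(3)[rule_format, OF conjI]
  define \<B> where "\<B> = (\<lambda>(c, k::nat). {h\<in>topspace (path_topology T). mdist ?m c h < 1 / real (Suc k)}) ` (C \<times> UNIV)"
  have 1: "countable \<B>" unfolding \<B>_def using C by (intro countable_image countable_SIGMA) auto
  have 2: "openin (path_topology T) V" if "V \<in> \<B>" for V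
    using that C(2) unfolding \<B>_def by (auto intro!: path_ball_open simp del: of_nat_Suc)
  have 3: "\<exists>V\<in>\<B>. x \<in> V \<and> V \<subseteq> U" if U: "openin (path_topology T) U" "x \<in> U" for U x
  proof -
    from C(3)[OF U] obtain c k where "c \<in> C" "x \<in> {h\<in>topspace (path_topology T). mdist ?m c h < 1 / real (Suc k)}"
       "{h\<in>topspace (path_topology T). mdist ?m c h < 1 / real (Suc k)} \<subseteq> U" by blast
    then show ?thesis unfolding \<B>_def by (intro bexI[of _ "{h\<in>topspace (path_topology T). mdist ?m c h < 1 / real (Suc k)}"]) auto
  qed
  show ?thesis by (rule second_countableI[OF 1 2 3])
qed

lemma le_on_rationals:
  fixes f h :: "real \<Rightarrow> 'b::metric_space"
  assumes T: "T > 0" and f: "continuous_on {0..T} f" "continuous_on {0..T} h"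
  shows "(\<forall>t\<in>{0..T}. dist (f t) (h t) \<le> a) \<longleftrightarrow> (\<forall>q\<in>\<rat>. dist (f (max 0 (min T q))) (h (max 0 (min T q))) \<le> a)" (is "?L \<longleftrightarrow> ?R")
proof
  assume R: ?R
  let ?c = "\<lambda>q::real. max 0 (min T q)"
  have cont: "continuous_on UNIV (\<lambda>q. dist (f (?c q)) (h (?c q)))"
    using T by (intro continuous_on_dist continuous_on_compose2[OF f(1)] continuous_on_compose2[OF f(2)] continuous_intros) auto
  have "closed {q. dist (f (?c q)) (h (?c q)) \<le> a}"
    by (intro closed_Collect_le cont continuous_intros)
  moreover have "\<rat> \<subseteq> {q. dist (f (?c q)) (h (?c q)) \<le> a}" using R by auto
  ultimately have "closure \<rat> \<subseteq> {q. dist (f (?c q)) (h (?c q)) \<le> a}" by (rule closure_minimal[rotated])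
  then have all: "dist (f (?c q)) (h (?c q)) \<le> a" for q unfolding Rats_closure_real by blast
  show ?L
  proof
    fix t assume "t \<in> {0..T}"
    then have "?c t = t" by auto
    then show "dist (f t) (h t) \<le> a" using all[of t] by simp
  qed
qed (use T in auto)

text \<open>
  Open sets are countable unions of balls by \<open>path_basis\<close>, and the distance to a fixed path is a supremum
  over rational times.
\<close>

lemma measurable_path:
  fixes f :: "'w \<Rightarrow> real \<Rightarrow> real ^ 'n::finite"
  assumes T: "T > 0" and fX: "\<And>\<omega>. \<omega> \<in> space M \<Longrightarrow> f \<omega> \<in> extensional {0..T}" "\<And>\<omega>. \<omega> \<in> space M \<Longrightarrow> continuous_on {0..T} (f \<omega>)"
    and m: "\<And>t. t \<in> {0..T} \<Longrightarrow> (\<lambda>\<omega>. f \<omega> t) \<in> borel_measurable M"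
  shows "f \<in> measurable M (borel_of (path_topology T))"
proof -
  let ?m = "cfunspace (top_of_set {0..T}) euclidean_metric :: (real \<Rightarrow> real ^ 'n) metric"
  let ?X = "topspace (path_topology T) :: (real \<Rightarrow> real ^ 'n) set"
  obtain C where C0: "countable C" "C \<subseteq> ?X"
    "\<forall>U f. openin (path_topology T) U \<and> f \<in> U \<longrightarrow> (\<exists>c\<in>C. \<exists>k::nat. f \<in> {h\<in>?X. mdist ?m c h < 1 / real (Suc k)} \<and>
       {h\<in>?X. mdist ?m c h < 1 / real (Suc k)} \<subseteq> U)"
    by (rule path_basis[OF assms(1)])
  note C = C0(1,2) C0(3)[rule_format, OF conjI]
  define \<B> where "\<B> = (\<lambda>(c, k::nat). {h\<in>?X. mdist ?m c h < 1 / real (Suc k)}) ` (C \<times> UNIV)"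
  have fX': "f \<omega> \<in> ?X" if "\<omega> \<in> space M" for \<omega> using fX that by (simp add: topspace_path_topology)
  have le: "{\<omega>\<in>space M. mdist ?m c (f \<omega>) \<le> a} \<in> sets M" if c: "c \<in> ?X" for c a
  proof -
    have "{\<omega>\<in>space M. mdist ?m c (f \<omega>) \<le> a} = {\<omega>\<in>space M. \<forall>q\<in>\<rat>. dist (c (max 0 (min T q))) (f \<omega> (max 0 (min T q))) \<le> a}"
      using path_metric_le[OF T c fX'] le_on_rationals[OF T _ fX(2), of c] c by (auto simp: topspace_path_topology)
    also have "\<dots> \<in> sets M"
    proof (rule sets.sets_Collect_countable_All')
      fix q :: real assume "q \<in> \<rat>"
      have [measurable]: "(\<lambda>\<omega>. f \<omega> (max 0 (min T q))) \<in> borel_measurable M" using T by (intro m) auto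
      show "{\<omega>\<in>space M. dist (c (max 0 (min T q))) (f \<omega> (max 0 (min T q))) \<le> a} \<in> sets M" by measurable
    qed (rule countable_rat)
    finally show ?thesis .
  qed
  show ?thesis
  proof (rule measurable_borel_of_basis[where \<B>=\<B>])
    show "countable \<B>" unfolding \<B>_def using C by (intro countable_image countable_SIGMA) auto
    show "\<exists>V\<in>\<B>. x \<in> V \<and> V \<subseteq> U" if U: "openin (path_topology T) U" "x \<in> U" for U x
    proof -
      from C(3)[OF U] obtain c k where "c \<in> C" "x \<in> {h\<in>?X. mdist ?m c h < 1 / real (Suc k)}"
         "{h\<in>?X. mdist ?m c h < 1 / real (Suc k)} \<subseteq> U" by blast
      then show ?thesis unfolding \<B>_def by (intro bexI[of _ "{h\<in>?X. mdist ?m c h < 1 / real (Suc k)}"]) auto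
    qed
    show "f \<omega> \<in> ?X" if "\<omega> \<in> space M" for \<omega> by (rule fX'[OF that])
    fix V assume "V \<in> \<B>"
    then obtain c k where c: "c \<in> C" and V: "V = {h\<in>?X. mdist ?m c h < 1 / real (Suc k)}" unfolding \<B>_def by auto
    have "f -` V \<inter> space M = (\<Union>j. {\<omega>\<in>space M. mdist ?m c (f \<omega>) \<le> 1 / real (Suc k) - 1 / real (Suc j)})"
    proof (intro set_eqI iffI)
      fix \<omega> assume \<omega>: "\<omega> \<in> f -` V \<inter> space M"
      then have "0 < 1 / real (Suc k) - mdist ?m c (f \<omega>)" by (simp add: V)
      then obtain j where "1 / real (Suc j) < 1 / real (Suc k) - mdist ?m c (f \<omega>)" using nat_approx_posE by blast
      then show "\<omega> \<in> (\<Union>j. {\<omega>\<in>space M. mdist ?m c (f \<omega>) \<le> 1 / real (Suc k) - 1 / real (Suc j)})" using \<omega> by (intro UN_I[of j]) auto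
    next
      fix \<omega> assume "\<omega> \<in> (\<Union>j. {\<omega>\<in>space M. mdist ?m c (f \<omega>) \<le> 1 / real (Suc k) - 1 / real (Suc j)})"
      then obtain j where j: "\<omega> \<in> space M" "mdist ?m c (f \<omega>) \<le> 1 / real (Suc k) - 1 / real (Suc j)" by auto
      have "1 / real (Suc j) > 0" by simp
      then have "mdist ?m c (f \<omega>) < 1 / real (Suc k)" using j(2) by linarith
      then show "\<omega> \<in> f -` V \<inter> space M" using j(1) fX' V by auto
    qed
    also have "\<dots> \<in> sets M" using le C(2) c by (intro sets.countable_UN) auto
    finally show "f -` V \<inter> space M \<in> sets M" .
  qed
qed

section \<open>The torus and weighted Dirac sums\<close>

lemma integer_lattice_closed: "closed {z :: real ^ 'n::finite. \<forall>k. z $ k \<in> \<int>}"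
proof -
  have "closed ((\<lambda>z :: real ^ 'n. z $ k) -` \<int>)" for k
    by (intro closed_vimage closed_Ints continuous_intros)
  then have "closed (\<Inter>k. (\<lambda>z :: real ^ 'n. z $ k) -` \<int>)" by (intro closed_INT) auto
  moreover have "(\<Inter>k. (\<lambda>z :: real ^ 'n. z $ k) -` \<int>) = {z. \<forall>k. z $ k \<in> \<int>}" by auto
  ultimately show ?thesis by simp
qed

lemma torus_proj_saturation:
  "torus_proj -` (torus_proj ` S) = (\<Union>x\<in>S. \<Union>y\<in>{z. \<forall>k. z $ k \<in> \<int>}. {x + y})"
proof (intro set_eqI iffI)
  fix z assume "z \<in> torus_proj -` (torus_proj ` S)"
  then obtain x where x: "x \<in> S" "torus_proj z = torus_proj x" by auto
  then have "z - x \<in> {z. \<forall>k. z $ k \<in> \<int>}" by (simp add: torus_proj_eq_iff)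
  moreover have "z = x + (z - x)" by simp
  ultimately show "z \<in> (\<Union>x\<in>S. \<Union>y\<in>{z. \<forall>k. z $ k \<in> \<int>}. {x + y})" using x(1) by blast
next
  fix z assume "z \<in> (\<Union>x\<in>S. \<Union>y\<in>{z. \<forall>k. z $ k \<in> \<int>}. {x + y})"
  then obtain x y where "x \<in> S" "\<forall>k. y $ k \<in> \<int>" "z = x + y" by auto
  then have "torus_proj z = torus_proj x" "x \<in> S" by (simp_all add: torus_proj_eq_iff)
  then show "z \<in> torus_proj -` (torus_proj ` S)" by auto
qed

lemma open_torus_proj_image: "open U \<Longrightarrow> open (torus_proj ` U)"
  unfolding open_torus_def torus_proj_saturation by (intro open_sums) simp

lemma closed_torus_proj_image:
  assumes "compact U"
  shows "closed (torus_proj ` U)"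
proof -
  have "closed (torus_proj -` (torus_proj ` U))"
    unfolding torus_proj_saturation by (intro compact_closed_sums assms integer_lattice_closed)
  then show ?thesis unfolding closed_def open_torus_def by (simp add: vimage_Compl)
qed

lemma continuous_torus_proj: "continuous_on UNIV torus_proj"
  unfolding continuous_on_open_vimage[OF open_UNIV] by (auto simp: open_torus_def)

lemma torus_rep_bounds: "0 \<le> torus_rep p $ k" "torus_rep p $ k < 1" and torus_proj_rep: "torus_proj (torus_rep p) = p"
  using theI'[OF torus_rep_ex1, of p] unfolding torus_rep_def[symmetric] by auto

lemma torus_rep_unique: "\<forall>k. 0 \<le> y $ k \<and> y $ k < 1 \<Longrightarrow> torus_proj y = p \<Longrightarrow> torus_rep p = y"
  using torus_rep_ex1[of p] torus_rep_bounds[of p] torus_proj_rep[of p] by blast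

lemma second_countable_euclidean: "second_countable (euclidean :: 'a::second_countable_topology topology)"
proof -
  obtain B :: "'a set set" where B: "countable B" "topological_basis B" using ex_countable_basis by blast
  show ?thesis
  proof (rule second_countableI[OF B(1)])
    show "openin euclidean V" if "V \<in> B" for V using topological_basis_open[OF B(2) that] by simp
    show "\<exists>V\<in>B. x \<in> V \<and> V \<subseteq> U" if "openin euclidean U" "x \<in> U" for U x
      using topological_basisE[OF B(2), of U x] that by (metis open_openin)
  qed
qed

lemma second_countable_torus: "second_countable (euclidean :: 'n::finite torus topology)"
proof (rule second_countable_open_map_image[where X="euclidean :: (real ^ 'n) topology" and f=torus_proj])
  show "continuous_map euclidean euclidean (torus_proj :: real ^ 'n \<Rightarrow> 'n torus)"
    using continuous_torus_proj by simp
  show "open_map euclidean euclidean (torus_proj :: real ^ 'n \<Rightarrow> 'n torus)"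
    unfolding open_map_def using open_torus_proj_image by auto
  show "torus_proj ` topspace euclidean = topspace (euclidean :: 'n torus topology)"
    unfolding topspace_euclidean by (rule surjI[where f=torus_rep]) (rule torus_proj_rep)
qed (rule second_countable_euclidean)

text \<open>
  \<open>torus_rep\<close> is not continuous. The half-open cube is a countable union of compact cubes, and
  \<open>torus_proj\<close> maps compact sets to closed ones, so the preimage of an open set is a countable union of
  closed sets.
\<close>

lemma torus_rep_measurable [measurable]: "torus_rep \<in> borel_measurable borel"
proof (rule borel_measurableI)
  fix S :: "(real ^ 'n) set" assume "open S"
  then obtain C :: "nat \<Rightarrow> (real ^ 'n) set" where C: "\<And>n. compact (C n)" "\<Union>(C ` UNIV) = S"
    using open_Union_compact_subsets[of S] by metis
  let ?Q = "\<lambda>j. cbox (0 :: real ^ 'n) (\<chi> k. 1 - 1 / real (Suc j))"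
  have "torus_rep -` S = (\<Union>n. \<Union>j. torus_proj ` (C n \<inter> ?Q j))"
  proof (intro set_eqI iffI)
    fix p assume "p \<in> torus_rep -` S"
    then obtain n where n: "torus_rep p \<in> C n" using C(2) by auto
    have "\<forall>k. \<exists>j. torus_rep p $ k \<le> 1 - 1 / real (Suc j)"
    proof
      fix k
      have "0 < 1 - torus_rep p $ k" using torus_rep_bounds[of p k] by simp
      then obtain j where "1 / real (Suc j) < 1 - torus_rep p $ k" using nat_approx_posE by blast
      then show "\<exists>j. torus_rep p $ k \<le> 1 - 1 / real (Suc j)" by (intro exI[of _ j]) linarith
    qed
    then obtain j where j: "\<And>k. torus_rep p $ k \<le> 1 - 1 / real (Suc (j k))" by metis
    let ?m = "Max (range j)"
    have "torus_rep p $ k \<le> 1 - 1 / real (Suc ?m)" for k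
    proof -
      have "j k \<le> ?m" by (intro Max_ge) auto
      then have "1 / real (Suc ?m) \<le> 1 / real (Suc (j k))" by (intro divide_left_mono) auto
      then show ?thesis using j[of k] by linarith
    qed
    then have "torus_rep p \<in> ?Q ?m" using torus_rep_bounds[of p] by (simp add: mem_box_cart)
    then have "torus_proj (torus_rep p) \<in> torus_proj ` (C n \<inter> ?Q ?m)" using n by blast
    then show "p \<in> (\<Union>n. \<Union>j. torus_proj ` (C n \<inter> ?Q j))" unfolding torus_proj_rep by blast
  next
    fix p assume "p \<in> (\<Union>n. \<Union>j. torus_proj ` (C n \<inter> ?Q j))"
    then obtain n j y where y: "y \<in> C n" "y \<in> ?Q j" "p = torus_proj y" by auto
    have "0 \<le> y $ k \<and> y $ k < 1" for k
    proof -
      have "0 \<le> y $ k" "y $ k \<le> 1 - 1 / real (Suc j)" using y(2) by (simp_all add: mem_box_cart)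
      moreover have "1 / real (Suc j) > 0" by simp
      ultimately show ?thesis by linarith
    qed
    then have "torus_rep p = y" using y(3) by (intro torus_rep_unique) auto
    then show "p \<in> torus_rep -` S" using y(1) C(2) by auto
  qed
  also have "\<dots> \<in> sets borel"
  proof -
    have "closed (torus_proj ` (C n \<inter> ?Q j))" for n j
      by (intro closed_torus_proj_image compact_Int C compact_cbox)
    then show ?thesis by (intro sets.countable_UN' borel_closed) auto
  qed
  finally show "torus_rep -` S \<inter> space borel \<in> sets borel" by simp
qed

lemma mass_seqsD:
  assumes "s \<in> mass_seqs"
  shows "0 < s i" "s i \<le> 1" "s sums 1"
proof -
  have a: "\<forall>i. s i \<in> {0..1}" "\<forall>i j. i < j \<longrightarrow> s j < s i" "s sums 1" using assms by (auto simp: mass_seqs_def)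
  have "0 \<le> s (Suc i)" using a(1)[rule_format, of "Suc i"] by simp
  also have "s (Suc i) < s i" using a(2) by blast
  finally show "0 < s i" .
  show "s i \<le> 1" "s sums 1" using a(1)[rule_format, of i] a(3) by auto
qed

lemma weighted_dirac_sum_eq_distr:
  "weighted_dirac_sum s y = distr (density (count_space UNIV) (\<lambda>j. ennreal (s j))) borel y"
proof (rule measure_eqI)
  fix A assume "A \<in> sets (weighted_dirac_sum s y)"
  then have A: "A \<in> sets borel" by simp
  have "emeasure (distr (density (count_space UNIV) (\<lambda>j. ennreal (s j))) borel y) A =
      (\<integral>\<^sup>+j. ennreal (s j) * indicator (y -` A) j \<partial>count_space UNIV)"
    using A by (subst emeasure_distr) (auto simp: emeasure_density)
  also have "\<dots> = (\<Sum>j. ennreal (s j) * indicator (y -` A) j)" by (rule nn_integral_count_space_nat)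
  also have "\<dots> = emeasure (weighted_dirac_sum s y) A"
    using A by (simp add: emeasure_weighted_dirac_sum indicator_def)
  finally show "emeasure (weighted_dirac_sum s y) A = emeasure (distr (density (count_space UNIV) (\<lambda>j. ennreal (s j))) borel y) A" ..
qed simp

lemma integral_dirac_mixture:
  fixes f :: "'a::topological_space \<Rightarrow> real"
  assumes s: "s \<in> mass_seqs" and f: "f \<in> borel_measurable borel" "\<And>x. \<bar>f x\<bar> \<le> C"
  shows "(\<integral>x. f x \<partial>Rep_borel_prob (dirac_mixture s y)) = (\<Sum>j. s j * f (y j))" "summable (\<lambda>j. \<bar>s j * f (y j)\<bar>)"
proof -
  note s' = mass_seqsD[OF s]
  show sm: "summable (\<lambda>j. \<bar>s j * f (y j)\<bar>)"
  proof (rule summable_comparison_test')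
    show "summable (\<lambda>j. s j * C)" using s'(3) by (intro summable_mult2) (rule sums_summable)
    show "norm \<bar>s j * f (y j)\<bar> \<le> s j * C" for j
      using f(2)[of "y j"] s'(1)[of j] by (simp add: abs_mult)
  qed
  have "(\<integral>x. f x \<partial>Rep_borel_prob (dirac_mixture s y)) = (\<integral>j. f (y j) \<partial>density (count_space UNIV) (\<lambda>j. ennreal (s j)))"
    unfolding Rep_dirac_mixture[OF s] weighted_dirac_sum_eq_distr by (rule integral_distr) (use f in auto)
  also have "\<dots> = (\<integral>j. s j * f (y j) \<partial>count_space UNIV)"
    using s'(1) by (subst integral_density) (auto simp: less_imp_le)
  also have "\<dots> = (\<Sum>j. s j * f (y j))"
    by (rule integral_count_space_nat) (simp add: integrable_count_space_nat_iff sm)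
  finally show "(\<integral>x. f x \<partial>Rep_borel_prob (dirac_mixture s y)) = (\<Sum>j. s j * f (y j))" .
qed

lemma weighted_series_tail:
  fixes f :: "'a \<Rightarrow> real"
  assumes s: "s \<in> mass_seqs" and f: "\<And>x. \<bar>f x\<bar> \<le> C" "summable (\<lambda>j. \<bar>s j * f (y j)\<bar>)"
  shows "\<bar>(\<Sum>j. s j * f (y j)) - (\<Sum>j<n. s j * f (y j))\<bar> \<le> C * (1 - (\<Sum>j<n. s j))"
proof -
  note s' = mass_seqsD[OF s]
  have sum: "summable s" using s'(3) by (rule sums_summable)
  have sf: "summable (\<lambda>j. s j * f (y j))" using f(2) by (rule summable_rabs_cancel)
  have "(\<Sum>j. s j * f (y j)) - (\<Sum>j<n. s j * f (y j)) = (\<Sum>j. s (j + n) * f (y (j + n)))"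
    using suminf_split_initial_segment[OF sf, of n] by simp
  also have "\<bar>\<dots>\<bar> \<le> (\<Sum>j. \<bar>s (j + n) * f (y (j + n))\<bar>)"
    by (rule summable_rabs) (rule summable_ignore_initial_segment[OF f(2)])
  also have "\<dots> \<le> (\<Sum>j. C * s (j + n))"
  proof (rule suminf_le)
    show "\<bar>s (j + n) * f (y (j + n))\<bar> \<le> C * s (j + n)" for j
    proof -
      have "\<bar>f (y (j + n))\<bar> * s (j + n) \<le> C * s (j + n)"
        using f(1) s'(1)[of "j + n"] by (intro mult_right_mono) auto
      then show ?thesis using s'(1)[of "j + n"] by (simp add: abs_mult mult.commute)
    qed
  qed (use f(2) sum in \<open>auto intro: summable_ignore_initial_segment summable_mult\<close>)
  also have "\<dots> = C * (\<Sum>j. s (j + n))"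
    by (rule suminf_mult) (rule summable_ignore_initial_segment[OF sum])
  also have "(\<Sum>j. s (j + n)) = 1 - (\<Sum>j<n. s j)"
    using suminf_split_initial_segment[OF sum, of n] sums_unique[OF s'(3)] by simp
  finally show ?thesis .
qed

text \<open>
  For a bounded continuous test function the tail of the series is bounded by a multiple of the missing
  mass \<open>1 - (\<Sum>j<n. s j)\<close>, which is itself continuous in the masses. So the partial sums converge locally
  uniformly, although the masses are not dominated by a common summable sequence.
\<close>

lemma continuous_dirac_mixture:
  "continuous_on (mass_seqs \<times> UNIV) (\<lambda>z :: (nat \<Rightarrow> real) \<times> (nat \<Rightarrow> real ^ 'n::finite). dirac_mixture (fst z) (\<lambda>j. torus_proj (snd z j)))"
proof (rule continuous_on_generate_topology[OF open_borel_prob_def])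
  fix B :: "'n torus borel_prob set"
  assume "B \<in> {{\<mu>. (\<integral>x. f x \<partial>Rep_borel_prob \<mu>) \<in> U} | (f :: 'n torus \<Rightarrow> real) (U :: real set).
        continuous_on UNIV f \<and> bounded (range f) \<and> open U}"
  then obtain f :: "'n torus \<Rightarrow> real" and U where B: "B = {\<mu>. (\<integral>x. f x \<partial>Rep_borel_prob \<mu>) \<in> U}"
    and f: "continuous_on UNIV f" "bounded (range f)" and U: "open U" by blast
  obtain C0 where C0: "\<And>x. \<bar>f x\<bar> \<le> C0" using f(2) unfolding bounded_iff by auto
  define C where "C = \<bar>C0\<bar> + 1"
  have C: "\<bar>f x\<bar> \<le> C" for x using C0[of x] unfolding C_def by linarith
  have Cp: "C > 0" by (simp add: C_def)
  have fm: "f \<in> borel_measurable borel" using f(1) by (rule borel_measurable_continuous_onI)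
  let ?D = "mass_seqs \<times> (UNIV :: (nat \<Rightarrow> real ^ 'n) set)"
  define I where "I = (\<lambda>z :: (nat \<Rightarrow> real) \<times> (nat \<Rightarrow> real ^ 'n). \<Sum>j. fst z j * f (torus_proj (snd z j)))"
  define P where "P = (\<lambda>n (z :: (nat \<Rightarrow> real) \<times> (nat \<Rightarrow> real ^ 'n)). \<Sum>j<n. fst z j * f (torus_proj (snd z j)))"
  define M where "M = (\<lambda>n (z :: (nat \<Rightarrow> real) \<times> (nat \<Rightarrow> real ^ 'n)). \<Sum>j<n. fst z j)"
  have coord: "continuous_on UNIV (\<lambda>z :: (nat \<Rightarrow> real) \<times> (nat \<Rightarrow> real ^ 'n). fst z j)"
    "continuous_on UNIV (\<lambda>z :: (nat \<Rightarrow> real) \<times> (nat \<Rightarrow> real ^ 'n). snd z j)" for j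
    by (rule continuous_on_compose2[OF continuous_on_product_coordinates[of j]], intro continuous_intros, simp)+
  have fp: "continuous_on UNIV (\<lambda>z :: (nat \<Rightarrow> real) \<times> (nat \<Rightarrow> real ^ 'n). f (torus_proj (snd z j)))" for j
    by (intro continuous_on_compose2[OF f(1)] continuous_on_compose2[OF continuous_torus_proj] coord) auto
  have Pc: "continuous_on UNIV (P n)" for n unfolding P_def by (intro continuous_on_sum continuous_on_mult coord fp)
  have Mc: "continuous_on UNIV (M n)" for n unfolding M_def by (intro continuous_on_sum coord)
  have tail: "\<bar>I z - P n z\<bar> \<le> C * (1 - M n z)" if "z \<in> ?D" for z n
    unfolding I_def P_def M_def using that
    by (intro weighted_series_tail integral_dirac_mixture(2)[OF _ fm C] C) auto
  have "continuous_on ?D I"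
    unfolding continuous_on_def
  proof (intro ballI tendstoI)
    fix z :: "(nat \<Rightarrow> real) \<times> (nat \<Rightarrow> real ^ 'n)" and e :: real assume z: "z \<in> ?D" and e: "e > 0"
    have "(\<lambda>n. M n z) \<longlonglongrightarrow> 1" using mass_seqsD(3)[of "fst z"] z unfolding M_def sums_def by auto
    then have "eventually (\<lambda>n. 1 - e / (8 * C) < M n z) sequentially"
      using e Cp by (intro order_tendstoD(1)) auto
    then obtain n where n: "1 - e / (8 * C) < M n z" by (auto simp: eventually_sequentially)
    have Pz: "(P n \<longlongrightarrow> P n z) (at z within ?D)"
      using continuous_on_subset[OF Pc] z unfolding continuous_on_def by blast
    have Mz: "(M n \<longlongrightarrow> M n z) (at z within ?D)"
      using continuous_on_subset[OF Mc] z unfolding continuous_on_def by blast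
    have "eventually (\<lambda>z'. dist (P n z') (P n z) < e / 4) (at z within ?D)"
      using tendstoD[OF Pz, of "e / 4"] e by simp
    moreover have "eventually (\<lambda>z'. 1 - e / (8 * C) < M n z') (at z within ?D)"
      by (rule order_tendstoD(1)[OF Mz n])
    moreover have "eventually (\<lambda>z'. z' \<in> ?D) (at z within ?D)" by (simp add: eventually_at_filter)
    ultimately show "eventually (\<lambda>z'. dist (I z') (I z) < e) (at z within ?D)"
    proof eventually_elim
      case (elim z')
      have small: "C * (1 - m) < e / 4" if "1 - e / (8 * C) < m" for m
      proof -
        have "C * (1 - m) < C * (e / (8 * C))" using that Cp by (intro mult_strict_left_mono) auto
        also have "\<dots> = e / 8" using Cp by simp
        also have "\<dots> < e / 4" using e by simp
        finally show ?thesis .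
      qed
      have "\<bar>I z' - P n z'\<bar> < e / 4" using tail[OF elim(3), of n] small[OF elim(2)] by linarith
      moreover have "\<bar>I z - P n z\<bar> < e / 4" using tail[OF z, of n] small[OF n] by linarith
      ultimately show ?case using elim(1) e unfolding dist_real_def by linarith
    qed
  qed
  then obtain V where V: "open V" "V \<inter> ?D = I -` U \<inter> ?D"
    using U unfolding continuous_on_open_invariant by blast
  have "I -` U \<inter> ?D = (\<lambda>z. dirac_mixture (fst z) (\<lambda>j. torus_proj (snd z j))) -` B \<inter> ?D"
    unfolding B I_def using integral_dirac_mixture(1)[OF _ fm C] by auto
  then show "\<exists>V. open V \<and> V \<inter> ?D = (\<lambda>z. dirac_mixture (fst z) (\<lambda>j. torus_proj (snd z j))) -` B \<inter> ?D"
    using V by (intro exI[of _ V]) simp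
qed

section \<open>Initial data\<close>

lemma topspace_data: "topspace data_topology = mass_seqs \<times> distinct_seqs"
  by (simp add: data_topology_def)

lemma second_countable_data: "second_countable (data_topology :: ((nat \<Rightarrow> real) \<times> (nat \<Rightarrow> 'n::finite torus)) topology)"
proof -
  have "second_countable (euclidean :: (nat \<Rightarrow> 'n torus) topology)"
    unfolding euclidean_product_topology[symmetric]
    by (rule second_countable_product_topology[OF second_countable_torus])
  then show ?thesis unfolding data_topology_def
    by (intro second_countable_prod_topology second_countable_subtopology second_countable_euclidean)
qed

lemma data_fst_measurable: "fst \<in> borel_measurable (borel_of data_topology)"
proof (rule measurable_borel_continuous)
  have "continuous_map data_topology (top_of_set mass_seqs) fst" unfolding data_topology_def by (rule continuous_map_fst)
  then show "continuous_map data_topology euclidean fst" by (rule continuous_map_into_fulltopology)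
qed

lemma data_snd_measurable: "snd \<in> borel_measurable (borel_of data_topology)"
proof (rule measurable_borel_continuous)
  have "continuous_map data_topology (top_of_set distinct_seqs) snd" unfolding data_topology_def by (rule continuous_map_snd)
  then show "continuous_map data_topology euclidean snd" by (rule continuous_map_into_fulltopology)
qed

lemma coordinate_measurable: "(\<lambda>x :: nat \<Rightarrow> 'a::topological_space. x i) \<in> borel_measurable borel"
  by (intro borel_measurable_continuous_onI continuous_on_product_coordinates)

lemma measurable_real_vector:
  fixes f :: "'w \<Rightarrow> real ^ 'n::finite"
  assumes "\<And>k. (\<lambda>\<omega>. f \<omega> $ k) \<in> borel_measurable M"
  shows "f \<in> borel_measurable M"
  unfolding borel_measurable_euclidean_space[of f]
  using assms by (auto simp: Basis_vec_def inner_axis)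

section \<open>Components of independent vector-valued Brownian motions\<close>

text \<open>
  The product density gives the measure of all boxes, by Fubini's theorem over the standard basis.
\<close>

lemma (in prob_space) gaussian_vector:
  fixes D :: "'a \<Rightarrow> real ^ 'n::finite"
  assumes \<sigma>: "\<sigma> > 0"
    and D: "distributed M lborel D (\<lambda>z. ennreal (\<Prod>k\<in>UNIV. normal_density 0 \<sigma> (z $ k)))"
  shows gaussian_vector_component: "distributed M lborel (\<lambda>\<omega>. D \<omega> $ a) (normal_density 0 \<sigma>)"
    and gaussian_vector_indep: "a \<noteq> b \<Longrightarrow> indep_var borel (\<lambda>\<omega>. D \<omega> $ a) borel (\<lambda>\<omega>. D \<omega> $ b)"
proof -
  have Dm: "D \<in> borel_measurable M" using distributed_measurable[OF D] by simp
  have [measurable]: "(\<lambda>\<omega>. D \<omega> $ k) \<in> borel_measurable M" for k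
    by (rule measurable_compose[OF Dm borel_measurable_nth])
  define \<nu> where "\<nu> = (\<lambda>S. \<integral>\<^sup>+x. ennreal (normal_density 0 \<sigma> x) * indicator S x \<partial>lborel)"
  have \<nu>1: "\<nu> UNIV = 1"
    using prob_space.emeasure_space_1[OF prob_space_normal_density[OF \<sigma>, of 0]]
    by (simp add: \<nu>_def emeasure_density)
  have box: "emeasure M {\<omega>\<in>space M. \<forall>k. D \<omega> $ k \<in> S k} = (\<Prod>k\<in>UNIV. \<nu> (S k))"
    if S: "\<And>k. S k \<in> sets borel" for S :: "'n \<Rightarrow> real set"
  proof -
    have mS: "{z :: real ^ 'n. \<forall>k. z $ k \<in> S k} \<in> sets lborel"
    proof -
      have "{z :: real ^ 'n. z $ k \<in> S k} \<in> sets borel" for k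
        using measurable_sets[OF borel_measurable_nth S, of k k] by (simp add: vimage_def)
      then have "(\<Inter>k. {z :: real ^ 'n. z $ k \<in> S k}) \<in> sets borel" by (intro sets.finite_INT) auto
      moreover have "(\<Inter>k. {z :: real ^ 'n. z $ k \<in> S k}) = {z. \<forall>k. z $ k \<in> S k}" by auto
      ultimately show ?thesis by simp
    qed
    define G where "G = (\<lambda>c :: real ^ 'n. S (THE k. c = axis k (1::real)))"
    have "(THE k'. axis k (1::real) = axis k' 1) = k" for k :: 'n
      by (rule the_equality) (auto simp: axis_eq_axis)
    then have the: "G (axis k 1) = S k" for k by (simp add: G_def)
    let ?f = "\<lambda>c x. normal_density 0 \<sigma> x * indicator (G c) x"
    have Bas: "(Basis :: (real ^ 'n) set) = (\<lambda>k. axis k 1) ` UNIV" by (auto simp: Basis_vec_def)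
    have inj: "inj_on (\<lambda>k::'n. axis k (1::real)) UNIV" by (auto simp: inj_on_def axis_eq_axis)
    have "{\<omega>\<in>space M. \<forall>k. D \<omega> $ k \<in> S k} = D -` {z. \<forall>k. z $ k \<in> S k} \<inter> space M" by auto
    then have "emeasure M {\<omega>\<in>space M. \<forall>k. D \<omega> $ k \<in> S k} =
        (\<integral>\<^sup>+z. ennreal (\<Prod>k\<in>UNIV. normal_density 0 \<sigma> (z $ k)) * indicator {z. \<forall>k. z $ k \<in> S k} z \<partial>lborel)"
      using distributed_emeasure[OF D mS] by simp
    also have "\<dots> = (\<integral>\<^sup>+z. (\<Prod>c\<in>Basis. ennreal (?f c (z \<bullet> c))) \<partial>lborel)"
    proof (intro nn_integral_cong)
      fix z :: "real ^ 'n"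
      have "(\<Prod>c\<in>Basis. ennreal (?f c (z \<bullet> c))) = (\<Prod>k\<in>UNIV. ennreal (?f (axis k 1) (z \<bullet> axis k 1)))"
        unfolding Bas by (subst prod.reindex[OF inj]) simp
      also have "\<dots> = (\<Prod>k\<in>UNIV. ennreal (normal_density 0 \<sigma> (z $ k) * indicator (S k) (z $ k)))"
        by (simp add: the inner_axis)
      also have "\<dots> = ennreal (\<Prod>k\<in>UNIV. normal_density 0 \<sigma> (z $ k) * indicator (S k) (z $ k))"
        by (rule prod_ennreal) simp
      also have "\<dots> = ennreal (\<Prod>k\<in>UNIV. normal_density 0 \<sigma> (z $ k)) * indicator {z. \<forall>k. z $ k \<in> S k} z"
        proof (cases "\<forall>k. z $ k \<in> S k")
        case False
        then obtain k where "z $ k \<notin> S k" by blast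
        then have "(\<Prod>k\<in>UNIV. normal_density 0 \<sigma> (z $ k) * indicator (S k) (z $ k)) = 0"
          by (intro prod_zero bexI[of _ k]) auto
        moreover have "indicator {z. \<forall>k. z $ k \<in> S k} z = (0 :: ennreal)" using False by simp
        ultimately show ?thesis by (simp only: ennreal_0 mult_zero_right)
      qed simp
      finally show "ennreal (\<Prod>k\<in>UNIV. normal_density 0 \<sigma> (z $ k)) * indicator {z. \<forall>k. z $ k \<in> S k} z =
          (\<Prod>c\<in>Basis. ennreal (?f c (z \<bullet> c)))" ..
    qed
    also have "\<dots> = (\<Prod>c\<in>Basis. \<integral>\<^sup>+x. ennreal (?f c x) \<partial>lborel)"
    proof (rule nn_integral_lborel_prod[where f="\<lambda>c x. ennreal (?f c x)"])
      fix c :: "real ^ 'n"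
      have [measurable]: "G c \<in> sets borel" unfolding G_def by (rule S)
      show "(\<lambda>x. ennreal (?f c x)) \<in> borel_measurable borel" by measurable
    qed simp
    also have "\<dots> = (\<Prod>k\<in>UNIV. \<integral>\<^sup>+x. ennreal (?f (axis k 1) x) \<partial>lborel)"
      unfolding Bas by (subst prod.reindex[OF inj]) (rule refl[unfolded comp_def] | simp only: comp_def)+
    also have "\<dots> = (\<Prod>k\<in>UNIV. \<nu> (S k))"
      unfolding \<nu>_def the by (intro prod.cong nn_integral_cong) (auto simp: indicator_def)
    finally show ?thesis .
  qed
  have one: "emeasure M {\<omega>\<in>space M. D \<omega> $ a \<in> S} = \<nu> S" if S: "S \<in> sets borel" for a S
  proof -
    have "emeasure M {\<omega>\<in>space M. \<forall>k. D \<omega> $ k \<in> (if k = a then S else UNIV)} = (\<Prod>k\<in>UNIV. \<nu> (if k = a then S else UNIV))"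
      using S by (intro box) auto
    also have "\<dots> = (\<Prod>k\<in>UNIV. if k = a then \<nu> S else 1)" by (intro prod.cong) (auto simp: \<nu>1)
    also have "\<dots> = \<nu> S" by simp
    also have "{\<omega>\<in>space M. \<forall>k. D \<omega> $ k \<in> (if k = a then S else UNIV)} = {\<omega>\<in>space M. D \<omega> $ a \<in> S}" by auto
    finally show ?thesis .
  qed
  show "distributed M lborel (\<lambda>\<omega>. D \<omega> $ a) (normal_density 0 \<sigma>)"
    unfolding distributed_def
  proof (intro conjI)
    show "(\<lambda>\<omega>. D \<omega> $ a) \<in> measurable M lborel" by simp
    show "(\<lambda>x. ennreal (normal_density 0 \<sigma> x)) \<in> borel_measurable lborel" by simp
    show "distr M lborel (\<lambda>\<omega>. D \<omega> $ a) = density lborel (\<lambda>x. ennreal (normal_density 0 \<sigma> x))"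
    proof (rule measure_eqI)
      fix S assume "S \<in> sets (distr M lborel (\<lambda>\<omega>. D \<omega> $ a))"
      then have S: "S \<in> sets borel" by simp
      have "emeasure (distr M lborel (\<lambda>\<omega>. D \<omega> $ a)) S = emeasure M {\<omega>\<in>space M. D \<omega> $ a \<in> S}"
        using S by (subst emeasure_distr) (auto intro!: arg_cong2[where f=emeasure])
      also have "\<dots> = \<nu> S" by (rule one[OF S])
      also have "\<dots> = emeasure (density lborel (\<lambda>x. ennreal (normal_density 0 \<sigma> x))) S"
        using S by (simp add: \<nu>_def emeasure_density)
      finally show "emeasure (distr M lborel (\<lambda>\<omega>. D \<omega> $ a)) S = emeasure (density lborel (\<lambda>x. ennreal (normal_density 0 \<sigma> x))) S" .
    qed simp
  qed
  assume ab: "a \<noteq> b"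
  have two: "emeasure M {\<omega>\<in>space M. D \<omega> $ a \<in> S \<and> D \<omega> $ b \<in> R} = \<nu> S * \<nu> R"
    if S: "S \<in> sets borel" "R \<in> sets borel" for S R
  proof -
    let ?S = "\<lambda>k. if k = a then S else if k = b then R else UNIV"
    have "emeasure M {\<omega>\<in>space M. \<forall>k. D \<omega> $ k \<in> ?S k} = (\<Prod>k\<in>UNIV. \<nu> (?S k))" using S by (intro box) auto
    also have "\<dots> = (\<Prod>k\<in>UNIV. (if k = a then \<nu> S else 1) * (if k = b then \<nu> R else 1))"
      using ab by (intro prod.cong) (auto simp: \<nu>1)
    also have "\<dots> = \<nu> S * \<nu> R" by (simp add: prod.distrib)
    also have "{\<omega>\<in>space M. \<forall>k. D \<omega> $ k \<in> ?S k} = {\<omega>\<in>space M. D \<omega> $ a \<in> S \<and> D \<omega> $ b \<in> R}"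
    proof (intro Collect_cong conj_cong refl iffI)
      fix \<omega> assume *: "\<forall>k. D \<omega> $ k \<in> ?S k"
      show "D \<omega> $ a \<in> S \<and> D \<omega> $ b \<in> R" using *[rule_format, of a] *[rule_format, of b] ab by simp
    qed simp
    finally show ?thesis .
  qed
  have "indep_set {(\<lambda>\<omega>. D \<omega> $ a) -` S \<inter> space M |S. S \<in> sets borel} {(\<lambda>\<omega>. D \<omega> $ b) -` S \<inter> space M |S. S \<in> sets borel}"
  proof (rule indep_setI)
    fix x y assume "x \<in> {(\<lambda>\<omega>. D \<omega> $ a) -` S \<inter> space M |S. S \<in> sets borel}" "y \<in> {(\<lambda>\<omega>. D \<omega> $ b) -` S \<inter> space M |S. S \<in> sets borel}"
    then obtain S R where S: "S \<in> sets borel" "x = {\<omega>\<in>space M. D \<omega> $ a \<in> S}" and R: "R \<in> sets borel" "y = {\<omega>\<in>space M. D \<omega> $ b \<in> R}"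
      by auto
    have "x \<inter> y = {\<omega>\<in>space M. D \<omega> $ a \<in> S \<and> D \<omega> $ b \<in> R}" using S R by auto
    then have "emeasure M (x \<inter> y) = emeasure M x * emeasure M y"
      using two[OF S(1) R(1)] one[OF S(1), of a] one[OF R(1), of b] S R by simp
    then show "prob (x \<inter> y) = prob x * prob y" by (simp add: measure_def enn2real_mult)
  qed auto
  then show "indep_var borel (\<lambda>\<omega>. D \<omega> $ a) borel (\<lambda>\<omega>. D \<omega> $ b)"
    unfolding indep_var_eq by (intro conjI indep_set_sigma_sets Int_stable_preimages) auto
qed

lemma (in prob_space) integral_double_sum:
  assumes "\<And>l l'. l < m \<Longrightarrow> l' < m \<Longrightarrow> all_moments M (f l l')"
  shows "(\<integral>\<omega>. (\<Sum>l<(m::nat). \<Sum>l'<m. f l l' \<omega>) \<partial>M) = (\<Sum>l<m. \<Sum>l'<m. \<integral>\<omega>. f l l' \<omega> \<partial>M)"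
proof -
  have "(\<integral>\<omega>. (\<Sum>l<m. \<Sum>l'<m. f l l' \<omega>) \<partial>M) = (\<Sum>l<m. \<integral>\<omega>. (\<Sum>l'<m. f l l' \<omega>) \<partial>M)"
    using assms by (intro Bochner_Integration.integral_sum all_moments_integrable all_moments_sum) auto
  also have "\<dots> = (\<Sum>l<m. \<Sum>l'<m. \<integral>\<omega>. f l l' \<omega> \<partial>M)"
    using assms by (intro sum.cong refl Bochner_Integration.integral_sum all_moments_integrable) auto
  finally show ?thesis .
qed

text \<open>
  Cut \<open>[s, t]\<close> into \<open>m\<close> pieces. The products of increments over different pieces have conditional mean
  \<open>0\<close>, because the later increment is independent of the past up to its starting time. The products over equal pieces
  add up to the discrete cross variation \<open>S\<close>, and by independence of the two paths \<open>S\<close> has second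
  moment \<open>(t - s)\<^sup>2 / m\<close>. Therefore the left-hand side, which does not depend on \<open>m\<close>, vanishes.
\<close>

lemma (in brownian_marginals) independent_increments_orth:
  fixes Y :: "'w \<Rightarrow> complex"
  assumes ind: "indep_var (PiM {t0..T} (\<lambda>_. borel)) (\<lambda>\<omega>. \<lambda>t\<in>{t0..T}. w p t \<omega>) (PiM {t0..T} (\<lambda>_. borel)) (\<lambda>\<omega>. \<lambda>t\<in>{t0..T}. w q t \<omega>)"
    and st: "t0 \<le> s" "s < t" "t \<le> T" and Y: "Y \<in> borel_measurable (F s)" "all_moments Q Y"
  shows "(\<integral>\<omega>. Y \<omega> * complex_of_real ((w p t \<omega> - w p s \<omega>) * (w q t \<omega> - w q s \<omega>)) \<partial>Q) = 0" (is "?I = 0")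
proof -
  have bound: "norm ?I \<le> ((\<integral>\<omega>. (norm (Y \<omega>))\<^sup>2 \<partial>Q) + (t - s)\<^sup>2) / real (Suc n)" for n
  proof -
    \<comment> \<open>With \<open>m\<close> a square, the weight \<open>Suc n\<close> in \<open>mult_le_weighted_squares\<close> balances both terms.\<close>
    define m where "m = Suc n * Suc n"
    define h where "h = (t - s) / real m"
    define u where "u = (\<lambda>l. s + real l * h)"
    have m0: "real m > 0" unfolding m_def of_nat_mult by (intro mult_pos_pos) auto
    have h0: "h > 0" using st m0 by (simp add: h_def)
    have u0: "u 0 = s" and um: "u m = t" using m0 by (simp_all add: u_def h_def)
    have umono: "l \<le> l' \<Longrightarrow> u l \<le> u l'" for l l' using h0 by (simp add: u_def mult_right_mono)
    have usuc: "u (Suc l) - u l = h" for l by (simp add: u_def algebra_simps)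
    have ust: "t0 \<le> u l" "u l < u (Suc l)" "u (Suc l) \<le> T" if "l < m" for l
      using st umono[of 0 l] umono[of "Suc l" m] usuc[of l] h0 that unfolding u0 um by auto
    have uin: "u l \<in> {t0..T}" if "l \<le> m" for l using st umono[of 0 l] umono[of l m] that unfolding u0 um by auto
    define D where "D = (\<lambda>r l \<omega>. w r (u (Suc l)) \<omega> - w r (u l) \<omega>)"
    define C where "C = (\<lambda>r l \<omega>. complex_of_real (D r l \<omega>))"
    have tele: "w r t \<omega> - w r s \<omega> = (\<Sum>l<m. D r l \<omega>)" for r \<omega>
      unfolding D_def using sum_lessThan_telescope[of "\<lambda>l. w r (u l) \<omega>" m] by (simp add: u0 um)
    have Dm: "all_moments Q (D r l)" and Cm: "all_moments Q (C r l)" if "l < m" for r l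
      unfolding C_def D_def by (rule incr_all_moments[OF ust[OF that]], rule incr_c_all_moments[OF ust[OF that]])
    have CF: "C r l \<in> borel_measurable (F (u l'))" if "l < l'" "l' \<le> m" for r l l'
    proof -
      have "w r (u k) \<in> borel_measurable (F (u l'))" if "k \<le> l'" for k
        by (rule meas_F_mono[OF uin uin umono adapted[OF uin]]) (use that \<open>l' \<le> m\<close> in linarith)+
      then have [measurable]: "w r (u (Suc l)) \<in> borel_measurable (F (u l'))" "w r (u l) \<in> borel_measurable (F (u l'))"
        using that by auto
      show ?thesis unfolding C_def D_def by measurable
    qed
    have YF: "Y \<in> borel_measurable (F (u l))" if "l \<le> m" for l
      using meas_F_mono[OF uin uin umono Y(1)[folded u0]] that by auto
    have mz: "(\<integral>\<omega>. V \<omega> * C r l \<omega> \<partial>Q) = 0" if "l < m" "V \<in> borel_measurable (F (u l))" "all_moments Q V" for V r l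
      unfolding C_def D_def by (rule incr_mean_zero[OF ust[OF that(1)] that(2) all_moments_integrable[OF that(3)]])
    have cross: "(\<integral>\<omega>. Y \<omega> * (C p l \<omega> * C q l' \<omega>) \<partial>Q) = 0" if l: "l < m" "l' < m" "l \<noteq> l'" for l l'
    proof (cases "l < l'")
      case True
      have [measurable]: "Y \<in> borel_measurable (F (u l'))" "C p l \<in> borel_measurable (F (u l'))"
        using YF CF True l by auto
      have "(\<integral>\<omega>. (Y \<omega> * C p l \<omega>) * C q l' \<omega> \<partial>Q) = 0"
        using l by (intro mz all_moments_mult Y Cm) auto
      then show ?thesis by (simp add: mult.assoc)
    next
      case False
      then have l'l: "l' < l" using l by simp
      have [measurable]: "Y \<in> borel_measurable (F (u l))" "C q l' \<in> borel_measurable (F (u l))"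
        using YF CF l'l l by auto
      have "(\<integral>\<omega>. (Y \<omega> * C q l' \<omega>) * C p l \<omega> \<partial>Q) = 0"
        using l by (intro mz all_moments_mult Y Cm) auto
      then show ?thesis by (simp add: mult_ac)
    qed
    have orth1: "(\<integral>\<omega>. D r l \<omega> * D r l' \<omega> \<partial>Q) = (if l = l' then h else 0)" if l: "l < m" "l' < m" for r l l'
    proof -
      have off: "(\<integral>\<omega>. D r l \<omega> * D r l' \<omega> \<partial>Q) = 0" if "l < l'" "l' < m" for l l'
      proof -
        have "(\<integral>\<omega>. C r l \<omega> * C r l' \<omega> \<partial>Q) = 0" using that by (intro mz CF Cm) auto
        then show ?thesis by (simp add: C_def flip: of_real_mult)
      qed
      have diag: "(\<integral>\<omega>. D r l \<omega> * D r l \<omega> \<partial>Q) = h"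
        using incr_var[OF ust[OF l(1)], of r] by (simp add: D_def usuc power2_eq_square)
      show ?thesis
      proof (cases l l' rule: linorder_cases)
        case greater
        then show ?thesis using off[OF greater l(1)] by (simp add: mult.commute)
      qed (use off[OF _ l(2)] diag in auto)
    qed
    define S where "S = (\<lambda>\<omega>. \<Sum>l<m. D p l \<omega> * D q l \<omega>)"
    have Sm: "all_moments Q S" unfolding S_def by (intro all_moments_sum all_moments_mult Dm) auto
    have IS: "?I = (\<integral>\<omega>. Y \<omega> * complex_of_real (S \<omega>) \<partial>Q)"
    proof -
      have "?I = (\<integral>\<omega>. (\<Sum>l<m. \<Sum>l'<m. Y \<omega> * (C p l \<omega> * C q l' \<omega>)) \<partial>Q)"
        unfolding tele C_def of_real_mult of_real_sum sum_product unfolding sum_distrib_left ..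
      also have "\<dots> = (\<Sum>l<m. \<Sum>l'<m. \<integral>\<omega>. Y \<omega> * (C p l \<omega> * C q l' \<omega>) \<partial>Q)"
        by (rule integral_double_sum) (intro all_moments_mult Y Cm)
      also have "\<dots> = (\<Sum>l<m. \<Sum>l'<m. if l' = l then \<integral>\<omega>. Y \<omega> * (C p l \<omega> * C q l \<omega>) \<partial>Q else 0)"
        using cross by (intro sum.cong refl) auto
      also have "\<dots> = (\<Sum>l<m. \<integral>\<omega>. Y \<omega> * (C p l \<omega> * C q l \<omega>) \<partial>Q)" by simp
      also have "\<dots> = (\<integral>\<omega>. (\<Sum>l<m. Y \<omega> * (C p l \<omega> * C q l \<omega>)) \<partial>Q)"
        by (rule Bochner_Integration.integral_sum[symmetric]) (intro all_moments_integrable all_moments_mult Y Cm; simp)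
      also have "\<dots> = (\<integral>\<omega>. Y \<omega> * complex_of_real (S \<omega>) \<partial>Q)" by (simp add: S_def C_def sum_distrib_left)
      finally show ?thesis .
    qed
    have factor: "(\<integral>\<omega>. (D p l \<omega> * D p l' \<omega>) * (D q l \<omega> * D q l' \<omega>) \<partial>Q) =
        (\<integral>\<omega>. D p l \<omega> * D p l' \<omega> \<partial>Q) * (\<integral>\<omega>. D q l \<omega> * D q l' \<omega> \<partial>Q)" if l: "l < m" "l' < m" for l l'
    proof -
      define H where "H = (\<lambda>f :: real \<Rightarrow> real. (f (u (Suc l)) - f (u l)) * (f (u (Suc l')) - f (u l')))"
      have ev: "(\<lambda>f. f (u k)) \<in> borel_measurable (PiM {t0..T} (\<lambda>_. borel :: real measure))" if "k \<le> m" for k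
        by (rule measurable_component_singleton[OF uin[OF that]])
      have Hm: "H \<in> borel_measurable (PiM {t0..T} (\<lambda>_. borel))" unfolding H_def
        by (intro borel_measurable_times borel_measurable_diff ev) (use l in linarith)+
      have Heq: "(H \<circ> (\<lambda>\<omega>. \<lambda>t\<in>{t0..T}. w r t \<omega>)) \<omega> = D r l \<omega> * D r l' \<omega>" for r \<omega>
        using uin[of l] uin[of "Suc l"] uin[of l'] uin[of "Suc l'"] l by (simp add: H_def D_def)
      from indep_var_compose[OF ind Hm Hm]
      have "indep_var borel (\<lambda>\<omega>. D p l \<omega> * D p l' \<omega>) borel (\<lambda>\<omega>. D q l \<omega> * D q l' \<omega>)"
        unfolding comp_def Heq[unfolded comp_def] .
      then show ?thesis
        by (rule indep_var_lebesgue_integral) (use l in \<open>auto intro!: all_moments_integrable all_moments_mult Dm\<close>)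
    qed
    have S2: "(\<integral>\<omega>. (S \<omega>)\<^sup>2 \<partial>Q) = (t - s)\<^sup>2 / real m"
    proof -
      have "(\<integral>\<omega>. (S \<omega>)\<^sup>2 \<partial>Q) = (\<integral>\<omega>. (\<Sum>l<m. \<Sum>l'<m. (D p l \<omega> * D p l' \<omega>) * (D q l \<omega> * D q l' \<omega>)) \<partial>Q)"
        unfolding S_def power2_eq_square sum_product by (simp only: mult.assoc mult.left_commute)
      also have "\<dots> = (\<Sum>l<m. \<Sum>l'<m. \<integral>\<omega>. (D p l \<omega> * D p l' \<omega>) * (D q l \<omega> * D q l' \<omega>) \<partial>Q)"
        by (rule integral_double_sum) (intro all_moments_mult Dm)
      also have "\<dots> = (\<Sum>l<m. \<Sum>l'<m. if l' = l then h\<^sup>2 else 0)"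
        by (intro sum.cong refl) (auto simp: factor orth1 power2_eq_square)
      also have "\<dots> = real m * h\<^sup>2" by simp
      also have "\<dots> = (t - s)\<^sup>2 / real m" using m0 by (simp add: h_def power2_eq_square)
      finally show ?thesis .
    qed
    have iY: "integrable Q (\<lambda>\<omega>. (norm (Y \<omega>))\<^sup>2)" by (rule all_moments_integrable_power[OF Y(2)])
    have iS: "integrable Q (\<lambda>\<omega>. (S \<omega>)\<^sup>2)"
      using all_moments_integrable[OF all_moments_mult[OF Sm Sm]] by (simp add: power2_eq_square)
    have "norm ?I \<le> (\<integral>\<omega>. norm (Y \<omega> * complex_of_real (S \<omega>)) \<partial>Q)" unfolding IS by (rule integral_norm_bound)
    also have "\<dots> \<le> (\<integral>\<omega>. (norm (Y \<omega>))\<^sup>2 / real (Suc n) + real (Suc n) * (S \<omega>)\<^sup>2 \<partial>Q)"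
    proof (intro integral_mono')
      show "norm (Y \<omega> * complex_of_real (S \<omega>)) \<le> (norm (Y \<omega>))\<^sup>2 / real (Suc n) + real (Suc n) * (S \<omega>)\<^sup>2" for \<omega>
        using mult_le_weighted_squares[of "real (Suc n)" "norm (Y \<omega>)" "\<bar>S \<omega>\<bar>"] by (simp add: norm_mult)
      show "integrable Q (\<lambda>\<omega>. (norm (Y \<omega>))\<^sup>2 / real (Suc n) + real (Suc n) * (S \<omega>)\<^sup>2)"
        by (intro Bochner_Integration.integrable_add integrable_divide integrable_mult_right iY iS)
    qed simp
    also have "\<dots> = (\<integral>\<omega>. (norm (Y \<omega>))\<^sup>2 \<partial>Q) / real (Suc n) + real (Suc n) * ((t - s)\<^sup>2 / real m)"
      using iY iS by (subst Bochner_Integration.integral_add) (simp_all add: S2 del: of_nat_Suc)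
    also have "\<dots> = ((\<integral>\<omega>. (norm (Y \<omega>))\<^sup>2 \<partial>Q) + (t - s)\<^sup>2) / real (Suc n)"
      unfolding m_def of_nat_mult by (simp add: add_divide_distrib del: of_nat_Suc)
    finally show ?thesis .
  qed
  have "(\<lambda>n. ((\<integral>\<omega>. (norm (Y \<omega>))\<^sup>2 \<partial>Q) + (t - s)\<^sup>2) / real (Suc n)) \<longlonglongrightarrow> 0"
    by (rule LIMSEQ_Suc[OF lim_const_over_n])
  from LIMSEQ_le_const[OF this, of "norm ?I"] bound show ?thesis by auto
qed

text \<open>
  Components of the same vector are uncorrelated by the Gaussian law of the increment, whose independence
  from the past is assumed for the vector as a whole; components of different vectors are treated by
  \<open>independent_increments_orth\<close>.
\<close>

lemma brownian_components:
  fixes W :: "nat \<Rightarrow> real \<Rightarrow> 'w \<Rightarrow> real ^ 'n::finite"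
  assumes FP: "filtered_prob_space Q F t0 T" and BM: "\<And>i. brownian_motion Q F t0 T (W i)"
    and ind: "prob_space.indep_vars Q (\<lambda>i. PiM {t0..T} (\<lambda>_. borel)) (\<lambda>i \<omega>. \<lambda>t\<in>{t0..T}. W i t \<omega>) UNIV"
  shows "brownian_family Q F t0 T (\<lambda>p t \<omega>. W (fst p) t \<omega> $ snd p)"
proof -
  interpret prob_space Q using FP by (simp add: filtered_prob_space_def)
  have incr: "indep_set (sets (F s)) {(\<lambda>\<omega>. W i t \<omega> - W i s \<omega>) -` A \<inter> space Q | A. A \<in> sets borel}"
    "distributed Q lborel (\<lambda>\<omega>. W i t \<omega> - W i s \<omega>) (\<lambda>z. ennreal (\<Prod>k\<in>UNIV. normal_density 0 (sqrt (t - s)) (z $ k)))"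
    if "t0 \<le> s" "s < t" "t \<le> T" for i s t
    using BM[of i] that unfolding brownian_motion_def by auto
  have marg: "brownian_marginals Q F t0 T (\<lambda>p t \<omega>. W (fst p) t \<omega> $ snd p)"
  proof
    show "subalgebra Q (F t)" if "t \<in> {t0..T}" for t using FP that by (simp add: filtered_prob_space_def)
    show "subalgebra (F t) (F s)" if "s \<in> {t0..T}" "t \<in> {t0..T}" "s \<le> t" for s t
      using FP that by (simp add: filtered_prob_space_def)
    fix p :: "nat \<times> 'n"
    show "(\<lambda>\<omega>. W (fst p) t \<omega> $ snd p) \<in> borel_measurable (F t)" if "t \<in> {t0..T}" for t
    proof -
      have "W (fst p) t \<in> borel_measurable (F t)"
        using BM[of "fst p"] that unfolding brownian_motion_def continuous_adapted_def by blast
      then show ?thesis by (rule measurable_compose[OF _ borel_measurable_nth])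
    qed
    fix s t assume st: "t0 \<le> s" "s < t" "t \<le> T"
    show "distributed Q lborel (\<lambda>\<omega>. W (fst p) t \<omega> $ snd p - W (fst p) s \<omega> $ snd p) (\<lambda>x. ennreal (normal_density 0 (sqrt (t - s)) x))"
      using gaussian_vector_component[OF _ incr(2)[OF st, of "fst p"], of "snd p"] st by simp
    have sub: "{(\<lambda>\<omega>. W (fst p) t \<omega> $ snd p - W (fst p) s \<omega> $ snd p) -` A \<inter> space Q | A. A \<in> sets borel} \<subseteq>
        {(\<lambda>\<omega>. W (fst p) t \<omega> - W (fst p) s \<omega>) -` A \<inter> space Q | A. A \<in> sets borel}"
    proof (intro subsetI, elim CollectE exE conjE)
      fix x A assume x: "x = (\<lambda>\<omega>. W (fst p) t \<omega> $ snd p - W (fst p) s \<omega> $ snd p) -` A \<inter> space Q" "A \<in> sets (borel :: real measure)"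
      have "(\<lambda>z :: real ^ 'n. z $ snd p) -` A \<inter> space borel \<in> sets borel" by (rule measurable_sets[OF borel_measurable_nth x(2)])
      moreover have "x = (\<lambda>\<omega>. W (fst p) t \<omega> - W (fst p) s \<omega>) -` ((\<lambda>z. z $ snd p) -` A \<inter> space borel) \<inter> space Q"
        using x by auto
      ultimately show "x \<in> {(\<lambda>\<omega>. W (fst p) t \<omega> - W (fst p) s \<omega>) -` A \<inter> space Q | A. A \<in> sets borel}" by blast
    qed
    show "indep_set (sets (F s)) {(\<lambda>\<omega>. W (fst p) t \<omega> $ snd p - W (fst p) s \<omega> $ snd p) -` A \<inter> space Q | A. A \<in> sets borel}"
    proof (rule indep_setI)
      note i = incr(1)[OF st, of "fst p"]
      show "sets (F s) \<subseteq> events" by (rule indep_setD_ev1[OF i])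
      show "{(\<lambda>\<omega>. W (fst p) t \<omega> $ snd p - W (fst p) s \<omega> $ snd p) -` A \<inter> space Q | A. A \<in> sets borel} \<subseteq> events"
        by (rule order_trans[OF sub indep_setD_ev2[OF i]])
      show "prob (x \<inter> y) = prob x * prob y" if "x \<in> sets (F s)"
        "y \<in> {(\<lambda>\<omega>. W (fst p) t \<omega> $ snd p - W (fst p) s \<omega> $ snd p) -` A \<inter> space Q | A. A \<in> sets borel}" for x y
        by (rule indep_setD[OF i that(1) subsetD[OF sub that(2)]])
    qed
  qed
  interpret bm: brownian_marginals Q F t0 T "\<lambda>p t \<omega>. W (fst p) t \<omega> $ snd p" by (rule marg)
  show ?thesis
  proof
    fix p q :: "nat \<times> 'n" and s t and Y :: "'w \<Rightarrow> complex"
    assume pq: "p \<noteq> q" and st: "t0 \<le> s" "s < t" "t \<le> T" and Y: "Y \<in> borel_measurable (F s)" "all_moments Q Y"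
    show "(\<integral>\<omega>. Y \<omega> * complex_of_real ((W (fst p) t \<omega> $ snd p - W (fst p) s \<omega> $ snd p) * (W (fst q) t \<omega> $ snd q - W (fst q) s \<omega> $ snd q)) \<partial>Q) = 0"
    proof (cases "fst p = fst q")
      case True
      let ?D = "\<lambda>\<omega>. W (fst p) t \<omega> - W (fst p) s \<omega>"
      have ne: "snd p \<noteq> snd q" using pq True by (simp add: prod_eq_iff)
      have i1: "integrable Q (\<lambda>\<omega>. ?D \<omega> $ snd p)" "integrable Q (\<lambda>\<omega>. ?D \<omega> $ snd q)"
        using all_moments_integrable[OF bm.incr_all_moments[OF st, of p]] all_moments_integrable[OF bm.incr_all_moments[OF st, of q]] True
        by simp_all
      have "(\<integral>\<omega>. ?D \<omega> $ snd p * ?D \<omega> $ snd q \<partial>Q) = (\<integral>\<omega>. ?D \<omega> $ snd p \<partial>Q) * (\<integral>\<omega>. ?D \<omega> $ snd q \<partial>Q)"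
        using gaussian_vector_indep[OF _ incr(2)[OF st, of "fst p"] ne] st i1 by (intro indep_var_lebesgue_integral) auto
      also have "\<dots> = 0" using bm.incr_mean[OF st, of p] by simp
      finally have z: "(\<integral>\<omega>. ?D \<omega> $ snd p * ?D \<omega> $ snd q \<partial>Q) = 0" .
      have "(\<integral>\<omega>. Y \<omega> * complex_of_real ((\<lambda>z. z $ snd p * z $ snd q) (?D \<omega>)) \<partial>Q) =
          (\<integral>\<omega>. Y \<omega> \<partial>Q) * complex_of_real (\<integral>\<omega>. (\<lambda>z. z $ snd p * z $ snd q) (?D \<omega>) \<partial>Q)"
      proof (rule integral_indep_factor[OF _ incr(1)[OF st] _ Y(1) all_moments_integrable[OF Y(2)]])
        show "subalgebra Q (F s)" using st by (intro bm.subalg) auto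
        show "?D \<in> borel_measurable Q" using distributed_measurable[OF incr(2)[OF st, of "fst p"]] by simp
        show "integrable Q (\<lambda>\<omega>. ?D \<omega> $ snd p * ?D \<omega> $ snd q)"
          using all_moments_integrable[OF all_moments_mult[OF bm.incr_all_moments[OF st, of p] bm.incr_all_moments[OF st, of q]]] True
          by simp
      qed measurable
      then show ?thesis using z True by simp
    next
      case False
      let ?P = "PiM {t0..T} (\<lambda>_. borel :: (real ^ 'n) measure)" and ?R = "PiM {t0..T} (\<lambda>_. borel :: real measure)"
      have proj: "(\<lambda>f. \<lambda>t\<in>{t0..T}. f t $ a) \<in> measurable ?P ?R" for a :: 'n
      proof (rule measurable_restrict)
        fix t assume "t \<in> {t0..T}"
        then have "(\<lambda>f :: real \<Rightarrow> real ^ 'n. f t) \<in> measurable ?P borel" by (rule measurable_component_singleton)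
        then show "(\<lambda>f. f t $ a) \<in> borel_measurable ?P" by (rule measurable_compose[OF _ borel_measurable_nth])
      qed
      have "indep_var ?P (\<lambda>\<omega>. \<lambda>t\<in>{t0..T}. W (fst p) t \<omega>) ?P (\<lambda>\<omega>. \<lambda>t\<in>{t0..T}. W (fst q) t \<omega>)"
      proof -
        have "indep_var (PiM {fst p} (\<lambda>_. ?P)) (\<lambda>\<omega>. \<lambda>i\<in>{fst p}. \<lambda>t\<in>{t0..T}. W i t \<omega>)
            (PiM {fst q} (\<lambda>_. ?P)) (\<lambda>\<omega>. \<lambda>i\<in>{fst q}. \<lambda>t\<in>{t0..T}. W i t \<omega>)"
          using False by (intro indep_var_restrict[OF ind]) auto
        from indep_var_compose[OF this measurable_component_singleton[of "fst p"] measurable_component_singleton[of "fst q"]]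
        show ?thesis by (simp add: comp_def)
      qed
      from indep_var_compose[OF this proj[of "snd p"] proj[of "snd q"]]
      have "indep_var ?R (\<lambda>\<omega>. \<lambda>t\<in>{t0..T}. W (fst p) t \<omega> $ snd p) ?R (\<lambda>\<omega>. \<lambda>t\<in>{t0..T}. W (fst q) t \<omega> $ snd q)"
        by (simp add: comp_def cong: restrict_cong)
      from bm.independent_increments_orth[OF this st Y] show ?thesis .
    qed
  qed
qed

section \<open>The space of observed paths\<close>

text \<open>
  Continuous paths with the sigma-algebra of the evaluations. Restriction to continuous paths makes
  evaluation jointly measurable in time and path.
\<close>

definition path_space :: "real \<Rightarrow> real \<Rightarrow> (real \<Rightarrow> real ^ 'n::finite) measure" where
  "path_space t0 T = restrict_space (PiM {t0..T} (\<lambda>_. borel)) {f. continuous_on {t0..T} f}"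

definition observation_space ::
    "real \<Rightarrow> real \<Rightarrow> (((nat \<Rightarrow> real) \<times> (nat \<Rightarrow> 'n::finite torus)) \<times> (nat \<Rightarrow> real \<Rightarrow> real ^ 'n)) measure" where
  "observation_space t0 T = borel_of data_topology \<Otimes>\<^sub>M PiM UNIV (\<lambda>_. path_space t0 T)"

lemma space_path_space: "space (path_space t0 T) = {f. f \<in> extensional {t0..T} \<and> continuous_on {t0..T} f}"
  by (auto simp: path_space_def space_restrict_space space_PiM PiE_def)

lemma space_observation_space:
  "y \<in> space (observation_space t0 T) \<longleftrightarrow> fst (fst y) \<in> mass_seqs \<and> snd (fst y) \<in> distinct_seqs \<and>
     (\<forall>i. snd y i \<in> extensional {t0..T} \<and> continuous_on {t0..T} (snd y i))"
  by (cases y) (auto simp: observation_space_def space_pair_measure space_PiM space_path_space topspace_data PiE_def Pi_iff)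

lemma measurable_path_spaceI:
  assumes "\<And>\<omega>. \<omega> \<in> space M \<Longrightarrow> f \<omega> \<in> extensional {t0..T}" "\<And>\<omega>. \<omega> \<in> space M \<Longrightarrow> continuous_on {t0..T} (f \<omega>)"
    and "\<And>t. t \<in> {t0..T} \<Longrightarrow> (\<lambda>\<omega>. f \<omega> t) \<in> borel_measurable M"
  shows "f \<in> measurable M (path_space t0 T)"
  unfolding path_space_def
proof (rule measurable_restrict_space2)
  show "f \<in> measurable M (PiM {t0..T} (\<lambda>_. borel))"
    by (rule measurable_PiM_single') (use assms in \<open>auto simp: PiE_def\<close>)
qed (use assms in auto)

lemma measurable_observationI:
  assumes "d \<in> measurable M (borel_of data_topology)" "\<And>i. V i \<in> measurable M (path_space t0 T)"
  shows "(\<lambda>\<omega>. (d \<omega>, \<lambda>i. V i \<omega>)) \<in> measurable M (observation_space t0 T)"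
  unfolding observation_space_def
proof (rule measurable_Pair[OF assms(1)])
  show "(\<lambda>\<omega> i. V i \<omega>) \<in> measurable M (PiM UNIV (\<lambda>_. path_space t0 T))"
    by (rule measurable_PiM_single') (use assms(2) in \<open>auto dest: measurable_space\<close>)
qed

lemma observed_data: "fst \<in> measurable (observation_space t0 T) (borel_of data_topology)"
  unfolding observation_space_def by (rule measurable_fst)

lemma observed_path:
  assumes "t \<in> {t0..T}"
  shows "(\<lambda>y. snd y i t) \<in> borel_measurable (observation_space t0 T)"
proof -
  have "(\<lambda>y. snd y i) \<in> measurable (observation_space t0 T) (path_space t0 T)"
    unfolding observation_space_def
    by (rule measurable_compose[OF measurable_snd]) (rule measurable_component_singleton, simp)
  moreover have "(\<lambda>f. f t) \<in> borel_measurable (path_space t0 T)"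
    unfolding path_space_def by (rule measurable_restrict_space1) (rule measurable_component_singleton[OF assms])
  ultimately show ?thesis by (rule measurable_compose)
qed

lemma data_masses:
  assumes "d \<in> measurable M (borel_of data_topology)"
  shows "(\<lambda>\<omega>. fst (d \<omega>) i) \<in> borel_measurable M"
  by (rule measurable_compose[OF measurable_compose[OF assms data_fst_measurable] coordinate_measurable])

lemma data_positions:
  assumes "d \<in> measurable M (borel_of data_topology)"
  shows "(\<lambda>\<omega>. torus_rep (snd (d \<omega>) i)) \<in> borel_measurable M"
  by (rule measurable_compose[OF measurable_compose[OF measurable_compose[OF assms data_snd_measurable] coordinate_measurable]
        torus_rep_measurable])

text \<open>
  Rounding the time to multiples of \<open>1 / Suc n\<close> leaves countably many times, for which evaluation is
  measurable, and continuity of the paths gives the limit. Clamping the time to \<open>[t0, T]\<close> makes the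
  statement one about all real times.
\<close>

lemma continuous_paths_jointly_measurable:
  fixes V :: "'y \<Rightarrow> real \<Rightarrow> 'b::metric_space"
  assumes t0T: "t0 \<le> T" and V: "\<And>t. t \<in> {t0..T} \<Longrightarrow> (\<lambda>y. V y t) \<in> borel_measurable M"
    and cont: "\<And>y. y \<in> space M \<Longrightarrow> continuous_on {t0..T} (V y)"
  shows "(\<lambda>z. V (fst z) (max t0 (min T (snd z)))) \<in> borel_measurable (M \<Otimes>\<^sub>M lborel)"
proof (rule borel_measurable_LIMSEQ_metric)
  let ?c = "\<lambda>r. max t0 (min T r)"
  let ?q = "\<lambda>n r. of_int \<lfloor>r * real (Suc n)\<rfloor> / real (Suc n)"
  show "(\<lambda>z. V (fst z) (?c (?q n (snd z)))) \<in> borel_measurable (M \<Otimes>\<^sub>M lborel)" for n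
  proof (rule measurable_compose_countable[where f="\<lambda>k z. V (fst z) (?c (of_int k / real (Suc n)))" and g="\<lambda>z. \<lfloor>snd z * real (Suc n)\<rfloor>"])
    show "(\<lambda>z. V (fst z) (?c (of_int k / real (Suc n)))) \<in> borel_measurable (M \<Otimes>\<^sub>M lborel)" for k
      by (rule measurable_compose[OF measurable_fst V]) (use t0T in auto)
    have "(\<lambda>z. snd z * real (Suc n)) \<in> borel_measurable (M \<Otimes>\<^sub>M lborel)" by simp
    then show "(\<lambda>z. \<lfloor>snd z * real (Suc n)\<rfloor>) \<in> measurable (M \<Otimes>\<^sub>M lborel) (count_space UNIV)"
      by (rule measurable_compose[OF _ measurable_real_floor])
  qed
  fix z :: "'y \<times> real" assume "z \<in> space (M \<Otimes>\<^sub>M lborel)"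
  then have y: "fst z \<in> space M" by (auto simp: space_pair_measure)
  have "(\<lambda>n. ?q n (snd z)) \<longlonglongrightarrow> snd z"
  proof (rule LIMSEQ_I)
    fix e :: real assume "e > 0"
    then obtain N where N: "1 / real (Suc N) < e" using nat_approx_posE by blast
    have "norm (?q n (snd z) - snd z) < e" if "N \<le> n" for n
    proof -
      have "\<bar>of_int \<lfloor>snd z * real (Suc n)\<rfloor> - snd z * real (Suc n)\<bar> \<le> 1" by linarith
      moreover have "?q n (snd z) - snd z = (of_int \<lfloor>snd z * real (Suc n)\<rfloor> - snd z * real (Suc n)) / real (Suc n)"
        by (simp add: diff_divide_distrib del: of_nat_Suc)
      ultimately have "norm (?q n (snd z) - snd z) \<le> 1 / real (Suc n)" by (simp add: abs_divide divide_right_mono del: of_nat_Suc)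
      also have "\<dots> \<le> 1 / real (Suc N)" using that by (intro divide_left_mono) auto
      finally show ?thesis using N by linarith
    qed
    then show "\<exists>no. \<forall>n\<ge>no. norm (?q n (snd z) - snd z) < e" by blast
  qed
  moreover have "continuous_on UNIV (\<lambda>r. V (fst z) (?c r))"
    by (rule continuous_on_compose2[OF cont[OF y]]) (use t0T in \<open>auto intro!: continuous_intros\<close>)
  then have "isCont (\<lambda>r. V (fst z) (?c r)) (snd z)" by (simp add: continuous_on_eq_continuous_at)
  ultimately show "(\<lambda>n. V (fst z) (?c (?q n (snd z)))) \<longlonglongrightarrow> V (fst z) (?c (snd z))"
    by (rule isCont_tendsto_compose[rotated])
qed

section \<open>Bounded drifts as functionals of the observed paths\<close>

lemma set_integral_lipschitz:
  fixes f :: "real \<Rightarrow> 'b::{banach, second_countable_topology}"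
  assumes f: "f \<in> borel_measurable lborel" "\<And>r. norm (f r) \<le> C" and ut: "t0 \<le> u" "t0 \<le> t"
  shows "norm ((LINT r:{t0..t}|lborel. f r) - (LINT r:{t0..u}|lborel. f r)) \<le> C * \<bar>t - u\<bar>"
proof -
  have le: "norm ((LINT r:{t0..t}|lborel. f r) - (LINT r:{t0..u}|lborel. f r)) \<le> C * (t - u)" if ut: "t0 \<le> u" "u \<le> t" for u t
  proof -
    have int: "set_integrable lborel {t0..x} f" for x
      unfolding set_integrable_def
      by (rule integrableI_bounded_set_indicator[where B=C]) (use f in \<open>auto simp: emeasure_lborel_Icc_eq\<close>)
    have int': "set_integrable lborel {u<..t} f" by (rule set_integrable_subset[OF int[of t]]) (use ut in auto)
    have "{t0..t} = {t0..u} \<union> {u<..t}" using ut by auto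
    moreover have "{t0..u} \<inter> {u<..t} = {}" by auto
    ultimately have "(LINT r:{t0..t}|lborel. f r) - (LINT r:{t0..u}|lborel. f r) = (LINT r:{u<..t}|lborel. f r)"
      using set_integral_Un[OF _ int[of u] int'] by simp
    also have "norm \<dots> \<le> (LINT r|lborel. norm (indicator {u<..t} r *\<^sub>R f r))"
      unfolding set_lebesgue_integral_def by (rule integral_norm_bound)
    also have "\<dots> \<le> (LINT r|lborel. indicator {u<..t} r *\<^sub>R C)"
    proof (rule integral_mono)
      show "integrable lborel (\<lambda>r. norm (indicator {u<..t} r *\<^sub>R f r))"
        using int' unfolding set_integrable_def by (rule integrable_norm)
      show "integrable lborel (\<lambda>r. indicator {u<..t} r *\<^sub>R C)"
        by (intro integrable_scaleR_left integrable_real_indicator) (use ut in \<open>auto simp: emeasure_lborel_Ioc\<close>)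
    qed (use f(2) in \<open>auto simp: indicator_def\<close>)
    also have "\<dots> = C * (t - u)" using ut by simp
    finally show ?thesis .
  qed
  show ?thesis
  proof (cases "u \<le> t")
    case True
    then show ?thesis using le[OF ut(1) True] by simp
  next
    case False
    then show ?thesis using le[OF ut(2), of u] by (simp add: norm_minus_commute)
  qed
qed

text \<open>
  Undoes the rescaling \<open>V\<^sup>i = sqrt (s\<^sub>i / 2) (X\<^sup>i - \<iota>(x\<^sub>i))\<close>.
\<close>

definition position :: "((nat \<Rightarrow> real) \<times> (nat \<Rightarrow> 'n::finite torus)) \<times> (nat \<Rightarrow> real \<Rightarrow> real ^ 'n) \<Rightarrow> nat \<Rightarrow> real \<Rightarrow> real ^ 'n" where
  "position y i t = torus_rep (snd (fst y) i) + sqrt (2 / fst (fst y) i) *\<^sub>R snd y i t"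

lemma position_measurable: "t \<in> {t0..T} \<Longrightarrow> (\<lambda>y. position y i t) \<in> borel_measurable (observation_space t0 T)"
proof -
  assume t: "t \<in> {t0..T}"
  note [measurable] = data_masses[OF observed_data] data_positions[OF observed_data] observed_path[OF t]
  show ?thesis unfolding position_def by measurable
qed

lemma position_continuous: "y \<in> space (observation_space t0 T) \<Longrightarrow> continuous_on {t0..T} (position y i)"
  unfolding position_def space_observation_space by (intro continuous_intros) auto

locale bounded_drift =
  fixes T t0 C :: real and b :: "nat \<Rightarrow> real \<Rightarrow> 'n::finite torus borel_prob \<Rightarrow> 'n torus \<Rightarrow> real ^ 'n"
  assumes t0: "0 \<le> t0" "t0 < T" and C: "0 \<le> C"
    and b_bound: "t \<in> {0..T} \<Longrightarrow> norm (b i t \<mu> p) \<le> C"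
    and b_measurable: "(\<lambda>(t, \<mu>, p). b i t \<mu> p) \<in> borel_measurable (restrict_space borel {0..T} \<Otimes>\<^sub>M (borel \<Otimes>\<^sub>M borel))"
begin

text \<open>
  The drift of particle \<open>i\<close> computed from the observed state. The time is clamped to \<open>[t0, T]\<close>, outside of
  which neither the paths nor the bound on \<open>b\<close> are available.
\<close>

definition drift_at where
  "drift_at y i r = (let r' = max t0 (min T r) in
     b i r' (dirac_mixture (fst (fst y)) (\<lambda>j. torus_proj (position y j r'))) (torus_proj (position y i r')))"

lemma drift_at_bound: "norm (drift_at y i r) \<le> C"
  unfolding drift_at_def Let_def using t0 by (intro b_bound) auto

text \<open>
  The empirical measure is a continuous function of masses and positions only on \<open>mass_seqs\<close>, so
  measurability is obtained through the restriction of the Borel sigma-algebra to this set.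
\<close>

lemma drift_at_measurable:
  "(\<lambda>z. drift_at (fst z) i (snd z)) \<in> borel_measurable (observation_space t0 T \<Otimes>\<^sub>M lborel)" (is "_ \<in> borel_measurable ?M")
proof -
  let ?c = "\<lambda>r. max t0 (min T r)"
  let ?x = "\<lambda>z j. position (fst z) j (?c (snd z))"
  have x: "(\<lambda>z. ?x z j) \<in> borel_measurable ?M" for j
    using t0 by (intro continuous_paths_jointly_measurable position_measurable position_continuous) auto
  have s: "(\<lambda>z. fst (fst (fst z))) \<in> borel_measurable ?M"
    by (intro measurable_compose[OF measurable_compose[OF measurable_fst observed_data] data_fst_measurable])
  have "(\<lambda>z. ?x z) \<in> borel_measurable ?M" by (rule measurable_coordinatewise_then_product) (rule x)
  then have "(\<lambda>z. (fst (fst (fst z)), ?x z)) \<in> borel_measurable ?M" by (rule borel_measurable_Pair[OF s])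
  moreover have "fst (fst (fst z)) \<in> mass_seqs" if "z \<in> space ?M" for z
    using that by (auto simp: space_pair_measure space_observation_space)
  ultimately have "(\<lambda>z. (fst (fst (fst z)), ?x z)) \<in> measurable ?M (restrict_space borel (mass_seqs \<times> UNIV))"
    by (intro measurable_restrict_space2) auto
  from measurable_compose[OF this borel_measurable_continuous_on_restrict[OF continuous_dirac_mixture]]
  have mu: "(\<lambda>z. dirac_mixture (fst (fst (fst z))) (\<lambda>j. torus_proj (?x z j))) \<in> borel_measurable ?M" by simp
  have p: "(\<lambda>z. torus_proj (?x z i)) \<in> borel_measurable ?M"
    by (rule measurable_compose[OF x borel_measurable_continuous_onI[OF continuous_torus_proj]])
  have "(\<lambda>z. ?c (snd z)) \<in> borel_measurable ?M" by simp
  then have r: "(\<lambda>z. ?c (snd z)) \<in> measurable ?M (restrict_space borel {0..T})"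
    by (rule measurable_restrict_space2[rotated]) (use t0 in auto)
  from measurable_compose[OF measurable_Pair[OF r measurable_Pair[OF mu p]] b_measurable]
  show ?thesis by (simp add: drift_at_def Let_def)
qed

definition rescaled_drift where
  "rescaled_drift y i t = sqrt (fst (fst y) i / 2) *\<^sub>R (LINT r:{t0..t}|lborel. drift_at y i r)"

lemma rescaled_drift_measurable: "(\<lambda>y. rescaled_drift y i t) \<in> borel_measurable (observation_space t0 T)"
proof -
  have "(\<lambda>y. LINT r:{t0..t}|lborel. drift_at y i r) \<in> borel_measurable (observation_space t0 T)"
    unfolding set_lebesgue_integral_def
  proof (rule lborel.borel_measurable_lebesgue_integral)
    note [measurable] = drift_at_measurable
    show "(\<lambda>(y, r). indicator {t0..t} r *\<^sub>R drift_at y i r) \<in> borel_measurable (observation_space t0 T \<Otimes>\<^sub>M lborel)"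
      unfolding case_prod_beta by measurable
  qed
  note [measurable] = this data_masses[OF observed_data]
  show ?thesis unfolding rescaled_drift_def by measurable
qed

lemma rescaled_drift_lipschitz:
  assumes y: "y \<in> space (observation_space t0 T)" and tu: "t \<in> {t0..T}" "u \<in> {t0..T}"
  shows "norm (rescaled_drift y i t - rescaled_drift y i u) \<le> C * sqrt (fst (fst y) i / 2) * \<bar>t - u\<bar>"
proof -
  have "(\<lambda>r. drift_at y i r) \<in> borel_measurable lborel" using measurable_Pair2[OF drift_at_measurable y] by simp
  then have "norm ((LINT r:{t0..t}|lborel. drift_at y i r) - (LINT r:{t0..u}|lborel. drift_at y i r)) \<le> C * \<bar>t - u\<bar>"
    using tu by (intro set_integral_lipschitz drift_at_bound) auto
  moreover have "0 < fst (fst y) i" using y mass_seqsD(1) by (auto simp: space_observation_space)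
  ultimately show ?thesis
    unfolding rescaled_drift_def scaleR_right_diff_distrib[symmetric] norm_scaleR
    by (simp add: mult.assoc mult.left_commute mult_left_mono)
qed

lemma rescaled_drift_start: "rescaled_drift y i t0 = 0"
proof -
  have "AE r in lborel. indicator {t0..t0} r *\<^sub>R drift_at y i r = 0"
    using AE_lborel_singleton[of t0] by eventually_elim (auto simp: indicator_def)
  then show ?thesis by (simp add: rescaled_drift_def set_lebesgue_integral_def integral_eq_zero_AE)
qed

text \<open>
  Here the normalisation of the masses enters: each of the \<open>CARD('n)\<close> components of particle \<open>i\<close> is
  Lipschitz with squared constant \<open>C\<^sup>2 s\<^sub>i / 2\<close>.
\<close>

lemma rescaled_drift_energy:
  assumes y: "y \<in> space (observation_space t0 T)"
  shows "energy_bounded t0 T (real CARD('n) * C\<^sup>2 / 2) (\<lambda>p t. rescaled_drift y (fst p) t $ snd p)"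
  unfolding energy_bounded_def
proof (intro exI[of _ "\<lambda>p. C * sqrt (fst (fst y) (fst p) / 2)"] conjI allI ballI impI)
  let ?s = "fst (fst y)"
  have s: "?s \<in> mass_seqs" using y by (simp add: space_observation_space)
  note s' = mass_seqsD[OF s]
  show "0 \<le> C * sqrt (?s (fst p) / 2)" for p :: "nat \<times> 'n" using C s'(1)[of "fst p"] by simp
  fix S :: "(nat \<times> 'n) set" assume S: "finite S"
  obtain n where n: "fst ` S \<subseteq> {..<n}" using finite_nat_iff_bounded S by blast
  have "(\<Sum>p\<in>S. (C * sqrt (?s (fst p) / 2))\<^sup>2) = (\<Sum>p\<in>S. C\<^sup>2 / 2 * ?s (fst p))"
    using s'(1) by (intro sum.cong refl) (simp add: power_mult_distrib less_imp_le)
  also have "\<dots> \<le> (\<Sum>p\<in>{..<n} \<times> (UNIV :: 'n set). C\<^sup>2 / 2 * ?s (fst p))"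
    using n s'(1) by (intro sum_mono2) (auto simp: less_imp_le)
  also have "\<dots> = (\<Sum>i<n. \<Sum>a\<in>(UNIV :: 'n set). C\<^sup>2 / 2 * ?s i)" by (subst sum.cartesian_product) (simp add: case_prod_beta)
  also have "\<dots> = real CARD('n) * C\<^sup>2 / 2 * (\<Sum>i<n. ?s i)" by (simp add: sum_distrib_left mult.assoc)
  also have "\<dots> \<le> real CARD('n) * C\<^sup>2 / 2 * 1"
  proof (rule mult_left_mono)
    show "(\<Sum>i<n. ?s i) \<le> 1"
      using sum_le_suminf[OF sums_summable[OF s'(3)], of "{..<n}"] sums_unique[OF s'(3)] s'(1) by (simp add: less_imp_le)
  qed simp
  finally show "(\<Sum>p\<in>S. (C * sqrt (?s (fst p) / 2))\<^sup>2) \<le> real CARD('n) * C\<^sup>2 / 2" by simp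
next
  fix p :: "nat \<times> 'n" and t u assume tu: "t \<in> {t0..T}" "u \<in> {t0..T}"
  show "\<bar>rescaled_drift y (fst p) t $ snd p - rescaled_drift y (fst p) u $ snd p\<bar> \<le> C * sqrt (fst (fst y) (fst p) / 2) * \<bar>t - u\<bar>"
    using component_le_norm_cart[of "rescaled_drift y (fst p) t - rescaled_drift y (fst p) u" "snd p"]
      rescaled_drift_lipschitz[OF y tu, of "fst p"] by simp
qed

end

text \<open>
  All factors of \<open>solution_topology\<close> are second countable, so it is enough to consider single paths, and
  for these the values at fixed times.
\<close>

lemma measurable_solution:
  fixes d :: "'w \<Rightarrow> (nat \<Rightarrow> real) \<times> (nat \<Rightarrow> 'n::finite torus)" and f g :: "nat \<Rightarrow> real \<Rightarrow> 'w \<Rightarrow> real ^ 'n"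
  assumes t0: "0 \<le> t0" "t0 < T" and d: "d \<in> measurable M (borel_of data_topology)"
    and f: "\<And>i t. t \<in> {t0..T} \<Longrightarrow> f i t \<in> borel_measurable M" "\<And>i \<omega>. \<omega> \<in> space M \<Longrightarrow> continuous_on {t0..T} (\<lambda>t. f i t \<omega>)"
    and g: "\<And>i t. t \<in> {t0..T} \<Longrightarrow> g i t \<in> borel_measurable M" "\<And>i \<omega>. \<omega> \<in> space M \<Longrightarrow> continuous_on {t0..T} (\<lambda>t. g i t \<omega>)"
  shows "(\<lambda>\<omega>. (d \<omega>, (\<lambda>i. extend_path t0 T (\<lambda>t. f i t \<omega>)), (\<lambda>i. extend_path t0 T (\<lambda>t. g i t \<omega>))))
    \<in> measurable M (borel_of (solution_topology T))"
proof -
  have T: "T > 0" using t0 by simp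
  have path: "(\<lambda>\<omega>. extend_path t0 T (\<lambda>t. h t \<omega>)) \<in> measurable M (borel_of (path_topology T))"
    if h: "\<And>t. t \<in> {t0..T} \<Longrightarrow> h t \<in> borel_measurable M" "\<And>\<omega>. \<omega> \<in> space M \<Longrightarrow> continuous_on {t0..T} (\<lambda>t. h t \<omega>)"
    for h :: "real \<Rightarrow> 'w \<Rightarrow> real ^ 'n"
  proof (rule measurable_path[OF T])
    show "extend_path t0 T (\<lambda>t. h t \<omega>) \<in> extensional {0..T}" for \<omega> by (simp add: extend_path_def)
    show "continuous_on {0..T} (extend_path t0 T (\<lambda>t. h t \<omega>))" if "\<omega> \<in> space M" for \<omega>
    proof -
      have "continuous_on {0..T} (\<lambda>t. h (max t0 t) \<omega>)"
        by (rule continuous_on_compose2[OF h(2)[OF that]]) (use t0 in \<open>auto intro!: continuous_intros\<close>)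
      then show ?thesis by (rule continuous_on_eq) (simp add: extend_path_def)
    qed
    show "(\<lambda>\<omega>. extend_path t0 T (\<lambda>t. h t \<omega>) t) \<in> borel_measurable M" if "t \<in> {0..T}" for t
      using h(1)[of "max t0 t"] that t0 by (auto simp: extend_path_def)
  qed
  note sc = second_countable_product_topology[OF second_countable_path_topology[OF T]]
  show ?thesis
    unfolding solution_topology_def
    by (intro measurable_borel_of_prod second_countable_data second_countable_prod_topology sc d
        measurable_borel_of_product[OF second_countable_path_topology[OF T]] path f g)
qed

context bounded_drift
begin

abbreviation "\<E> \<equiv> observation_space t0 T :: (((nat \<Rightarrow> real) \<times> (nat \<Rightarrow> 'n torus)) \<times> (nat \<Rightarrow> real \<Rightarrow> real ^ 'n)) measure"

definition initial_events :: "(((nat \<Rightarrow> real) \<times> (nat \<Rightarrow> 'n torus)) \<times> (nat \<Rightarrow> real \<Rightarrow> real ^ 'n)) set set" where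
  "initial_events = {fst -` A \<inter> space \<E> | A. A \<in> sets (borel_of data_topology)}"

text \<open>
  Recovers the whole solution from the observed state, since the Brownian motions are the observed paths
  minus their drifts.
\<close>

definition reconstruct where
  "reconstruct y = (fst y, (\<lambda>i. extend_path t0 T (\<lambda>t. position y i t)),
     (\<lambda>i. extend_path t0 T (\<lambda>t. snd y i t - rescaled_drift y i t)))"

lemma rescaled_drift_continuous:
  assumes y: "y \<in> space \<E>"
  shows "continuous_on {t0..T} (rescaled_drift y i)"
proof -
  have "(C * sqrt (fst (fst y) i / 2))-lipschitz_on {t0..T} (rescaled_drift y i)"
    using y C mass_seqsD(1)[of "fst (fst y)" i]
    by (intro lipschitz_onI) (auto simp: dist_norm space_observation_space intro: rescaled_drift_lipschitz[OF y, simplified])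
  then show ?thesis by (rule lipschitz_on_continuous_on)
qed

lemma reconstruct_measurable: "reconstruct \<in> measurable \<E> (borel_of (solution_topology T))"
  unfolding reconstruct_def
proof (rule measurable_solution[OF t0 observed_data])
  fix i t assume t: "t \<in> {t0..T}"
  show "(\<lambda>y. position y i t) \<in> borel_measurable \<E>" by (rule position_measurable[OF t])
  show "(\<lambda>y. snd y i t - rescaled_drift y i t) \<in> borel_measurable \<E>"
    by (intro borel_measurable_diff observed_path[OF t] rescaled_drift_measurable)
next
  fix i and y :: "((nat \<Rightarrow> real) \<times> (nat \<Rightarrow> 'n torus)) \<times> (nat \<Rightarrow> real \<Rightarrow> real ^ 'n)" assume y: "y \<in> space \<E>"
  show "continuous_on {t0..T} (\<lambda>t. position y i t)" by (rule position_continuous[OF y])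
  show "continuous_on {t0..T} (\<lambda>t. snd y i t - rescaled_drift y i t)"
    using y by (intro continuous_on_diff rescaled_drift_continuous) (auto simp: space_observation_space)
qed

text \<open>
  With the right-hand side as sigma-algebra on the source, the identity map is measurable, because the
  initial data and all evaluations of the paths are.
\<close>

lemma observation_space_generated:
  fixes v :: "nat \<times> 'n \<Rightarrow> real \<Rightarrow> ((nat \<Rightarrow> real) \<times> (nat \<Rightarrow> 'n torus)) \<times> (nat \<Rightarrow> real \<Rightarrow> real ^ 'n) \<Rightarrow> real"
  defines "v \<equiv> \<lambda>p t y. snd y (fst p) t $ snd p"
  shows "sets \<E> = sigma_sets (space \<E>) {D \<inter> {y\<in>space \<E>. \<forall>x\<in>M. v (fst x) (snd x) y \<in> B x} | D M B.
       D \<in> initial_events \<and> finite M \<and> M \<subseteq> UNIV \<times> {t0..T} \<and> (\<forall>x. B x \<in> sets (borel :: real measure))}"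
    (is "_ = sigma_sets _ ?G")
proof
  have v: "v p t \<in> borel_measurable \<E>" if "t \<in> {t0..T}" for p t
    unfolding v_def by (rule measurable_compose[OF observed_path[OF that] borel_measurable_nth])
  have DE: "D \<in> sets \<E>" if "D \<in> initial_events" for D
    using that measurable_sets[OF observed_data] unfolding initial_events_def by blast
  have G: "?G \<subseteq> sets \<E>"
  proof (intro subsetI, elim CollectE exE conjE)
    fix S D M B assume S: "S = D \<inter> {y\<in>space \<E>. \<forall>x\<in>M. v (fst x) (snd x) y \<in> B x}" "D \<in> initial_events" "finite M"
      "M \<subseteq> UNIV \<times> {t0..T}" "\<forall>x. B x \<in> sets (borel :: real measure)"
    have "{y\<in>space \<E>. \<forall>x\<in>M. v (fst x) (snd x) y \<in> B x} \<in> sets \<E>"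
    proof (rule sets.sets_Collect_finite_All)
      fix x assume x: "x \<in> M"
      have "v (fst x) (snd x) -` B x \<inter> space \<E> \<in> sets \<E>"
        using S x by (intro measurable_sets[OF v]) auto
      moreover have "v (fst x) (snd x) -` B x \<inter> space \<E> = {y\<in>space \<E>. v (fst x) (snd x) y \<in> B x}" by auto
      ultimately show "{y\<in>space \<E>. v (fst x) (snd x) y \<in> B x} \<in> sets \<E>" by simp
    qed fact
    then show "S \<in> sets \<E>" unfolding S(1) by (rule sets.Int[OF DE[OF S(2)]])
  qed
  then show "sigma_sets (space \<E>) ?G \<subseteq> sets \<E>" by (rule sets.sigma_sets_subset)
  define N where "N = sigma (space \<E>) ?G"
  have GP: "?G \<subseteq> Pow (space \<E>)" using G sets.space_closed by blast
  have N: "space N = space \<E>" "sets N = sigma_sets (space \<E>) ?G"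
    unfolding N_def using GP by (auto simp: space_measure_of sets_measure_of)
  have "(\<lambda>y. (fst y, \<lambda>i. snd y i)) \<in> measurable N \<E>"
  proof (rule measurable_observationI)
    show "fst \<in> measurable N (borel_of data_topology)"
    proof (rule measurableI)
      show "fst y \<in> space (borel_of data_topology)" if "y \<in> space N" for y
        using that measurable_space[OF observed_data] by (simp only: N)
      fix A :: "((nat \<Rightarrow> real) \<times> (nat \<Rightarrow> 'n torus)) set" assume A: "A \<in> sets (borel_of data_topology)"
      have "fst -` A \<inter> space \<E> = (fst -` A \<inter> space \<E>) \<inter> {y\<in>space \<E>. \<forall>x\<in>{}. v (fst x) (snd x) y \<in> UNIV}" by auto
      then have "fst -` A \<inter> space \<E> \<in> ?G"
        using A by (intro CollectI exI[of _ "fst -` A \<inter> space \<E>"] exI[of _ "{}"] exI[of _ "\<lambda>_. UNIV"])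
          (auto simp: initial_events_def)
      then show "fst -` A \<inter> space N \<in> sets N" unfolding N by (rule sigma_sets.Basic)
    qed
    fix i
    show "(\<lambda>y. snd y i) \<in> measurable N (path_space t0 T)"
    proof (rule measurable_path_spaceI)
      fix t assume t: "t \<in> {t0..T}"
      show "(\<lambda>y. snd y i t) \<in> borel_measurable N"
      proof (intro measurable_real_vector measurableI)
        fix a :: 'n and S :: "real set" assume S: "S \<in> sets borel"
        have top: "space \<E> \<in> initial_events"
          unfolding initial_events_def
        proof (intro CollectI exI[of _ "space (borel_of data_topology)"] conjI sets.top)
          show "space \<E> = fst -` space (borel_of data_topology) \<inter> space \<E>" using measurable_space[OF observed_data] by blast
        qed
        have "(\<lambda>y. snd y i t $ a) -` S \<inter> space \<E> = space \<E> \<inter> {y\<in>space \<E>. \<forall>x\<in>{((i, a), t)}. v (fst x) (snd x) y \<in> S}"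
          by (auto simp: v_def)
        then have "(\<lambda>y. snd y i t $ a) -` S \<inter> space \<E> \<in> ?G"
          using S t top by (intro CollectI exI[of _ "space \<E>"] exI[of _ "{((i, a), t)}"] exI[of _ "\<lambda>_. S"]) auto
        then show "(\<lambda>y. snd y i t $ a) -` S \<inter> space N \<in> sets N" unfolding N by (rule sigma_sets.Basic)
      qed simp
    qed (simp_all add: N space_observation_space)
  qed
  then have id: "(\<lambda>y. y) \<in> measurable N \<E>" by simp
  show "sets \<E> \<subseteq> sigma_sets (space \<E>) ?G"
  proof
    fix A assume A: "A \<in> sets \<E>"
    then have "A \<inter> space N \<in> sets N" using measurable_sets[OF id A] by simp
    moreover have "A \<inter> space N = A" using sets.sets_into_space[OF A] N by auto
    ultimately show "A \<in> sigma_sets (space \<E>) ?G" using N by simp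
  qed
qed

end

section \<open>Weak solutions\<close>

definition observation :: "real \<Rightarrow> real \<Rightarrow> ('w \<Rightarrow> nat \<Rightarrow> real) \<Rightarrow> ('w \<Rightarrow> nat \<Rightarrow> 'n torus) \<Rightarrow>
    (nat \<Rightarrow> real \<Rightarrow> 'w \<Rightarrow> real ^ 'n::finite) \<Rightarrow> 'w \<Rightarrow> ((nat \<Rightarrow> real) \<times> (nat \<Rightarrow> 'n torus)) \<times> (nat \<Rightarrow> real \<Rightarrow> real ^ 'n)" where
  "observation t0 T s x X \<omega> = ((s \<omega>, x \<omega>), \<lambda>i. \<lambda>t\<in>{t0..T}. sqrt (s \<omega> i / 2) *\<^sub>R (X i t \<omega> - torus_rep (x \<omega> i)))"

context bounded_drift
begin

text \<open>
  The processes \<open>A\<close> are defined as observed path minus Brownian motion, which makes them adapted at once;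
  by the equation they coincide almost surely with the drift functionals evaluated at \<open>Y\<close>, and only then
  are they known to have bounded energy.
\<close>

lemma weak_solution_observed:
  fixes W X :: "nat \<Rightarrow> real \<Rightarrow> 'w \<Rightarrow> real ^ 'n"
  assumes ws: "weak_solution T b t0 m Q F s x X W"
  defines "Y \<equiv> observation t0 T s x X"
  shows "observed_drift Q F t0 T (\<lambda>p t \<omega>. W (fst p) t \<omega> $ snd p)
      (\<lambda>p t \<omega>. sqrt (s \<omega> (fst p) / 2) * (X (fst p) t \<omega> - torus_rep (x \<omega> (fst p))) $ snd p - W (fst p) t \<omega> $ snd p)
      (real CARD('n) * C\<^sup>2 / 2) (\<lambda>n. {..<n} \<times> UNIV) \<E> Y
      (\<lambda>p t y. snd y (fst p) t $ snd p) (\<lambda>p t y. rescaled_drift y (fst p) t $ snd p) initial_events" (is ?obs)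
    and "solution_law T t0 Q s x X W = distr (distr Q \<E> Y) (borel_of (solution_topology T)) reconstruct" (is ?law)
    and "A \<in> sets (borel_of data_topology) \<Longrightarrow> measure Q (Y -` (fst -` A \<inter> space \<E>) \<inter> space Q) = measure m A"
proof -
  have FP: "filtered_prob_space Q F t0 T" and BM: "\<And>i. brownian_motion Q F t0 T (W i)"
    and ind: "prob_space.indep_vars Q (\<lambda>i. PiM {t0..T} (\<lambda>_. borel)) (\<lambda>i \<omega>. \<lambda>t\<in>{t0..T}. W i t \<omega>) UNIV"
    and dF0: "(\<lambda>\<omega>. (s \<omega>, x \<omega>)) \<in> measurable (F t0) (borel_of data_topology)"
    and dlaw: "distr Q (borel_of data_topology) (\<lambda>\<omega>. (s \<omega>, x \<omega>)) = m"
    and Xca: "\<And>i. continuous_adapted Q F t0 T (X i)"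
    and eq: "AE \<omega> in Q. \<forall>i. \<forall>t\<in>{t0..T}. X i t \<omega> = torus_rep (x \<omega> i)
          + (LINT r:{t0..t}|lborel. b i r (dirac_mixture (s \<omega>) (\<lambda>j. torus_proj (X j r \<omega>))) (torus_proj (X i r \<omega>)))
          + sqrt (2 / s \<omega> i) *\<^sub>R W i t \<omega>"
    using ws unfolding weak_solution_def by blast+
  interpret bf: brownian_family Q F t0 T "\<lambda>p t \<omega>. W (fst p) t \<omega> $ snd p" by (rule brownian_components[OF FP BM ind])
  have t0in: "t0 \<in> {t0..T}" using t0 by simp
  have dF: "(\<lambda>\<omega>. (s \<omega>, x \<omega>)) \<in> measurable (F t) (borel_of data_topology)" if "t \<in> {t0..T}" for t
    using bf.meas_F_mono[OF t0in that _ dF0] that by simp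
  note dQ = bf.meas_F[OF t0in dF0]
  have XF: "X i t \<in> borel_measurable (F t)" and WF: "W i t \<in> borel_measurable (F t)" if "t \<in> {t0..T}" for i t
    using Xca[of i] BM[of i] that unfolding continuous_adapted_def brownian_motion_def by blast+
  note XQ = bf.meas_F[OF _ XF] and WQ = bf.meas_F[OF _ WF]
  have Xc: "continuous_on {t0..T} (\<lambda>t. X i t \<omega>)" and Wc: "continuous_on {t0..T} (\<lambda>t. W i t \<omega>)" if "\<omega> \<in> space Q" for i \<omega>
    using Xca[of i] BM[of i] that unfolding continuous_adapted_def brownian_motion_def by blast+
  have mass: "s \<omega> \<in> mass_seqs" if "\<omega> \<in> space Q" for \<omega>
    using measurable_space[OF dQ that] by (simp add: topspace_data)
  note spos = mass_seqsD(1)[OF mass]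
  have vecF: "(\<lambda>\<omega>. sqrt (s \<omega> i / 2) *\<^sub>R (X i t \<omega> - torus_rep (x \<omega> i))) \<in> borel_measurable (F t)" if "t \<in> {t0..T}" for i t
  proof -
    have [measurable]: "(\<lambda>\<omega>. s \<omega> i) \<in> borel_measurable (F t)" "(\<lambda>\<omega>. torus_rep (x \<omega> i)) \<in> borel_measurable (F t)"
      using data_masses[OF dF[OF that], of i] data_positions[OF dF[OF that], of i] by simp_all
    note [measurable] = XF[OF that]
    show ?thesis by measurable
  qed
  have vecQ: "(\<lambda>\<omega>. sqrt (s \<omega> i / 2) *\<^sub>R (X i t \<omega> - torus_rep (x \<omega> i))) \<in> borel_measurable Q" if "t \<in> {t0..T}" for i t
    using bf.meas_F[OF that vecF[OF that]] .
  have Ym: "Y \<in> measurable Q \<E>"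
    unfolding Y_def observation_def
  proof (rule measurable_observationI[OF dQ measurable_path_spaceI])
    fix i \<omega> assume \<omega>: "\<omega> \<in> space Q"
    have "continuous_on {t0..T} (\<lambda>t. sqrt (s \<omega> i / 2) *\<^sub>R (X i t \<omega> - torus_rep (x \<omega> i)))"
      by (intro continuous_intros Xc[OF \<omega>])
    then show "continuous_on {t0..T} (\<lambda>t\<in>{t0..T}. sqrt (s \<omega> i / 2) *\<^sub>R (X i t \<omega> - torus_rep (x \<omega> i)))"
      by (rule continuous_on_eq) simp
  qed (use vecQ in auto)
  have Ysp: "Y \<omega> \<in> space \<E>" if "\<omega> \<in> space Q" for \<omega> by (rule measurable_space[OF Ym that])
  have vY: "snd (Y \<omega>) i t = sqrt (s \<omega> i / 2) *\<^sub>R (X i t \<omega> - torus_rep (x \<omega> i))" if "t \<in> {t0..T}" for i t \<omega>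
    using that by (simp add: Y_def observation_def)
  have fY: "fst (Y \<omega>) = (s \<omega>, x \<omega>)" for \<omega> by (simp add: Y_def observation_def)
  have inv: "sqrt (2 / s \<omega> i) * sqrt (s \<omega> i / 2) = 1" if "\<omega> \<in> space Q" for i \<omega>
    using spos[OF that, of i] by (simp flip: real_sqrt_mult)
  have pos: "position (Y \<omega>) i t = X i t \<omega>" if "\<omega> \<in> space Q" "t \<in> {t0..T}" for i t \<omega>
    using inv[OF that(1), of i] by (simp add: position_def fY vY[OF that(2)])
  have drift: "rescaled_drift (Y \<omega>) i t = sqrt (s \<omega> i / 2) *\<^sub>R
      (LINT r:{t0..t}|lborel. b i r (dirac_mixture (s \<omega>) (\<lambda>j. torus_proj (X j r \<omega>))) (torus_proj (X i r \<omega>)))"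
    if \<omega>: "\<omega> \<in> space Q" and t: "t \<in> {t0..T}" for i t \<omega>
  proof -
    have "(LINT r:{t0..t}|lborel. drift_at (Y \<omega>) i r) =
        (LINT r:{t0..t}|lborel. b i r (dirac_mixture (s \<omega>) (\<lambda>j. torus_proj (X j r \<omega>))) (torus_proj (X i r \<omega>)))"
    proof (intro set_lebesgue_integral_cong allI impI)
      fix r assume r: "r \<in> {t0..t}"
      then have c: "max t0 (min T r) = r" "r \<in> {t0..T}" using t by auto
      show "drift_at (Y \<omega>) i r = b i r (dirac_mixture (s \<omega>) (\<lambda>j. torus_proj (X j r \<omega>))) (torus_proj (X i r \<omega>))"
        by (simp add: drift_at_def c(1) pos[OF \<omega> c(2)] fY)
    qed simp
    then show ?thesis by (simp add: rescaled_drift_def fY)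
  qed
  have key: "AE \<omega> in Q. \<forall>i. \<forall>t\<in>{t0..T}. rescaled_drift (Y \<omega>) i t = snd (Y \<omega>) i t - W i t \<omega>"
    using eq AE_space
  proof eventually_elim
    case (elim \<omega>)
    show ?case
    proof (intro allI ballI)
      fix i t assume t: "t \<in> {t0..T}"
      let ?L = "LINT r:{t0..t}|lborel. b i r (dirac_mixture (s \<omega>) (\<lambda>j. torus_proj (X j r \<omega>))) (torus_proj (X i r \<omega>))"
      have "X i t \<omega> - torus_rep (x \<omega> i) = ?L + sqrt (2 / s \<omega> i) *\<^sub>R W i t \<omega>"
        using elim(1)[rule_format, OF t, of i] by simp
      then have "snd (Y \<omega>) i t = sqrt (s \<omega> i / 2) *\<^sub>R ?L + (sqrt (s \<omega> i / 2) * sqrt (2 / s \<omega> i)) *\<^sub>R W i t \<omega>"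
        unfolding vY[OF t] by (simp only: scaleR_add_right scaleR_scaleR)
      then show "rescaled_drift (Y \<omega>) i t = snd (Y \<omega>) i t - W i t \<omega>"
        using inv[OF elim(2), of i] by (simp add: drift[OF elim(2) t] mult.commute)
    qed
  qed
  have init: "Y -` D \<inter> space Q \<in> sets (F t0)" if D: "D \<in> initial_events" for D
  proof -
    obtain A where A: "A \<in> sets (borel_of data_topology)" "D = fst -` A \<inter> space \<E>" using D unfolding initial_events_def by blast
    have "space (F t0) = space Q" using bf.subalg[OF t0in] by (simp add: subalgebra_def)
    then have "Y -` D \<inter> space Q = (\<lambda>\<omega>. (s \<omega>, x \<omega>)) -` A \<inter> space (F t0)"
      unfolding A(2) by (intro set_eqI iffI; simp add: fY Ysp)
    then show ?thesis using measurable_sets[OF dF0 A(1)] by simp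
  qed
  show "measure Q (Y -` (fst -` A \<inter> space \<E>) \<inter> space Q) = measure m A" if A: "A \<in> sets (borel_of data_topology)"
  proof -
    have "Y -` (fst -` A \<inter> space \<E>) \<inter> space Q = (\<lambda>\<omega>. (s \<omega>, x \<omega>)) -` A \<inter> space Q"
      by (intro set_eqI iffI; simp add: fY Ysp)
    then show ?thesis using measure_distr[OF dQ A] dlaw by simp
  qed
  show ?obs
  proof
    show "t0 < T" by (rule t0)
    show "finite ({..<n} \<times> (UNIV :: 'n set))" for n :: nat by simp
    show "mono (\<lambda>n :: nat. {..<n} \<times> (UNIV :: 'n set))" by (auto simp: mono_def)
    show "(\<Union>n :: nat. {..<n} \<times> (UNIV :: 'n set)) = UNIV" by auto
    show "0 \<le> real CARD('n) * C\<^sup>2 / 2" by simp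
    show "(\<lambda>\<omega>. sqrt (s \<omega> (fst p) / 2) * (X (fst p) t \<omega> - torus_rep (x \<omega> (fst p))) $ snd p - W (fst p) t \<omega> $ snd p) \<in> borel_measurable (F t)"
      if "t \<in> {t0..T}" for t and p :: "nat \<times> 'n"
      using measurable_compose[OF vecF[OF that, of "fst p"] borel_measurable_nth[of "snd p"]]
        measurable_compose[OF WF[OF that, of "fst p"] borel_measurable_nth[of "snd p"]]
      by (intro borel_measurable_diff) simp_all
    show "AE \<omega> in Q. energy_bounded t0 T (real CARD('n) * C\<^sup>2 / 2) (\<lambda>p t. sqrt (s \<omega> (fst p) / 2) *
        (X (fst p) t \<omega> - torus_rep (x \<omega> (fst p))) $ snd p - W (fst p) t \<omega> $ snd p)"
      using key AE_space
    proof eventually_elim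
      case (elim \<omega>)
      have "energy_bounded t0 T (real CARD('n) * C\<^sup>2 / 2) (\<lambda>p t. rescaled_drift (Y \<omega>) (fst p) t $ snd p)"
        by (rule rescaled_drift_energy[OF Ysp[OF elim(2)]])
      moreover have "rescaled_drift (Y \<omega>) (fst p) t $ snd p = sqrt (s \<omega> (fst p) / 2) *
        (X (fst p) t \<omega> - torus_rep (x \<omega> (fst p))) $ snd p - W (fst p) t \<omega> $ snd p" if "t \<in> {t0..T}" for t and p :: "nat \<times> 'n"
        using elim(1)[rule_format, OF that, of "fst p"] by (simp add: vY[OF that])
      ultimately show ?case unfolding energy_bounded_def by simp
    qed
    show "AE \<omega> in Q. \<forall>p. continuous_on {t0..T} (\<lambda>t. W (fst p) t \<omega> $ snd p)"
      using AE_space by eventually_elim (intro allI continuous_on_component Wc)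
    have "AE \<omega> in Q. \<forall>i. W i t0 \<omega> = 0" unfolding AE_all_countable using BM unfolding brownian_motion_def by blast
    then show "AE \<omega> in Q. \<forall>p. W (fst p) t0 \<omega> $ snd p = 0 \<and> sqrt (s \<omega> (fst p) / 2) *
        (X (fst p) t0 \<omega> - torus_rep (x \<omega> (fst p))) $ snd p - W (fst p) t0 \<omega> $ snd p = 0"
      using key
    proof eventually_elim
      case (elim \<omega>)
      show ?case
      proof
        fix p :: "nat \<times> 'n"
        have "snd (Y \<omega>) (fst p) t0 - W (fst p) t0 \<omega> = 0"
          using elim(2)[rule_format, OF t0in, of "fst p"] rescaled_drift_start by simp
        then have "(snd (Y \<omega>) (fst p) t0 - W (fst p) t0 \<omega>) $ snd p = 0" by simp
        then show "W (fst p) t0 \<omega> $ snd p = 0 \<and> sqrt (s \<omega> (fst p) / 2) *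
          (X (fst p) t0 \<omega> - torus_rep (x \<omega> (fst p))) $ snd p - W (fst p) t0 \<omega> $ snd p = 0"
          using elim(1) by (simp add: vY[OF t0in])
      qed
    qed
    show "Y \<in> measurable Q \<E>" by (rule Ym)
    show "(\<lambda>y. snd y (fst p) t $ snd p) \<in> borel_measurable \<E>" if "t \<in> {t0..T}" for t and p :: "nat \<times> 'n"
      by (rule measurable_compose[OF observed_path[OF that] borel_measurable_nth])
    show "(\<lambda>y. rescaled_drift y (fst p) t $ snd p) \<in> borel_measurable \<E>" for t and p :: "nat \<times> 'n"
      by (rule measurable_compose[OF rescaled_drift_measurable borel_measurable_nth])
    show "AE \<omega> in Q. \<forall>p. \<forall>t\<in>{t0..T}. snd (Y \<omega>) (fst p) t $ snd p = W (fst p) t \<omega> $ snd p +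
        (sqrt (s \<omega> (fst p) / 2) * (X (fst p) t \<omega> - torus_rep (x \<omega> (fst p))) $ snd p - W (fst p) t \<omega> $ snd p) \<and>
        rescaled_drift (Y \<omega>) (fst p) t $ snd p =
        sqrt (s \<omega> (fst p) / 2) * (X (fst p) t \<omega> - torus_rep (x \<omega> (fst p))) $ snd p - W (fst p) t \<omega> $ snd p"
      using key by eventually_elim (auto simp: vY)
    show "initial_events \<subseteq> sets \<E>"
      unfolding initial_events_def using measurable_sets[OF observed_data] by blast
  qed (rule init)
  have "solution_law T t0 Q s x X W = distr Q (borel_of (solution_topology T)) (\<lambda>\<omega>. reconstruct (Y \<omega>))"
    unfolding solution_law_def
  proof (rule distr_cong_AE[OF refl refl])
    show "(\<lambda>\<omega>. ((s \<omega>, x \<omega>), (\<lambda>i. extend_path t0 T (\<lambda>t. X i t \<omega>)), (\<lambda>i. extend_path t0 T (\<lambda>t. W i t \<omega>))))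
        \<in> measurable Q (borel_of (solution_topology T))"
      by (rule measurable_solution[OF t0 dQ XQ Xc WQ Wc])
    show "(\<lambda>\<omega>. reconstruct (Y \<omega>)) \<in> measurable Q (borel_of (solution_topology T))"
      by (rule measurable_compose[OF Ym reconstruct_measurable])
    show "AE \<omega> in Q. ((s \<omega>, x \<omega>), (\<lambda>i. extend_path t0 T (\<lambda>t. X i t \<omega>)), (\<lambda>i. extend_path t0 T (\<lambda>t. W i t \<omega>))) = reconstruct (Y \<omega>)"
      using key AE_space
    proof eventually_elim
      case (elim \<omega>)
      have ext: "extend_path t0 T f = extend_path t0 T g" if "\<And>t. t \<in> {t0..T} \<Longrightarrow> f t = g t" for f g :: "real \<Rightarrow> real ^ 'n"
        unfolding extend_path_def by (intro restrict_ext that) (use t0 in auto)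
      have "extend_path t0 T (\<lambda>t. X i t \<omega>) = extend_path t0 T (\<lambda>t. position (Y \<omega>) i t)" for i
        by (rule ext) (simp add: pos[OF elim(2)])
      moreover have "extend_path t0 T (\<lambda>t. W i t \<omega>) = extend_path t0 T (\<lambda>t. snd (Y \<omega>) i t - rescaled_drift (Y \<omega>) i t)" for i
        by (rule ext) (use elim(1) in simp)
      ultimately show ?case by (simp add: reconstruct_def fY)
    qed
  qed
  also have "\<dots> = distr (distr Q \<E> Y) (borel_of (solution_topology T)) reconstruct"
    by (subst distr_distr[OF reconstruct_measurable Ym]) (simp add: comp_def)
  finally show ?law .
qed

lemma weak_solutions_same_law:
  fixes Q1 :: "'a measure" and Q2 :: "'c measure"
  assumes 1: "weak_solution T b t0 m Q1 F1 s1 x1 X1 W1" and 2: "weak_solution T b t0 m Q2 F2 s2 x2 X2 W2"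
  shows "solution_law T t0 Q1 s1 x1 X1 W1 = solution_law T t0 Q2 s2 x2 X2 W2"
proof -
  have "distr Q1 \<E> (observation t0 T s1 x1 X1) = distr Q2 \<E> (observation t0 T s2 x2 X2)"
  proof (rule girsanov_uniqueness[OF weak_solution_observed(1)[OF 1] weak_solution_observed(1)[OF 2]])
    show "Int_stable initial_events" unfolding initial_events_def by (rule Int_stable_preimages)
    show "space \<E> \<in> initial_events"
      unfolding initial_events_def
    proof (intro CollectI exI[of _ "space (borel_of data_topology)"] conjI sets.top)
      show "space \<E> = fst -` space (borel_of data_topology) \<inter> space \<E>" using measurable_space[OF observed_data] by blast
    qed
    show "measure Q1 (observation t0 T s1 x1 X1 -` D \<inter> space Q1) = measure Q2 (observation t0 T s2 x2 X2 -` D \<inter> space Q2)"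
      if D: "D \<in> initial_events" for D
    proof -
      obtain A where A: "A \<in> sets (borel_of data_topology)" "D = fst -` A \<inter> space \<E>" using D unfolding initial_events_def by blast
      show ?thesis unfolding A(2) weak_solution_observed(3)[OF 1 A(1)] weak_solution_observed(3)[OF 2 A(1)] ..
    qed
  qed (rule observation_space_generated)
  then show ?thesis using weak_solution_observed(2)[OF 1] weak_solution_observed(2)[OF 2] by simp
qed

end

theorem proposition4p2:
  fixes T t0 :: real
    and b :: "nat \<Rightarrow> real \<Rightarrow> 'n::finite torus borel_prob \<Rightarrow> 'n torus \<Rightarrow> real ^ 'n"
    and m :: "((nat \<Rightarrow> real) \<times> (nat \<Rightarrow> 'n torus)) measure"
    and Q1 :: "'a measure" and F1 :: "real \<Rightarrow> 'a measure"
    and s1 :: "'a \<Rightarrow> nat \<Rightarrow> real" and x1 :: "'a \<Rightarrow> nat \<Rightarrow> 'n torus"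
    and X1 W1 :: "nat \<Rightarrow> real \<Rightarrow> 'a \<Rightarrow> real ^ 'n"
    and Q2 :: "'b measure" and F2 :: "real \<Rightarrow> 'b measure"
    and s2 :: "'b \<Rightarrow> nat \<Rightarrow> real" and x2 :: "'b \<Rightarrow> nat \<Rightarrow> 'n torus"
    and X2 W2 :: "nat \<Rightarrow> real \<Rightarrow> 'b \<Rightarrow> real ^ 'n"
  assumes "CARD('n) \<ge> 2"
    and "T > 0"
    and "t0 \<in> {0..<T}"
    and "\<exists>C. \<forall>i. \<forall>t\<in>{0..T}. \<forall>\<mu> y. norm (b i t \<mu> y) \<le> C"
    and "\<And>i. (\<lambda>(t, \<mu>, y). b i t \<mu> y)
           \<in> borel_measurable (restrict_space borel {0..T} \<Otimes>\<^sub>M (borel \<Otimes>\<^sub>M borel))"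
    and "prob_space m"
    and "sets m = sets (borel_of data_topology)"
    and "weak_solution T b t0 m Q1 F1 s1 x1 X1 W1"
    and "weak_solution T b t0 m Q2 F2 s2 x2 X2 W2"
  shows "solution_law T t0 Q1 s1 x1 X1 W1 = solution_law T t0 Q2 s2 x2 X2 W2"
proof -
  obtain C where C: "\<forall>i. \<forall>t\<in>{0..T}. \<forall>\<mu> y. norm (b i t \<mu> y) \<le> C" using assms(4) by blast
  interpret bounded_drift T t0 "\<bar>C\<bar>" b
  proof
    show "norm (b i t \<mu> p) \<le> \<bar>C\<bar>" if "t \<in> {0..T}" for i t \<mu> p
      using C[rule_format, OF that, of i \<mu> p] by linarith
  qed (use assms(3,5) in auto)
  show ?thesis by (rule weak_solutions_same_law[OF assms(8,9)])
qed

end
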